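(* If $\pi=\mathrm{Ind}_{B_0}^B\pi_0$ is a compactly induced representation of $B$ for some smooth $o/\varpi^h$-representation $\pi_0$ of $B_0$, then $D^\vee_\xi(\pi)=0$. In particular, $D^\vee_\xi$ is not exact on the category of smooth $o/\varpi^h$-representations of $B$.
   Context: Setting. $K/\mathbb{Q}_p$ is a finite extension with ring of integers $o$ and uniformizer $\varpi$; $A=o/\varpi^h$. $\mathbf{G}$ is a $\mathbb{Q}_p$-split connected reductive group defined over $\mathbb{Z}_p$ with connected centre, $\mathbf{B}=\mathbf{T}\mathbf{N}$ a split Borel subgroup; $G,B,T,N$ denote the $\mathbb{Q}_p$-points. $\Phi_+$ is the set of roots of $T$ in $N$, $\Delta\subset\Phi_+$ the simple roots, $u_\beta\colon\mathbb{G}_a\to N_\beta$ the root subgroup isomorphisms with $tu_\beta(x)t^{-1}=u_\beta(\beta(t)x)$, $N_0=\prod_{\beta\in\Phi_+}u_\beta(\mathbb{Z}_p)=\mathbf{N}(\mathbb{Z}_p)$, $T_0$ the maximal compact subgroup of $T$, $B_0=N_0T_0$. $\xi\colon\mathbb{Q}_p^\times\to T$ is a cocharacter with $\alpha\circ\xi=\mathrm{id}$ for all $\alpha\in\Delta$; $\Gamma=\xi(\mathbb{Z}_p^\times)$, $s=\xi(p)$. $(\cdot)^\vee=\mathrm{Hom}_o(\cdot,K/o)$ is the Pontryagin dual. $\ell\colon N_0\to\mathbb{Z}_p$ is a surjective group homomorphism with kernel $H_0$ (which satisfies $sH_0s^{-1}\subseteq H_0$ and is normalized by $\Gamma$), and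 $\Lambda(N_0/H_0)/\varpi^h\cong A[[X]]$, $X=[1]-1$ for the generator $1\in\mathbb{Z}_p\cong N_0/H_0$. For a smooth $A$-representation $\pi$ of $B$ let $F(m)=\sum_{u\in J(H_0/sH_0s^{-1})}usm$ for $m\in\pi^{H_0}$, where $J$ denotes a set of left coset representatives; $\pi^{H_0}$ is a module over the skew polynomial ring $A[[X]][F]$, $FX=((X+1)^p-1)F$. $\mathcal{M}(\pi^{H_0})$ is the set, partially ordered by inclusion, of finitely generated $A[[X]][F]$-submodules $M\subseteq\pi^{H_0}$ that are $\Gamma$-stable and admissible ($M^\vee$ is finitely generated over $A[[X]]$). Then $D^\vee_\xi(\pi)=\varprojlim_{M\in\mathcal{M}(\pi^{H_0})}M^\vee[1/X]$ (a contravariant functor in $\pi$). *)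

theory Defs
  imports
    "HOL-Analysis.Analysis"
    "HOL-Library.Poly_Mapping"
    "HOL-Library.FuncSet"
    "HOL-Algebra.Algebraic_Closure_Type"
    "HOL-Algebra.Solvable_Groups"
begin

section \<open>The field of p-adic numbers\<close>

text \<open>
  The field of p-adic numbers is the completion of the rationals for the p-adic absolute value,
  here \<open>dist x 0\<close>. The absolute value on rationals is determined by multiplicativity and its
  values at \<open>p\<close> and at integers prime to \<open>p\<close>.
\<close>

locale padic_numbers =
  fixes p :: nat and Qp :: "'q::{field_char_0,metric_space} itself"
  assumes prime_p: "Factorial_Ring.prime p"
    and dist_diff: "\<And>x y :: 'q. dist x y = dist (x - y) 0"
    and abs_mult: "\<And>x y :: 'q. dist (x * y) 0 = dist x 0 * dist y 0"
    and abs_ultrametric: "\<And>x y :: 'q. dist (x + y) 0 \<le> max (dist x 0) (dist y 0)"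
    and abs_p: "dist (of_nat p :: 'q) 0 = 1 / real p"
    and abs_prime_to_p: "\<And>m::int. \<not> int p dvd m \<Longrightarrow> dist (of_int m :: 'q) 0 = 1"
    and rationals_dense: "closure (range (of_rat :: rat \<Rightarrow> 'q)) = UNIV"
    and complete_Qp: "complete (UNIV :: 'q set)"

definition Zp :: "'q::{field_char_0,metric_space} set" where
  "Zp = {x. dist x 0 \<le> 1}"

definition Zp_units :: "'q::{field_char_0,metric_space} set" where
  "Zp_units = {x. dist x 0 = 1}"

text \<open>On p-adic integers this is reduction modulo \<open>p\<close>, if \<open>'f\<close> has characteristic \<open>p\<close>.\<close>

definition red :: "nat \<Rightarrow> 'q::{field_char_0,metric_space} \<Rightarrow> 'f::field" where
  "red p x = of_nat (THE r. r < p \<and> dist x (of_nat r) < 1)"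


section \<open>Linear algebraic groups\<close>

text \<open>Polynomials in the \<open>n\<^sup>2\<close> matrix entries, evaluated after applying \<open>\<phi>\<close> to coefficients.\<close>

type_synonym ('a, 'n) mpol = "('n \<times> 'n \<Rightarrow>\<^sub>0 nat) \<Rightarrow>\<^sub>0 'a"

definition mev :: "('a::zero \<Rightarrow> 'r::comm_ring_1) \<Rightarrow> ('a, 'n) mpol \<Rightarrow> 'r^'n^'n \<Rightarrow> 'r" where
  "mev \<phi> f g = (\<Sum>m\<in>Poly_Mapping.keys f. \<phi> (Poly_Mapping.lookup f m) *
      (\<Prod>ij\<in>Poly_Mapping.keys m. (g $ fst ij $ snd ij) ^ Poly_Mapping.lookup m ij))"

definition det_pol :: "('a::comm_ring_1, 'n::finite) mpol" where
  "det_pol = det (\<chi> i j. Poly_Mapping.single (Poly_Mapping.single (i, j) 1) 1)"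

definition mat_group :: "('a::semiring_1^'n^'n) set \<Rightarrow> ('a^'n^'n) monoid" where
  "mat_group H = \<lparr>carrier = H, mult = (**), one = mat 1\<rparr>"

definition GL :: "('a::semiring_1^'n^'n) set" where
  "GL = {g. invertible g}"

text \<open>
  \<open>zclosed \<phi> Z\<close>: \<open>Z\<close> is the subset of \<open>GL\<close> cut out by polynomials with coefficients in the
  domain of the ring homomorphism \<open>\<phi>\<close>. With \<open>\<phi> = id\<close> this is Zariski closedness, with
  \<open>\<phi> = to_ac\<close> it is closedness over the base field.
\<close>

definition zclosed :: "('a::zero \<Rightarrow> 'c::field) \<Rightarrow> ('c^'n::finite^'n) set \<Rightarrow> bool" where
  "zclosed \<phi> Z \<longleftrightarrow> (\<exists>P :: ('a, 'n) mpol set. Z = {g \<in> GL. \<forall>f\<in>P. mev \<phi> f g = 0})"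

definition zconnected :: "('c::field^'n::finite^'n) set \<Rightarrow> bool" where
  "zconnected H \<longleftrightarrow> \<not> (\<exists>Y Z. zclosed (id :: 'c \<Rightarrow> 'c) Y \<and> zclosed (id :: 'c \<Rightarrow> 'c) Z \<and>
      H \<subseteq> Y \<union> Z \<and> Y \<inter> H \<noteq> {} \<and> Z \<inter> H \<noteq> {} \<and> Y \<inter> Z \<inter> H = {})"

definition connected_alg_group :: "('c::alg_closed_field^'n::finite^'n) set \<Rightarrow> bool" where
  "connected_alg_group H \<longleftrightarrow>
     subgroup H (mat_group GL) \<and> zclosed (id :: 'c \<Rightarrow> 'c) H \<and> zconnected H"

definition unipotent :: "('c::field^'n::finite^'n) set \<Rightarrow> bool" where
  "unipotent H \<longleftrightarrow> (\<forall>g\<in>H. \<exists>k. (((**) (g - mat 1)) ^^ k) (mat 1) = 0)"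

definition is_unipotent_radical ::
    "('c::alg_closed_field^'n::finite^'n) set \<Rightarrow> ('c^'n^'n) set \<Rightarrow> bool" where
  "is_unipotent_radical N H \<longleftrightarrow>
     connected_alg_group N \<and> unipotent N \<and> N \<lhd> mat_group H \<and>
     (\<forall>U. connected_alg_group U \<and> unipotent U \<and> U \<lhd> mat_group H \<longrightarrow> U \<subseteq> N)"

definition connected_reductive :: "('c::alg_closed_field^'n::finite^'n) set \<Rightarrow> bool" where
  "connected_reductive G \<longleftrightarrow> connected_alg_group G \<and> is_unipotent_radical {mat 1} G"

definition borel_subgroup ::
    "('c::alg_closed_field^'n::finite^'n) set \<Rightarrow> ('c^'n^'n) set \<Rightarrow> bool" where
  "borel_subgroup B G \<longleftrightarrow>
     B \<subseteq> G \<and> connected_alg_group B \<and> solvable (mat_group B) \<and>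
     (\<forall>B'. B \<subseteq> B' \<and> B' \<subseteq> G \<and> connected_alg_group B' \<and> solvable (mat_group B') \<longrightarrow> B' = B)"

text \<open>A torus split by a change of basis with entries in the domain of \<open>\<phi>\<close>.\<close>

definition split_torus ::
    "('a::field \<Rightarrow> 'c::alg_closed_field) \<Rightarrow> ('c^'n::finite^'n) set \<Rightarrow> bool" where
  "split_torus \<phi> T \<longleftrightarrow> connected_alg_group T \<and>
     (\<exists>g :: 'a^'n^'n. invertible g \<and>
        (\<forall>t\<in>T. \<forall>i j. i \<noteq> j \<longrightarrow>
           (map_matrix \<phi> g ** t ** matrix_inv (map_matrix \<phi> g)) $ i $ j = 0))"

text \<open>Over the algebraically closed field itself, every torus is split.\<close>

definition maximal_torus ::
    "('c::alg_closed_field^'n::finite^'n) set \<Rightarrow> ('c^'n^'n) set \<Rightarrow> bool" where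
  "maximal_torus T G \<longleftrightarrow> T \<subseteq> G \<and> split_torus (id :: 'c \<Rightarrow> 'c) T \<and>
     (\<forall>T'. T \<subseteq> T' \<and> T' \<subseteq> G \<and> split_torus (id :: 'c \<Rightarrow> 'c) T' \<longrightarrow> T' = T)"

definition centre :: "('c::field^'n::finite^'n) set \<Rightarrow> ('c^'n^'n) set" where
  "centre G = {z\<in>G. \<forall>g\<in>G. z ** g = g ** z}"

definition rational_points ::
    "('q::field alg_closure^'n::finite^'n) set \<Rightarrow> ('q^'n^'n) set" where
  "rational_points H = {g. map_matrix to_ac g \<in> H}"

definition Zp_points ::
    "('q::{field_char_0,metric_space} alg_closure^'n::finite^'n) set \<Rightarrow> ('q^'n^'n) set" where
  "Zp_points H = {g \<in> rational_points H.
     \<forall>i j. g $ i $ j \<in> Zp \<and> matrix_inv g $ i $ j \<in> Zp}"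

text \<open>
  A flat closed subgroup scheme over the p-adic integers of the general linear group, with reduced
  generic fibre, is the schematic closure of its generic fibre, which is given here by its points
  \<open>G\<close> over the algebraic closure. Its ideal consists of the integral polynomials vanishing on
  \<open>G\<close>; reducing these modulo \<open>p\<close> yields the points of the special fibre over an algebraically
  closed field \<open>'f\<close> of characteristic \<open>p\<close>. This geometric special fibre is smooth iff it is
  reduced, i.e. iff the reduced polynomials generate the whole vanishing ideal in
  \<open>'f[x\<^sub>i\<^sub>j, 1/det]\<close>.
\<close>

definition integral_ideal ::
    "('q::{field_char_0,metric_space} alg_closure^'n::finite^'n) set \<Rightarrow> ('q, 'n) mpol set" where
  "integral_ideal G = {f. (\<forall>m. Poly_Mapping.lookup f m \<in> Zp) \<and> (\<forall>g\<in>G. mev to_ac f g = 0)}"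

definition special_fibre ::
    "nat \<Rightarrow> ('q::{field_char_0,metric_space} alg_closure^'n::finite^'n) set
      \<Rightarrow> ('f::alg_closed_field^'n^'n) set" where
  "special_fibre p G =
     {g \<in> GL. \<forall>f\<in>integral_ideal G. mev (red p :: 'q \<Rightarrow> 'f) f g = 0}"

definition smooth_special_fibre ::
    "nat \<Rightarrow> 'f::alg_closed_field itself
      \<Rightarrow> ('q::{field_char_0,metric_space} alg_closure^'n::finite^'n) set \<Rightarrow> bool" where
  "smooth_special_fibre p F G \<longleftrightarrow>
     (\<forall>k :: ('f, 'n) mpol. (\<forall>g\<in>special_fibre p G. mev id k g = 0) \<longrightarrow>
        (\<exists>e S c. finite S \<and> S \<subseteq> integral_ideal G \<and>
           det_pol ^ e * k = (\<Sum>f\<in>S. c f * Poly_Mapping.map (red p) f)))"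

text \<open>
  A connected reductive group scheme over the p-adic integers: smooth and affine with connected
  reductive geometric fibres.
\<close>

definition reductive_over_Zp ::
    "nat \<Rightarrow> 'f::alg_closed_field itself
      \<Rightarrow> ('q::{field_char_0,metric_space} alg_closure^'n::finite^'n) set \<Rightarrow> bool" where
  "reductive_over_Zp p F G \<longleftrightarrow>
     zclosed (to_ac :: 'q \<Rightarrow> 'q alg_closure) G \<and> connected_reductive G \<and>
     smooth_special_fibre p F G \<and>
     connected_reductive (special_fibre p G :: ('f^'n^'n) set)"

text \<open>
  A split torus has Zariski dense rational points (the base field being infinite), so its
  characters are the homomorphisms on rational points given by regular functions.
\<close>

definition characters ::
    "('q::field_char_0 alg_closure^'n::finite^'n) set \<Rightarrow> ('q^'n^'n \<Rightarrow> 'q) set" where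
  "characters T = {\<beta> \<in> extensional (rational_points T).
     (\<forall>t\<in>rational_points T. \<beta> t \<noteq> 0) \<and>
     (\<forall>t\<in>rational_points T. \<forall>t'\<in>rational_points T. \<beta> (t ** t') = \<beta> t * \<beta> t') \<and>
     (\<exists>(f :: ('q, 'n) mpol) e. \<forall>t\<in>rational_points T. \<beta> t = mev id f t / det t ^ e)}"

text \<open>
  The Lie algebra as tangent space at the identity: \<open>f (1 + \<epsilon> Y)\<close> has vanishing linear
  coefficient in \<open>\<epsilon>\<close>, for all \<open>f\<close> in the ideal.
\<close>

definition lie_algebra ::
    "('q::field_char_0 alg_closure^'n::finite^'n) set \<Rightarrow> ('q^'n^'n) set" where
  "lie_algebra H = {Y. \<forall>f :: ('q, 'n) mpol. (\<forall>g\<in>H. mev to_ac f g = 0) \<longrightarrow>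
     Polynomial.coeff (mev (\<lambda>c. [:c:]) f (\<chi> i j. [:mat 1 $ i $ j, Y $ i $ j:])) 1 = 0}"

definition roots_in ::
    "('q::field_char_0 alg_closure^'n::finite^'n) set \<Rightarrow> ('q alg_closure^'n^'n) set
      \<Rightarrow> ('q^'n^'n \<Rightarrow> 'q) set" where
  "roots_in T N = {\<beta> \<in> characters T. (\<exists>t\<in>rational_points T. \<beta> t \<noteq> 1) \<and>
     (\<exists>Y\<in>lie_algebra N. Y \<noteq> 0 \<and>
        (\<forall>t\<in>rational_points T. t ** Y ** matrix_inv t = (\<chi> i j. \<beta> t * Y $ i $ j)))}"

text \<open>\<open>\<Delta>\<close> is the base of the root system determined by the positive roots \<open>\<Phi>\<close>.\<close>

definition simple_roots ::
    "('q::field_char_0 alg_closure^'n::finite^'n) set \<Rightarrow> ('q^'n^'n \<Rightarrow> 'q) set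
      \<Rightarrow> ('q^'n^'n \<Rightarrow> 'q) set \<Rightarrow> bool" where
  "simple_roots T \<Phi> \<Delta> \<longleftrightarrow> finite \<Delta> \<and> \<Delta> \<subseteq> \<Phi> \<and>
     (\<forall>\<beta>\<in>\<Phi>. \<exists>m :: _ \<Rightarrow> nat. \<forall>t\<in>rational_points T. \<beta> t = (\<Prod>\<alpha>\<in>\<Delta>. \<alpha> t ^ m \<alpha>)) \<and>
     (\<forall>m :: _ \<Rightarrow> int. (\<forall>t\<in>rational_points T. (\<Prod>\<alpha>\<in>\<Delta>. \<alpha> t powi m \<alpha>) = 1)
        \<longrightarrow> (\<forall>\<alpha>\<in>\<Delta>. m \<alpha> = 0))"

text \<open>
  An isomorphism of algebraic groups from the additive group onto a closed subgroup of \<open>N\<close>, on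
  which \<open>T\<close> acts by \<open>\<beta>\<close>. (Its image is the root subgroup; a regular function on a closed unipotent
  subgroup is a polynomial in the matrix entries, so the inverse map is one.)
\<close>

definition root_subgroup_iso ::
    "('q::field_char_0 alg_closure^'n::finite^'n) set \<Rightarrow> ('q alg_closure^'n^'n) set
      \<Rightarrow> ('q^'n^'n \<Rightarrow> 'q) \<Rightarrow> ('q \<Rightarrow> 'q^'n^'n) \<Rightarrow> bool" where
  "root_subgroup_iso T N \<beta> u \<longleftrightarrow>
     (\<exists>P :: 'q poly^'n^'n. \<forall>x i j. u x $ i $ j = poly (P $ i $ j) x) \<and>
     (\<exists>f :: ('q, 'n) mpol. \<forall>x. mev id f (u x) = x) \<and>
     range u \<subseteq> rational_points N \<and>
     (\<forall>x y. u (x + y) = u x ** u y) \<and>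
     (\<forall>t\<in>rational_points T. \<forall>x. t ** u x ** matrix_inv t = u (\<beta> t * x))"

definition is_cocharacter ::
    "('q::field_char_0 alg_closure^'n::finite^'n) set \<Rightarrow> ('q \<Rightarrow> 'q^'n^'n) \<Rightarrow> bool" where
  "is_cocharacter T \<xi> \<longleftrightarrow>
     (\<forall>x. x \<noteq> 0 \<longrightarrow> \<xi> x \<in> rational_points T) \<and>
     (\<forall>x y. x \<noteq> 0 \<longrightarrow> y \<noteq> 0 \<longrightarrow> \<xi> (x * y) = \<xi> x ** \<xi> y) \<and>
     (\<exists>(P :: 'q poly^'n^'n) e. \<forall>x. x \<noteq> 0 \<longrightarrow> (\<forall>i j. \<xi> x $ i $ j = poly (P $ i $ j) x / x ^ e))"

definition is_maximal_compact ::
    "('q::{field_char_0,metric_space}^'n::finite^'n) set \<Rightarrow> ('q^'n^'n) set \<Rightarrow> bool" where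
  "is_maximal_compact K H \<longleftrightarrow>
     subgroup K (mat_group H) \<and> compact K \<and>
     (\<forall>K'. subgroup K' (mat_group H) \<and> compact K' \<longrightarrow> K' \<subseteq> K)"


section \<open>Coefficients and modules over power series\<close>

definition ring_of_integers ::
    "('q::{field_char_0,metric_space} \<Rightarrow> 'k::field) \<Rightarrow> 'k set" where
  "ring_of_integers \<iota> = {x. \<exists>f :: 'q poly. Polynomial.lead_coeff f = 1 \<and>
      (\<forall>i. Polynomial.coeff f i \<in> Zp) \<and> poly (map_poly \<iota> f) x = 0}"

definition fin_gen :: "('a, 'r) ring_scheme \<Rightarrow> ('a, 'b, 's) module_scheme \<Rightarrow> bool" where
  "fin_gen R M \<longleftrightarrow> (\<exists>S. finite S \<and> S \<subseteq> carrier M \<and>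
     (\<forall>m\<in>carrier M. \<exists>c\<in>S \<rightarrow> carrier R. m = finsum M (\<lambda>x. c x \<odot>\<^bsub>M\<^esub> x) S))"

definition power_series_ring :: "('a, 'r) ring_scheme \<Rightarrow> (nat \<Rightarrow> 'a) ring" where
  "power_series_ring R =
    \<lparr>carrier = UNIV \<rightarrow> carrier R,
     mult = (\<lambda>a b n. finsum R (\<lambda>i. a i \<otimes>\<^bsub>R\<^esub> b (n - i)) {..n}),
     one = (\<lambda>n. if n = 0 then \<one>\<^bsub>R\<^esub> else \<zero>\<^bsub>R\<^esub>),
     zero = (\<lambda>n. \<zero>\<^bsub>R\<^esub>),
     add = (\<lambda>a b n. a n \<oplus>\<^bsub>R\<^esub> b n)\<rparr>"

locale coefficients = padic_numbers p Qp
  for p :: nat and Qp :: "'q::{field_char_0,metric_space} itself" +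
  fixes \<iota> :: "'q \<Rightarrow> 'k::field" and \<pi> :: 'k and h :: nat
  assumes iota_add: "\<And>x y. \<iota> (x + y) = \<iota> x + \<iota> y"
    and iota_mult: "\<And>x y. \<iota> (x * y) = \<iota> x * \<iota> y"
    and iota_one: "\<iota> 1 = 1"
    and finite_extension: "\<exists>S. finite S \<and> (\<forall>x. \<exists>c. x = (\<Sum>v\<in>S. \<iota> (c v) * v))"
    and uniformizer:
      "maximalideal
         (PIdl\<^bsub>ring_of_type_algebra\<lparr>carrier := ring_of_integers \<iota>\<rparr>\<^esub> \<pi>)
         (ring_of_type_algebra\<lparr>carrier := ring_of_integers \<iota>\<rparr>)"
    and uniformizer_in: "\<pi> \<in> ring_of_integers \<iota>"
    and h_pos: "h > 0"
begin

abbreviation K :: "'k ring" where "K \<equiv> ring_of_type_algebra"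

definition oring :: "'k ring" where
  "oring = K\<lparr>carrier := ring_of_integers \<iota>\<rparr>"

definition modulus :: "'k set" where
  "modulus = PIdl\<^bsub>oring\<^esub> (\<pi> ^ h)"

definition A :: "'k set ring" where
  "A = oring Quot modulus"

definition AX :: "(nat \<Rightarrow> 'k set) ring" where
  "AX = power_series_ring A"

definition var_X :: "nat \<Rightarrow> 'k set" where
  "var_X = (\<lambda>n. if n = 1 then \<one>\<^bsub>A\<^esub> else \<zero>\<^bsub>A\<^esub>)"

definition const_o :: "'k \<Rightarrow> nat \<Rightarrow> 'k set" where
  "const_o c = (\<lambda>n. if n = 0 then modulus +>\<^bsub>oring\<^esub> c else \<zero>\<^bsub>A\<^esub>)"

text \<open>
  \<open>K/o\<close> is the additive quotient group, written multiplicatively in HOL-Algebra; scalars in \<open>o\<close>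
  act by \<open>c (x + o) = c x + o\<close>.
\<close>

definition K_mod_o :: "'k set monoid" where
  "K_mod_o = K A_Mod (ring_of_integers \<iota>)"

definition scale_K_mod_o :: "'k \<Rightarrow> 'k set \<Rightarrow> 'k set" where
  "scale_K_mod_o c C = (\<Union>x\<in>C. ring_of_integers \<iota> +>\<^bsub>K\<^esub> (c * x))"

text \<open>
  The Pontryagin dual of an \<open>A[[X]]\<close>-module, consisting of \<open>o\<close>-linear maps to \<open>K/o\<close>. The ring
  \<open>o\<close> acts through the constant power series.
\<close>

definition pdual ::
    "(nat \<Rightarrow> 'k set, 'b) module \<Rightarrow> (nat \<Rightarrow> 'k set, 'b \<Rightarrow> 'k set) module" where
  "pdual M =
    \<lparr>carrier = {f \<in> carrier M \<rightarrow>\<^sub>E carrier K_mod_o.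
        (\<forall>x\<in>carrier M. \<forall>y\<in>carrier M. f (x \<oplus>\<^bsub>M\<^esub> y) = f x \<otimes>\<^bsub>K_mod_o\<^esub> f y) \<and>
        (\<forall>c\<in>ring_of_integers \<iota>. \<forall>x\<in>carrier M.
            f (const_o c \<odot>\<^bsub>M\<^esub> x) = scale_K_mod_o c (f x))},
     mult = undefined, one = undefined,
     zero = (\<lambda>x\<in>carrier M. \<one>\<^bsub>K_mod_o\<^esub>),
     add = (\<lambda>f g. \<lambda>x\<in>carrier M. f x \<otimes>\<^bsub>K_mod_o\<^esub> g x),
     smult = (\<lambda>a f. \<lambda>x\<in>carrier M. f (a \<odot>\<^bsub>M\<^esub> x))\<rparr>"

text \<open>The localization \<open>P[1/X]\<close>: the class of \<open>(f, n)\<close> stands for \<open>X\<^sup>-\<^sup>n f\<close>.\<close>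

definition X_pow :: "(nat \<Rightarrow> 'k set, 'b) module \<Rightarrow> nat \<Rightarrow> 'b \<Rightarrow> 'b" where
  "X_pow P n = ((\<lambda>f. var_X \<odot>\<^bsub>P\<^esub> f) ^^ n)"

definition fraction :: "(nat \<Rightarrow> 'k set, 'b) module \<Rightarrow> 'b \<Rightarrow> nat \<Rightarrow> ('b \<times> nat) set" where
  "fraction P f n = {(g, k). g \<in> carrier P \<and> (\<exists>j. X_pow P (j + k) f = X_pow P (j + n) g)}"

definition localize ::
    "(nat \<Rightarrow> 'k set, 'b) module \<Rightarrow> (nat \<Rightarrow> 'k set, ('b \<times> nat) set) module" where
  "localize P =
    \<lparr>carrier = {fraction P f n | f n. f \<in> carrier P},
     mult = undefined, one = undefined,
     zero = fraction P \<zero>\<^bsub>P\<^esub> 0,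
     add = (\<lambda>C D. \<Union>(f, n)\<in>C. \<Union>(g, k)\<in>D. fraction P (X_pow P k f \<oplus>\<^bsub>P\<^esub> X_pow P n g) (n + k)),
     smult = (\<lambda>a C. \<Union>(f, n)\<in>C. fraction P (a \<odot>\<^bsub>P\<^esub> f) n)\<rparr>"

text \<open>
  For a homomorphism \<open>\<phi>\<close> from \<open>M\<close> to \<open>M'\<close>, the map from \<open>M'\<^sup>\<or>[1/X]\<close> to \<open>M\<^sup>\<or>[1/X]\<close> induced
  by precomposition with \<open>\<phi>\<close>.
\<close>

definition dual_loc_map ::
    "(nat \<Rightarrow> 'k set, 'b) module \<Rightarrow> ('b \<Rightarrow> 'c) \<Rightarrow> (('c \<Rightarrow> 'k set) \<times> nat) set
      \<Rightarrow> (('b \<Rightarrow> 'k set) \<times> nat) set" where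
  "dual_loc_map M \<phi> C = (\<Union>(f, n)\<in>C. fraction (pdual M) (\<lambda>x\<in>carrier M. f (\<phi> x)) n)"

definition smooth_rep ::
    "('q^'n::finite^'n) set \<Rightarrow> ('k set, 'v) module \<Rightarrow> ('q^'n^'n \<Rightarrow> 'v \<Rightarrow> 'v) \<Rightarrow> bool" where
  "smooth_rep H V \<rho> \<longleftrightarrow> module A V \<and>
     (\<forall>g\<in>H. \<forall>v\<in>carrier V. \<rho> g v \<in> carrier V) \<and>
     (\<forall>g\<in>H. \<forall>v\<in>carrier V. \<forall>w\<in>carrier V. \<rho> g (v \<oplus>\<^bsub>V\<^esub> w) = \<rho> g v \<oplus>\<^bsub>V\<^esub> \<rho> g w) \<and>
     (\<forall>g\<in>H. \<forall>a\<in>carrier A. \<forall>v\<in>carrier V. \<rho> g (a \<odot>\<^bsub>V\<^esub> v) = a \<odot>\<^bsub>V\<^esub> \<rho> g v) \<and>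
     (\<forall>v\<in>carrier V. \<rho> (mat 1) v = v) \<and>
     (\<forall>g\<in>H. \<forall>g'\<in>H. \<forall>v\<in>carrier V. \<rho> (g ** g') v = \<rho> g (\<rho> g' v)) \<and>
     (\<forall>v\<in>carrier V. openin (top_of_set H) {g\<in>H. \<rho> g v = v})"

definition rep_hom ::
    "('q^'n::finite^'n) set \<Rightarrow> ('k set, 'v) module \<Rightarrow> ('q^'n^'n \<Rightarrow> 'v \<Rightarrow> 'v)
      \<Rightarrow> ('k set, 'w) module \<Rightarrow> ('q^'n^'n \<Rightarrow> 'w \<Rightarrow> 'w) \<Rightarrow> ('v \<Rightarrow> 'w) \<Rightarrow> bool" where
  "rep_hom H V \<rho> W \<sigma> f \<longleftrightarrow>
     (\<forall>v\<in>carrier V. f v \<in> carrier W) \<and>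
     (\<forall>v\<in>carrier V. \<forall>w\<in>carrier V. f (v \<oplus>\<^bsub>V\<^esub> w) = f v \<oplus>\<^bsub>W\<^esub> f w) \<and>
     (\<forall>a\<in>carrier A. \<forall>v\<in>carrier V. f (a \<odot>\<^bsub>V\<^esub> v) = a \<odot>\<^bsub>W\<^esub> f v) \<and>
     (\<forall>g\<in>H. \<forall>v\<in>carrier V. f (\<rho> g v) = \<sigma> g (f v))"

text \<open>
  Compact induction from \<open>J\<close> to \<open>H\<close>, for an open subgroup \<open>J\<close>: smooth functions on \<open>H\<close> with
  \<open>f (j x) = j (f x)\<close> and compact support modulo \<open>J\<close>, where \<open>H\<close> acts by right translation. As
  \<open>J\<close> is open, the cosets \<open>J x\<close> form a discrete space, so compact support means that \<open>f\<close> is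
  nonzero on finitely many of them only.
\<close>

definition cind ::
    "('q^'n::finite^'n) set \<Rightarrow> ('q^'n^'n) set \<Rightarrow> ('k set, 'v) module
      \<Rightarrow> ('q^'n^'n \<Rightarrow> 'v \<Rightarrow> 'v) \<Rightarrow> ('k set, 'q^'n^'n \<Rightarrow> 'v) module" where
  "cind J H V \<rho> =
    \<lparr>carrier = {f \<in> H \<rightarrow>\<^sub>E carrier V.
        (\<forall>j\<in>J. \<forall>x\<in>H. f (j ** x) = \<rho> j (f x)) \<and>
        finite ((\<lambda>x. J #>\<^bsub>mat_group H\<^esub> x) ` {x\<in>H. f x \<noteq> \<zero>\<^bsub>V\<^esub>}) \<and>
        openin (top_of_set H) {g\<in>H. \<forall>x\<in>H. f (x ** g) = f x}},
     mult = undefined, one = undefined,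
     zero = (\<lambda>x\<in>H. \<zero>\<^bsub>V\<^esub>),
     add = (\<lambda>f f'. \<lambda>x\<in>H. f x \<oplus>\<^bsub>V\<^esub> f' x),
     smult = (\<lambda>a f. \<lambda>x\<in>H. a \<odot>\<^bsub>V\<^esub> f x)\<rparr>"

definition cind_action ::
    "('q^'n::finite^'n) set \<Rightarrow> 'q^'n^'n \<Rightarrow> ('q^'n^'n \<Rightarrow> 'v) \<Rightarrow> 'q^'n^'n \<Rightarrow> 'v" where
  "cind_action H g f = (\<lambda>x\<in>H. f (x ** g))"

end


section \<open>The functor\<close>

text \<open>
  The algebraic groups \<open>GG\<close>, \<open>BB\<close>, \<open>TT\<close>, \<open>NN\<close> are given by their points over the algebraic
  closure of the p-adic numbers, together with an embedding in a general linear group. The field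
  \<open>'f\<close> only serves to form the geometric special fibre of \<open>GG\<close>.
\<close>

locale borel_setting = coefficients p Qp \<iota> \<pi> h
  for p :: nat and Qp :: "'q::{field_char_0,metric_space} itself"
    and \<iota> :: "'q \<Rightarrow> 'k::field" and \<pi> :: 'k and h :: nat +
  fixes Fbar :: "'f::alg_closed_field itself"
    and GG BB TT NN :: "('q alg_closure^'n::finite^'n) set"
    and \<Delta> :: "('q^'n^'n \<Rightarrow> 'q) set"
    and \<beta>s :: "('q^'n^'n \<Rightarrow> 'q) list"
    and u :: "('q^'n^'n \<Rightarrow> 'q) \<Rightarrow> 'q \<Rightarrow> 'q^'n^'n"
    and T0 :: "('q^'n^'n) set"
    and \<xi> :: "'q \<Rightarrow> 'q^'n^'n"
    and ell :: "'q^'n^'n \<Rightarrow> 'q"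
  assumes char_Fbar: "CHAR('f) = p"
    and G_reductive: "reductive_over_Zp p Fbar GG"
    and centre_connected: "zconnected (centre GG)"
    and T_maximal: "maximal_torus TT GG"
    and T_over_Qp: "zclosed (to_ac :: 'q \<Rightarrow> 'q alg_closure) TT"
    and T_split: "split_torus (to_ac :: 'q \<Rightarrow> 'q alg_closure) TT"
    and B_borel: "borel_subgroup BB GG"
    and B_over_Qp: "zclosed (to_ac :: 'q \<Rightarrow> 'q alg_closure) BB"
    and N_radical: "is_unipotent_radical NN BB"
    and N_over_Qp: "zclosed (to_ac :: 'q \<Rightarrow> 'q alg_closure) NN"
    \<comment> \<open>\<open>B = TN\<close> as algebraic groups over the base field, hence also on rational points\<close>
    and B_eq_TN: "BB = {t ** x | t x. t \<in> TT \<and> x \<in> NN}"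
    and B_eq_TN_rational: "rational_points BB =
      {t ** x | t x. t \<in> rational_points TT \<and> x \<in> rational_points NN}"
    and enum_roots: "distinct \<beta>s" "set \<beta>s = roots_in TT NN"
    and Delta_simple: "simple_roots TT (roots_in TT NN) \<Delta>"
    and root_isos: "\<And>\<beta>. \<beta> \<in> roots_in TT NN \<Longrightarrow> root_subgroup_iso TT NN \<beta> (u \<beta>)"
    and N0_product: "Zp_points NN =
      {foldr (\<lambda>\<beta> g. u \<beta> (x \<beta>) ** g) \<beta>s (mat 1) | x. \<forall>\<beta>\<in>set \<beta>s. x \<beta> \<in> Zp}"
    and T0_maximal_compact: "is_maximal_compact T0 (rational_points TT)"
    and xi_cocharacter: "is_cocharacter TT \<xi>"
    and simple_xi: "\<And>\<alpha> x. \<alpha> \<in> \<Delta> \<Longrightarrow> x \<noteq> 0 \<Longrightarrow> \<alpha> (\<xi> x) = x"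
    and ell_hom: "\<And>x y. x \<in> Zp_points NN \<Longrightarrow> y \<in> Zp_points NN \<Longrightarrow> ell (x ** y) = ell x + ell y"
    and ell_surj: "ell ` Zp_points NN = Zp"
    and s_H0: "\<And>x. x \<in> Zp_points NN \<Longrightarrow> ell x = 0 \<Longrightarrow>
      \<xi> (of_nat p) ** x ** matrix_inv (\<xi> (of_nat p)) \<in> {y \<in> Zp_points NN. ell y = 0}"
    and Gamma_H0: "\<And>z x. z \<in> Zp_units \<Longrightarrow> x \<in> Zp_points NN \<Longrightarrow> ell x = 0 \<Longrightarrow>
      \<xi> z ** x ** matrix_inv (\<xi> z) \<in> {y \<in> Zp_points NN. ell y = 0}"
begin

definition B :: "('q^'n^'n) set" where "B = rational_points BB"

definition N0 :: "('q^'n^'n) set" where "N0 = Zp_points NN"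

definition B0 :: "('q^'n^'n) set" where "B0 = {x ** t | x t. x \<in> N0 \<and> t \<in> T0}"

definition \<Gamma> :: "('q^'n^'n) set" where "\<Gamma> = \<xi> ` Zp_units"

definition s :: "'q^'n^'n" where "s = \<xi> (of_nat p)"

definition H0 :: "('q^'n^'n) set" where "H0 = {x\<in>N0. ell x = 0}"

text \<open>
  On \<open>H0\<close>-invariants, \<open>N0\<close> acts through \<open>N0/H0\<close>, which \<open>ell\<close> identifies with the p-adic integers;
  \<open>X\<close> acts as \<open>[1] - 1\<close>. By smoothness \<open>X\<close> acts locally nilpotently, so the sum defining the
  action of a power series is finite.
\<close>

definition act_X :: "('k set, 'v) module \<Rightarrow> ('q^'n^'n \<Rightarrow> 'v \<Rightarrow> 'v) \<Rightarrow> 'v \<Rightarrow> 'v" where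
  "act_X V \<rho> v = \<rho> (SOME x. x \<in> N0 \<and> ell x = 1) v \<ominus>\<^bsub>V\<^esub> v"

definition act_series ::
    "('k set, 'v) module \<Rightarrow> ('q^'n^'n \<Rightarrow> 'v \<Rightarrow> 'v) \<Rightarrow> (nat \<Rightarrow> 'k set) \<Rightarrow> 'v \<Rightarrow> 'v" where
  "act_series V \<rho> a v = finsum V (\<lambda>n. a n \<odot>\<^bsub>V\<^esub> (act_X V \<rho> ^^ n) v)
      {n. (act_X V \<rho> ^^ n) v \<noteq> \<zero>\<^bsub>V\<^esub>}"

definition invariants ::
    "('k set, 'v) module \<Rightarrow> ('q^'n^'n \<Rightarrow> 'v \<Rightarrow> 'v) \<Rightarrow> (nat \<Rightarrow> 'k set, 'v) module" where
  "invariants V \<rho> =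
    \<lparr>carrier = {v \<in> carrier V. \<forall>x\<in>H0. \<rho> x v = v},
     mult = undefined, one = undefined,
     zero = \<zero>\<^bsub>V\<^esub>, add = (\<lambda>v w. v \<oplus>\<^bsub>V\<^esub> w), smult = act_series V \<rho>\<rparr>"

text \<open>The summand does not depend on the representative of a left coset in \<open>H0/sH0s\<^sup>-\<^sup>1\<close>.\<close>

definition F_op :: "('k set, 'v) module \<Rightarrow> ('q^'n^'n \<Rightarrow> 'v \<Rightarrow> 'v) \<Rightarrow> 'v \<Rightarrow> 'v" where
  "F_op V \<rho> v = finsum V (\<lambda>C. \<rho> (SOME x. x \<in> C) (\<rho> s v))
      ((\<lambda>x. x <#\<^bsub>mat_group N0\<^esub> {s ** y ** matrix_inv s | y. y \<in> H0}) ` H0)"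

definition AXF_submodule ::
    "('k set, 'v) module \<Rightarrow> ('q^'n^'n \<Rightarrow> 'v \<Rightarrow> 'v) \<Rightarrow> 'v set \<Rightarrow> bool" where
  "AXF_submodule V \<rho> M \<longleftrightarrow>
     submodule M AX (invariants V \<rho>) \<and> (\<forall>m\<in>M. F_op V \<rho> m \<in> M)"

definition AXF_fin_gen ::
    "('k set, 'v) module \<Rightarrow> ('q^'n^'n \<Rightarrow> 'v \<Rightarrow> 'v) \<Rightarrow> 'v set \<Rightarrow> bool" where
  "AXF_fin_gen V \<rho> M \<longleftrightarrow>
     (\<exists>S. finite S \<and> S \<subseteq> M \<and> M = \<Inter>{M'. AXF_submodule V \<rho> M' \<and> S \<subseteq> M'})"

definition as_module ::
    "('k set, 'v) module \<Rightarrow> ('q^'n^'n \<Rightarrow> 'v \<Rightarrow> 'v) \<Rightarrow> 'v set \<Rightarrow> (nat \<Rightarrow> 'k set, 'v) module" where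
  "as_module V \<rho> M = (invariants V \<rho>)\<lparr>carrier := M\<rparr>"

definition MM :: "('k set, 'v) module \<Rightarrow> ('q^'n^'n \<Rightarrow> 'v \<Rightarrow> 'v) \<Rightarrow> 'v set set" where
  "MM V \<rho> = {M. AXF_submodule V \<rho> M \<and> AXF_fin_gen V \<rho> M \<and>
     (\<forall>g\<in>\<Gamma>. \<forall>m\<in>M. \<rho> g m \<in> M) \<and>
     fin_gen AX (pdual (as_module V \<rho> M))}"

definition D_xi ::
    "('k set, 'v) module \<Rightarrow> ('q^'n^'n \<Rightarrow> 'v \<Rightarrow> 'v)
      \<Rightarrow> (nat \<Rightarrow> 'k set, 'v set \<Rightarrow> (('v \<Rightarrow> 'k set) \<times> nat) set) module" where
  "D_xi V \<rho> =
    \<lparr>carrier = {y \<in> (\<Pi>\<^sub>E M\<in>MM V \<rho>. carrier (localize (pdual (as_module V \<rho> M)))).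
        \<forall>M\<in>MM V \<rho>. \<forall>M'\<in>MM V \<rho>. M \<subseteq> M' \<longrightarrow>
          y M = dual_loc_map (as_module V \<rho> M) (\<lambda>m. m) (y M')},
     mult = undefined, one = undefined,
     zero = (\<lambda>M\<in>MM V \<rho>. \<zero>\<^bsub>localize (pdual (as_module V \<rho> M))\<^esub>),
     add = (\<lambda>y z. \<lambda>M\<in>MM V \<rho>. y M \<oplus>\<^bsub>localize (pdual (as_module V \<rho> M))\<^esub> z M),
     smult = (\<lambda>a y. \<lambda>M\<in>MM V \<rho>. a \<odot>\<^bsub>localize (pdual (as_module V \<rho> M))\<^esub> y M)\<rparr>"

text \<open>
  For a homomorphism \<open>f\<close> of representations from \<open>V\<close> to \<open>W\<close>, the induced map from \<open>D_xi W\<close> to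
  \<open>D_xi V\<close>: its component at \<open>M\<close> comes from the component at \<open>f ` M\<close> by precomposition with \<open>f\<close>.
\<close>

definition D_xi_map ::
    "('k set, 'v) module \<Rightarrow> ('q^'n^'n \<Rightarrow> 'v \<Rightarrow> 'v) \<Rightarrow> ('v \<Rightarrow> 'w)
      \<Rightarrow> ('w set \<Rightarrow> (('w \<Rightarrow> 'k set) \<times> nat) set) \<Rightarrow> 'v set \<Rightarrow> (('v \<Rightarrow> 'k set) \<times> nat) set" where
  "D_xi_map V \<rho> f y = (\<lambda>M\<in>MM V \<rho>. dual_loc_map (as_module V \<rho> M) f (y (f ` M)))"

text \<open>
  Exactness of the contravariant functor on smooth representations of \<open>B\<close> whose underlying set
  lies in the type \<open>'v\<close>. An \<open>'v itself\<close> argument is needed because HOL has no quantification over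
  types; non-exactness for one type \<open>'v\<close> implies non-exactness on all smooth representations.
\<close>

definition D_xi_exact :: "'v itself \<Rightarrow> bool" where
  "D_xi_exact U \<longleftrightarrow>
     (\<forall>(V1 :: ('k set, 'v) module) \<rho>1 (V2 :: ('k set, 'v) module) \<rho>2
        (V3 :: ('k set, 'v) module) \<rho>3 f g.
        smooth_rep B V1 \<rho>1 \<and> smooth_rep B V2 \<rho>2 \<and> smooth_rep B V3 \<rho>3 \<and>
        rep_hom B V1 \<rho>1 V2 \<rho>2 f \<and> rep_hom B V2 \<rho>2 V3 \<rho>3 g \<and>
        inj_on f (carrier V1) \<and>
        f ` carrier V1 = {v \<in> carrier V2. g v = \<zero>\<^bsub>V3\<^esub>} \<and>
        g ` carrier V2 = carrier V3
        \<longrightarrow>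
        inj_on (D_xi_map V2 \<rho>2 g) (carrier (D_xi V3 \<rho>3)) \<and>
        D_xi_map V2 \<rho>2 g ` carrier (D_xi V3 \<rho>3) =
          {y \<in> carrier (D_xi V2 \<rho>2). D_xi_map V1 \<rho>1 f y = \<zero>\<^bsub>D_xi V1 \<rho>1\<^esub>} \<and>
        D_xi_map V1 \<rho>1 f ` carrier (D_xi V2 \<rho>2) = carrier (D_xi V1 \<rho>1))"

end

end

theory Submission
  imports Defs
begin

text \<open>
  The vanishing rests on a continuous homomorphism \<open>deg\<close> from \<open>B\<close> to the positive reals that is
  trivial on \<open>N\<close> and on \<open>B\<^sub>0\<close> but not at \<open>s\<close>: the absolute value of a suitable diagonal
  entry in a basis that diagonalizes \<open>T\<close>. It exists because conjugation by \<open>s\<close> contracts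
  \<open>N\<^sub>0\<close>: this forces \<open>n - 1\<close> to be strictly triangular for all \<open>n\<close> in \<open>N\<close>, if the basis is
  ordered by the absolute values of the eigenvalues of \<open>s\<close>, and these are not all \<open>1\<close> because
  \<open>N\<^sub>0\<close> is not trivial. A function in a compact induction is supported on finitely many
  cosets \<open>B\<^sub>0x\<close>, hence on finitely many degrees. The operator \<open>X\<close> comes from \<open>N\<^sub>0\<close> and
  preserves degrees, whereas \<open>F\<close> involves one translation by \<open>s\<close> and rescales them by a constant
  different from \<open>1\<close>. Let \<open>M\<close> be finitely generated and admissible. The submodule of \<open>M\<close> killed by
  \<open>X\<close> and \<open>\<pi>\<close> has finite dimension over the residue field, so that only finitely many degrees
  occur in it; every nonzero element of \<open>M\<close> has a nonzero multiple in this submodule, whose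
  degrees are among its own. Therefore \<open>F\<^sup>km = 0\<close> for all large \<open>k\<close>. As \<open>M\<close> is generated by
  finitely many elements, a power of \<open>X\<close> kills \<open>M\<close>, so that \<open>M\<^sup>\<or>[1/X] = 0\<close>
  (\<open>D_xi_zero_of_degree\<close>, \<open>D_xi_cind_zero\<close>). This uses that \<open>X\<close> is locally nilpotent on smooth
  representations and that the Pontryagin dual of an \<open>A\<close>-module separates its points
  (\<open>dual_separates_points\<close>).

  The argument applies to any representation of \<open>B\<close> on functions with finitely many degrees, and
  exactness fails because such a representation can have a quotient with a nonzero image. Let \<open>W\<close>
  be a copy of \<open>A\<close>. Smooth functions on \<open>B\<close> with finitely many degrees that are invariant from the
  left under the elements of \<open>T\<close> of degree \<open>1\<close> map onto all smooth functions that are invariant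
  from the left under \<open>T\<close>, by summation over the translates by \<open>T\<close> (\<open>torus_sum_surj\<close>). The source
  has trivial image under the functor, so exactness would imply the same for the target
  (\<open>exact_imp_torus_inv_trivial\<close>). However, the target contains the module \<open>M0\<close> of functions
  supported on \<open>TN\<^sub>0\<close> that only depend on the image of the component in \<open>N\<^sub>0\<close> under
  \<open>ell\<close>. These are the locally constant functions from the p-adic integers to \<open>A\<close>, on which \<open>X\<close> is
  the difference operator. It is surjective, because the partial sums of a periodic function are
  again periodic, as \<open>p\<close> is nilpotent in \<open>A\<close>; its kernel consists of the constant functions. Hence
  the dual of \<open>M0\<close> is generated over \<open>A[[X]]\<close> by evaluation at \<open>0\<close>, and no power of \<open>X\<close> kills this
  functional. Moreover, \<open>F\<close> stretches functions by the factor by which conjugation by \<open>s\<close> acts on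
  \<open>N\<^sub>0/H\<^sub>0\<close>, a positive power of \<open>p\<close>. Thus the powers of \<open>F\<close> map the constant function
  \<open>1\<close> to the indicator functions of smaller and smaller neighbourhoods of \<open>0\<close>, and the constant
  function generates \<open>M0\<close>. So \<open>M0\<close> belongs to \<open>MM\<close> (\<open>M0_in_MM\<close>), and evaluation at \<open>0\<close> yields a
  nonzero element of the limit (\<open>D_xi_torus_nontrivial\<close>).
\<close>

(* The symbol is kept for the entries of vectors and matrices. *)
no_notation Formal_Power_Series.fps_nth (infixl \<open>$\<close> 75)

section \<open>The p-adic absolute value\<close>

abbreviation pabs :: "'q::{field_char_0,metric_space} \<Rightarrow> real" where
  "pabs x \<equiv> dist x 0"

context padic_numbers
begin

lemma p_gt_1: "1 < p"
  using prime_p prime_gt_1_nat by blast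

lemma pabs_one [simp]: "pabs (1::'q) = 1"
proof -
  have "pabs (1::'q) = pabs (1::'q) * pabs (1::'q)"
    using abs_mult[of 1 1] by simp
  moreover have "pabs (1::'q) \<noteq> 0" by simp
  ultimately show ?thesis by (metis mult_cancel_left2)
qed

lemma pabs_minus [simp]: "pabs (- x :: 'q) = pabs x"
proof -
  have "pabs (-1 :: 'q) * pabs (-1 :: 'q) = 1"
    using abs_mult[of "-1" "-1"] by simp
  then have "pabs (-1 :: 'q) = 1"
    by (metis abs_mult_self_eq abs_of_nonneg mult_cancel_right1 real_sqrt_abs2 real_sqrt_one zero_le_dist)
  then show ?thesis using abs_mult[of "-1" x] by simp
qed

lemma pabs_power: "pabs (x ^ n :: 'q) = pabs x ^ n"
  by (induction n) (auto simp: abs_mult)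

lemma pabs_inverse: "pabs (inverse x :: 'q) = inverse (pabs x)"
proof (cases "x = 0")
  case False
  then have "pabs x * pabs (inverse x) = 1"
    using abs_mult[of x "inverse x"] by simp
  then show ?thesis by (metis inverse_unique)
qed simp

lemma pabs_divide: "pabs (x / y :: 'q) = pabs x / pabs y"
  by (simp add: divide_inverse abs_mult pabs_inverse)

lemma pabs_add_le: "pabs (x::'q) \<le> C \<Longrightarrow> pabs y \<le> C \<Longrightarrow> pabs (x + y) \<le> C"
  using abs_ultrametric[of x y] by linarith

lemma pabs_diff_le: "pabs (x::'q) \<le> C \<Longrightarrow> pabs y \<le> C \<Longrightarrow> pabs (x - y) \<le> C"
  using pabs_add_le[of x C "-y"] by simp

lemma pabs_mult_le:
  "pabs (x::'q) \<le> C \<Longrightarrow> pabs y \<le> D \<Longrightarrow> pabs (x * y) \<le> C * D"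
  by (simp add: abs_mult) (meson mult_mono order_trans zero_le_dist)

lemma pabs_sum_le: "0 \<le> C \<Longrightarrow> (\<And>i. i \<in> I \<Longrightarrow> pabs (f i :: 'q) \<le> C) \<Longrightarrow> pabs (sum f I) \<le> C"
  by (induction I rule: infinite_finite_induct) (auto intro!: pabs_add_le)

lemma pabs_of_nat_le_1: "pabs (of_nat m :: 'q) \<le> 1"
  by (induction m) (auto intro!: pabs_add_le)

lemma pabs_of_int_le_1: "pabs (of_int m :: 'q) \<le> 1"
  by (cases m rule: int_cases2) (auto simp: pabs_of_nat_le_1)

lemma Zp_mult: "(x::'q) \<in> Zp \<Longrightarrow> y \<in> Zp \<Longrightarrow> x * y \<in> Zp"
  using pabs_mult_le[of x 1 y 1] by (simp add: Zp_def)
lemma Zp_diff: "(x::'q) \<in> Zp \<Longrightarrow> y \<in> Zp \<Longrightarrow> x - y \<in> Zp"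
  by (simp add: Zp_def pabs_diff_le)
lemma Zp_power: "(x::'q) \<in> Zp \<Longrightarrow> x ^ n \<in> Zp"
  by (simp add: Zp_def pabs_power power_le_one)
lemma Zp_of_nat [simp]: "(of_nat m :: 'q) \<in> Zp"
  by (simp add: Zp_def pabs_of_nat_le_1)
lemma Zp_0 [simp]: "(0 :: 'q) \<in> Zp" and Zp_1 [simp]: "(1 :: 'q) \<in> Zp"
  by (simp_all add: Zp_def)
lemma pabs_p_power: "pabs (of_nat p ^ k :: 'q) = 1 / real p ^ k"
  by (simp add: pabs_power abs_p power_divide)

text \<open>
  Write the integer as a power of \<open>p\<close> times an integer prime to \<open>p\<close>, whose
  absolute value is \<open>1\<close>.
\<close>

lemma pabs_of_int_le_iff:
  "pabs (of_int j :: 'q) \<le> 1 / real p ^ k \<longleftrightarrow> int p ^ k dvd j"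
proof
  assume "int p ^ k dvd j"
  then obtain i where j: "j = int p ^ k * i" by auto
  have "pabs (of_nat p ^ k * of_int i :: 'q) \<le> 1 / real p ^ k * 1"
    by (rule pabs_mult_le) (auto simp: pabs_p_power pabs_of_int_le_1)
  then show "pabs (of_int j :: 'q) \<le> 1 / real p ^ k" by (simp add: j)
next
  assume le: "pabs (of_int j :: 'q) \<le> 1 / real p ^ k"
  show "int p ^ k dvd j"
  proof (cases "j = 0")
    case False
    have pp: "Factorial_Ring.prime (int p)" using prime_p by simp
    define v where "v = multiplicity (int p) j"
    have nu: "\<not> is_unit (int p)" using p_gt_1 by simp
    obtain i where i: "j = int p ^ v * i" "\<not> int p dvd i"
      using multiplicity_decompose'[OF False nu] unfolding v_def by blast
    have "pabs (of_int j :: 'q) = 1 / real p ^ v"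
      using abs_mult[of "of_nat p ^ v" "of_int i"] i abs_prime_to_p[of i]
      by (simp add: pabs_p_power)
    with le have "real p ^ k \<le> real p ^ v"
      using p_gt_1 by (simp add: field_simps)
    then have "k \<le> v" using p_gt_1 by simp
    then show ?thesis using i by (simp add: dvd_mult2 le_imp_power_dvd)
  qed simp
qed

lemma power_p_small: "(0::real) < e \<Longrightarrow> \<exists>k. 1 / real p ^ k < e"
  using real_arch_pow_inv[of e "1 / real p"] p_gt_1 by (auto simp: power_divide)

text \<open>
  The rational approximations of a p-adic integer have denominators prime to \<open>p\<close>, which can be
  inverted modulo a power of \<open>p\<close>.
\<close>

lemma Zp_approx_int:
  assumes "(x::'q) \<in> Zp"
  shows "\<exists>j::int. 0 \<le> j \<and> j < int p ^ k \<and> pabs (x - of_int j) \<le> 1 / real p ^ k"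
proof -
  let ?e = "1 / real p ^ k"
  have e: "0 < ?e" "?e \<le> 1" using p_gt_1 by auto
  have "x \<in> closure (range (of_rat :: rat \<Rightarrow> 'q))" using rationals_dense by simp
  then obtain r :: rat where r: "pabs (of_rat r - x) < ?e"
    using e(1) dist_diff unfolding closure_approachable by (metis imageE)
  obtain a b where ab: "r = Rat.Fract a b" "b > 0" "coprime a b"
    by (metis Rat_cases)
  have rq: "(of_rat r :: 'q) = of_int a / of_int b"
    using ab by (simp add: of_rat_rat)
  have rle: "pabs (of_rat r :: 'q) \<le> 1"
    using pabs_add_le[of "of_rat r - x" 1 x] r e assms by (simp add: Zp_def)
  have nd: "\<not> int p dvd b"
  proof
    assume pb: "int p dvd b"
    have "\<not> int p dvd a"
    proof
      assume "int p dvd a"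
      then have "is_unit (int p)" using coprime_common_divisor[OF ab(3) _ pb] by blast
      then show False using p_gt_1 by simp
    qed
    then have A: "pabs (of_int a :: 'q) = 1" by (rule abs_prime_to_p)
    have "pabs (of_int b :: 'q) \<le> 1 / real p ^ 1"
      using pabs_of_int_le_iff[of b 1] pb by simp
    also have "\<dots> < 1" using p_gt_1 by simp
    finally have "pabs (of_int b :: 'q) < 1" .
    moreover have "pabs (of_int b :: 'q) > 0" using ab by simp
    ultimately have "pabs (of_rat r :: 'q) > 1"
      using A by (simp add: rq pabs_divide)
    with rle show False by simp
  qed
  then have "coprime (int p ^ k) b"
    using prime_p by (simp add: prime_imp_coprime)
  then have "gcd b (int p ^ k) = 1"
    using coprime_imp_gcd_eq_1 coprime_commute by blast
  then obtain c v where c: "c * b + v * int p ^ k = 1"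
    using bezout_int[of b "int p ^ k"] by metis
  have B: "pabs (of_int b :: 'q) = 1" using nd by (rule abs_prime_to_p)
  define j where "j = (a * c) mod (int p ^ k)"
  have "int p ^ k dvd a - b * j"
  proof -
    have "int p ^ k dvd a * c - j" unfolding j_def by (simp add: dvd_minus_mod)
    moreover have "a - b * j = a * v * int p ^ k + b * (a * c - j)"
      using arg_cong[OF c, of "\<lambda>z. a * z"] by (simp add: algebra_simps)
    ultimately show ?thesis by simp
  qed
  then have "pabs (of_int (a - b * j) :: 'q) \<le> ?e" by (simp only: pabs_of_int_le_iff)
  moreover have "(of_rat r :: 'q) - of_int j = of_int (a - b * j) / of_int b"
    unfolding rq using ab(2) by (simp add: field_simps)
  ultimately have "pabs (of_rat r - of_int j :: 'q) \<le> ?e"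
    using B by (simp only: pabs_divide)
  then have "pabs (x - of_int j) \<le> ?e"
    using pabs_diff_le[of "of_rat r - of_int j" ?e "of_rat r - x"] r by (simp add: algebra_simps)
  moreover have "0 \<le> j" "j < int p ^ k"
    using p_gt_1 unfolding j_def by auto
  ultimately show ?thesis by blast
qed

lemma pabs_le_all_imp_0: "(\<And>k. pabs (x::'q) \<le> 1 / real p ^ k) \<Longrightarrow> x = 0"
  by (meson dist_eq_0_iff leD power_p_small zero_less_dist_iff)

lemma Zp_divide_p_power:
  assumes "pabs (x::'q) \<le> 1 / real p ^ k"
  obtains y where "y \<in> Zp" "x = of_nat p ^ k * y"
proof
  show "x / of_nat p ^ k \<in> Zp"
    using assms p_gt_1 by (simp add: Zp_def pabs_divide pabs_p_power field_simps)
  show "x = of_nat p ^ k * (x / of_nat p ^ k)" using p_gt_1 by simp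
qed

text \<open>
  An additive endomorphism of the p-adic integers maps \<open>p\<^sup>k\<close>-multiples to \<open>p\<^sup>k\<close>-multiples, so it
  is continuous, and it is linear because integers are dense.
\<close>

lemma additive_Zp_linear:
  assumes add: "\<And>x y. x \<in> Zp \<Longrightarrow> y \<in> Zp \<Longrightarrow> f (x + y) = f x + (f y :: 'q)"
    and cl: "\<And>x. x \<in> Zp \<Longrightarrow> f x \<in> (Zp :: 'q set)"
    and x: "(x::'q) \<in> Zp"
  shows "f x = x * f 1"
proof -
  have f0: "f 0 = 0" using add[of 0 0] by simp
  have fnat: "f (of_nat m * y) = of_nat m * f y" if "y \<in> Zp" for m y
    by (induction m) (use that in \<open>auto simp: f0 add Zp_mult distrib_right\<close>)
  have "pabs (f x - x * f 1) \<le> 1 / real p ^ k" for k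
  proof -
    obtain j where j: "0 \<le> j" "pabs (x - of_int j) \<le> 1 / real p ^ k"
      using Zp_approx_int[OF x, of k] by blast
    define m where "m = nat j"
    have mj: "(of_int j :: 'q) = of_nat m" using j by (simp add: m_def)
    obtain y where y: "y \<in> Zp" "x - of_nat m = of_nat p ^ k * y"
      using Zp_divide_p_power[of "x - of_nat m" k] j mj by metis
    have x': "x = of_nat m + of_nat (p ^ k) * y" using y by (simp add: algebra_simps)
    have "f x = f (of_nat m * 1) + f (of_nat (p ^ k) * y)"
      unfolding x' using y by (simp add: add Zp_mult del: of_nat_power)
    also have "\<dots> = of_nat m * f 1 + of_nat (p ^ k) * f y"
      using y by (simp only: fnat Zp_1)
    finally have "f x - x * f 1 = of_nat p ^ k * (f y - y * f 1)"
      unfolding x' by (simp add: algebra_simps)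
    moreover have "f y - y * f 1 \<in> Zp" using y by (simp add: Zp_diff Zp_mult cl)
    ultimately show ?thesis
      using pabs_mult_le[of "of_nat p ^ k" "1 / real p ^ k" "f y - y * f 1" 1]
      by (simp add: pabs_p_power Zp_def)
  qed
  then show ?thesis using pabs_le_all_imp_0 by fastforce
qed

lemma pabs_eq_1_Zp_inverse: "pabs (x::'q) = 1 \<Longrightarrow> inverse x \<in> Zp"
  by (simp add: Zp_def pabs_inverse)

text \<open>
  From \<open>i (p\<^sup>k choose i) = p\<^sup>k (p\<^sup>k - 1 choose i - 1)\<close>.
\<close>

lemma binomial_p_power_small:
  assumes "0 < i"
  shows "pabs (of_nat ((p ^ k) choose i) :: 'q) \<le> (1 / real p ^ k) / pabs (of_nat i :: 'q)"
proof -
  obtain i' where i: "i = Suc i'" using assms by (cases i) auto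
  obtain m where m: "p ^ k = Suc m" using p_gt_1 by (metis not0_implies_Suc power_not_zero not_less_zero)
  have "of_nat i * of_nat ((p ^ k) choose i) = (of_nat p ^ k * of_nat (m choose i') :: 'q)"
    using Suc_times_binomial_eq[of m i'] unfolding m[symmetric] i
    by (metis mult.commute of_nat_mult of_nat_power)
  then have "pabs (of_nat i :: 'q) * pabs (of_nat ((p ^ k) choose i) :: 'q)
      = 1 / real p ^ k * pabs (of_nat (m choose i') :: 'q)"
    by (metis abs_mult pabs_p_power)
  also have "\<dots> \<le> 1 / real p ^ k"
    using pabs_of_nat_le_1[of "m choose i'"] p_gt_1 by (simp add: divide_right_mono)
  finally show ?thesis using assms
    by (subst pos_le_divide_eq) (auto simp: mult.commute)
qed

end

section \<open>Matrices over the p-adic numbers\<close>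

definition mball :: "real \<Rightarrow> ('q::{field_char_0,metric_space}^'n^'m) set" where
  "mball C = {M. \<forall>i j. pabs (M $ i $ j) \<le> C}"

lemma mballD: "M \<in> mball C \<Longrightarrow> pabs (M $ i $ j) \<le> C" by (simp add: mball_def)

lemma mball_mono: "M \<in> mball C \<Longrightarrow> C \<le> D \<Longrightarrow> M \<in> mball D"
  unfolding mball_def using order_trans by blast

lemma mball_exists: "\<exists>C>0. (M :: 'q::{field_char_0,metric_space}^'n::finite^'m::finite) \<in> mball C"
proof -
  define C where "C = (\<Sum>i\<in>UNIV. \<Sum>j\<in>UNIV. pabs (M $ i $ j)) + 1"
  have "pabs (M $ i $ j) \<le> C" for i j
  proof -
    have "pabs (M $ i $ j) \<le> (\<Sum>j\<in>UNIV. pabs (M $ i $ j))"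
      by (rule member_le_sum) auto
    also have "\<dots> \<le> (\<Sum>i\<in>UNIV. \<Sum>j\<in>UNIV. pabs (M $ i $ j))"
      by (rule member_le_sum[where f = "\<lambda>i. \<Sum>j\<in>UNIV. pabs (M $ i $ j)"]) (auto intro: sum_nonneg)
    finally show ?thesis by (simp add: C_def)
  qed
  moreover have "C > 0" unfolding C_def
    by (smt (verit) sum_nonneg zero_le_dist)
  ultimately show ?thesis unfolding mball_def by blast
qed

lemma dist_matrix_le:
  fixes M M' :: "'q::{field_char_0,metric_space}^'n::finite^'m::finite"
  shows "dist (M $ i $ j) (M' $ i $ j) \<le> dist M M'"
  by (meson dist_vec_nth_le order_trans)

lemma dist_matrix_less:
  fixes M M' :: "'q::{field_char_0,metric_space}^'n::finite^'m::finite"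
  assumes "0 < e" "\<And>i j. dist (M $ i $ j) (M' $ i $ j) \<le> e / (1 + real (CARD('n)) * real (CARD('m)))"
  shows "dist M M' < e"
proof -
  let ?d = "e / (1 + real (CARD('n)) * real (CARD('m)))"
  have *: "dist (M $ i) (M' $ i) \<le> real CARD('n) * ?d" for i
  proof -
    have "dist (M $ i) (M' $ i) \<le> (\<Sum>j\<in>UNIV. dist (M $ i $ j) (M' $ i $ j))"
      unfolding dist_vec_def by (rule L2_set_le_sum) auto
    also have "\<dots> \<le> (\<Sum>j\<in>(UNIV::'n set). ?d)" by (intro sum_mono assms)
    finally show ?thesis by simp
  qed
  have "dist M M' \<le> (\<Sum>i\<in>UNIV. dist (M $ i) (M' $ i))"
    unfolding dist_vec_def[of M] by (rule L2_set_le_sum) auto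
  also have "\<dots> \<le> (\<Sum>i\<in>(UNIV::'m set). real CARD('n) * ?d)"
    by (rule sum_mono) (rule *)
  also have "\<dots> = real CARD('m) * real CARD('n) * ?d" by simp
  also have "\<dots> < (1 + real (CARD('n)) * real (CARD('m))) * ?d"
    using assms(1) by (intro mult_strict_right_mono) (auto intro!: divide_pos_pos add_pos_nonneg)
  also have "\<dots> = e"
    by (smt (verit) nonzero_mult_div_cancel_left times_divide_eq_right mult_nonneg_nonneg of_nat_0_le_iff)
  finally show ?thesis .
qed

context padic_numbers
begin

lemma mball_add: "(M::'q^'n^'m) \<in> mball C \<Longrightarrow> M' \<in> mball C \<Longrightarrow> M + M' \<in> mball C"
  by (simp add: mball_def pabs_add_le)
lemma mball_diff: "(M::'q^'n^'m) \<in> mball C \<Longrightarrow> M' \<in> mball C \<Longrightarrow> M - M' \<in> mball C"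
  by (simp add: mball_def pabs_diff_le)
lemma mball_sum:
  "0 \<le> C \<Longrightarrow> (\<And>i. i \<in> I \<Longrightarrow> (f i::'q^'n^'m) \<in> mball C) \<Longrightarrow> sum f I \<in> mball C"
  by (auto simp: mball_def intro!: pabs_sum_le)
lemma mball_mult:
  "0 \<le> C \<Longrightarrow> 0 \<le> D \<Longrightarrow> (M::'q^'n::finite^'m) \<in> mball C \<Longrightarrow> (M'::'q^'l^'n) \<in> mball D \<Longrightarrow> M ** M' \<in> mball (C * D)"
  by (auto simp: mball_def matrix_matrix_mult_def intro!: pabs_sum_le pabs_mult_le)
lemma mball_mat1: "(mat 1 :: 'q^'n^'n) \<in> mball 1"
  by (auto simp: mball_def mat_def)
lemma mball_mult1: "(M::'q^'n::finite^'m) \<in> mball 1 \<Longrightarrow> (M'::'q^'l^'n) \<in> mball 1 \<Longrightarrow> M ** M' \<in> mball 1"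
  using mball_mult[of 1 1 M M'] by simp

text \<open>
  The conditions of closeness to the identity are stated by the balls \<open>1 +
  p\<^sup>kM\<^sub>n(\<int>\<^sub>p)\<close>, for which the ultrametric inequality gives simple
  estimates of products; this lemma relates them to the topology of the matrix space.
\<close>

lemma near_identity_iff:
  fixes H S :: "('q^'n::finite^'n) set"
  shows "(\<exists>e>0. \<forall>x\<in>H. dist x (mat 1) < e \<longrightarrow> x \<in> S) \<longleftrightarrow>
    (\<exists>k. \<forall>x\<in>H. x - mat 1 \<in> mball (1 / real p ^ k) \<longrightarrow> x \<in> S)" (is "?L \<longleftrightarrow> ?R")
proof
  assume ?L
  then obtain e where e: "e > 0" "\<forall>x\<in>H. dist x (mat 1) < e \<longrightarrow> x \<in> S" by blast
  have "0 < e / (1 + real (CARD('n)) * real (CARD('n)))"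
    using e by (auto intro!: divide_pos_pos add_pos_nonneg)
  then obtain k where k: "1 / real p ^ k < e / (1 + real (CARD('n)) * real (CARD('n)))"
    using power_p_small by blast
  have "dist x (mat 1) < e" if "x - mat 1 \<in> mball (1 / real p ^ k)" for x :: "'q^'n^'n"
  proof (rule dist_matrix_less[OF e(1)])
    fix i j
    have "pabs ((x - mat 1) $ i $ j) \<le> 1 / real p ^ k" using that by (rule mballD)
    then show "dist (x $ i $ j) (mat 1 $ i $ j) \<le> e / (1 + real (CARD('n)) * real (CARD('n)))"
      using k dist_diff[of "x $ i $ j"] by (metis less_eq_real_def order_trans vector_minus_component)
  qed
  with e show ?R by blast
next
  assume ?R
  then obtain k where k: "\<forall>x\<in>H. x - mat 1 \<in> mball (1 / real p ^ k) \<longrightarrow> x \<in> S" by blast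
  have "x - mat 1 \<in> mball (1 / real p ^ k)" if "dist x (mat 1) < 1 / real p ^ k" for x :: "'q^'n^'n"
    unfolding mball_def
  proof (safe)
    fix i j
    show "pabs ((x - mat 1) $ i $ j) \<le> 1 / real p ^ k"
      using that dist_diff[of "x $ i $ j" "mat 1 $ i $ j"] dist_matrix_le[of x i j "mat 1"]
      by simp
  qed
  moreover have "1 / real p ^ k > 0" using p_gt_1 by simp
  ultimately show ?L using k by blast
qed

end

section \<open>The ring of integers and its quotients\<close>

lemma ring_of_type_algebra_simps [simp]:
  "carrier (ring_of_type_algebra :: 'a::comm_ring_1 ring) = UNIV"
  "x \<otimes>\<^bsub>ring_of_type_algebra\<^esub> y = x * (y::'a)"
  "x \<oplus>\<^bsub>ring_of_type_algebra\<^esub> y = x + (y::'a)"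
  "\<one>\<^bsub>ring_of_type_algebra\<^esub> = (1::'a)"
  "\<zero>\<^bsub>ring_of_type_algebra\<^esub> = (0::'a)"
  by (simp_all add: ring_of_type_algebra_def)

context coefficients
begin

abbreviation OK :: "'k set" where "OK \<equiv> ring_of_integers \<iota>"

lemma oring_simps [simp]:
  "carrier oring = OK" "x \<otimes>\<^bsub>oring\<^esub> y = x * y" "x \<oplus>\<^bsub>oring\<^esub> y = x + y"
  "\<one>\<^bsub>oring\<^esub> = 1" "\<zero>\<^bsub>oring\<^esub> = 0"
  by (simp_all add: oring_def)

lemma uniformizer_maximal: "maximalideal (PIdl\<^bsub>oring\<^esub> \<pi>) oring"
  using uniformizer by (simp add: oring_def)

lemma oring_ring: "ring oring"
  using uniformizer_maximal maximalideal.axioms(1) ideal.axioms(2) by blast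

interpretation oR: ring oring by (rule oring_ring)

lemma OK_add: "a \<in> OK \<Longrightarrow> b \<in> OK \<Longrightarrow> a + b \<in> OK"
  using oR.a_closed[of a b] by simp
lemma OK_mult: "a \<in> OK \<Longrightarrow> b \<in> OK \<Longrightarrow> a * b \<in> OK"
  using oR.m_closed[of a b] by simp
lemma OK_0 [simp]: "0 \<in> OK" using oR.zero_closed by simp
lemma OK_1 [simp]: "1 \<in> OK" using oR.one_closed by simp
lemma OK_minus: "a \<in> OK \<Longrightarrow> - a \<in> OK"
  using oR.a_inv_closed[of a] oR.r_neg[of a] by (simp add: eq_neg_iff_add_eq_0 add.commute)
     (metis add_eq_0_iff)
lemma OK_diff: "a \<in> OK \<Longrightarrow> b \<in> OK \<Longrightarrow> a - b \<in> OK"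
  using OK_add[of a "-b"] OK_minus[of b] by simp
lemma OK_power: "a \<in> OK \<Longrightarrow> a ^ n \<in> OK"
  by (induction n) (auto simp: OK_mult)
lemma OK_of_nat: "of_nat n \<in> OK"
  by (induction n) (auto simp: OK_add)
lemma OK_sum: "(\<And>i. i \<in> I \<Longrightarrow> f i \<in> OK) \<Longrightarrow> sum f I \<in> OK"
  by (induction I rule: infinite_finite_induct) (auto simp: OK_add)

lemma oring_a_inv: "a \<in> OK \<Longrightarrow> \<ominus>\<^bsub>oring\<^esub> a = - a"
  using oR.minus_equality[of "-a" a] OK_minus by simp

lemma oring_cring: "cring oring"
  by (intro cring.intro oring_ring comm_monoid.intro oR.monoid_axioms comm_monoid_axioms.intro)
     (auto simp: mult.commute)

interpretation oR: cring oring by (rule oring_cring)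

definition unif_ideal :: "'k set" where "unif_ideal = {x * \<pi> | x. x \<in> OK}"

lemma unif_ideal_eq: "PIdl\<^bsub>oring\<^esub> \<pi> = unif_ideal"
  by (simp add: cgenideal_def unif_ideal_def)

lemma iota_zero [simp]: "\<iota> 0 = 0"
  using iota_add[of 0 0] by (metis add_cancel_right_right add_0)
lemma iota_of_nat [simp]: "\<iota> (of_nat n) = of_nat n"
  by (induction n) (auto simp: iota_add iota_one)
lemma iota_nonzero: "x \<noteq> 0 \<Longrightarrow> \<iota> x \<noteq> 0"
  using iota_mult[of x "inverse x"] iota_one by (metis field_class.field_inverse mult.commute mult_zero_left zero_neq_one)
lemma iota_power: "\<iota> (x ^ n) = \<iota> x ^ n"
  by (induction n) (auto simp: iota_one iota_mult)
lemma iota_sum: "\<iota> (sum f I) = (\<Sum>i\<in>I. \<iota> (f i))"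
  by (induction I rule: infinite_finite_induct) (auto simp: iota_add)
lemma iota_minus: "\<iota> (- x) = - \<iota> x"
  using iota_add[of x "-x"] by (simp add: eq_neg_iff_add_eq_0 add.commute)

lemma poly_map_iota:
  "poly (map_poly \<iota> f) y = (\<Sum>i\<le>Polynomial.degree f. \<iota> (Polynomial.coeff f i) * y ^ i)"
proof -
  have "Polynomial.degree (map_poly \<iota> f) = Polynomial.degree f"
    by (rule degree_map_poly) (use iota_nonzero in blast)
  then show ?thesis by (simp add: poly_altdef coeff_map_poly)
qed

lemma Zp_in_OK: "x \<in> Zp \<Longrightarrow> \<iota> x \<in> OK"
  unfolding ring_of_integers_def
proof (safe intro!: exI[of _ "[:-x, 1:]"])
  fix i assume "x \<in> Zp"
  then show "Polynomial.coeff [:- x, 1:] i \<in> Zp"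
    by (auto simp: coeff_pCons Zp_def split: nat.split)
qed (auto simp: map_poly_pCons iota_minus iota_one)

text \<open>
  The sum is \<open>p\<^sup>d\<close> times the value at \<open>1/p\<close> of a monic polynomial of
  degree \<open>d\<close>; all terms but the leading one are divisible by \<open>p\<close>.
\<close>

lemma reversed_at_p_unit:
  fixes f :: "'q poly"
  assumes "Polynomial.lead_coeff f = 1" "\<And>i. Polynomial.coeff f i \<in> Zp"
  defines "d \<equiv> Polynomial.degree f"
  shows "pabs (\<Sum>i\<le>d. Polynomial.coeff f i * of_nat p ^ (d - i)) = 1"
proof -
  define S where "S = (\<Sum>i<d. Polynomial.coeff f i * of_nat p ^ (d - i))"
  have "pabs (Polynomial.coeff f i * of_nat p ^ (d - i)) \<le> 1 * (1 / real p)" if "i < d" for i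
  proof (rule pabs_mult_le)
    show "pabs (of_nat p ^ (d - i) :: 'q) \<le> 1 / real p"
      using that p_gt_1 power_increasing[of 1 "d - i" "real p"] unfolding pabs_p_power
      by (intro divide_left_mono) auto
  qed (use assms in \<open>auto simp: Zp_def\<close>)
  then have "pabs S \<le> 1 / real p" unfolding S_def by (intro pabs_sum_le) auto
  then have S: "pabs S < 1" using p_gt_1
    by (smt (verit) divide_less_eq_1 of_nat_1 of_nat_less_iff)
  have e: "(\<Sum>i\<le>d. Polynomial.coeff f i * of_nat p ^ (d - i)) = 1 + S"
    using assms(1) unfolding S_def d_def
    by (simp add: lessThan_Suc_atMost[symmetric] add.commute)
  have "pabs (1 + S) \<le> 1" using S by (intro pabs_add_le) auto
  moreover have "1 \<le> max (pabs (1 + S)) (pabs S)"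
    using abs_ultrametric[of "1 + S" "- S"] by simp
  ultimately show ?thesis using S e by simp
qed

lemma integral_relation:
  assumes "a \<in> OK"
  obtains d c where "\<And>i. c i \<in> Zp" "pabs (\<Sum>i\<le>d. c i * of_nat p ^ (d - i) :: 'q) = 1"
    "(\<Sum>i\<le>d. \<iota> (c i) * a ^ i) = 0"
proof -
  obtain f :: "'q poly" where f: "Polynomial.lead_coeff f = 1" "\<And>i. Polynomial.coeff f i \<in> Zp"
    "poly (map_poly \<iota> f) a = 0"
    using assms unfolding ring_of_integers_def by blast
  show thesis
    by (rule that[of "Polynomial.coeff f" "Polynomial.degree f"])
      (use f reversed_at_p_unit poly_map_iota in auto)
qed

lemma p_nonzero_K: "(of_nat p :: 'k) \<noteq> 0"
proof -
  have "(of_nat p :: 'q) \<noteq> 0" using p_gt_1 by simp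
  then show ?thesis using iota_nonzero[of "of_nat p"] by simp
qed

lemma integral_relation_times_p:
  assumes "(\<Sum>i\<le>d. \<iota> (c i) * a ^ i) = 0"
  shows "(\<Sum>i\<le>d. \<iota> (c i) * of_nat p ^ (d - i) * (of_nat p * a) ^ i) = 0"
proof -
  have "(\<Sum>i\<le>d. \<iota> (c i) * of_nat p ^ (d - i) * (of_nat p * a) ^ i)
      = (\<Sum>i\<le>d. of_nat p ^ d * (\<iota> (c i) * a ^ i))"
  proof (rule sum.cong)
    fix i assume "i \<in> {..d}"
    then have "(of_nat p :: 'k) ^ d = of_nat p ^ (d - i) * of_nat p ^ i"
      by (simp add: power_add[symmetric])
    then show "\<iota> (c i) * of_nat p ^ (d - i) * (of_nat p * a) ^ i = of_nat p ^ d * (\<iota> (c i) * a ^ i)"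
      by (simp add: power_mult_distrib)
  qed simp
  also have "\<dots> = 0" using assms by (simp add: sum_distrib_left[symmetric])
  finally show ?thesis .
qed

text \<open>At \<open>1/p\<close>, an integral equation would make a p-adic unit vanish.\<close>

lemma inverse_p_not_integral: "a \<in> OK \<Longrightarrow> of_nat p * a \<noteq> 1"
proof
  assume a: "a \<in> OK" "of_nat p * a = 1"
  obtain d c where c: "\<And>i. c i \<in> Zp" "pabs (\<Sum>i\<le>d. c i * of_nat p ^ (d - i) :: 'q) = 1"
    "(\<Sum>i\<le>d. \<iota> (c i) * a ^ i) = 0"
    using integral_relation[OF a(1)] by metis
  have "\<iota> (\<Sum>i\<le>d. c i * of_nat p ^ (d - i)) = 0"
    using integral_relation_times_p[OF c(3)] a(2) by (simp add: iota_sum iota_mult iota_power)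
  then have "(\<Sum>i\<le>d. c i * of_nat p ^ (d - i)) = 0" using iota_nonzero by blast
  with c(2) show False by simp
qed

lemma one_notin_unif_ideal: "1 \<notin> unif_ideal"
proof
  assume "1 \<in> unif_ideal"
  then obtain y where y: "y \<in> OK" "1 = y * \<pi>" by (auto simp: unif_ideal_def)
  have "OK \<subseteq> unif_ideal"
  proof
    fix a assume "a \<in> OK"
    then have "a * y \<in> OK" "a = (a * y) * \<pi>" using y by (auto simp: OK_mult mult.assoc)
    then show "a \<in> unif_ideal" unfolding unif_ideal_def by blast
  qed
  moreover have "unif_ideal \<subseteq> OK"
    using uniformizer_in by (auto simp: unif_ideal_def OK_mult)
  ultimately show False
    using maximalideal.I_notcarr[OF uniformizer_maximal] by (simp add: unif_ideal_eq)
qed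

text \<open>
  The ideal of \<open>\<pi>\<close> is maximal, so together with \<open>a\<close> it generates the
  unit ideal.
\<close>

lemma unit_mod_uniformizer:
  assumes "a \<in> OK" "a \<notin> unif_ideal"
  shows "\<exists>b\<in>OK. \<exists>c\<in>OK. a * b + c * \<pi> = 1"
proof -
  let ?J = "PIdl\<^bsub>oring\<^esub> a <+>\<^bsub>oring\<^esub> PIdl\<^bsub>oring\<^esub> \<pi>"
  have J: "?J = {x * a + y * \<pi> | x y. x \<in> OK \<and> y \<in> OK}"
    by (auto simp: set_add_def set_mult_def cgenideal_def) (blast+)?
  have "ideal ?J oring"
    using assms uniformizer_in by (intro oR.add_ideals oR.cgenideal_ideal) auto
  moreover have "PIdl\<^bsub>oring\<^esub> \<pi> \<subseteq> ?J"
  proof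
    fix z assume "z \<in> PIdl\<^bsub>oring\<^esub> \<pi>"
    then obtain y where "y \<in> OK" "z = 0 * a + y * \<pi> \<and> 0 \<in> OK \<and> y \<in> OK" by (auto simp: cgenideal_def)
    then show "z \<in> ?J" unfolding J by (intro CollectI exI)
  qed
  moreover have "?J \<subseteq> carrier oring"
    unfolding J using assms uniformizer_in by (auto intro!: OK_add OK_mult)
  ultimately have "?J = PIdl\<^bsub>oring\<^esub> \<pi> \<or> ?J = carrier oring"
    by (rule maximalideal.I_maximal[OF uniformizer_maximal])
  moreover have "a \<in> ?J"
  proof -
    have "a = 1 * a + 0 * \<pi> \<and> 1 \<in> OK \<and> 0 \<in> OK" by simp
    then show ?thesis unfolding J by (intro CollectI exI)
  qed
  ultimately have "?J = carrier oring" using assms(2) unif_ideal_eq by metis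
  then have "1 \<in> ?J" using OK_1 oring_simps(1) by metis
  then obtain b c where "1 = b * a + c * \<pi>" "b \<in> OK" "c \<in> OK" unfolding J by blast
  then have "a * b + c * \<pi> = 1" by (simp add: mult.commute)
  then show ?thesis using \<open>b \<in> OK\<close> \<open>c \<in> OK\<close> by blast
qed

text \<open>
  Otherwise \<open>o\<close> would be a field, and \<open>1/p\<close> would be integral.
\<close>

lemma uniformizer_nonzero: "\<pi> \<noteq> 0"
proof
  assume "\<pi> = 0"
  then have "(of_nat p :: 'k) \<notin> unif_ideal"
    using p_nonzero_K unfolding unif_ideal_def by auto
  then obtain b c where "b \<in> OK" "of_nat p * b + c * \<pi> = 1"
    using unit_mod_uniformizer[OF OK_of_nat] by blast
  then show False using inverse_p_not_integral \<open>\<pi> = 0\<close> by simp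
qed

text \<open>
  If \<open>p\<close> were a unit modulo \<open>\<pi>\<close>, then some \<open>t = 1 - pa\<close> would be a multiple of \<open>\<pi>\<close>, but the integral
  equation of \<open>a\<close> shows that \<open>t\<close> is a unit.
\<close>

lemma p_in_unif_ideal: "of_nat p \<in> unif_ideal"
proof (rule ccontr)
  assume "of_nat p \<notin> unif_ideal"
  then obtain a e where a: "a \<in> OK" "e \<in> OK" "of_nat p * a + e * \<pi> = 1"
    using unit_mod_uniformizer[OF OK_of_nat] by blast
  define t where "t = e * \<pi>"
  have tO: "t \<in> OK" using a uniformizer_in by (simp add: t_def OK_mult)
  have pa: "of_nat p * a = 1 - t" using a by (simp add: t_def algebra_simps)
  obtain d c where c: "\<And>i. c i \<in> Zp" "pabs (\<Sum>i\<le>d. c i * of_nat p ^ (d - i) :: 'q) = 1"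
    "(\<Sum>i\<le>d. \<iota> (c i) * a ^ i) = 0"
    using integral_relation[OF a(1)] by metis
  define P where "P = (\<Sum>i\<le>d. c i * of_nat p ^ (d - i))"
  have ex: "\<exists>q\<in>OK. (1 - t) ^ i = 1 - t * q" for i
  proof (induction i)
    case 0 then show ?case by (auto intro!: bexI[of _ 0])
  next
    case (Suc i)
    then obtain q where q: "q \<in> OK" "(1 - t) ^ i = 1 - t * q" by blast
    have "(1 - t) ^ Suc i = 1 - t * (1 + q - t * q)"
      by (simp only: power_Suc q) (simp add: algebra_simps)
    then show ?case using q tO by (intro bexI[of _ "1 + q - t * q"]) (auto intro!: OK_add OK_diff OK_mult)
  qed
  then obtain q where q: "\<And>i. q i \<in> OK" "\<And>i. (1 - t) ^ i = 1 - t * q i" by metis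
  define Q where "Q = (\<Sum>i\<le>d. \<iota> (c i) * of_nat p ^ (d - i) * q i)"
  have QO: "Q \<in> OK" unfolding Q_def
    by (intro OK_sum OK_mult OK_power OK_of_nat Zp_in_OK c q)
  have "0 = (\<Sum>i\<le>d. \<iota> (c i) * of_nat p ^ (d - i) * (1 - t * q i))"
    using integral_relation_times_p[OF c(3)] unfolding pa q(2) by simp
  also have "\<dots> = \<iota> P - t * Q"
    by (simp add: P_def Q_def iota_sum iota_mult iota_power right_diff_distrib sum_subtractf
        sum_distrib_left mult.left_commute)
  finally have PQ: "\<iota> P = t * Q" by simp
  have P1: "pabs P = 1" using c(2) by (simp add: P_def)
  then have "P \<noteq> 0" by auto
  then have "1 = \<iota> P * \<iota> (inverse P)" by (simp flip: iota_mult add: iota_one)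
  also have "\<dots> = (e * Q * \<iota> (inverse P)) * \<pi>" by (simp add: PQ t_def)
  finally have "1 \<in> unif_ideal" unfolding unif_ideal_def
    using Zp_in_OK[OF pabs_eq_1_Zp_inverse[OF P1]] a QO by (auto intro!: OK_mult)
  then show False using one_notin_unif_ideal by simp
qed

lemma unit_mod_uniformizer_power:
  assumes "a \<in> OK" "a \<notin> unif_ideal"
  shows "\<exists>b\<in>OK. \<exists>c\<in>OK. a * b + c * \<pi> ^ m = 1"
proof (induction m)
  case 0
  have "a * 0 + 1 * \<pi> ^ 0 = 1" by simp
  then show ?case using OK_0 OK_1 by blast
next
  case (Suc m)
  then obtain b c where bc: "b \<in> OK" "c \<in> OK" "a * b + c * \<pi> ^ m = 1" by blast
  obtain b' c' where bc': "b' \<in> OK" "c' \<in> OK" "a * b' + c' * \<pi> = 1"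
    using unit_mod_uniformizer[OF assms] by blast
  have "a * (b + c * \<pi> ^ m * b') + (c * c') * \<pi> ^ Suc m
      = a * b + c * \<pi> ^ m * (a * b' + c' * \<pi>)" by (simp add: algebra_simps)
  also have "\<dots> = 1" using bc bc' by simp
  finally show ?case using bc bc' uniformizer_in assms
    by (intro bexI[of _ "b + c * \<pi> ^ m * b'"] bexI[of _ "c * c'"]) (auto intro!: OK_add OK_mult OK_power)
qed

text \<open>
  The bound \<open>m\<close> makes the repeated division by \<open>\<pi>\<close> terminate.
\<close>

lemma uniformizer_factor:
  assumes "a \<in> OK"
  shows "\<exists>j\<le>m. \<exists>b\<in>OK. a = \<pi> ^ j * b \<and> (j = m \<or> b \<notin> unif_ideal)"
proof (induction m)
  case 0 then show ?case using assms by simp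
next
  case (Suc m)
  then obtain j b where j: "j \<le> m" "b \<in> OK" "a = \<pi> ^ j * b" "j = m \<or> b \<notin> unif_ideal" by blast
  show ?case
  proof (cases "b \<in> unif_ideal")
    case True
    then obtain b' where "b' \<in> OK" "b = b' * \<pi>" by (auto simp: unif_ideal_def)
    moreover have "j = m" using True j by blast
    ultimately show ?thesis using j by (intro exI[of _ "Suc m"]) (auto simp: algebra_simps intro!: bexI[of _ b'])
  next
    case False
    then show ?thesis using j by (intro exI[of _ j]) auto
  qed
qed

lemma inverse_uniformizer_power_notin: "0 < i \<Longrightarrow> 1 / \<pi> ^ i \<notin> OK"
proof
  assume i: "0 < i" "1 / \<pi> ^ i \<in> OK"
  have e: "1 = (1 / \<pi> ^ i * \<pi> ^ (i - 1)) * \<pi>"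
    using i uniformizer_nonzero by (cases i) (auto simp: field_simps)
  have "1 / \<pi> ^ i * \<pi> ^ (i - 1) \<in> OK"
    using i uniformizer_in by (intro OK_mult OK_power)
  with e have "1 \<in> unif_ideal" unfolding unif_ideal_def by blast
  then show False using one_notin_unif_ideal by simp
qed

lemma p_power_h_multiple: "\<exists>x\<in>OK. of_nat p ^ h = x * \<pi> ^ h"
proof -
  obtain x where "x \<in> OK" "of_nat p = x * \<pi>" using p_in_unif_ideal by (auto simp: unif_ideal_def)
  then show ?thesis by (intro bexI[of _ "x ^ h"]) (auto simp: power_mult_distrib OK_power)
qed

subsection \<open>The coefficient ring\<close>

lemma modulus_ideal: "ideal modulus oring"
  unfolding modulus_def using uniformizer_in by (intro oR.cgenideal_ideal) (simp add: OK_power)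

lemma modulus_eq: "modulus = {x * \<pi> ^ h | x. x \<in> OK}"
  by (simp add: modulus_def cgenideal_def)

text \<open>
  The class in \<open>A = o/\<pi>\<^sup>h\<close>. Module elements are multiplied by integral
  elements through it, so that computations with scalars take place in a field.
\<close>

definition cls :: "'k \<Rightarrow> 'k set" where "cls c = modulus +>\<^bsub>oring\<^esub> c"

lemma A_cring: "cring A"
  unfolding A_def by (rule ideal.quotient_is_cring[OF modulus_ideal oring_cring])

lemma cls_hom: "cls \<in> ring_hom oring A"
  unfolding A_def cls_def[abs_def] by (rule ideal.rcos_ring_hom[OF modulus_ideal])

lemma cls_closed: "c \<in> OK \<Longrightarrow> cls c \<in> carrier A"
  using ring_hom_closed[OF cls_hom] by simp
lemma cls_add: "a \<in> OK \<Longrightarrow> b \<in> OK \<Longrightarrow> cls (a + b) = cls a \<oplus>\<^bsub>A\<^esub> cls b"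
  using ring_hom_add[OF cls_hom, of a b] by simp
lemma cls_mult: "a \<in> OK \<Longrightarrow> b \<in> OK \<Longrightarrow> cls (a * b) = cls a \<otimes>\<^bsub>A\<^esub> cls b"
  using ring_hom_mult[OF cls_hom, of a b] by simp
lemma cls_one: "cls 1 = \<one>\<^bsub>A\<^esub>"
  using ring_hom_one[OF cls_hom] by simp
lemma cls_zero: "cls 0 = \<zero>\<^bsub>A\<^esub>"
  using ring_hom_zero[OF cls_hom oring_ring ideal.quotient_is_ring[OF modulus_ideal, folded A_def]] by simp
lemma A_elem: "a \<in> carrier A \<Longrightarrow> \<exists>c\<in>OK. a = cls c"
  by (auto simp: A_def FactRing_def A_RCOSETS_def' cls_def)

lemma cls_eq_iff: "a \<in> OK \<Longrightarrow> b \<in> OK \<Longrightarrow> cls a = cls b \<longleftrightarrow> a - b \<in> modulus"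
proof -
  assume ab: "a \<in> OK" "b \<in> OK"
  interpret I: ideal modulus oring by (rule modulus_ideal)
  have "a - b = a \<ominus>\<^bsub>oring\<^esub> b" using ab by (simp add: a_minus_def oring_a_inv)
  then show ?thesis unfolding cls_def
    using oR.quotient_eq_iff_same_a_r_cos[OF modulus_ideal, of a b] ab by simp
qed

lemma const_o_def': "const_o c = (\<lambda>n. if n = 0 then cls c else \<zero>\<^bsub>A\<^esub>)"
  by (rule ext) (simp add: const_o_def cls_def)

lemma cls_pi_h: "cls (\<pi> ^ h) = \<zero>\<^bsub>A\<^esub>"
proof -
  have "cls (\<pi> ^ h) = cls 0"
    using uniformizer_in by (subst cls_eq_iff) (auto simp: OK_power modulus_eq intro!: exI[of _ 1])
  then show ?thesis by (simp add: cls_zero)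
qed

lemma cls_p_h: "cls (of_nat p ^ h) = \<zero>\<^bsub>A\<^esub>"
proof -
  obtain x where "x \<in> OK" "of_nat p ^ h = x * \<pi> ^ h" using p_power_h_multiple by blast
  then have "cls (of_nat p ^ h) = cls 0"
    using uniformizer_in by (subst cls_eq_iff) (auto simp: OK_mult OK_power modulus_eq)
  then show ?thesis by (simp add: cls_zero)
qed

subsection \<open>The group \<open>K/o\<close>\<close>

definition kcl :: "'k \<Rightarrow> 'k set" where "kcl x = {y. y - x \<in> OK}"

lemma kcl_eq: "ring_of_integers \<iota> +>\<^bsub>K\<^esub> x = kcl x"
  by (auto simp: kcl_def a_r_coset_def' intro!: bexI[of _ "_ - x"])

lemma kcl_eq_iff: "kcl x = kcl y \<longleftrightarrow> x - y \<in> OK"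
proof
  assume "kcl x = kcl y"
  moreover have "x \<in> kcl x" by (simp add: kcl_def)
  ultimately show "x - y \<in> OK" by (simp add: kcl_def)
next
  assume xy: "x - y \<in> OK"
  have "z - y = (z - x) + (x - y)" "z - x = (z - y) - (x - y)" for z by simp_all
  then show "kcl x = kcl y" unfolding kcl_def using xy OK_add OK_diff by metis
qed

lemma K_mod_o_carrier: "carrier K_mod_o = range kcl"
proof -
  have "carrier K_mod_o = a_rcosets\<^bsub>K\<^esub> OK"
    by (simp add: K_mod_o_def A_FactGroup_def FactGroup_def A_RCOSETS_def)
  also have "\<dots> = range kcl" by (auto simp: A_RCOSETS_def' kcl_eq)
  finally show ?thesis .
qed

lemma K_mod_o_one: "\<one>\<^bsub>K_mod_o\<^esub> = kcl 0"
  by (simp add: K_mod_o_def A_FactGroup_def FactGroup_def kcl_def)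

lemma K_mod_o_mult: "kcl x \<otimes>\<^bsub>K_mod_o\<^esub> kcl y = kcl (x + y)"
proof -
  have "kcl x \<otimes>\<^bsub>K_mod_o\<^esub> kcl y = {a + b | a b. a \<in> kcl x \<and> b \<in> kcl y}"
    by (auto simp: K_mod_o_def A_FactGroup_def FactGroup_def set_mult_def)
  also have "\<dots> = kcl (x + y)"
  proof (intro equalityI subsetI)
    fix z assume "z \<in> {a + b | a b. a \<in> kcl x \<and> b \<in> kcl y}"
    then obtain a b where "z = a + b" "a - x \<in> OK" "b - y \<in> OK" by (auto simp: kcl_def)
    then show "z \<in> kcl (x + y)" using OK_add[of "a - x" "b - y"] by (simp add: kcl_def algebra_simps)
  next
    fix z assume "z \<in> kcl (x + y)"
    then have "z = x + (z - x) \<and> x \<in> kcl x \<and> z - x \<in> kcl y" by (simp add: kcl_def diff_diff_eq)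
    then show "z \<in> {a + b | a b. a \<in> kcl x \<and> b \<in> kcl y}" by (intro CollectI exI)
  qed
  finally show ?thesis .
qed

lemma scale_kcl: "c \<in> OK \<Longrightarrow> scale_K_mod_o c (kcl x) = kcl (c * x)"
proof -
  assume c: "c \<in> OK"
  have "kcl (c * y) = kcl (c * x)" if "y \<in> kcl x" for y
    using that OK_mult[OF c, of "y - x"] unfolding kcl_eq_iff by (simp add: kcl_def right_diff_distrib)
  moreover have "x \<in> kcl x" by (simp add: kcl_def)
  ultimately show ?thesis unfolding scale_K_mod_o_def kcl_eq by blast
qed

lemma K_mod_o_comm_group: "comm_group K_mod_o"
proof (rule comm_groupI)
  fix x assume "x \<in> carrier K_mod_o"
  then obtain a where "x = kcl a" by (auto simp: K_mod_o_carrier)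
  then show "\<exists>y\<in>carrier K_mod_o. y \<otimes>\<^bsub>K_mod_o\<^esub> x = \<one>\<^bsub>K_mod_o\<^esub>"
    by (auto simp: K_mod_o_carrier K_mod_o_mult K_mod_o_one intro!: exI[of _ "-a"])
qed (auto simp: K_mod_o_carrier K_mod_o_mult K_mod_o_one add_ac)

end

section \<open>Pontryagin duality separates points\<close>

context coefficients
begin

lemma cls_smult:
  fixes V :: "('k set, 'v) module"
  assumes V: "module A V" and v: "v \<in> carrier V"
  shows "a \<in> OK \<Longrightarrow> b \<in> OK \<Longrightarrow> cls (a + b) \<odot>\<^bsub>V\<^esub> v = cls a \<odot>\<^bsub>V\<^esub> v \<oplus>\<^bsub>V\<^esub> cls b \<odot>\<^bsub>V\<^esub> v"
    and "a \<in> OK \<Longrightarrow> b \<in> OK \<Longrightarrow> cls (a * b) \<odot>\<^bsub>V\<^esub> v = cls a \<odot>\<^bsub>V\<^esub> (cls b \<odot>\<^bsub>V\<^esub> v)"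
    and "a \<in> OK \<Longrightarrow> cls a \<odot>\<^bsub>V\<^esub> v \<in> carrier V"
    and "cls 1 \<odot>\<^bsub>V\<^esub> v = v" and "cls 0 \<odot>\<^bsub>V\<^esub> v = \<zero>\<^bsub>V\<^esub>"
    and "cls (\<pi> ^ h) \<odot>\<^bsub>V\<^esub> v = \<zero>\<^bsub>V\<^esub>"
    and "cls (of_nat p ^ h) \<odot>\<^bsub>V\<^esub> v = \<zero>\<^bsub>V\<^esub>"
    and "a \<in> OK \<Longrightarrow> cls (- a) \<odot>\<^bsub>V\<^esub> v = \<ominus>\<^bsub>V\<^esub> (cls a \<odot>\<^bsub>V\<^esub> v)"
proof -
  interpret V: module A V by (rule V)
  have 1: "cls (a + b) \<odot>\<^bsub>V\<^esub> v = cls a \<odot>\<^bsub>V\<^esub> v \<oplus>\<^bsub>V\<^esub> cls b \<odot>\<^bsub>V\<^esub> v" if "a \<in> OK" "b \<in> OK" for a b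
    using v that by (simp add: cls_add cls_closed V.smult_l_distr)
  then show "a \<in> OK \<Longrightarrow> b \<in> OK \<Longrightarrow> cls (a + b) \<odot>\<^bsub>V\<^esub> v = cls a \<odot>\<^bsub>V\<^esub> v \<oplus>\<^bsub>V\<^esub> cls b \<odot>\<^bsub>V\<^esub> v" .
  show "a \<in> OK \<Longrightarrow> b \<in> OK \<Longrightarrow> cls (a * b) \<odot>\<^bsub>V\<^esub> v = cls a \<odot>\<^bsub>V\<^esub> (cls b \<odot>\<^bsub>V\<^esub> v)"
    using v by (simp add: cls_mult cls_closed V.smult_assoc1)
  have 2: "cls a \<odot>\<^bsub>V\<^esub> v \<in> carrier V" if "a \<in> OK" for a
    using v that by (simp add: cls_closed)
  then show "a \<in> OK \<Longrightarrow> cls a \<odot>\<^bsub>V\<^esub> v \<in> carrier V" .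
  show "cls 1 \<odot>\<^bsub>V\<^esub> v = v" "cls (\<pi> ^ h) \<odot>\<^bsub>V\<^esub> v = \<zero>\<^bsub>V\<^esub>"
    "cls (of_nat p ^ h) \<odot>\<^bsub>V\<^esub> v = \<zero>\<^bsub>V\<^esub>"
    using v by (simp_all add: cls_one cls_pi_h cls_p_h)
  show 3: "cls 0 \<odot>\<^bsub>V\<^esub> v = \<zero>\<^bsub>V\<^esub>" using v by (simp add: cls_zero)
  assume a: "a \<in> OK"
  have "cls (- a) \<odot>\<^bsub>V\<^esub> v \<oplus>\<^bsub>V\<^esub> cls a \<odot>\<^bsub>V\<^esub> v = \<zero>\<^bsub>V\<^esub>"
    using 1[of "-a" a] 3 a OK_minus by simp
  then show "cls (- a) \<odot>\<^bsub>V\<^esub> v = \<ominus>\<^bsub>V\<^esub> (cls a \<odot>\<^bsub>V\<^esub> v)"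
    using 2 a OK_minus by (metis V.minus_equality)
qed

lemma cls_smult_zero: "module A V \<Longrightarrow> a \<in> OK \<Longrightarrow> cls a \<odot>\<^bsub>V\<^esub> \<zero>\<^bsub>V\<^esub> = \<zero>\<^bsub>V\<^esub>"
  by (simp add: cls_closed module.smult_r_null)

text \<open>
  Partial \<open>o\<close>-linear maps from \<open>V\<close> to \<open>K/o\<close>, encoded by the
  preimage of their graphs in \<open>V \<times> K\<close>. In this form, the values need no choice
  of representatives, and a graph over all of \<open>V\<close> is a map to cosets of
  \<open>o\<close>.
\<close>

definition partial_functional :: "('k set, 'v) module \<Rightarrow> ('v \<times> 'k) set \<Rightarrow> bool" where
  "partial_functional V G \<longleftrightarrow> G \<subseteq> carrier V \<times> UNIV \<and>
     (\<forall>v x w y. (v, x) \<in> G \<longrightarrow> (w, y) \<in> G \<longrightarrow> (v \<oplus>\<^bsub>V\<^esub> w, x + y) \<in> G) \<and>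
     (\<forall>c\<in>OK. \<forall>v x. (v, x) \<in> G \<longrightarrow> (cls c \<odot>\<^bsub>V\<^esub> v, c * x) \<in> G) \<and>
     (\<forall>x. (\<zero>\<^bsub>V\<^esub>, x) \<in> G \<longleftrightarrow> x \<in> OK)"

text \<open>
  The annihilator of \<open>v\<close> modulo the domain is generated by a power \<open>\<pi>\<^sup>i\<close>, so the value at \<open>v\<close> may be
  any quotient by \<open>\<pi>\<^sup>i\<close> of the value at \<open>\<pi>\<^sup>i v\<close>; this is where the divisibility of \<open>K/o\<close> enters.
\<close>

lemma partial_functional_extend:
  fixes V :: "('k set, 'v) module"
  assumes V: "module A V" and G: "partial_functional V G" and v: "v \<in> carrier V"
    and i: "(cls (\<pi> ^ i) \<odot>\<^bsub>V\<^esub> v, y) \<in> G"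
    and min: "\<And>j z. j < i \<Longrightarrow> (cls (\<pi> ^ j) \<odot>\<^bsub>V\<^esub> v, z) \<notin> G"
  shows "\<exists>G'. partial_functional V G' \<and> G \<subseteq> G' \<and> (v, y / \<pi> ^ i) \<in> G'"
proof -
  interpret V: module A V by (rule V)
  note sm = cls_smult[OF V]
  define G' where "G' = {(u \<oplus>\<^bsub>V\<^esub> cls a \<odot>\<^bsub>V\<^esub> v, x + a * (y / \<pi> ^ i)) | u x a. (u, x) \<in> G \<and> a \<in> OK}"
  have Gc: "u \<in> carrier V" if "(u, x) \<in> G" for u x using G that by (auto simp: partial_functional_def)
  have Gadd: "(u \<oplus>\<^bsub>V\<^esub> u', x + x') \<in> G" if "(u, x) \<in> G" "(u', x') \<in> G" for u u' x x'
    using G that by (auto simp: partial_functional_def)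
  have Gsm: "(cls c \<odot>\<^bsub>V\<^esub> u, c * x) \<in> G" if "(u, x) \<in> G" "c \<in> OK" for u x c
    using G that by (auto simp: partial_functional_def)
  have G0: "(\<zero>\<^bsub>V\<^esub>, x) \<in> G \<longleftrightarrow> x \<in> OK" for x using G by (auto simp: partial_functional_def)
  have pow: "\<pi> ^ j \<in> OK" for j using uniformizer_in OK_power by blast
  have sub: "G \<subseteq> G'"
  proof clarify
    fix u x assume ux: "(u, x) \<in> G"
    have "(u, x) = (u \<oplus>\<^bsub>V\<^esub> cls 0 \<odot>\<^bsub>V\<^esub> v, x + 0 * (y / \<pi> ^ i))"
      using Gc[OF ux] v by (simp add: sm)
    then show "(u, x) \<in> G'" unfolding G'_def using ux OK_0 by blast
  qed
  have "(v, y / \<pi> ^ i) = (\<zero>\<^bsub>V\<^esub> \<oplus>\<^bsub>V\<^esub> cls 1 \<odot>\<^bsub>V\<^esub> v, 0 + 1 * (y / \<pi> ^ i))"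
    using v by (simp add: sm)
  then have vG: "(v, y / \<pi> ^ i) \<in> G'" unfolding G'_def using G0 OK_0 OK_1 by blast
  have ker: "x + a * (y / \<pi> ^ i) \<in> OK"
    if ux: "(u, x) \<in> G" and a: "a \<in> OK" and z: "u \<oplus>\<^bsub>V\<^esub> cls a \<odot>\<^bsub>V\<^esub> v = \<zero>\<^bsub>V\<^esub>" for u x a
  proof -
    have av: "(cls a \<odot>\<^bsub>V\<^esub> v, - x) \<in> G"
    proof -
      have "cls a \<odot>\<^bsub>V\<^esub> v = \<ominus>\<^bsub>V\<^esub> u"
        using z Gc[OF ux] v a by (metis V.add.m_comm V.minus_equality sm(3))
      also have "\<dots> = cls (- 1) \<odot>\<^bsub>V\<^esub> u" using Gc[OF ux] by (simp add: sm)
      finally show ?thesis using Gsm[OF ux, of "-1"] OK_minus[OF OK_1] by simp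
    qed
    obtain j b where j: "j \<le> i" "b \<in> OK" "a = \<pi> ^ j * b" "j = i \<or> b \<notin> unif_ideal"
      using uniformizer_factor[OF a, of i] by blast
    show ?thesis
    proof (cases "j = i")
      case True
      have "(cls a \<odot>\<^bsub>V\<^esub> v, b * y) \<in> G"
        using Gsm[OF i j(2)] j v pow True by (simp add: sm mult.commute[of "\<pi> ^ i"])
      then have "(cls (-1) \<odot>\<^bsub>V\<^esub> (cls a \<odot>\<^bsub>V\<^esub> v), -1 * (b * y)) \<in> G"
        using Gsm OK_minus[OF OK_1] by blast
      from Gadd[OF this av] have "(\<zero>\<^bsub>V\<^esub>, - (b * y) - x) \<in> G"
        using v a by (simp add: sm V.l_neg)
      then have "- (b * y) - x \<in> OK" using G0 by blast
      then have "x + b * y \<in> OK" using OK_minus[of "- (b * y) - x"] by (simp add: add.commute)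
      moreover have "a * (y / \<pi> ^ i) = b * y" using j True uniformizer_nonzero by simp
      ultimately show ?thesis by simp
    next
      case False
      then obtain c d where cd: "c \<in> OK" "d \<in> OK" "b * c + d * \<pi> ^ h = 1"
        using j unit_mod_uniformizer_power by blast
      have e: "\<pi> ^ j = c * a + \<pi> ^ j * d * \<pi> ^ h"
        using arg_cong[OF cd(3), of "\<lambda>z. \<pi> ^ j * z"] j(3) by (simp add: algebra_simps)
      have "cls (\<pi> ^ j) \<odot>\<^bsub>V\<^esub> v = cls (c * a) \<odot>\<^bsub>V\<^esub> v \<oplus>\<^bsub>V\<^esub> cls (\<pi> ^ j * d * \<pi> ^ h) \<odot>\<^bsub>V\<^esub> v"
        using cd a v pow by (subst e) (intro sm(1) OK_mult)
      also have "\<dots> = cls c \<odot>\<^bsub>V\<^esub> (cls a \<odot>\<^bsub>V\<^esub> v)"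
        using cd a v pow by (simp add: sm OK_mult cls_smult_zero[OF V])
      finally show ?thesis
        using Gsm[OF av cd(1)] min[of j] False j by auto
    qed
  qed
  have "partial_functional V G'"
    unfolding partial_functional_def
  proof (intro conjI allI ballI impI)
    show "G' \<subseteq> carrier V \<times> UNIV" unfolding G'_def using Gc v by (auto simp: sm)
  next
    fix v1 x1 v2 x2 assume "(v1, x1) \<in> G'" "(v2, x2) \<in> G'"
    then obtain u z a u' z' a' where *: "(u, z) \<in> G" "a \<in> OK" "v1 = u \<oplus>\<^bsub>V\<^esub> cls a \<odot>\<^bsub>V\<^esub> v" "x1 = z + a * (y / \<pi> ^ i)"
      "(u', z') \<in> G" "a' \<in> OK" "v2 = u' \<oplus>\<^bsub>V\<^esub> cls a' \<odot>\<^bsub>V\<^esub> v" "x2 = z' + a' * (y / \<pi> ^ i)"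
      unfolding G'_def by blast
    have "v1 \<oplus>\<^bsub>V\<^esub> v2 = (u \<oplus>\<^bsub>V\<^esub> u') \<oplus>\<^bsub>V\<^esub> cls (a + a') \<odot>\<^bsub>V\<^esub> v"
      using * Gc v by (simp add: sm V.add.m_ac)
    moreover have "x1 + x2 = (z + z') + (a + a') * (y / \<pi> ^ i)" using * by (simp add: distrib_right add_divide_distrib)
    ultimately show "(v1 \<oplus>\<^bsub>V\<^esub> v2, x1 + x2) \<in> G'"
      unfolding G'_def using Gadd * OK_add by blast
  next
    fix c v1 x1 assume c: "c \<in> OK" and "(v1, x1) \<in> G'"
    then obtain u z a where *: "(u, z) \<in> G" "a \<in> OK" "v1 = u \<oplus>\<^bsub>V\<^esub> cls a \<odot>\<^bsub>V\<^esub> v" "x1 = z + a * (y / \<pi> ^ i)"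
      unfolding G'_def by blast
    have "cls c \<odot>\<^bsub>V\<^esub> v1 = cls c \<odot>\<^bsub>V\<^esub> u \<oplus>\<^bsub>V\<^esub> cls (c * a) \<odot>\<^bsub>V\<^esub> v"
      using * Gc v c by (simp add: sm cls_closed V.smult_r_distr)
    moreover have "c * x1 = c * z + (c * a) * (y / \<pi> ^ i)" using * by (simp add: distrib_left)
    ultimately show "(cls c \<odot>\<^bsub>V\<^esub> v1, c * x1) \<in> G'"
      unfolding G'_def using Gsm * c OK_mult by blast
  next
    fix x show "(\<zero>\<^bsub>V\<^esub>, x) \<in> G' \<longleftrightarrow> x \<in> OK"
    proof
      assume "(\<zero>\<^bsub>V\<^esub>, x) \<in> G'"
      then obtain u z a where *: "(u, z) \<in> G" "a \<in> OK" "\<zero>\<^bsub>V\<^esub> = u \<oplus>\<^bsub>V\<^esub> cls a \<odot>\<^bsub>V\<^esub> v" "x = z + a * (y / \<pi> ^ i)"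
        unfolding G'_def by blast
      then show "x \<in> OK" using ker[of u z a] by simp
    qed (use sub G0 in blast)
  qed
  then show ?thesis using sub vG by blast
qed

lemma partial_functional_extend':
  fixes V :: "('k set, 'v) module"
  assumes V: "module A V" and G: "partial_functional V G" and v: "v \<in> carrier V"
  shows "\<exists>G' x. partial_functional V G' \<and> G \<subseteq> G' \<and> (v, x) \<in> G'"
proof -
  let ?P = "\<lambda>i. \<exists>y. (cls (\<pi> ^ i) \<odot>\<^bsub>V\<^esub> v, y) \<in> G"
  have "(\<zero>\<^bsub>V\<^esub>, 0) \<in> G" using G by (auto simp: partial_functional_def)
  then have "?P h" using cls_smult(6)[OF V v] by metis
  then have "?P (LEAST i. ?P i)" by (rule LeastI)
  then show ?thesis
    using partial_functional_extend[OF V G v, of "LEAST i. ?P i"] not_less_Least[of _ ?P] by blast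
qed

text \<open>
  If \<open>i\<close> is the exponent with which \<open>\<pi>\<close> annihilates \<open>w\<close>,
  then \<open>1/\<pi>\<^sup>i\<close> is an admissible value at \<open>w\<close>; by Zorn's lemma,
  the functional on the submodule generated by \<open>w\<close> extends to \<open>V\<close>.
\<close>

theorem dual_separates_points:
  fixes V :: "('k set, 'v) module"
  assumes V: "module A V" and w: "w \<in> carrier V" "w \<noteq> \<zero>\<^bsub>V\<^esub>"
  shows "\<exists>f. (\<forall>v\<in>carrier V. f v \<in> carrier K_mod_o) \<and>
    (\<forall>v\<in>carrier V. \<forall>v'\<in>carrier V. f (v \<oplus>\<^bsub>V\<^esub> v') = f v \<otimes>\<^bsub>K_mod_o\<^esub> f v') \<and>
    (\<forall>c\<in>OK. \<forall>v\<in>carrier V. f (cls c \<odot>\<^bsub>V\<^esub> v) = scale_K_mod_o c (f v)) \<and>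
    f w \<noteq> \<one>\<^bsub>K_mod_o\<^esub>"
proof -
  interpret V: module A V by (rule V)
  note sm = cls_smult[OF V]
  define G0 :: "('v \<times> 'k) set" where "G0 = {\<zero>\<^bsub>V\<^esub>} \<times> OK"
  have G0: "partial_functional V G0"
    unfolding partial_functional_def G0_def by (auto simp: OK_add OK_mult cls_closed)
  \<comment> \<open>the exponent of the annihilator of \<open>w\<close> is positive, and \<open>1/\<pi>\<^sup>i\<close> is then nonzero in \<open>K/o\<close>\<close>
  let ?P = "\<lambda>i. cls (\<pi> ^ i) \<odot>\<^bsub>V\<^esub> w = \<zero>\<^bsub>V\<^esub>"
  define i where "i = (LEAST i. ?P i)"
  have "?P h" using cls_smult(6)[OF V w(1)] by metis
  then have i: "?P i" unfolding i_def by (rule LeastI)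
  have i0: "0 < i" using i w sm(4)[OF w(1)] by (cases i) auto
  have "\<exists>G'. partial_functional V G' \<and> G0 \<subseteq> G' \<and> (w, 1 / \<pi> ^ i) \<in> G'"
    by (rule partial_functional_extend[OF V G0 w(1)])
      (use i not_less_Least[of _ ?P] in \<open>auto simp: G0_def i_def\<close>)
  then obtain G1 where G1: "partial_functional V G1" "(w, 1 / \<pi> ^ i) \<in> G1" by blast
  let ?\<A> = "{G. partial_functional V G \<and> G1 \<subseteq> G}"
  have "\<exists>M\<in>?\<A>. \<forall>G\<in>?\<A>. M \<subseteq> G \<longrightarrow> G = M"
  proof (rule subset_Zorn_nonempty)
    show "?\<A> \<noteq> {}" using G1 by blast
    fix C assume C: "C \<noteq> {}" "subset.chain ?\<A> C"
    have mem: "partial_functional V G" "G1 \<subseteq> G" if "G \<in> C" for G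
      using C(2) that unfolding subset.chain_def by auto
    have ch: "G \<subseteq> G' \<or> G' \<subseteq> G" if "G \<in> C" "G' \<in> C" for G G'
      using C(2) that unfolding subset.chain_def by blast
    have "partial_functional V (\<Union>C)"
      unfolding partial_functional_def
    proof (intro conjI allI ballI impI)
      show "\<Union>C \<subseteq> carrier V \<times> UNIV" using mem(1) unfolding partial_functional_def by blast
    next
      fix v x v' x' assume "(v, x) \<in> \<Union>C" "(v', x') \<in> \<Union>C"
      then obtain G where "G \<in> C" "(v, x) \<in> G" "(v', x') \<in> G" using ch by blast
      then show "(v \<oplus>\<^bsub>V\<^esub> v', x + x') \<in> \<Union>C" using mem(1) unfolding partial_functional_def by blast
    next
      fix c v x assume "c \<in> OK" "(v, x) \<in> \<Union>C"
      then show "(cls c \<odot>\<^bsub>V\<^esub> v, c * x) \<in> \<Union>C" using mem(1) unfolding partial_functional_def by blast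
    next
      fix x show "(\<zero>\<^bsub>V\<^esub>, x) \<in> \<Union>C \<longleftrightarrow> x \<in> OK"
        using mem(1) C(1) unfolding partial_functional_def by blast
    qed
    then show "\<Union>C \<in> ?\<A>" using C(1) mem(2) by blast
  qed
  then obtain G where GA: "G \<in> ?\<A>" and Gmax: "\<forall>G'\<in>?\<A>. G \<subseteq> G' \<longrightarrow> G' = G" by (rule bexE)
  from GA have G: "partial_functional V G" "G1 \<subseteq> G" by simp_all
  have max: "G' = G" if "partial_functional V G'" "G1 \<subseteq> G'" "G \<subseteq> G'" for G'
    using Gmax that by simp
  have total: "\<exists>x. (v, x) \<in> G" if v: "v \<in> carrier V" for v
  proof -
    obtain G' x where "partial_functional V G'" "G \<subseteq> G'" "(v, x) \<in> G'"
      using partial_functional_extend'[OF V G(1) v] by blast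
    moreover from this have "G' = G" using max G(2) by blast
    ultimately show ?thesis by blast
  qed
  have Gadd: "(v \<oplus>\<^bsub>V\<^esub> v', x + x') \<in> G" if "(v, x) \<in> G" "(v', x') \<in> G" for v v' x x'
    using G that by (auto simp: partial_functional_def)
  have Gsm: "(cls c \<odot>\<^bsub>V\<^esub> v, c * x) \<in> G" if "(v, x) \<in> G" "c \<in> OK" for v x c
    using G that by (auto simp: partial_functional_def)
  define f where "f v = {x. (v, x) \<in> G}" for v
  have f: "f v = kcl x" if vx: "(v, x) \<in> G" for v x
  proof -
    have v: "v \<in> carrier V" using G(1) vx by (auto simp: partial_functional_def)
    have "(v, z) \<in> G \<longleftrightarrow> z - x \<in> OK" for z
    proof
      assume "(v, z) \<in> G"
      from Gadd[OF this Gsm[OF vx OK_minus[OF OK_1]]] have "(\<zero>\<^bsub>V\<^esub>, z - x) \<in> G"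
        using v by (simp add: sm V.r_neg)
      then show "z - x \<in> OK" using G(1) by (auto simp: partial_functional_def)
    next
      assume "z - x \<in> OK"
      then have "(\<zero>\<^bsub>V\<^esub>, z - x) \<in> G" using G(1) by (auto simp: partial_functional_def)
      from Gadd[OF this vx] show "(v, z) \<in> G" using v by simp
    qed
    then show ?thesis by (simp add: f_def kcl_def)
  qed
  show ?thesis
  proof (intro exI[of _ f] conjI ballI)
    fix v assume v: "v \<in> carrier V"
    then obtain x where x: "(v, x) \<in> G" using total by blast
    then show "f v \<in> carrier K_mod_o" by (simp add: f K_mod_o_carrier)
    show "f (cls c \<odot>\<^bsub>V\<^esub> v) = scale_K_mod_o c (f v)" if "c \<in> OK" for c
      using f[OF x] f[OF Gsm[OF x that]] that by (simp add: scale_kcl)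
    fix v' assume "v' \<in> carrier V"
    then obtain x' where x': "(v', x') \<in> G" using total by blast
    show "f (v \<oplus>\<^bsub>V\<^esub> v') = f v \<otimes>\<^bsub>K_mod_o\<^esub> f v'"
      using f[OF x] f[OF x'] f[OF Gadd[OF x x']] by (simp add: K_mod_o_mult)
  next
    have "f w = kcl (1 / \<pi> ^ i)" using f G1 G(2) by blast
    then show "f w \<noteq> \<one>\<^bsub>K_mod_o\<^esub>"
      using inverse_uniformizer_power_notin[OF i0] by (simp add: K_mod_o_one kcl_eq_iff)
  qed
qed

end

section \<open>Matrix groups and their rational points\<close>

lemma matrix_inv:
  fixes g :: "'a::field^'n::finite^'n"
  assumes "invertible g"
  shows "g ** matrix_inv g = mat 1" "matrix_inv g ** g = mat 1"
proof -
  have "g ** matrix_inv g = mat 1 \<and> matrix_inv g ** g = mat 1"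
    unfolding matrix_inv_def using assms unfolding invertible_def by (rule someI_ex)
  then show "g ** matrix_inv g = mat 1" "matrix_inv g ** g = mat 1" by auto
qed

lemma matrix_inv_eqI:
  fixes g :: "'a::field^'n::finite^'n"
  assumes "g ** g' = mat 1"
  shows "matrix_inv g = g'" "invertible g"
proof -
  show i: "invertible g" using assms invertible_right_inverse by blast
  have "matrix_inv g = matrix_inv g ** (g ** g')" using assms by simp
  also have "\<dots> = g'" by (simp add: matrix_mul_assoc matrix_inv[OF i])
  finally show "matrix_inv g = g'" .
qed

lemma matrix_inv_cancel:
  fixes g :: "'a::field^'n::finite^'n"
  assumes "invertible g"
  shows "x ** g ** matrix_inv g = x" "x ** matrix_inv g ** g = x"
  by (simp_all add: matrix_mul_assoc[symmetric] matrix_inv[OF assms])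

lemma matrix_inv_inv: "invertible g \<Longrightarrow> matrix_inv (matrix_inv g) = (g :: 'a::field^'n::finite^'n)"
  using matrix_inv_eqI(1) matrix_inv(2) by blast

lemma invertible_matrix_inv: "invertible g \<Longrightarrow> invertible (matrix_inv g :: 'a::field^'n::finite^'n)"
  using matrix_inv_eqI(2) matrix_inv(2) by blast

lemma matrix_inv_mult:
  fixes g k :: "'a::field^'n::finite^'n"
  assumes "invertible g" "invertible k"
  shows "matrix_inv (g ** k) = matrix_inv k ** matrix_inv g"
  by (rule matrix_inv_eqI) (simp add: matrix_mul_assoc matrix_inv_cancel matrix_inv assms)

lemma matrix_add_rdistrib': "(B + C) ** A = B ** A + C ** (A :: 'a::ring_1^'n::finite^'m::finite)"
  by (vector matrix_matrix_mult_def sum.distrib[symmetric] distrib_right)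
lemma matrix_diff_ldistrib: "A ** (B - C) = A ** B - A ** (C :: 'a::ring_1^'n::finite^'m::finite)"
  by (vector matrix_matrix_mult_def sum_subtractf[symmetric] right_diff_distrib)
lemma matrix_diff_rdistrib: "(B - C) ** A = B ** A - C ** (A :: 'a::ring_1^'n::finite^'m::finite)"
  by (vector matrix_matrix_mult_def sum_subtractf[symmetric] left_diff_distrib)

lemma mat_group_simps [simp]:
  "carrier (mat_group H) = H" "x \<otimes>\<^bsub>mat_group H\<^esub> y = x ** y" "\<one>\<^bsub>mat_group H\<^esub> = mat 1"
  by (simp_all add: mat_group_def)

text \<open>
  Closure conditions without a group record, to be used in calculations with matrices; they are
  equivalent to being a subgroup of the group record, by \<open>subgroup_mat_group\<close>.
\<close>

definition matrix_subgroup :: "('a::field^'n::finite^'n) set \<Rightarrow> bool" where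
  "matrix_subgroup H \<longleftrightarrow> H \<subseteq> GL \<and> mat 1 \<in> H \<and> (\<forall>x\<in>H. \<forall>y\<in>H. x ** y \<in> H) \<and> (\<forall>x\<in>H. matrix_inv x \<in> H)"

lemma matrix_subgroupD:
  assumes "matrix_subgroup H"
  shows "x \<in> H \<Longrightarrow> invertible x" "mat 1 \<in> H" "x \<in> H \<Longrightarrow> y \<in> H \<Longrightarrow> x ** y \<in> H"
    "x \<in> H \<Longrightarrow> matrix_inv x \<in> H"
  using assms by (auto simp: matrix_subgroup_def GL_def)

lemma matrix_subgroup_group:
  assumes "matrix_subgroup H"
  shows "group (mat_group H)" "x \<in> H \<Longrightarrow> inv\<^bsub>mat_group H\<^esub> x = matrix_inv x"
proof -
  show G: "group (mat_group H)"
  proof (rule groupI)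
    fix x assume "x \<in> carrier (mat_group H)"
    then show "\<exists>y\<in>carrier (mat_group H). y \<otimes>\<^bsub>mat_group H\<^esub> x = \<one>\<^bsub>mat_group H\<^esub>"
      using matrix_subgroupD[OF assms] matrix_inv(2) by fastforce
  qed (use matrix_subgroupD[OF assms] in \<open>auto simp: matrix_mul_assoc\<close>)
  show "inv\<^bsub>mat_group H\<^esub> x = matrix_inv x" if "x \<in> H"
    using matrix_subgroupD[OF assms] that matrix_inv(2)[OF matrix_subgroupD(1)[OF assms that]]
    by (intro group.inv_equality[OF G]) simp_all
qed

lemma matrix_subgroup_GL: "matrix_subgroup (GL :: ('a::field^'n::finite^'n) set)"
  by (auto simp: matrix_subgroup_def GL_def invertible_mult invertible_matrix_inv
      intro: matrix_inv_eqI(2)[of _ "mat 1"])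

lemma subgroup_mat_group:
  assumes "matrix_subgroup H" "subgroup L (mat_group H)"
  shows "matrix_subgroup L"
proof -
  have "L \<subseteq> H" using subgroup.subset[OF assms(2)] by simp
  then show ?thesis
    using subgroup.one_closed[OF assms(2)] subgroup.m_closed[OF assms(2)]
      subgroup.m_inv_closed[OF assms(2)] matrix_subgroup_group(2)[OF assms(1)]
      matrix_subgroupD(1)[OF assms(1)]
    unfolding matrix_subgroup_def GL_def by (auto simp: subset_eq)
qed

lemma map_matrix_to_ac:
  fixes a b :: "'q::field^'n::finite^'n"
  shows "map_matrix to_ac (a ** b) = map_matrix to_ac a ** map_matrix to_ac b"
    and "map_matrix to_ac (mat 1 :: 'q^'n^'n) = mat 1"
    and "map_matrix to_ac (a - b) = map_matrix to_ac a - map_matrix to_ac b"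
  by (auto simp: vec_eq_iff matrix_matrix_mult_def mat_def to_ac_sum)

lemma invertible_of_map_to_ac:
  fixes a :: "'q::field^'n::finite^'n"
  assumes "invertible (map_matrix to_ac a)"
  shows "invertible a"
proof -
  have "det (map_matrix to_ac a) = to_ac (det a)"
    by (simp add: det_def to_ac_sum to_ac_prod)
  then show ?thesis using assms invertible_det_nz by (metis to_ac_0)
qed

lemma map_to_ac_matrix_inv:
  fixes a :: "'q::field^'n::finite^'n"
  assumes "invertible a"
  shows "map_matrix to_ac (matrix_inv a) = matrix_inv (map_matrix to_ac a)"
  by (rule matrix_inv_eqI(1)[symmetric])
    (simp add: matrix_inv[OF assms] map_matrix_to_ac flip: map_matrix_to_ac(1))

lemma rational_points_subgroup:
  fixes H :: "('q::field alg_closure^'n::finite^'n) set"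
  assumes "matrix_subgroup H"
  shows "matrix_subgroup (rational_points H)"
proof -
  have inv: "invertible x" if "x \<in> rational_points H" for x :: "'q^'n^'n"
    using that matrix_subgroupD(1)[OF assms] invertible_of_map_to_ac by (auto simp: rational_points_def)
  then show ?thesis
    using matrix_subgroupD[OF assms]
    by (auto simp: matrix_subgroup_def GL_def rational_points_def map_matrix_to_ac map_to_ac_matrix_inv)
qed

subsection \<open>Powers of matrices\<close>

definition mpow :: "'a::semiring_1^'n::finite^'n \<Rightarrow> nat \<Rightarrow> 'a^'n^'n" where
  "mpow x m = ((**) x ^^ m) (mat 1)"

lemma mpow_simps [simp]: "mpow x 0 = mat 1" "mpow x (Suc m) = x ** mpow x m"
  by (simp_all add: mpow_def)

lemma mpow_add: "mpow x (k + m) = mpow x k ** mpow x m"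
  by (induction k) (auto simp: matrix_mul_assoc)

lemma mpow_commute: "x ** mpow x m = mpow x m ** x"
  using mpow_add[of x m 1] mpow_add[of x 1 m] by (simp add: add.commute)

lemma mpow_mult: "mpow x (k * m) = mpow (mpow x k) m"
  by (induction m) (auto simp: mpow_add)

lemma mpow_zero_mono: "mpow x d = 0 \<Longrightarrow> d \<le> m \<Longrightarrow> mpow (x :: 'a::ring_1^'n::finite^'n) m = 0"
  using mpow_add[of x "m - d" d] by simp

lemma matrix_subgroup_mpow: "matrix_subgroup H \<Longrightarrow> x \<in> H \<Longrightarrow> mpow x m \<in> H"
  by (induction m) (auto dest: matrix_subgroupD)

text \<open>The binomial theorem for \<open>x = 1 + (x - 1)\<close>.\<close>

lemma mpow_binomial:
  fixes x :: "'a::comm_ring_1^'n::finite^'n"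
  shows "mpow x m $ i $ j = (\<Sum>l\<le>m. of_nat (m choose l) * mpow (x - mat 1) l $ i $ j)"
proof (induction m arbitrary: i j)
  case 0 then show ?case by simp
next
  case (Suc m)
  let ?y = "x - mat 1"
  let ?b = "\<lambda>m l. of_nat (m choose l) :: 'a"
  have "mpow x (Suc m) $ i $ j = (?y ** mpow x m + mpow x m) $ i $ j"
    by (simp add: matrix_diff_rdistrib)
  also have "\<dots> = (\<Sum>a\<in>UNIV. ?y $ i $ a * mpow x m $ a $ j) + mpow x m $ i $ j"
    by (simp add: matrix_matrix_mult_def)
  also have "(\<Sum>a\<in>UNIV. ?y $ i $ a * mpow x m $ a $ j)
      = (\<Sum>l\<le>m. ?b m l * (\<Sum>a\<in>UNIV. ?y $ i $ a * mpow ?y l $ a $ j))"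
    unfolding Suc sum_distrib_left
    by (subst sum.swap) (simp add: mult.left_commute)
  also have "\<dots> = (\<Sum>l\<le>m. ?b m l * mpow ?y (Suc l) $ i $ j)"
    by (simp add: matrix_matrix_mult_def)
  also have "mpow x m $ i $ j = ?b m 0 * mpow ?y 0 $ i $ j + (\<Sum>l\<le>m. ?b m (Suc l) * mpow ?y (Suc l) $ i $ j)"
    unfolding Suc
    by (subst sum.atMost_Suc_shift[symmetric]) (simp add: binomial_eq_0)
  finally show ?case
    unfolding sum.atMost_Suc_shift
    by (simp add: algebra_simps sum.distrib)
qed

subsection \<open>Polynomial expressions in a matrix\<close>

text \<open>
  A unipotent matrix is recovered from a power \<open>n\<^sup>q\<close> by a polynomial expression; the following set
  of polynomial expressions in \<open>Y = n - 1\<close> is used to prove that \<open>n\<close> is triangular if \<open>n\<^sup>q\<close> is.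
\<close>

definition mpoly :: "'a::comm_ring_1^'n::finite^'n \<Rightarrow> ('a^'n^'n) set" where
  "mpoly Y = \<Inter>{S. mat 1 \<in> S \<and> (\<forall>M\<in>S. \<forall>M'\<in>S. M + M' \<in> S) \<and>
     (\<forall>c. \<forall>M\<in>S. mat c ** M \<in> S) \<and> (\<forall>M\<in>S. Y ** M \<in> S)}"

lemma mpoly_one: "mat 1 \<in> mpoly Y"
  and mpoly_add: "M \<in> mpoly Y \<Longrightarrow> M' \<in> mpoly Y \<Longrightarrow> M + M' \<in> mpoly Y"
  and mpoly_scale: "M \<in> mpoly Y \<Longrightarrow> mat c ** M \<in> mpoly Y"
  and mpoly_shift: "M \<in> mpoly Y \<Longrightarrow> Y ** M \<in> mpoly Y"
  by (auto simp: mpoly_def)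

lemmas mpoly_intros = mpoly_one mpoly_add mpoly_scale mpoly_shift

lemma mpoly_induct [consumes 1, case_names mpoly_one mpoly_add mpoly_scale mpoly_shift]:
  assumes M: "M \<in> mpoly Y" and one: "P (mat 1)"
    and add: "\<And>M M'. M \<in> mpoly Y \<Longrightarrow> P M \<Longrightarrow> M' \<in> mpoly Y \<Longrightarrow> P M' \<Longrightarrow> P (M + M')"
    and scale: "\<And>M c. M \<in> mpoly Y \<Longrightarrow> P M \<Longrightarrow> P (mat c ** M)"
    and shift: "\<And>M. M \<in> mpoly Y \<Longrightarrow> P M \<Longrightarrow> P (Y ** M)"
  shows "P M"
proof -
  let ?S = "{M \<in> mpoly Y. P M}"
  have "mpoly Y \<subseteq> ?S"
    unfolding mpoly_def[of Y]
    by (rule Inter_lower) (unfold mpoly_def[of Y, symmetric], use assms mpoly_intros in auto)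
  then show ?thesis using M by blast
qed

lemma mat_scalar_entry: "(mat c ** M) $ i $ j = c * (M $ i $ j :: 'a::comm_ring_1)"
  by (simp add: matrix_matrix_mult_def mat_def if_distrib[of "\<lambda>x. x * _"] cong: if_cong)

lemma mat_scalar_commute: "M ** mat c = mat c ** (M :: 'a::comm_ring_1^'n::finite^'n)"
  by (simp add: vec_eq_iff mat_scalar_entry)
    (simp add: matrix_matrix_mult_def mat_def if_distrib[of "\<lambda>x. _ * x"] mult.commute cong: if_cong)

lemma mpoly_commute: "M \<in> mpoly Y \<Longrightarrow> M ** Y = Y ** M"
proof (induction rule: mpoly_induct)
  case (mpoly_scale M c)
  then show ?case by (metis mat_scalar_commute matrix_mul_assoc)
qed (auto simp: matrix_add_ldistrib matrix_add_rdistrib' matrix_mul_assoc[symmetric])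

lemma mpoly_mult: "M \<in> mpoly Y \<Longrightarrow> M' \<in> mpoly Y \<Longrightarrow> M ** M' \<in> mpoly Y"
  by (induction rule: mpoly_induct)
    (auto simp: matrix_add_rdistrib' matrix_mul_assoc[symmetric] intro: mpoly_intros)

lemma mat_add: "mat (a + b) = mat a + (mat b :: 'a::comm_ring_1^'n::finite^'n)"
  by (simp add: vec_eq_iff mat_def)
lemma mat_mult: "mat (a * b) = mat a ** (mat b :: 'a::comm_ring_1^'n::finite^'n)"
  by (simp add: vec_eq_iff mat_scalar_entry) (simp add: mat_def)

text \<open>
  The linear term of the binomial expansion, up to multiples of \<open>Y\<^sup>2\<close>.
\<close>

lemma mpow_expansion:
  fixes n :: "'a::comm_ring_1^'n::finite^'n"
  defines "Y \<equiv> n - mat 1"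
  shows "\<exists>Z\<in>mpoly Y. mpow n m = mat 1 + mat (of_nat m) ** Y + Y ** (Y ** Z)"
proof (induction m)
  case 0
  show ?case
  proof
    show "mat 0 ** mat 1 \<in> mpoly Y" by (intro mpoly_scale mpoly_one)
    have "mat 0 = (0 :: 'a^'n^'n)" by (simp add: vec_eq_iff mat_def)
    then show "mpow n 0 = mat 1 + mat (of_nat 0) ** Y + Y ** (Y ** (mat 0 ** mat 1))" by simp
  qed
next
  case (Suc m)
  then obtain Z where Z: "Z \<in> mpoly Y" "mpow n m = mat 1 + mat (of_nat m) ** Y + Y ** (Y ** Z)" by blast
  have nX: "n = mat 1 + Y" by (simp add: Y_def)
  show ?case
  proof
    show "mat (of_nat m) ** mat 1 + Z + Y ** Z \<in> mpoly Y"
      by (intro mpoly_scale mpoly_one mpoly_add mpoly_shift Z)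
    have "Y ** (mat (of_nat m) ** Y) = Y ** (Y ** (mat (of_nat m)))"
      by (simp add: mat_scalar_commute)
    then show "mpow n (Suc m) = mat 1 + mat (of_nat (Suc m)) ** Y + Y ** (Y ** (mat (of_nat m) ** mat 1 + Z + Y ** Z))"
      by (simp only: mpow_simps Z(2)) (simp add: nX mat_add matrix_add_ldistrib matrix_add_rdistrib' Y_def[symmetric])
  qed
qed

text \<open>
  Its purpose: with \<open>c = q\<close>, the base is \<open>(1 + Y)\<^sup>q - 1\<close>, so the
  powers of \<open>Y\<close> can be expressed by powers of \<open>(1 + Y)\<^sup>q - 1\<close>,
  starting from the highest one.
\<close>

lemma mpow_leading_term:
  fixes Y Z :: "'a::comm_ring_1^'n::finite^'n"
  assumes Z: "Z \<in> mpoly Y"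
  shows "\<exists>W\<in>mpoly Y. mpow (mat c ** Y + Y ** (Y ** Z)) i = mat (c ^ i) ** mpow Y i + mpow Y (Suc i) ** W"
proof (induction i)
  case 0
  show ?case
  proof
    show "mat 0 ** mat 1 \<in> mpoly Y" by (intro mpoly_scale mpoly_one)
    have "mat 0 = (0 :: 'a^'n^'n)" by (simp add: vec_eq_iff mat_def)
    then show "mpow (mat c ** Y + Y ** (Y ** Z)) 0 = mat (c ^ 0) ** mpow Y 0 + mpow Y (Suc 0) ** (mat 0 ** mat 1)"
      by simp
  qed
next
  case (Suc i)
  let ?y = "mat c ** Y + Y ** (Y ** Z)"
  obtain W where W: "W \<in> mpoly Y" "mpow ?y i = mat (c ^ i) ** mpow Y i + mpow Y (Suc i) ** W"
    using Suc by blast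
  have P: "mpow Y k \<in> mpoly Y" for k by (induction k) (auto intro: mpoly_intros)
  have comm: "M ** mpow Y k = mpow Y k ** M" if "M \<in> mpoly Y" for M k
  proof (induction k)
    case (Suc k)
    have "M ** mpow Y (Suc k) = (M ** Y) ** mpow Y k" by (simp add: matrix_mul_assoc)
    also have "\<dots> = Y ** (M ** mpow Y k)" using mpoly_commute[OF that] by (simp add: matrix_mul_assoc)
    also have "\<dots> = mpow Y (Suc k) ** M" using Suc by (simp add: matrix_mul_assoc)
    finally show ?case .
  qed simp
  show ?case
  proof
    show "mat c ** W + mat (c ^ i) ** Z + Y ** (Z ** W) \<in> mpoly Y"
      by (intro mpoly_add mpoly_scale mpoly_shift mpoly_mult W Z)
    have 1: "mat c ** Y ** (mat (c ^ i) ** mpow Y i) = mat (c ^ Suc i) ** mpow Y (Suc i)"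
      by (simp add: mat_mult matrix_mul_assoc mat_scalar_commute[of Y])
        (metis mat_scalar_commute matrix_mul_assoc)
    have 2: "mat c ** Y ** (mpow Y (Suc i) ** W) = mpow Y (Suc (Suc i)) ** (mat c ** W)"
      by (simp add: matrix_mul_assoc) (metis mat_scalar_commute matrix_mul_assoc)
    have 3: "Y ** (Y ** Z) ** (mat (c ^ i) ** mpow Y i) = mpow Y (Suc (Suc i)) ** (mat (c ^ i) ** Z)"
    proof -
      have "Y ** (Y ** Z) ** (mat (c ^ i) ** mpow Y i) = Y ** (Y ** (Z ** (mat (c ^ i) ** mpow Y i)))"
        by (simp add: matrix_mul_assoc)
      also have "Z ** (mat (c ^ i) ** mpow Y i) = mat (c ^ i) ** (Z ** mpow Y i)"
        by (metis mat_scalar_commute matrix_mul_assoc)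
      also have "\<dots> = mpow Y i ** (mat (c ^ i) ** Z)"
        using comm[OF Z] by (metis mat_scalar_commute matrix_mul_assoc)
      finally show ?thesis by (simp add: matrix_mul_assoc)
    qed
    have 4: "Y ** (Y ** Z) ** (mpow Y (Suc i) ** W) = mpow Y (Suc (Suc i)) ** (Y ** (Z ** W))"
    proof -
      have "Y ** (Y ** Z) ** (mpow Y (Suc i) ** W) = Y ** (Y ** ((Z ** mpow Y (Suc i)) ** W))"
        by (simp add: matrix_mul_assoc)
      also have "Z ** mpow Y (Suc i) = mpow Y i ** (Y ** Z)"
        using comm[OF Z, of "Suc i"] mpow_commute[of Y i] by (simp add: matrix_mul_assoc)
      finally show ?thesis by (simp add: matrix_mul_assoc)
    qed
    show "mpow ?y (Suc i) = mat (c ^ Suc i) ** mpow Y (Suc i)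
        + mpow Y (Suc (Suc i)) ** (mat c ** W + mat (c ^ i) ** Z + Y ** (Z ** W))"
      unfolding mpow_simps(2)[of ?y] W(2) matrix_add_ldistrib matrix_add_rdistrib' 1 2 3 4
      by (simp add: add_ac)
  qed
qed

text \<open>
  By descending induction on \<open>i > 0\<close>, the power \<open>Y\<^sup>i\<close> lies in
  \<open>S\<close>: it agrees with \<open>((1 + Y)\<^sup>q - 1)\<^sup>i / q\<^sup>i\<close> up to
  higher powers of \<open>Y\<close>.
\<close>

lemma nilpotent_in_closed_space:
  fixes n :: "'a::field_char_0^'n::finite^'n"
  defines "Y \<equiv> n - mat 1"
  assumes add: "\<And>M M'. M \<in> S \<Longrightarrow> M' \<in> S \<Longrightarrow> M + M' \<in> S"
    and scale: "\<And>c M. M \<in> S \<Longrightarrow> mat c ** M \<in> S"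
    and mult: "\<And>M M'. M \<in> S \<Longrightarrow> M' \<in> S \<Longrightarrow> M ** M' \<in> S"
    and nil: "mpow Y d = 0" and q: "q > 0" and y: "mpow n q - mat 1 \<in> S"
  shows "Y \<in> S"
proof -
  have m0: "mat 0 = (0 :: 'a^'n^'n)" by (simp add: vec_eq_iff mat_def)
  have zero: "0 \<in> S" using scale[OF y, of 0] by (simp add: m0)
  obtain Z where Z: "Z \<in> mpoly Y" "mpow n q = mat 1 + mat (of_nat q) ** Y + Y ** (Y ** Z)"
    using mpow_expansion[of n q] unfolding Y_def by blast
  have ye: "mpow n q - mat 1 = mat (of_nat q) ** Y + Y ** (Y ** Z)" by (simp add: Z(2))
  have ypow: "mpow (mpow n q - mat 1) (Suc i) \<in> S" for i
    by (induction i) (use mult y in auto)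
  have high: "mpow Y l ** M \<in> S" if "M \<in> mpoly Y" "\<And>l. l \<ge> j \<Longrightarrow> mpow Y l \<in> S" "l \<ge> j" for M j l
    using that
  proof (induction arbitrary: l rule: mpoly_induct)
    case (mpoly_scale M c)
    then have "mat c ** (mpow Y l ** M) \<in> S" using scale by blast
    then show ?case by (metis mat_scalar_commute matrix_mul_assoc)
  next
    case (mpoly_shift M)
    have "mpow Y (Suc l) ** M \<in> S" using mpoly_shift.prems by (intro mpoly_shift.IH) auto
    then show ?case by (simp add: mpow_commute matrix_mul_assoc)
  qed (auto simp: matrix_add_ldistrib add)
  have "mpow Y l \<in> S" if "l \<ge> Suc (d - k)" for k l
    using that
  proof (induction k arbitrary: l)
    case 0
    then show ?case using mpow_zero_mono[OF nil, of l] zero by simp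
  next
    case (Suc k)
    show ?case
    proof (cases "l \<ge> Suc (d - k)")
      case False
      then have l: "Suc l \<ge> Suc (d - k)" "l > 0" using Suc.prems by auto
      obtain i where i: "l = Suc i" using l by (cases l) auto
      obtain W where W: "W \<in> mpoly Y"
        "mpow (mpow n q - mat 1) l = mat (of_nat q ^ l) ** mpow Y l + mpow Y (Suc l) ** W"
        using mpow_leading_term[OF Z(1)] unfolding ye by blast
      have 1: "mpow (mpow n q - mat 1) l \<in> S" using ypow[of i] unfolding i .
      have 2: "mpow Y (Suc l) ** W \<in> S" by (rule high[OF W(1) Suc.IH l(1)])
      have "mat (1 / of_nat q ^ l) ** (mpow (mpow n q - mat 1) l + mat (- 1) ** (mpow Y (Suc l) ** W)) \<in> S"
        by (intro scale add 1 2)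
      moreover have "mat (1 / of_nat q ^ l) ** (mpow (mpow n q - mat 1) l + mat (- 1) ** (mpow Y (Suc l) ** W)) = mpow Y l"
        unfolding W(2) using q by (simp add: vec_eq_iff mat_scalar_entry)
      ultimately show ?thesis by simp
    qed (use Suc.IH in blast)
  qed
  from this[of d 1] have "mpow Y 1 \<in> S" by simp
  then show ?thesis by simp
qed

section \<open>Conjugation\<close>

definition cj :: "'a::field^'n::finite^'n \<Rightarrow> 'a^'n^'n \<Rightarrow> 'a^'n^'n" where
  "cj g x = g ** x ** matrix_inv g"

lemma cj_mult: "invertible g \<Longrightarrow> cj g (x ** y) = cj g x ** cj g y"
  by (simp add: cj_def matrix_mul_assoc matrix_inv_cancel)
lemma cj_one: "invertible g \<Longrightarrow> cj g (mat 1) = mat 1"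
  by (simp add: cj_def matrix_inv)
lemma cj_cj: "invertible g \<Longrightarrow> invertible k \<Longrightarrow> cj g (cj k x) = cj (g ** k) x"
  by (simp add: cj_def matrix_mul_assoc matrix_inv_mult)
lemma cj_id: "cj (mat 1) x = (x :: 'a::field^'n::finite^'n)"
proof -
  have "matrix_inv (mat 1 :: 'a^'n^'n) = mat 1" by (rule matrix_inv_eqI(1)) simp
  then show ?thesis by (simp add: cj_def)
qed
lemma cj_inv: "invertible g \<Longrightarrow> cj (matrix_inv g) (cj g x) = x"
  by (simp add: cj_cj invertible_matrix_inv matrix_inv cj_id)
lemma cj_inv': "invertible g \<Longrightarrow> cj g (cj (matrix_inv g) x) = x"
  by (simp add: cj_cj invertible_matrix_inv matrix_inv cj_id)
lemma cj_matrix_inv: "invertible g \<Longrightarrow> invertible x \<Longrightarrow> matrix_inv (cj g x) = cj g (matrix_inv x)"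
  by (rule matrix_inv_eqI(1)) (simp add: cj_mult[symmetric] matrix_inv cj_one)
lemma cj_diff: "cj g (x - y) = cj g x - cj g y"
  by (simp add: cj_def matrix_diff_ldistrib matrix_diff_rdistrib)
lemma cj_mpow: "invertible g \<Longrightarrow> cj g (mpow x m) = mpow (cj g x) m"
  by (induction m) (auto simp: cj_mult cj_one)
lemma cj_zero: "cj g 0 = 0"
  using cj_diff[of g 0 0] by simp
lemma cj_swap: "invertible g \<Longrightarrow> cj g x ** g = g ** x"
  by (simp add: cj_def matrix_inv_cancel)

lemma mpow_minus: "mpow (- y) d = mpow y d \<or> mpow (- y) d = - mpow (y :: 'a::comm_ring_1^'n::finite^'n) d"
proof (induction d)
  case (Suc d)
  have m: "(- y) ** M = - (y ** M)" "y ** (- M) = - (y ** M)" for M :: "'a^'n^'n"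
    by (simp_all add: vec_eq_iff matrix_matrix_mult_def sum_negf)
  show ?case using Suc by (auto simp: m)
qed simp

context padic_numbers
begin

lemma poly_bounded: "\<exists>C\<ge>0. \<forall>y. pabs y \<le> 1 \<longrightarrow> pabs (poly P (y::'q)) \<le> C"
proof (induction P)
  case 0 then show ?case by auto
next
  case (pCons a P)
  then obtain C where C: "C \<ge> 0" "\<And>y. pabs y \<le> 1 \<Longrightarrow> pabs (poly P (y::'q)) \<le> C" by blast
  have "pabs (poly (pCons a P) y) \<le> max (pabs a) C" if "pabs y \<le> 1" for y
  proof -
    have "pabs (y * poly P y) \<le> 1 * C" using that C by (intro pabs_mult_le)
    then show ?thesis by (simp, intro pabs_add_le) auto
  qed
  then show ?case using C(1) by (intro exI[of _ "max (pabs a) C"]) auto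
qed

lemma poly_continuous_at_0:
  "\<exists>C\<ge>0. \<forall>y. pabs y \<le> 1 \<longrightarrow> pabs (poly P (y::'q) - poly P 0) \<le> pabs y * C"
proof (cases P)
  case (pCons a P')
  obtain C where C: "C \<ge> 0" "\<And>y. pabs y \<le> 1 \<Longrightarrow> pabs (poly P' (y::'q)) \<le> C"
    using poly_bounded[of P'] by blast
  show ?thesis using C by (intro exI[of _ C]) (auto simp: pCons intro!: pabs_mult_le)
qed

lemma small_times:
  assumes "(C::real) \<ge> 0" "e > 0"
  shows "\<exists>m. C * (1 / real p ^ m) \<le> e"
proof -
  obtain m where "1 / real p ^ m < e / (C + 1)" using power_p_small[of "e / (C + 1)"] assms by auto
  then have "(C + 1) * (1 / real p ^ m) \<le> e" using assms by (simp add: field_simps)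
  moreover have "C * (1 / real p ^ m) \<le> (C + 1) * (1 / real p ^ m)"
    by (intro mult_right_mono) auto
  ultimately show ?thesis by (intro exI[of _ m]) linarith
qed

lemma inverse_p_power_mono: "k \<le> m \<Longrightarrow> 1 / real p ^ m \<le> 1 / real p ^ k"
  using p_gt_1 by (simp add: frac_le power_increasing)

lemma inverse_p_power_le_1: "1 / real p ^ m \<le> 1"
  using inverse_p_power_mono[of 0 m] by simp

lemma mball_1_of_near: "x - mat 1 \<in> mball e \<Longrightarrow> e \<le> 1 \<Longrightarrow> (x :: 'q^'n::finite^'n) \<in> mball 1"
  using mball_add[of "x - mat 1" 1 "mat 1"] mball_mono[of "x - mat 1" e 1] mball_mat1 by simp

lemma near_mult:
  assumes "(x :: 'q^'n::finite^'n) - mat 1 \<in> mball e" "y - mat 1 \<in> mball e" "0 \<le> e" "e \<le> 1"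
  shows "x ** y - mat 1 \<in> mball e"
proof -
  have "(x - mat 1) ** y \<in> mball (e * 1)"
    using assms mball_1_of_near by (intro mball_mult) auto
  then have "(x - mat 1) ** y + (y - mat 1) \<in> mball e" using assms(2) by (intro mball_add) simp_all
  moreover have "(x - mat 1) ** y + (y - mat 1) = x ** y - mat 1" by (simp add: matrix_diff_rdistrib)
  ultimately show ?thesis by metis
qed

lemma near_inverse:
  assumes "(x :: 'q^'n::finite^'n) - mat 1 \<in> mball e" "invertible x" "matrix_inv x \<in> mball C" "0 \<le> e" "0 \<le> C"
  shows "matrix_inv x - mat 1 \<in> mball (C * e)"
proof -
  have "matrix_inv x - mat 1 = mat 1 - matrix_inv x ** (x - mat 1) - mat 1"
    using assms by (simp add: matrix_diff_ldistrib matrix_inv)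
  also have "\<dots> = 0 - matrix_inv x ** (x - mat 1)" by simp
  finally have "matrix_inv x - mat 1 = 0 - matrix_inv x ** (x - mat 1)" .
  moreover have "0 \<in> mball (C * e)" using assms by (simp add: mball_def)
  ultimately show ?thesis using assms mball_diff mball_mult by metis
qed

text \<open>
  Since \<open>x - 1\<close> is nilpotent, the binomial expansion of
  \<open>x\<^bsup>p^m\<^esup>\<close> has a bounded number of terms, and the coefficient at
  \<open>(x - 1)\<^sup>l\<close> has absolute value at most \<open>p\<^bsup>-m\<^esup>/|l|\<close>
  for \<open>l > 0\<close>.
\<close>

lemma unipotent_power_tends_to_1:
  fixes x :: "'q^'n::finite^'n"
  assumes nil: "mpow (x - mat 1) d = 0"
  shows "\<exists>m0. \<forall>m\<ge>m0. mpow x (p ^ m) - mat 1 \<in> mball (1 / real p ^ k)"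
proof -
  \<comment> \<open>a common bound of the factors \<open>1/|l|\<close> for the exponents \<open>l\<close> that occur\<close>
  define Q where "Q = (\<Sum>l\<in>{1..d}. 1 / pabs (of_nat l :: 'q))"
  have Ql: "1 / pabs (of_nat l :: 'q) \<le> Q" if "l \<in> {1..d}" for l
    unfolding Q_def using that by (intro member_le_sum) auto
  have Q0: "0 \<le> Q" unfolding Q_def by (intro sum_nonneg) auto
  have "\<exists>C>0. \<forall>l\<in>{..d}. mpow (x - mat 1) l \<in> mball C"
  proof (induction d)
    case 0 then show ?case using mball_exists[of "mpow (x - mat 1) 0"] by auto
  next
    case (Suc d)
    then obtain C where C: "C > 0" "\<forall>l\<in>{..d}. mpow (x - mat 1) l \<in> mball C" by blast
    obtain C' where C': "C' > 0" "mpow (x - mat 1) (Suc d) \<in> mball C'" using mball_exists by blast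
    show ?case
    proof (intro exI[of _ "max C C'"] conjI ballI)
      fix l assume "l \<in> {..Suc d}"
      then show "mpow (x - mat 1) l \<in> mball (max C C')"
        using C C' mball_mono[of _ C "max C C'"] mball_mono[of _ C' "max C C'"]
        by (cases "l = Suc d") (auto simp del: mpow_simps)
    qed (use C in auto)
  qed
  then obtain C where C: "C > 0" "\<And>l. l \<le> d \<Longrightarrow> mpow (x - mat 1) l \<in> mball C" by auto
  obtain m0 where m0: "Q * C * (1 / real p ^ m0) \<le> 1 / real p ^ k"
    using small_times[of "Q * C" "1 / real p ^ k"] Q0 C p_gt_1 by auto
  have "mpow x (p ^ m) - mat 1 \<in> mball (1 / real p ^ k)" if "m \<ge> m0" for m
    unfolding mball_def
  proof safe
    fix i j
    let ?t = "\<lambda>l. of_nat ((p ^ m) choose l) * mpow (x - mat 1) l $ i $ j"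
    have "mpow x (p ^ m) $ i $ j = (\<Sum>l\<le>p ^ m. ?t l)" by (rule mpow_binomial)
    also have "\<dots> = ?t 0 + (\<Sum>l\<in>{0<..p ^ m}. ?t l)"
    proof -
      have "{..p ^ m} = insert 0 {0<..p ^ m}" by auto
      then show ?thesis by (simp only:) simp
    qed
    finally have "(mpow x (p ^ m) - mat 1) $ i $ j = (\<Sum>l\<in>{0<..p ^ m}. ?t l)" by simp
    also have "pabs \<dots> \<le> 1 / real p ^ k"
    proof (rule pabs_sum_le)
      fix l assume l: "l \<in> {0<..p ^ m}"
      show "pabs (?t l) \<le> 1 / real p ^ k"
      proof (cases "l \<le> d")
        case True
        have "pabs (of_nat ((p ^ m) choose l) :: 'q) \<le> (1 / real p ^ m) / pabs (of_nat l :: 'q)"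
          using l by (intro binomial_p_power_small) auto
        also have "\<dots> = (1 / real p ^ m) * (1 / pabs (of_nat l :: 'q))" by simp
        also have "\<dots> \<le> (1 / real p ^ m0) * Q"
          using l True that by (intro mult_mono inverse_p_power_mono Ql) auto
        finally have "pabs (?t l) \<le> (1 / real p ^ m0 * Q) * C"
          using C(2)[OF True] by (intro pabs_mult_le) (auto simp: mball_def)
        then show ?thesis using m0 by (simp add: mult_ac)
      next
        case False
        then have "mpow (x - mat 1) l = 0" using mpow_zero_mono[OF nil] by simp
        then show ?thesis by simp
      qed
    qed simp
    finally show "pabs ((mpow x (p ^ m) - mat 1) $ i $ j) \<le> 1 / real p ^ k" .
  qed
  then show ?thesis by blast
qed

end

section \<open>The Borel subgroup\<close>

context borel_setting
begin

abbreviation TQ :: "('q^'n^'n) set" where "TQ \<equiv> rational_points TT"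
abbreviation NQ :: "('q^'n^'n) set" where "NQ \<equiv> rational_points NN"

lemma connected_alg_group_matrix_subgroup: "connected_alg_group H \<Longrightarrow> matrix_subgroup H"
  unfolding connected_alg_group_def using subgroup_mat_group[OF matrix_subgroup_GL] by blast

lemma BB_subgroup: "matrix_subgroup BB"
  using B_borel by (simp add: borel_subgroup_def connected_alg_group_matrix_subgroup)
lemma TT_subgroup: "matrix_subgroup TT"
  using T_split by (simp add: split_torus_def connected_alg_group_matrix_subgroup)
lemma NN_subgroup: "matrix_subgroup NN"
  using N_radical by (simp add: is_unipotent_radical_def connected_alg_group_matrix_subgroup)
lemmas B_subgroup = rational_points_subgroup[OF BB_subgroup, folded B_def]
lemmas TQ_subgroup = rational_points_subgroup[OF TT_subgroup]
lemmas NQ_subgroup = rational_points_subgroup[OF NN_subgroup]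
lemmas B_closed = matrix_subgroupD[OF B_subgroup]
lemmas TQ_closed = matrix_subgroupD[OF TQ_subgroup]
lemmas NQ_closed = matrix_subgroupD[OF NQ_subgroup]

lemma B_eq: "B = {t ** x | t x. t \<in> TQ \<and> x \<in> NQ}"
  using B_eq_TN_rational by (simp add: B_def)

lemma TQ_in_B: "t \<in> TQ \<Longrightarrow> t \<in> B"
proof -
  assume "t \<in> TQ"
  moreover have "t = t ** mat 1" by simp
  ultimately show ?thesis unfolding B_eq using NQ_closed(2) by blast
qed
lemma NQ_in_B: "x \<in> NQ \<Longrightarrow> x \<in> B"
proof -
  assume "x \<in> NQ"
  moreover have "x = mat 1 ** x" by simp
  ultimately show ?thesis unfolding B_eq using TQ_closed(2) by blast
qed

lemma NQ_normal:
  assumes "b \<in> B" "x \<in> NQ"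
  shows "cj b x \<in> NQ"
proof -
  have n: "NN \<lhd> mat_group BB" using N_radical by (simp add: is_unipotent_radical_def)
  have b: "map_matrix to_ac b \<in> BB" and x: "map_matrix to_ac x \<in> NN"
    using assms by (auto simp: B_def rational_points_def)
  have "map_matrix to_ac b ** map_matrix to_ac x ** matrix_inv (map_matrix to_ac b) \<in> NN"
    using normal.inv_op_closed2[OF n, of "map_matrix to_ac b" "map_matrix to_ac x"] b x
    by (simp add: matrix_subgroup_group(2)[OF BB_subgroup])
  then show ?thesis
    using B_closed(1)[OF assms(1)]
    by (simp add: rational_points_def cj_def map_matrix_to_ac map_to_ac_matrix_inv)
qed

lemma NQ_unipotent:
  assumes "x \<in> NQ" shows "\<exists>d. mpow (x - mat 1) d = 0"
proof -
  have "map_matrix to_ac x \<in> NN" using assms by (simp add: rational_points_def)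
  then obtain d where d: "mpow (map_matrix to_ac x - mat 1) d = 0"
    using N_radical by (auto simp: is_unipotent_radical_def unipotent_def mpow_def)
  have "mpow (map_matrix to_ac y) k = map_matrix to_ac (mpow y k)" for y :: "'q^'n^'n" and k
    by (induction k) (simp_all add: map_matrix_to_ac)
  then have "map_matrix to_ac (mpow (x - mat 1) d) = 0"
    using d by (metis map_matrix_to_ac(2,3))
  then have "mpow (x - mat 1) d = 0" by (simp add: vec_eq_iff)
  then show ?thesis by blast
qed

lemma N0_eq: "N0 = {x \<in> NQ. x \<in> mball 1 \<and> matrix_inv x \<in> mball 1}"
  by (auto simp: N0_def Zp_points_def mball_def Zp_def)

text \<open>
  With \<open>y = 1 - x\<close> nilpotent and integral, the inverse is the finite geometric sum of
  the powers of \<open>y\<close>, hence integral.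
\<close>

lemma integral_unipotent_in_N0:
  assumes "x \<in> NQ" "x \<in> mball 1"
  shows "x \<in> N0"
proof -
  obtain d where d: "mpow (x - mat 1) d = 0" using NQ_unipotent[OF assms(1)] by blast
  define y where "y = mat 1 - x"
  have "mpow y d = 0" using d mpow_minus[of "x - mat 1" d] by (auto simp: y_def)
  have "x ** (\<Sum>i<d. mpow y i) = mat 1 - mpow y d" for d
  proof (induction d)
    case (Suc d)
    have "x ** (\<Sum>i<Suc d. mpow y i) = mat 1 - mpow y d + x ** mpow y d"
      using Suc by (simp add: matrix_add_ldistrib)
    also have "x ** mpow y d = mpow y d - y ** mpow y d"
      by (simp add: y_def matrix_diff_rdistrib)
    finally show ?case by simp
  qed simp
  then have "x ** (\<Sum>i<d. mpow y i) = mat 1" using \<open>mpow y d = 0\<close> by simp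
  then have i: "matrix_inv x = (\<Sum>i<d. mpow y i)" by (rule matrix_inv_eqI(1))
  have "y \<in> mball 1" unfolding y_def by (intro mball_diff mball_mat1 assms)
  then have "mpow y k \<in> mball 1" for k by (induction k) (auto intro: mball_mat1 mball_mult1)
  then show ?thesis unfolding N0_eq using assms by (auto simp: i intro: mball_sum)
qed

lemma N0_in_NQ: "x \<in> N0 \<Longrightarrow> x \<in> NQ" by (simp add: N0_eq)
lemma N0_in_B: "x \<in> N0 \<Longrightarrow> x \<in> B" using N0_in_NQ NQ_in_B by blast

lemma N0_subgroup: "matrix_subgroup N0"
  unfolding matrix_subgroup_def
proof (intro conjI ballI)
  show "N0 \<subseteq> GL" using NQ_closed(1) by (auto simp: N0_eq GL_def)
  show "mat 1 \<in> N0" using NQ_closed(2) mball_mat1 by (rule integral_unipotent_in_N0)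
  show "x ** y \<in> N0" if "x \<in> N0" "y \<in> N0" for x y
    using that by (intro integral_unipotent_in_N0 NQ_closed mball_mult1) (auto simp: N0_eq)
  show "matrix_inv x \<in> N0" if "x \<in> N0" for x
    using that by (intro integral_unipotent_in_N0 NQ_closed) (auto simp: N0_eq)
qed
lemmas N0_closed = matrix_subgroupD[OF N0_subgroup]

lemma near_1_in_N0: "x \<in> NQ \<Longrightarrow> x - mat 1 \<in> mball (1 / real p ^ k) \<Longrightarrow> x \<in> N0"
  using integral_unipotent_in_N0 mball_1_of_near inverse_p_power_le_1 by blast

subsection \<open>The torus in a diagonalizing basis\<close>

definition diag_basis :: "'q^'n^'n" where
  "diag_basis = (SOME g. invertible g \<and> (\<forall>t\<in>TT. \<forall>i j. i \<noteq> j \<longrightarrow>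
     (map_matrix to_ac g ** t ** matrix_inv (map_matrix to_ac g)) $ i $ j = 0))"

definition dg :: "'q^'n^'n \<Rightarrow> 'q^'n^'n" where "dg x = cj diag_basis x"

lemma diag_basis: "invertible diag_basis" "t \<in> TQ \<Longrightarrow> i \<noteq> j \<Longrightarrow> dg t $ i $ j = 0"
proof -
  have "\<exists>g :: 'q^'n^'n. invertible g \<and> (\<forall>t\<in>TT. \<forall>i j. i \<noteq> j \<longrightarrow>
     (map_matrix to_ac g ** t ** matrix_inv (map_matrix to_ac g)) $ i $ j = 0)"
    using T_split unfolding split_torus_def by (rule conjunct2)
  from someI_ex[OF this]
  have *: "invertible diag_basis \<and> (\<forall>t\<in>TT. \<forall>i j. i \<noteq> j \<longrightarrow>
     (map_matrix to_ac diag_basis ** t ** matrix_inv (map_matrix to_ac diag_basis)) $ i $ j = 0)"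
    unfolding diag_basis_def[symmetric] .
  then show i: "invertible diag_basis" by blast
  assume t: "t \<in> TQ" "i \<noteq> j"
  have "map_matrix to_ac (dg t) = map_matrix to_ac diag_basis ** map_matrix to_ac t ** matrix_inv (map_matrix to_ac diag_basis)"
    by (simp add: dg_def cj_def map_matrix_to_ac map_to_ac_matrix_inv i)
  then have "map_matrix to_ac (dg t) $ i $ j = 0"
    using * t by (simp add: rational_points_def)
  then show "dg t $ i $ j = 0" by simp
qed

lemmas dg_mult = cj_mult[OF diag_basis(1), folded dg_def]
lemmas dg_one = cj_one[OF diag_basis(1), folded dg_def]

definition tor :: "'q^'n^'n \<Rightarrow> 'n \<Rightarrow> 'q" where "tor t i = dg t $ i $ i"

lemma dg_torus_entry: "t \<in> TQ \<Longrightarrow> dg t $ i $ k = (if k = i then tor t i else 0)"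
  using diag_basis(2)[of t i k] by (auto simp: tor_def)

lemma dg_torus_left: "t \<in> TQ \<Longrightarrow> (dg t ** M) $ i $ j = tor t i * M $ i $ j"
  by (simp add: matrix_matrix_mult_def dg_torus_entry if_distrib[of "\<lambda>x. x * _"] cong: if_cong)

lemma dg_torus_right: "t \<in> TQ \<Longrightarrow> (M ** dg t) $ i $ j = M $ i $ j * tor t j"
  by (simp add: matrix_matrix_mult_def dg_torus_entry if_distrib[of "\<lambda>x. _ * x"] cong: if_cong)

lemma tor_mult: "t \<in> TQ \<Longrightarrow> t' \<in> TQ \<Longrightarrow> tor (t ** t') i = tor t i * tor t' i"
  by (simp add: tor_def[of "t ** t'"] dg_mult dg_torus_left) (simp add: tor_def)

lemma tor_one: "tor (mat 1) i = 1"
  unfolding tor_def dg_one by (simp add: mat_def)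

lemma tor_inv: "t \<in> TQ \<Longrightarrow> tor t i * tor (matrix_inv t) i = 1"
  using tor_mult[of t "matrix_inv t" i] TQ_closed by (simp add: tor_one matrix_inv)

lemma tor_nonzero: "t \<in> TQ \<Longrightarrow> tor t i \<noteq> 0"
  using tor_inv[of t i] by auto

lemma dg_cj_torus: "t \<in> TQ \<Longrightarrow> dg (cj t x) $ i $ j = tor t i * dg x $ i $ j / tor t j"
proof -
  assume t: "t \<in> TQ"
  then have "dg (cj t x) $ i $ j = tor t i * dg x $ i $ j * tor (matrix_inv t) j"
    by (simp add: cj_def dg_mult dg_torus_left dg_torus_right TQ_closed)
  moreover have "tor (matrix_inv t) j = 1 / tor t j"
    using tor_inv[OF t, of j] tor_nonzero[OF t, of j] by (simp add: field_simps)
  ultimately show ?thesis by simp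
qed

lemma dg_bounded:
  "\<exists>C\<ge>1. \<forall>c\<ge>0. \<forall>x\<in>mball c. dg x \<in> mball (C * c) \<and> cj (matrix_inv diag_basis) x \<in> mball (C * c)"
proof -
  obtain C1 C2 where C: "C1 > 0" "diag_basis \<in> mball C1" "C2 > 0" "matrix_inv diag_basis \<in> mball C2"
    using mball_exists by metis
  have "dg x \<in> mball (C1 * c * C2)" "cj (matrix_inv diag_basis) x \<in> mball (C2 * c * C1)"
    if "c \<ge> 0" "x \<in> mball c" for c x
    unfolding dg_def cj_def matrix_inv_inv[OF diag_basis(1)]
    using C that by (auto intro!: mball_mult)
  moreover have "C1 * c * C2 \<le> max 1 (C1 * C2) * c" "C2 * c * C1 \<le> max 1 (C1 * C2) * c" if "c \<ge> 0" for c
    using mult_right_mono[of "C1 * C2" "max 1 (C1 * C2)" c] that by (simp_all add: mult_ac)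
  ultimately have "\<forall>c\<ge>0. \<forall>x\<in>mball c. dg x \<in> mball (max 1 (C1 * C2) * c) \<and> cj (matrix_inv diag_basis) x \<in> mball (max 1 (C1 * C2) * c)"
    by (intro allI impI ballI conjI) (rule mball_mono; assumption)+
  then show ?thesis by (intro exI[of _ "max 1 (C1 * C2)"]) auto
qed

lemma dg_inj: "cj (matrix_inv diag_basis) (dg x) = x"
  by (simp add: dg_def cj_inv diag_basis(1))

subsection \<open>Roots and the contraction of \<open>N\<^sub>0\<close>\<close>

lemma xi_in_TQ: "x \<noteq> 0 \<Longrightarrow> \<xi> x \<in> TQ"
  using xi_cocharacter by (simp add: is_cocharacter_def)
lemma xi_mult: "x \<noteq> 0 \<Longrightarrow> y \<noteq> 0 \<Longrightarrow> \<xi> (x * y) = \<xi> x ** \<xi> y"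
  using xi_cocharacter by (simp add: is_cocharacter_def)
lemma xi_one: "\<xi> 1 = mat 1"
proof -
  have "\<xi> 1 ** \<xi> 1 = \<xi> (1 * 1)" by (rule xi_mult[symmetric]) simp_all
  then have "\<xi> 1 ** \<xi> 1 = \<xi> 1" by simp
  then have "matrix_inv (\<xi> 1) ** (\<xi> 1 ** \<xi> 1) = matrix_inv (\<xi> 1) ** \<xi> 1" by simp
  then show ?thesis
    using TQ_closed(1)[OF xi_in_TQ[of 1]] by (simp add: matrix_mul_assoc matrix_inv)
qed
lemma xi_inverse: "x \<noteq> 0 \<Longrightarrow> matrix_inv (\<xi> x) = \<xi> (inverse x)"
  using xi_mult[of x "inverse x"] xi_one by (intro matrix_inv_eqI(1)) simp

lemma p_nonzero: "(of_nat p :: 'q) \<noteq> 0" using p_gt_1 by simp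
lemma s_in_TQ: "s \<in> TQ" unfolding s_def using xi_in_TQ p_nonzero by blast
lemma s_in_B: "s \<in> B" using s_in_TQ TQ_in_B by blast

text \<open>
  A root is a monomial in the simple roots with natural exponents that are not all zero, so it
  composes with \<open>\<xi>\<close> to a power \<open>x\<^sup>e\<close> where \<open>e\<close> is the height of the root.
\<close>

lemma root_height:
  assumes "\<beta> \<in> set \<beta>s"
  shows "\<exists>e\<ge>1. \<forall>x. x \<noteq> 0 \<longrightarrow> \<beta> (\<xi> x) = x ^ e"
proof -
  have b: "\<beta> \<in> roots_in TT NN" using assms enum_roots by simp
  have "\<forall>\<beta>\<in>roots_in TT NN. \<exists>m :: _ \<Rightarrow> nat. \<forall>t\<in>TQ. \<beta> t = (\<Prod>\<alpha>\<in>\<Delta>. \<alpha> t ^ m \<alpha>)"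
    using Delta_simple unfolding simple_roots_def by (elim conjE)
  from bspec[OF this b] obtain m :: "_ \<Rightarrow> nat" where "\<forall>t\<in>TQ. \<beta> t = (\<Prod>\<alpha>\<in>\<Delta>. \<alpha> t ^ m \<alpha>)"
    by (rule exE)
  then have m: "\<beta> t = (\<Prod>\<alpha>\<in>\<Delta>. \<alpha> t ^ m \<alpha>)" if "t \<in> TQ" for t using that by (rule bspec)
  have fin: "finite \<Delta>" using Delta_simple by (simp add: simple_roots_def)
  define e where "e = (\<Sum>\<alpha>\<in>\<Delta>. m \<alpha>)"
  have "\<beta> (\<xi> x) = x ^ e" if "x \<noteq> 0" for x
  proof -
    have "(\<Prod>\<alpha>\<in>\<Delta>. \<alpha> (\<xi> x) ^ m \<alpha>) = (\<Prod>\<alpha>\<in>\<Delta>. x ^ m \<alpha>)"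
      by (intro prod.cong refl) (simp add: simple_xi that)
    then show ?thesis using m[OF xi_in_TQ[OF that]] by (simp add: e_def power_sum)
  qed
  moreover have "e \<noteq> 0"
  proof
    assume "e = 0"
    then have "\<forall>\<alpha>\<in>\<Delta>. m \<alpha> = 0" using fin by (simp add: e_def)
    then have "\<forall>t\<in>TQ. \<beta> t = 1" using m by simp
    moreover have "\<exists>t\<in>TQ. \<beta> t \<noteq> 1" using b by (simp add: roots_in_def)
    ultimately show False by blast
  qed
  ultimately show ?thesis by (intro exI[of _ e]) auto
qed

abbreviation rootprod :: "(('q^'n^'n \<Rightarrow> 'q) \<Rightarrow> 'q) \<Rightarrow> ('q^'n^'n \<Rightarrow> 'q) list \<Rightarrow> 'q^'n^'n" where
  "rootprod x bs \<equiv> foldr (\<lambda>\<beta> g. u \<beta> (x \<beta>) ** g) bs (mat 1)"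

lemma N0_rootprod: "N0 = {rootprod x \<beta>s | x. \<forall>\<beta>\<in>set \<beta>s. x \<beta> \<in> Zp}"
  using N0_product by (simp add: N0_def)

lemma root_iso:
  assumes "\<beta> \<in> set \<beta>s"
  shows "u \<beta> x \<in> NQ" "u \<beta> (x + y) = u \<beta> x ** u \<beta> y" "t \<in> TQ \<Longrightarrow> cj t (u \<beta> x) = u \<beta> (\<beta> t * x)"
    "\<exists>P :: 'q poly^'n^'n. \<forall>x i j. u \<beta> x $ i $ j = poly (P $ i $ j) x"
    "u \<beta> 0 = mat 1"
proof -
  have r: "root_subgroup_iso TT NN \<beta> (u \<beta>)" using root_isos assms enum_roots by simp
  show 1: "u \<beta> x \<in> NQ" for x using r unfolding root_subgroup_iso_def by blast
  show 2: "u \<beta> (x + y) = u \<beta> x ** u \<beta> y" for x y using r unfolding root_subgroup_iso_def by blast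
  show "t \<in> TQ \<Longrightarrow> cj t (u \<beta> x) = u \<beta> (\<beta> t * x)"
    using r unfolding root_subgroup_iso_def cj_def by blast
  show "\<exists>P :: 'q poly^'n^'n. \<forall>x i j. u \<beta> x $ i $ j = poly (P $ i $ j) x"
    using r unfolding root_subgroup_iso_def by blast
  have "u \<beta> 0 ** u \<beta> 0 = u \<beta> (0 + 0)" by (rule 2[symmetric])
  then have "u \<beta> 0 ** u \<beta> 0 = u \<beta> 0" by simp
  then have "matrix_inv (u \<beta> 0) ** (u \<beta> 0 ** u \<beta> 0) = matrix_inv (u \<beta> 0) ** u \<beta> 0" by simp
  then show "u \<beta> 0 = mat 1" using NQ_closed(1)[OF 1[of 0]] by (simp add: matrix_mul_assoc matrix_inv)
qed

lemma cj_rootprod: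
  "set bs \<subseteq> set \<beta>s \<Longrightarrow> t \<in> TQ \<Longrightarrow> cj t (rootprod x bs) = rootprod (\<lambda>\<beta>. \<beta> t * x \<beta>) bs"
proof (induction bs)
  case (Cons b bs)
  then show ?case using root_iso(3)[of b t "x b"] TQ_closed(1) by (simp add: cj_mult)
qed (simp add: cj_one TQ_closed)

text \<open>A root subgroup is parametrized by polynomials, which are continuous.\<close>

lemma root_near_1:
  assumes "\<beta> \<in> set \<beta>s"
  shows "\<exists>m. \<forall>y. pabs y \<le> 1 / real p ^ m \<longrightarrow> u \<beta> y - mat 1 \<in> mball (1 / real p ^ k)"
proof -
  obtain P :: "'q poly^'n^'n" where P: "\<And>x i j. u \<beta> x $ i $ j = poly (P $ i $ j) x"
    using root_iso(4)[OF assms] by blast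
  have "\<exists>C\<ge>0. \<forall>y. pabs y \<le> 1 \<longrightarrow> pabs (poly (P $ i $ j) y - poly (P $ i $ j) 0) \<le> pabs y * C" for i j
    by (rule poly_continuous_at_0)
  then obtain C where "\<forall>i j. C i j \<ge> 0 \<and>
      (\<forall>y. pabs y \<le> 1 \<longrightarrow> pabs (poly (P $ i $ j) y - poly (P $ i $ j) 0) \<le> pabs y * C i j)"
    by metis
  then have C: "\<And>i j. C i j \<ge> 0"
    "\<And>i j y. pabs y \<le> 1 \<Longrightarrow> pabs (poly (P $ i $ j) y - poly (P $ i $ j) 0) \<le> pabs y * C i j"
    by blast+
  define D where "D = (\<Sum>i\<in>UNIV. \<Sum>j\<in>UNIV. C i j)"
  have D: "C i j \<le> D" for i j
  proof -
    have "C i j \<le> (\<Sum>j\<in>UNIV. C i j)" by (rule member_le_sum) (auto simp: C)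
    also have "\<dots> \<le> D" unfolding D_def
      by (rule member_le_sum[where f = "\<lambda>i. \<Sum>j\<in>UNIV. C i j"]) (auto intro: sum_nonneg C)
    finally show ?thesis .
  qed
  have D0: "D \<ge> 0" using C(1) D order_trans by blast
  obtain m where m: "D * (1 / real p ^ m) \<le> 1 / real p ^ k"
    using small_times[OF D0, of "1 / real p ^ k"] p_gt_1 by auto
  have "u \<beta> y - mat 1 \<in> mball (1 / real p ^ k)" if y: "pabs y \<le> 1 / real p ^ m" for y
    unfolding mball_def
  proof safe
    fix i j
    have "(u \<beta> y - mat 1) $ i $ j = poly (P $ i $ j) y - poly (P $ i $ j) 0"
      using P root_iso(5)[OF assms] by (metis vector_minus_component)
    also have "pabs \<dots> \<le> pabs y * C i j"
      using y inverse_p_power_le_1[of m] by (intro C(2)) linarith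
    also have "\<dots> \<le> (1 / real p ^ m) * D" using y D C(1) by (intro mult_mono) auto
    finally show "pabs ((u \<beta> y - mat 1) $ i $ j) \<le> 1 / real p ^ k" using m by (simp add: mult.commute)
  qed
  then show ?thesis by blast
qed

lemma rootprod_near_1:
  assumes "set bs \<subseteq> set \<beta>s"
  shows "\<exists>m. \<forall>x. (\<forall>\<beta>\<in>set bs. pabs (x \<beta>) \<le> 1 / real p ^ m) \<longrightarrow> rootprod x bs - mat 1 \<in> mball (1 / real p ^ k)"
  using assms
proof (induction bs)
  case Nil then show ?case by (auto simp: mball_def)
next
  case (Cons b bs)
  then obtain m where m: "\<And>x. (\<forall>\<beta>\<in>set bs. pabs (x \<beta>) \<le> 1 / real p ^ m) \<Longrightarrow> rootprod x bs - mat 1 \<in> mball (1 / real p ^ k)"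
    by auto
  obtain m' where m': "\<And>y. pabs y \<le> 1 / real p ^ m' \<Longrightarrow> u b y - mat 1 \<in> mball (1 / real p ^ k)"
    using root_near_1[of b k] Cons.prems by (meson list.set_intros(1) subsetD)
  have "rootprod x (b # bs) - mat 1 \<in> mball (1 / real p ^ k)"
    if "\<forall>\<beta>\<in>set (b # bs). pabs (x \<beta>) \<le> 1 / real p ^ (max m m')" for x
  proof -
    have "u b (x b) ** rootprod x bs - mat 1 \<in> mball (1 / real p ^ k)"
    proof (rule near_mult)
      show "u b (x b) - mat 1 \<in> mball (1 / real p ^ k)"
        using that inverse_p_power_mono[of m' "max m m'"] by (intro m') force
      show "rootprod x bs - mat 1 \<in> mball (1 / real p ^ k)"
        using that inverse_p_power_mono[of m "max m m'"] by (intro m) force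
    qed (use inverse_p_power_le_1 in auto)
    then show ?thesis by simp
  qed
  then show ?case by blast
qed

definition sp :: "nat \<Rightarrow> 'q^'n^'n" where "sp m = \<xi> (of_nat p ^ m)"

lemma sp_in_TQ: "sp m \<in> TQ" unfolding sp_def using p_nonzero xi_in_TQ by simp
lemma sp_0: "sp 0 = mat 1" by (simp add: sp_def xi_one)
lemma sp_Suc: "sp (Suc m) = s ** sp m" "sp (Suc m) = sp m ** s"
  using xi_mult[of "of_nat p" "of_nat p ^ m"] xi_mult[of "of_nat p ^ m" "of_nat p"] p_nonzero
  by (simp_all add: sp_def s_def mult.commute)

text \<open>
  Conjugation by \<open>\<xi> z\<close> multiplies the root coordinates by powers of
  \<open>z\<close>.
\<close>

lemma cj_xi_N0:
  assumes "z \<in> Zp" "z \<noteq> 0" "x \<in> N0"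
  shows "cj (\<xi> z) x \<in> N0"
proof -
  obtain c where c: "x = rootprod c \<beta>s" "\<forall>\<beta>\<in>set \<beta>s. c \<beta> \<in> Zp" using assms(3) unfolding N0_rootprod by blast
  have "cj (\<xi> z) x = rootprod (\<lambda>\<beta>. \<beta> (\<xi> z) * c \<beta>) \<beta>s"
    using cj_rootprod[of \<beta>s "\<xi> z" c] xi_in_TQ[OF assms(2)] c(1) by simp
  moreover have "\<beta> (\<xi> z) * c \<beta> \<in> Zp" if b: "\<beta> \<in> set \<beta>s" for \<beta>
  proof -
    obtain e where "\<beta> (\<xi> z) = z ^ e" using root_height[OF b] assms(2) by blast
    then show ?thesis using c(2) b assms(1) by (auto intro!: Zp_mult Zp_power)
  qed
  ultimately show ?thesis unfolding N0_rootprod by (intro CollectI exI conjI ballI)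
qed

text \<open>
  Conjugation by \<open>s\<^sup>m\<close> multiplies every root coordinate by a power of
  \<open>p\<close> with exponent at least \<open>m\<close>.
\<close>

lemma N0_contract:
  "\<exists>m0. \<forall>m\<ge>m0. \<forall>x\<in>N0. cj (sp m) x - mat 1 \<in> mball (1 / real p ^ k)"
proof -
  obtain m0 where m0: "\<And>c. (\<forall>\<beta>\<in>set \<beta>s. pabs (c \<beta>) \<le> 1 / real p ^ m0) \<Longrightarrow> rootprod c \<beta>s - mat 1 \<in> mball (1 / real p ^ k)"
    using rootprod_near_1[of \<beta>s k] by blast
  have "cj (sp m) x - mat 1 \<in> mball (1 / real p ^ k)" if "m \<ge> m0" and x: "x \<in> N0" for m x
  proof -
    obtain c where c: "x = rootprod c \<beta>s" "\<forall>\<beta>\<in>set \<beta>s. c \<beta> \<in> Zp" using x unfolding N0_rootprod by blast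
    have e: "cj (sp m) x = rootprod (\<lambda>\<beta>. \<beta> (sp m) * c \<beta>) \<beta>s"
      using cj_rootprod[of \<beta>s "sp m" c] sp_in_TQ c(1) by simp
    have "pabs (\<beta> (sp m) * c \<beta>) \<le> 1 / real p ^ m0" if b: "\<beta> \<in> set \<beta>s" for \<beta>
    proof -
      obtain e where e: "e \<ge> 1" "\<beta> (sp m) = (of_nat p ^ m) ^ e"
        using root_height[OF b] p_nonzero unfolding sp_def by (metis power_not_zero)
      have "\<beta> (sp m) = of_nat p ^ (m * e)" by (simp add: e power_mult)
      moreover have "m0 \<le> m * e" using e \<open>m \<ge> m0\<close> by (cases e) auto
      ultimately have "pabs (\<beta> (sp m)) \<le> 1 / real p ^ m0"
        using inverse_p_power_mono[of m0 "m * e"] pabs_p_power[of "m * e"] by simp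
      then have "pabs (\<beta> (sp m) * c \<beta>) \<le> 1 / real p ^ m0 * 1"
        using c(2) b by (intro pabs_mult_le) (auto simp: Zp_def)
      then show ?thesis by simp
    qed
    then show ?thesis unfolding e by (intro m0) blast
  qed
  then show ?thesis by blast
qed

definition lam :: "'n \<Rightarrow> 'q" where "lam i = tor s i"

lemma tor_sp: "tor (sp m) i = lam i ^ m"
  by (induction m) (auto simp: sp_0 tor_one sp_Suc(1) tor_mult s_in_TQ sp_in_TQ lam_def)

lemma lam_nonzero: "lam i \<noteq> 0" unfolding lam_def by (rule tor_nonzero[OF s_in_TQ])

text \<open>
  Conjugation by \<open>s\<^sup>m\<close> multiplies the \<open>(i, j)\<close> entry by \<open>(\<lambda>\<^sub>i/\<lambda>\<^sub>j)\<^sup>m\<close> and contracts \<open>N\<^sub>0\<close> to \<open>1\<close>; hence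
  an entry of an element of \<open>N\<^sub>0\<close> can differ from that of \<open>1\<close> only if \<open>|\<lambda>\<^sub>i| < |\<lambda>\<^sub>j|\<close>.
\<close>

lemma N0_triangular:
  assumes x: "x \<in> N0" and ij: "pabs (lam i) \<ge> pabs (lam j)"
  shows "(dg x - mat 1) $ i $ j = 0"
proof (rule pabs_le_all_imp_0)
  fix k
  obtain C where C: "C \<ge> 1" "\<And>c x. c \<ge> 0 \<Longrightarrow> x \<in> mball c \<Longrightarrow> dg x \<in> mball (C * c)"
    using dg_bounded by blast
  obtain l where l: "C * (1 / real p ^ l) \<le> 1 / real p ^ k"
    using small_times[of C "1 / real p ^ k"] C p_gt_1 by auto
  obtain m where m: "cj (sp m) x - mat 1 \<in> mball (1 / real p ^ l)"
    using N0_contract[of l] x by blast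
  have "dg (cj (sp m) x - mat 1) \<in> mball (C * (1 / real p ^ l))" using m by (intro C(2)) auto
  then have "dg (cj (sp m) x) - mat 1 \<in> mball (1 / real p ^ k)"
    using l mball_mono by (simp add: dg_def cj_diff cj_one diag_basis(1)) blast
  then have b: "pabs (dg (cj (sp m) x) $ i $ j - mat 1 $ i $ j) \<le> 1 / real p ^ k"
    by (simp add: mball_def)
  have e: "dg (cj (sp m) x) $ i $ j - mat 1 $ i $ j = (lam i / lam j) ^ m * (dg x - mat 1) $ i $ j"
    using dg_cj_torus[OF sp_in_TQ, of m x i j] lam_nonzero
    by (cases "i = j") (auto simp: tor_sp power_divide mat_def)
  have "1 \<le> pabs ((lam i / lam j) ^ m)"
    using ij lam_nonzero[of j] by (simp add: pabs_power pabs_divide one_le_power)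
  then have "pabs ((dg x - mat 1) $ i $ j) \<le> pabs ((lam i / lam j) ^ m) * pabs ((dg x - mat 1) $ i $ j)"
    using mult_right_mono[of 1 "pabs ((lam i / lam j) ^ m)" "pabs ((dg x - mat 1) $ i $ j)"] by simp
  then show "pabs ((dg x - mat 1) $ i $ j) \<le> 1 / real p ^ k" using b e by (simp add: abs_mult)
qed

text \<open>
  Some \<open>p\<^sup>m\<close>-th power of an element of \<open>N\<close> lies in
  \<open>N\<^sub>0\<close>, and the property is inherited by the element from this power, by
  \<open>nilpotent_in_closed_space\<close>.
\<close>

lemma NQ_triangular:
  assumes x: "x \<in> NQ" and ij: "pabs (lam i) \<ge> pabs (lam j)"
  shows "(dg x - mat 1) $ i $ j = 0"
proof -
  let ?S = "{M :: 'q^'n^'n. \<forall>i j. pabs (lam i) \<ge> pabs (lam j) \<longrightarrow> M $ i $ j = 0}"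
  obtain d where d: "mpow (x - mat 1) d = 0" using NQ_unipotent[OF x] by blast
  obtain m where m: "mpow x (p ^ m) - mat 1 \<in> mball (1 / real p ^ 0)"
    using unipotent_power_tends_to_1[OF d, of 0] by blast
  have N0: "mpow x (p ^ m) \<in> N0"
    using m matrix_subgroup_mpow[OF NQ_subgroup x] near_1_in_N0 by blast
  have "dg x - mat 1 \<in> ?S"
  proof (rule nilpotent_in_closed_space)
    show "M + M' \<in> ?S" if "M \<in> ?S" "M' \<in> ?S" for M M' using that by simp
    show "mat c ** M \<in> ?S" if "M \<in> ?S" for c M using that by (simp add: mat_scalar_entry)
    show "M ** M' \<in> ?S" if M: "M \<in> ?S" "M' \<in> ?S" for M M'
    proof (clarsimp)
      fix i j assume ij: "pabs (lam j) \<le> pabs (lam i)"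
      have "M $ i $ k * M' $ k $ j = 0" for k
      proof (cases "pabs (lam k) \<le> pabs (lam i)")
        case False
        then have "pabs (lam j) \<le> pabs (lam k)" using ij by linarith
        then show ?thesis using M by simp
      qed (use M in simp)
      then show "(M ** M') $ i $ j = 0"
        unfolding matrix_matrix_mult_def vec_lambda_beta by (intro sum.neutral ballI)
    qed
    have "dg (mpow (x - mat 1) d) = 0" using d by (simp add: dg_def cj_zero)
    then show "mpow (dg x - mat 1) d = 0"
      by (simp add: dg_def cj_mpow cj_diff cj_one diag_basis(1))
    show "0 < p ^ m" using p_gt_1 by simp
    have "dg (mpow x (p ^ m)) = mpow (dg x) (p ^ m)" by (simp add: dg_def cj_mpow diag_basis(1))
    then show "mpow (dg x) (p ^ m) - mat 1 \<in> ?S" using N0_triangular[OF N0] by simp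
  qed
  then show ?thesis using ij by blast
qed

lemma NQ_diagonal: "x \<in> NQ \<Longrightarrow> dg x $ i $ i = 1"
  using NQ_triangular[of x i i] by (simp add: mat_def)

lemma B_diagonal: "t \<in> TQ \<Longrightarrow> x \<in> NQ \<Longrightarrow> dg (t ** x) $ i $ i = tor t i"
  by (simp add: dg_mult dg_torus_left NQ_diagonal)

lemma TQ_NQ_inter:
  assumes "t \<in> TQ" "t \<in> NQ" shows "t = mat 1"
proof -
  have "tor t i = 1" for i unfolding tor_def by (rule NQ_diagonal[OF assms(2)])
  then have "dg t = mat 1" by (simp add: vec_eq_iff mat_def dg_torus_entry[OF assms(1)])
  then show ?thesis using dg_inj[of t] by (simp add: cj_one invertible_matrix_inv diag_basis(1))
qed

lemma ell_one: "ell (mat 1) = 0"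
  using ell_hom[of "mat 1" "mat 1"] N0_closed(2) by (simp add: N0_def)

text \<open>
  Otherwise \<open>N\<^sub>0\<close> would be trivial by \<open>N0_triangular\<close>, but
  \<open>ell\<close> is a surjection from it.
\<close>

lemma lam_not_all_units: "\<exists>i. pabs (lam i) \<noteq> 1"
proof (rule ccontr)
  assume units: "\<not> (\<exists>i. pabs (lam i) \<noteq> 1)"
  have "x = mat 1" if "x \<in> N0" for x
  proof -
    have "dg x = mat 1" using N0_triangular[OF that] units by (simp add: vec_eq_iff)
    then show ?thesis using dg_inj[of x] by (simp add: cj_one invertible_matrix_inv diag_basis(1))
  qed
  then have "ell ` N0 \<subseteq> {0}" using ell_one by auto
  moreover have "(1::'q) \<in> ell ` N0" using ell_surj by (simp add: N0_def)
  ultimately show False by auto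
qed

subsection \<open>A degree on \<open>B\<close>\<close>

text \<open>
  The absolute value of a diagonal entry is a continuous character of \<open>B\<close> that is trivial on \<open>N\<close>
  and on \<open>T\<^sub>0\<close> but not at \<open>s\<close>.
\<close>

definition deg_index :: 'n where "deg_index = (SOME i. pabs (lam i) \<noteq> 1)"

definition deg :: "'q^'n^'n \<Rightarrow> real" where "deg x = pabs (dg x $ deg_index $ deg_index)"

lemma deg_s: "deg s \<noteq> 1"
  using someI_ex[OF lam_not_all_units] by (simp add: deg_def deg_index_def lam_def tor_def)

lemma B_mult_decomp:
  assumes "t \<in> TQ" "x \<in> NQ" "t' \<in> TQ" "x' \<in> NQ"
  shows "(t ** x) ** (t' ** x') = (t ** t') ** (cj (matrix_inv t') x ** x')"
    and "cj (matrix_inv t') x ** x' \<in> NQ"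
proof -
  have i: "invertible t'" using assms TQ_closed by blast
  show "(t ** x) ** (t' ** x') = (t ** t') ** (cj (matrix_inv t') x ** x')"
    by (simp add: cj_def matrix_inv_inv[OF i] matrix_mul_assoc matrix_inv_cancel i)
  show "cj (matrix_inv t') x ** x' \<in> NQ"
    using assms by (intro NQ_closed NQ_normal TQ_in_B TQ_closed)
qed

lemma deg_mult: "x \<in> B \<Longrightarrow> y \<in> B \<Longrightarrow> deg (x ** y) = deg x * deg y"
  unfolding B_eq deg_def
  by (clarsimp simp: B_mult_decomp(1) B_diagonal B_mult_decomp(2) TQ_closed tor_mult abs_mult)

lemma deg_pos: "x \<in> B \<Longrightarrow> deg x > 0"
  unfolding B_eq deg_def by (auto simp: B_diagonal tor_nonzero)

lemma deg_NQ: "x \<in> NQ \<Longrightarrow> deg x = 1"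
  by (simp add: deg_def NQ_diagonal)

lemma deg_one: "deg (mat 1) = 1"
  using deg_NQ NQ_closed(2) by blast

lemma T0_in_TQ: "t \<in> T0 \<Longrightarrow> t \<in> TQ"
  using T0_maximal_compact subgroup.subset unfolding is_maximal_compact_def by fastforce

lemma T0_subgroup: "matrix_subgroup T0"
  using T0_maximal_compact subgroup_mat_group[OF TQ_subgroup] unfolding is_maximal_compact_def by blast

text \<open>
  The values of \<open>deg\<close> on \<open>T\<^sub>0\<close> form a bounded group of positive
  reals.
\<close>

lemma deg_T0:
  assumes "t \<in> T0" shows "deg t = 1"
proof -
  have "bounded T0" using T0_maximal_compact compact_imp_bounded unfolding is_maximal_compact_def by blast
  then obtain R where "\<forall>x\<in>T0. dist 0 x \<le> R" unfolding bounded_any_center[where a = 0] by (rule exE)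
  then have R: "dist 0 x \<le> R" if "x \<in> T0" for x using that by blast
  obtain C where C: "C \<ge> 1" "\<And>c x. c \<ge> 0 \<Longrightarrow> x \<in> mball c \<Longrightarrow> dg x \<in> mball (C * c)"
    using dg_bounded by blast
  have bd: "deg x \<le> C * max R 0" if "x \<in> T0" for x
  proof -
    have "x \<in> mball (max R 0)"
      unfolding mball_def
    proof safe
      fix i j show "pabs (x $ i $ j) \<le> max R 0"
        using R[OF that] dist_matrix_le[of x i j 0] by (simp add: dist_commute)
    qed
    from C(2)[OF _ this] show ?thesis unfolding deg_def by (simp add: mball_def)
  qed
  have le: "deg x \<le> 1" if x: "x \<in> T0" for x
  proof (rule ccontr)
    assume "\<not> deg x \<le> 1"
    then obtain m where m: "C * max R 0 < deg x ^ m" using real_arch_pow[of "deg x"] by auto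
    have "deg (mpow x m) = deg x ^ m" for m
      by (induction m) (use matrix_subgroup_mpow[OF T0_subgroup x] T0_in_TQ TQ_in_B x in
          \<open>auto simp: deg_one deg_mult\<close>)
    then show False using bd[OF matrix_subgroup_mpow[OF T0_subgroup x, of m]] m by simp
  qed
  have tB: "t \<in> B" "matrix_inv t \<in> B" using assms T0_in_TQ TQ_in_B B_closed(4) by blast+
  have "deg t * deg (matrix_inv t) = 1"
    using deg_mult[OF tB] B_closed(1)[OF tB(1)] by (simp add: matrix_inv deg_one)
  moreover have "deg t \<le> 1" "deg (matrix_inv t) \<le> 1"
    using le assms matrix_subgroupD(4)[OF T0_subgroup] by blast+
  ultimately show ?thesis using deg_pos[OF tB(1)] deg_pos[OF tB(2)]
    by (smt (verit) mult_le_cancel_left1 mult_left_le)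
qed

lemma B0_in_B: "x \<in> B0 \<Longrightarrow> x \<in> B"
  unfolding B0_def using N0_in_B T0_in_TQ TQ_in_B B_closed(3) by blast

lemma deg_B0: "x \<in> B0 \<Longrightarrow> deg x = 1"
  unfolding B0_def
  using deg_mult N0_in_B T0_in_TQ TQ_in_B deg_T0 deg_NQ N0_in_NQ by force

text \<open>
  In the diagonalizing basis, the diagonal of \<open>b = tx\<close> is that of \<open>t\<close>, so
  that \<open>t\<close> is close to \<open>1\<close>, and then so is \<open>x =
  t\<^sup>-\<^sup>1b\<close>.
\<close>

lemma B_decomp_near_1:
  "\<exists>m. \<forall>b\<in>B. b - mat 1 \<in> mball (1 / real p ^ m) \<longrightarrow>
     (\<exists>t\<in>TQ. \<exists>x\<in>NQ. b = t ** x \<and> t - mat 1 \<in> mball (1 / real p ^ k) \<and>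
        matrix_inv t - mat 1 \<in> mball (1 / real p ^ k) \<and> x - mat 1 \<in> mball (1 / real p ^ k) \<and> deg b = 1)"
proof -
  obtain C where C: "C \<ge> 1" "\<And>c x. c \<ge> 0 \<Longrightarrow> x \<in> mball c \<Longrightarrow> dg x \<in> mball (C * c)"
    "\<And>c x. c \<ge> 0 \<Longrightarrow> x \<in> mball c \<Longrightarrow> cj (matrix_inv diag_basis) x \<in> mball (C * c)"
    using dg_bounded by blast
  obtain m where m: "C * C * C * C * (1 / real p ^ m) \<le> 1 / real p ^ (k + 1)"
    using small_times[of "C * C * C * C" "1 / real p ^ (k + 1)"] C p_gt_1 by auto
  let ?e = "1 / real p ^ m"
  have e0: "0 \<le> ?e" by simp
  have c1: "C * ?e \<le> C * C * ?e" "C * C * ?e \<le> C * C * C * ?e" "C * C * C * ?e \<le> C * C * C * C * ?e"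
    using C(1) e0 by (intro mult_right_mono; simp add: mult_left_mono)+
  have lt1: "1 / real p ^ (k + 1) < 1" using p_gt_1 power_gt1[of "real p" k] by simp
  have lek: "1 / real p ^ (k + 1) \<le> 1 / real p ^ k" by (rule inverse_p_power_mono) simp
  have "\<exists>t\<in>TQ. \<exists>x\<in>NQ. b = t ** x \<and> t - mat 1 \<in> mball (1 / real p ^ k) \<and>
        matrix_inv t - mat 1 \<in> mball (1 / real p ^ k) \<and> x - mat 1 \<in> mball (1 / real p ^ k) \<and> deg b = 1"
    if b: "b \<in> B" "b - mat 1 \<in> mball ?e" for b
  proof -
    obtain t x where tx: "t \<in> TQ" "x \<in> NQ" "b = t ** x" using b(1) unfolding B_eq by blast
    have ti: "invertible t" using TQ_closed tx by blast
    have dgb: "dg b - mat 1 \<in> mball (C * ?e)"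
      using C(2)[OF e0 b(2)] by (simp add: dg_def cj_diff cj_one diag_basis(1))
    have tor: "pabs (tor t i - 1) \<le> C * ?e" for i
      using mballD[OF dgb, of i i] B_diagonal[OF tx(1,2), of i] by (simp add: tx(3) mat_def)
    have tor1: "pabs (tor t i) = 1" for i
    proof -
      have l: "pabs (tor t i - 1) < 1" using tor[of i] c1 m lt1 by linarith
      then have "pabs (tor t i) \<le> 1" using pabs_add_le[of "tor t i - 1" 1 1] by simp
      moreover have "1 \<le> max (pabs (tor t i)) (pabs (tor t i - 1))"
        using abs_ultrametric[of "tor t i" "- (tor t i - 1)"] by (simp only: pabs_minus) simp
      ultimately show ?thesis using l by simp
    qed
    have tori: "pabs (tor (matrix_inv t) i) = 1" for i
      using abs_mult[of "tor t i" "tor (matrix_inv t) i"] tor_inv[OF tx(1), of i] tor1[of i] by simp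
    have "dg t - mat 1 \<in> mball (C * ?e)"
      using tor C(1) unfolding mball_def by (auto simp: dg_torus_entry[OF tx(1)] mat_def)
    then have "cj (matrix_inv diag_basis) (dg t - mat 1) \<in> mball (C * (C * ?e))"
      using C(1) by (intro C(3)) auto
    then have t1: "t - mat 1 \<in> mball (C * C * ?e)"
      by (simp add: cj_diff dg_inj cj_one invertible_matrix_inv diag_basis(1) mult.assoc)
    have "dg (matrix_inv t) \<in> mball 1"
      using tori unfolding mball_def by (auto simp: dg_torus_entry[OF TQ_closed(4)[OF tx(1)]])
    then have ti1: "matrix_inv t \<in> mball C"
      using C(3)[of 1 "dg (matrix_inv t)"] by (simp add: dg_inj)
    have ti2: "matrix_inv t - mat 1 \<in> mball (C * (C * C * ?e))"
      using t1 ti ti1 C(1) by (intro near_inverse) auto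
    have xe: "x - mat 1 = matrix_inv t ** ((b - mat 1) - (t - mat 1))"
      by (simp add: tx(3) matrix_diff_ldistrib matrix_mul_assoc matrix_inv ti)
    have "(b - mat 1) - (t - mat 1) \<in> mball (C * C * ?e)"
    proof (rule mball_diff[OF _ t1])
      have "?e \<le> C * ?e" using C(1) e0 mult_right_mono[of 1 C ?e] by simp
      then show "b - mat 1 \<in> mball (C * C * ?e)" using b(2) c1(1) mball_mono by (meson order_trans)
    qed
    then have x1: "x - mat 1 \<in> mball (C * (C * C * ?e))"
      unfolding xe using ti1 C(1) by (intro mball_mult) auto
    have k3: "C * (C * C * ?e) \<le> 1 / real p ^ k" "C * C * ?e \<le> 1 / real p ^ k"
      using c1 m lek by (simp_all add: mult.assoc)
    have "deg b = 1" unfolding deg_def using tor1 B_diagonal[OF tx(1,2)] by (simp add: tx(3))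
    then show ?thesis using tx t1 ti2 x1 k3 mball_mono by blast
  qed
  then show ?thesis by blast
qed

end

section \<open>Smooth representations of \<open>B\<close>\<close>

context borel_setting
begin

lemma matrix_mult_near:
  fixes g :: "'q^'n^'n"
  assumes "invertible g" "e > 0"
  shows "\<exists>d>0. \<forall>x. dist x g < d \<longrightarrow> dist (matrix_inv g ** x) (mat 1) < e"
proof -
  have "\<exists>d>0. \<forall>x. dist x g < d \<longrightarrow> matrix_inv g ** x - mat 1 \<in> mball (1 / real p ^ k)" for k
  proof -
    obtain C where C: "C > 0" "matrix_inv g \<in> mball C" using mball_exists by blast
    have "matrix_inv g ** x - mat 1 \<in> mball (1 / real p ^ k)" if "dist x g < (1 / real p ^ k) / C" for x
    proof -
      have "x - g \<in> mball ((1 / real p ^ k) / C)"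
        unfolding mball_def
      proof safe
        fix i j
        show "pabs ((x - g) $ i $ j) \<le> (1 / real p ^ k) / C"
          using that dist_diff[of "x $ i $ j" "g $ i $ j"] dist_matrix_le[of x i j g] by simp
      qed
      then have "matrix_inv g ** (x - g) \<in> mball (C * ((1 / real p ^ k) / C))"
        using C by (intro mball_mult) auto
      then show ?thesis using C assms by (simp add: matrix_diff_ldistrib matrix_inv)
    qed
    moreover have "(1 / real p ^ k) / C > 0" using C p_gt_1 by simp
    ultimately show ?thesis by blast
  qed
  moreover have "\<exists>k. \<forall>x\<in>UNIV. x - mat 1 \<in> mball (1 / real p ^ k) \<longrightarrow> x \<in> {x :: 'q^'n^'n. dist x (mat 1) < e}"
    using near_identity_iff[of UNIV "{x :: 'q^'n^'n. dist x (mat 1) < e}"] assms(2) by blast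
  ultimately show ?thesis by (metis (no_types, lifting) UNIV_I mem_Collect_eq)
qed

text \<open>
  A subgroup that contains a neighbourhood of \<open>1\<close> contains a translate of it around
  each of its elements.
\<close>

lemma open_subgroup_iff:
  assumes sub: "S \<subseteq> B" and one: "mat 1 \<in> S"
    and mult: "\<And>x y. x \<in> S \<Longrightarrow> y \<in> S \<Longrightarrow> x ** y \<in> S"
  shows "openin (top_of_set B) S \<longleftrightarrow> (\<exists>k. \<forall>x\<in>B. x - mat 1 \<in> mball (1 / real p ^ k) \<longrightarrow> x \<in> S)"
proof
  assume "openin (top_of_set B) S"
  then obtain e where "e > 0" "\<forall>x\<in>B. dist x (mat 1) < e \<longrightarrow> x \<in> S"
    using one unfolding openin_euclidean_subtopology_iff by blast
  then show "\<exists>k. \<forall>x\<in>B. x - mat 1 \<in> mball (1 / real p ^ k) \<longrightarrow> x \<in> S"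
    using near_identity_iff[of B S] by blast
next
  assume "\<exists>k. \<forall>x\<in>B. x - mat 1 \<in> mball (1 / real p ^ k) \<longrightarrow> x \<in> S"
  then obtain e where e: "e > 0" "\<And>x. x \<in> B \<Longrightarrow> dist x (mat 1) < e \<Longrightarrow> x \<in> S"
    using near_identity_iff[of B S] by blast
  have "\<exists>d>0. \<forall>x'\<in>B. dist x' x < d \<longrightarrow> x' \<in> S" if x: "x \<in> S" for x
  proof -
    have xB: "x \<in> B" "invertible x" using x sub B_closed by blast+
    obtain d where d: "d > 0" "\<And>x'. dist x' x < d \<Longrightarrow> dist (matrix_inv x ** x') (mat 1) < e"
      using matrix_mult_near[OF xB(2) e(1)] by blast
    have "x' \<in> S" if "x' \<in> B" "dist x' x < d" for x'
    proof -
      have "matrix_inv x ** x' \<in> S" using d(2) that xB B_closed by (intro e(2)) auto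
      then have "x ** (matrix_inv x ** x') \<in> S" by (rule mult[OF x])
      then show ?thesis by (simp add: matrix_mul_assoc matrix_inv xB)
    qed
    then show ?thesis using d(1) by blast
  qed
  then show "openin (top_of_set B) S" unfolding openin_euclidean_subtopology_iff using sub by blast
qed

lemma H0_subset: "x \<in> H0 \<Longrightarrow> x \<in> N0" by (simp add: H0_def)

lemma ell_mult: "x \<in> N0 \<Longrightarrow> y \<in> N0 \<Longrightarrow> ell (x ** y) = ell x + ell y"
  using ell_hom by (simp add: N0_def)

lemma ell_inv: "x \<in> N0 \<Longrightarrow> ell (matrix_inv x) = - ell x"
  using ell_mult[of x "matrix_inv x"] N0_closed ell_one
  by (simp add: matrix_inv eq_neg_iff_add_eq_0 add.commute)

lemma H0_subgroup: "matrix_subgroup H0"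
  unfolding matrix_subgroup_def H0_def GL_def
  using N0_closed by (auto simp: ell_mult ell_one ell_inv)
lemmas H0_closed = matrix_subgroupD[OF H0_subgroup]

lemma H0_normal: "y \<in> N0 \<Longrightarrow> x \<in> H0 \<Longrightarrow> cj y x \<in> H0"
  unfolding H0_def cj_def using N0_closed by (auto simp: ell_mult ell_inv)

lemma cj_s_H0: "x \<in> H0 \<Longrightarrow> cj s x \<in> H0"
  using s_H0[of x] by (simp add: H0_def N0_def s_def cj_def)

lemma cj_s_N0: "x \<in> N0 \<Longrightarrow> cj s x \<in> N0"
  unfolding s_def by (rule cj_xi_N0) (use p_nonzero in auto)

definition gam :: "'q^'n^'n" where "gam = (SOME x. x \<in> N0 \<and> ell x = 1)"

lemma gam: "gam \<in> N0" "ell gam = 1"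
proof -
  have "1 \<in> ell ` N0" using ell_surj by (simp add: N0_def)
  then have "\<exists>x. x \<in> N0 \<and> ell x = 1" by force
  then have "gam \<in> N0 \<and> ell gam = 1" unfolding gam_def by (rule someI_ex)
  then show "gam \<in> N0" "ell gam = 1" by auto
qed

lemma gam_in_B: "gam \<in> B" using gam(1) by (rule N0_in_B)

end

locale borel_rep = borel_setting p Qp \<iota> \<pi> h Fbar GG BB TT NN \<Delta> \<beta>s u T0 \<xi> ell
  for p :: nat and Qp :: "'q::{field_char_0,metric_space} itself"
    and \<iota> :: "'q \<Rightarrow> 'k::field" and \<pi> :: 'k and h :: nat
    and Fbar :: "'f::alg_closed_field itself"
    and GG BB TT NN :: "('q alg_closure^'n::finite^'n) set"
    and \<Delta> :: "('q^'n^'n \<Rightarrow> 'q) set"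
    and \<beta>s :: "('q^'n^'n \<Rightarrow> 'q) list"
    and u :: "('q^'n^'n \<Rightarrow> 'q) \<Rightarrow> 'q \<Rightarrow> 'q^'n^'n"
    and T0 :: "('q^'n^'n) set"
    and \<xi> :: "'q \<Rightarrow> 'q^'n^'n"
    and ell :: "'q^'n^'n \<Rightarrow> 'q" +
  fixes V :: "('k set, 'v) module" and \<rho> :: "'q^'n^'n \<Rightarrow> 'v \<Rightarrow> 'v"
  assumes smooth: "smooth_rep B V \<rho>"
begin

lemma V_module: "module A V" using smooth by (simp add: smooth_rep_def)

sublocale V: module A V by (rule V_module)

abbreviation osm :: "'k \<Rightarrow> 'v \<Rightarrow> 'v" (infixr "\<cdot>" 75) where "c \<cdot> v \<equiv> cls c \<odot>\<^bsub>V\<^esub> v"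

lemmas osm = cls_smult[OF V_module] cls_smult_zero[OF V_module]

lemma osm_add: "c \<in> OK \<Longrightarrow> v \<in> carrier V \<Longrightarrow> w \<in> carrier V \<Longrightarrow> c \<cdot> (v \<oplus>\<^bsub>V\<^esub> w) = c \<cdot> v \<oplus>\<^bsub>V\<^esub> c \<cdot> w"
  by (simp add: cls_closed V.smult_r_distr)

lemma osm_commute: "c \<in> OK \<Longrightarrow> d \<in> OK \<Longrightarrow> v \<in> carrier V \<Longrightarrow> c \<cdot> d \<cdot> v = d \<cdot> c \<cdot> v"
  by (simp add: osm(2)[symmetric] mult.commute)

lemma act_closed [simp]: "b \<in> B \<Longrightarrow> v \<in> carrier V \<Longrightarrow> \<rho> b v \<in> carrier V"
  and act_add: "b \<in> B \<Longrightarrow> v \<in> carrier V \<Longrightarrow> w \<in> carrier V \<Longrightarrow> \<rho> b (v \<oplus>\<^bsub>V\<^esub> w) = \<rho> b v \<oplus>\<^bsub>V\<^esub> \<rho> b w"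
  and act_smult: "b \<in> B \<Longrightarrow> a \<in> carrier A \<Longrightarrow> v \<in> carrier V \<Longrightarrow> \<rho> b (a \<odot>\<^bsub>V\<^esub> v) = a \<odot>\<^bsub>V\<^esub> \<rho> b v"
  and act_one: "v \<in> carrier V \<Longrightarrow> \<rho> (mat 1) v = v"
  and act_mult: "b \<in> B \<Longrightarrow> b' \<in> B \<Longrightarrow> v \<in> carrier V \<Longrightarrow> \<rho> (b ** b') v = \<rho> b (\<rho> b' v)"
  using smooth by (auto simp: smooth_rep_def)

lemma act_osm: "b \<in> B \<Longrightarrow> c \<in> OK \<Longrightarrow> v \<in> carrier V \<Longrightarrow> \<rho> b (c \<cdot> v) = c \<cdot> \<rho> b v"
  by (simp add: act_smult cls_closed)

lemma act_zero [simp]: "b \<in> B \<Longrightarrow> \<rho> b \<zero>\<^bsub>V\<^esub> = \<zero>\<^bsub>V\<^esub>"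
  using act_osm[of b 0 "\<zero>\<^bsub>V\<^esub>"] by (simp add: osm)

lemma act_minus: "b \<in> B \<Longrightarrow> v \<in> carrier V \<Longrightarrow> \<rho> b (\<ominus>\<^bsub>V\<^esub> v) = \<ominus>\<^bsub>V\<^esub> \<rho> b v"
  using act_osm[of b "-1" v] OK_minus[OF OK_1] by (simp add: osm(8)[OF _ OK_1] osm(4))

lemma act_finsum:
  "b \<in> B \<Longrightarrow> f \<in> I \<rightarrow> carrier V \<Longrightarrow> \<rho> b (finsum V f I) = finsum V (\<lambda>i. \<rho> b (f i)) I"
proof (induction I rule: infinite_finite_induct)
  case (insert i I)
  then have "f i \<in> carrier V" "f \<in> I \<rightarrow> carrier V" by auto
  then show ?case using insert by (simp add: V.finsum_insert act_add Pi_def)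
qed (simp_all add: V.finsum_infinite V.finsum_empty)

lemma stabilizer_near_1:
  assumes "v \<in> carrier V"
  shows "\<exists>k. \<forall>b\<in>B. b - mat 1 \<in> mball (1 / real p ^ k) \<longrightarrow> \<rho> b v = v"
proof -
  have "openin (top_of_set B) {g \<in> B. \<rho> g v = v}"
    using smooth assms by (simp add: smooth_rep_def)
  moreover have "openin (top_of_set B) {g \<in> B. \<rho> g v = v} \<longleftrightarrow>
      (\<exists>k. \<forall>x\<in>B. x - mat 1 \<in> mball (1 / real p ^ k) \<longrightarrow> x \<in> {g \<in> B. \<rho> g v = v})"
    by (rule open_subgroup_iff) (use assms B_closed in \<open>auto simp: act_one act_mult\<close>)
  ultimately show ?thesis by blast
qed

subsection \<open>Local nilpotence of \<open>X\<close>\<close>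

definition diffop :: "'q^'n^'n \<Rightarrow> 'v \<Rightarrow> 'v" where "diffop g v = \<rho> g v \<ominus>\<^bsub>V\<^esub> v"

lemma act_X_eq: "act_X V \<rho> = diffop gam"
  by (simp add: act_X_def diffop_def gam_def fun_eq_iff)

lemma diffop_closed [simp]: "g \<in> B \<Longrightarrow> v \<in> carrier V \<Longrightarrow> diffop g v \<in> carrier V"
  by (simp add: diffop_def)

lemma diffop_pow_closed [simp]: "g \<in> B \<Longrightarrow> v \<in> carrier V \<Longrightarrow> (diffop g ^^ n) v \<in> carrier V"
  by (induction n) auto

lemma diffop_zero [simp]: "g \<in> B \<Longrightarrow> diffop g \<zero>\<^bsub>V\<^esub> = \<zero>\<^bsub>V\<^esub>"
  by (simp add: diffop_def V.minus_eq)

lemma diffop_pow_zero [simp]: "g \<in> B \<Longrightarrow> (diffop g ^^ n) \<zero>\<^bsub>V\<^esub> = \<zero>\<^bsub>V\<^esub>"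
  by (induction n) auto

lemma diffop_add:
  "g \<in> B \<Longrightarrow> v \<in> carrier V \<Longrightarrow> w \<in> carrier V \<Longrightarrow> diffop g (v \<oplus>\<^bsub>V\<^esub> w) = diffop g v \<oplus>\<^bsub>V\<^esub> diffop g w"
  by (simp add: diffop_def act_add V.minus_eq V.minus_add V.add.m_ac)

lemma diffop_pow_add:
  "g \<in> B \<Longrightarrow> v \<in> carrier V \<Longrightarrow> w \<in> carrier V \<Longrightarrow>
    (diffop g ^^ n) (v \<oplus>\<^bsub>V\<^esub> w) = (diffop g ^^ n) v \<oplus>\<^bsub>V\<^esub> (diffop g ^^ n) w"
  by (induction n) (auto simp: diffop_add)

lemma diffop_osm: "g \<in> B \<Longrightarrow> c \<in> OK \<Longrightarrow> v \<in> carrier V \<Longrightarrow> diffop g (c \<cdot> v) = c \<cdot> diffop g v"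
proof -
  assume a: "g \<in> B" "c \<in> OK" "v \<in> carrier V"
  have "c \<cdot> (\<ominus>\<^bsub>V\<^esub> v) = \<ominus>\<^bsub>V\<^esub> (c \<cdot> v)" using a by (simp add: V.smult_r_minus cls_closed)
  then show ?thesis using a by (simp add: diffop_def V.minus_eq osm_add act_osm)
qed

lemma diffop_pow_osm:
  "g \<in> B \<Longrightarrow> c \<in> OK \<Longrightarrow> v \<in> carrier V \<Longrightarrow> (diffop g ^^ n) (c \<cdot> v) = c \<cdot> (diffop g ^^ n) v"
  by (induction n) (auto simp: diffop_osm)

lemma diffop_finsum:
  "g \<in> B \<Longrightarrow> f \<in> I \<rightarrow> carrier V \<Longrightarrow> diffop g (finsum V f I) = finsum V (\<lambda>i. diffop g (f i)) I"
proof (induction I rule: infinite_finite_induct)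
  case (insert i I)
  then have "f i \<in> carrier V" "f \<in> I \<rightarrow> carrier V" by auto
  then show ?case using insert by (simp add: V.finsum_insert diffop_add Pi_def)
qed (simp_all add: V.finsum_infinite V.finsum_empty)

lemma act_eq_diffop: "g \<in> B \<Longrightarrow> v \<in> carrier V \<Longrightarrow> \<rho> g v = v \<oplus>\<^bsub>V\<^esub> diffop g v"
  by (simp add: diffop_def V.minus_eq V.add.m_comm[of v] V.add.m_assoc V.l_neg)

lemma diffop_eq_zero_iff: "g \<in> B \<Longrightarrow> v \<in> carrier V \<Longrightarrow> diffop g v = \<zero>\<^bsub>V\<^esub> \<longleftrightarrow> \<rho> g v = v"
  by (metis V.add.inv_solve_right' V.minus_eq V.r_zero act_closed act_eq_diffop diffop_def V.l_zero V.r_neg)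

lemma B_mpow: "g \<in> B \<Longrightarrow> mpow g m \<in> B"
  by (rule matrix_subgroup_mpow[OF B_subgroup])

text \<open>
  The binomial theorem for \<open>g\<^sup>m = (1 + (g - 1))\<^sup>m\<close>, as operators on
  \<open>V\<close>.
\<close>

lemma act_mpow_binomial:
  assumes g: "g \<in> B" and v: "v \<in> carrier V"
  shows "\<rho> (mpow g m) v = finsum V (\<lambda>l. of_nat (m choose l) \<cdot> (diffop g ^^ l) v) {..m}"
proof (induction m)
  case 0
  then show ?case using v by (simp add: V.finsum_0 act_one osm)
next
  case (Suc m)
  let ?E = "\<lambda>l. (diffop g ^^ l) v"
  let ?c = "\<lambda>m l. of_nat (m choose l) \<cdot> ?E l"
  have E: "?E l \<in> carrier V" for l using g v by simp
  have c: "of_nat k \<cdot> ?E l \<in> carrier V" for k l using E by (simp add: osm OK_of_nat)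
  have "\<rho> (mpow g (Suc m)) v = finsum V (?c m) {..m} \<oplus>\<^bsub>V\<^esub> diffop g (finsum V (?c m) {..m})"
    using g v c Suc by (simp add: act_mult B_mpow act_eq_diffop)
  also have "diffop g (finsum V (?c m) {..m}) = finsum V (\<lambda>l. of_nat (m choose l) \<cdot> ?E (Suc l)) {..m}"
    using g c E by (simp add: diffop_finsum diffop_osm OK_of_nat)
  also have "finsum V (?c m) {..m} = finsum V (?c m) {..Suc m}"
  proof -
    have "?c m (Suc m) = \<zero>\<^bsub>V\<^esub>" using osm(5)[OF E] by (simp add: binomial_eq_0 del: funpow.simps)
    then show ?thesis using c by (subst V.finsum_Suc) (auto simp del: funpow.simps)
  qed
  also have "\<dots> = finsum V (\<lambda>l. of_nat (m choose Suc l) \<cdot> ?E (Suc l)) {..m} \<oplus>\<^bsub>V\<^esub> ?c m 0"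
    using c by (subst V.finsum_Suc2) auto
  also have "\<dots> \<oplus>\<^bsub>V\<^esub> finsum V (\<lambda>l. of_nat (m choose l) \<cdot> ?E (Suc l)) {..m}
      = finsum V (\<lambda>l. of_nat (m choose Suc l) \<cdot> ?E (Suc l) \<oplus>\<^bsub>V\<^esub> of_nat (m choose l) \<cdot> ?E (Suc l)) {..m} \<oplus>\<^bsub>V\<^esub> ?c m 0"
  proof -
    have fc: "(\<lambda>l. of_nat (k l) \<cdot> ?E (Suc l)) \<in> {..m} \<rightarrow> carrier V" for k using c by blast
    have sw: "x \<oplus>\<^bsub>V\<^esub> y \<oplus>\<^bsub>V\<^esub> z = x \<oplus>\<^bsub>V\<^esub> z \<oplus>\<^bsub>V\<^esub> y"
      if "x \<in> carrier V" "y \<in> carrier V" "z \<in> carrier V" for x y z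
      using that by (simp add: V.add.m_ac)
    show ?thesis
      unfolding V.finsum_addf[OF fc fc] by (rule sw[OF V.finsum_closed[OF fc] c V.finsum_closed[OF fc]])
  qed
  also have "\<dots> = finsum V (\<lambda>l. ?c (Suc m) (Suc l)) {..m} \<oplus>\<^bsub>V\<^esub> ?c (Suc m) 0"
    using c E osm(1)[OF E OK_of_nat OK_of_nat, symmetric] by (simp add: add.commute del: funpow.simps)
  also have "\<dots> = finsum V (?c (Suc m)) {..Suc m}"
    using c by (subst V.finsum_Suc2) auto
  finally show ?case .
qed

text \<open>
  The Frobenius identity \<open>g\<^sup>p - 1 = (g - 1)\<^sup>p\<close> in characteristic
  \<open>p\<close>: the inner binomial coefficients are divisible by \<open>p\<close>.
\<close>

lemma diffop_p:
  assumes g: "g \<in> B" and v: "v \<in> carrier V" and pv: "of_nat p \<cdot> v = \<zero>\<^bsub>V\<^esub>"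
  shows "diffop (mpow g p) v = (diffop g ^^ p) v"
proof -
  let ?E = "\<lambda>l. (diffop g ^^ l) v"
  have E: "?E l \<in> carrier V" for l using g v by simp
  have c: "of_nat k \<cdot> ?E l \<in> carrier V" for k l using E by (simp add: osm OK_of_nat)
  have pE: "of_nat p \<cdot> ?E l = \<zero>\<^bsub>V\<^esub>" for l
    using g v pv by (simp add: diffop_pow_osm[symmetric] OK_of_nat)
  obtain q where q: "p = Suc (Suc q)" using p_gt_1 by (metis Suc_lessE less_natE One_nat_def)
  have mid: "of_nat (p choose Suc l) \<cdot> ?E (Suc l) = \<zero>\<^bsub>V\<^esub>" if "l \<in> {..q}" for l
  proof -
    have "p dvd (p choose Suc l)" using that q by (intro dvd_choose_prime[OF _ _ _ prime_p]) auto
    then obtain r where "p choose Suc l = r * p" by (metis dvdE mult.commute)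
    then show ?thesis using pE[of "Suc l"] E[of "Suc l"]
      by (simp add: osm(2)[OF E OK_of_nat OK_of_nat] osm(9) OK_of_nat del: funpow.simps)
  qed
  have "\<rho> (mpow g p) v = finsum V (\<lambda>l. of_nat (p choose l) \<cdot> ?E l) {..Suc (Suc q)}"
    using act_mpow_binomial[OF g v, of p] q by simp
  also have "\<dots> = of_nat (p choose p) \<cdot> ?E p \<oplus>\<^bsub>V\<^esub>
      (finsum V (\<lambda>l. of_nat (p choose Suc l) \<cdot> ?E (Suc l)) {..q} \<oplus>\<^bsub>V\<^esub> of_nat (p choose 0) \<cdot> ?E 0)"
    using c by (subst V.finsum_Suc, simp, subst V.finsum_Suc2) (auto simp: q)
  also have "finsum V (\<lambda>l. of_nat (p choose Suc l) \<cdot> ?E (Suc l)) {..q} = \<zero>\<^bsub>V\<^esub>"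
    by (rule V.add.finprod_one_eqI) (rule mid)
  finally have "\<rho> (mpow g p) v = ?E p \<oplus>\<^bsub>V\<^esub> v" using v E by (simp add: osm)
  then show ?thesis
    using v E by (simp add: diffop_def[of "mpow g p"] V.minus_eq V.add.m_assoc V.r_neg)
qed

lemma diffop_p_power:
  assumes g: "g \<in> B"
  shows "v \<in> carrier V \<Longrightarrow> of_nat p \<cdot> v = \<zero>\<^bsub>V\<^esub> \<Longrightarrow> diffop (mpow g (p ^ k)) v = (diffop g ^^ (p ^ k)) v"
proof (induction k arbitrary: v)
  case (Suc k)
  let ?g = "mpow g (p ^ k)"
  have iter: "(diffop ?g ^^ j) w = (diffop g ^^ (p ^ k * j)) w"
    if "w \<in> carrier V" "of_nat p \<cdot> w = \<zero>\<^bsub>V\<^esub>" for j w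
    using that
  proof (induction j arbitrary: w)
    case (Suc j)
    let ?w = "(diffop g ^^ (p ^ k)) w"
    have "(diffop ?g ^^ Suc j) w = (diffop ?g ^^ j) ?w"
      using Suc.prems \<open>\<And>v. v \<in> carrier V \<Longrightarrow> of_nat p \<cdot> v = \<zero>\<^bsub>V\<^esub> \<Longrightarrow> diffop ?g v = (diffop g ^^ (p ^ k)) v\<close>
      by (simp add: funpow_swap1)
    also have "\<dots> = (diffop g ^^ (p ^ k * j)) ?w"
      using Suc.prems g by (intro Suc.IH) (auto simp: diffop_pow_osm[symmetric] OK_of_nat)
    also have "\<dots> = (diffop g ^^ (p ^ k * Suc j)) w"
      by (simp add: funpow_add[symmetric, THEN fun_cong, unfolded o_apply] add.commute)
    finally show ?case .
  qed simp
  have "diffop (mpow ?g p) v = (diffop ?g ^^ p) v"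
    using Suc.prems g by (intro diffop_p B_mpow) auto
  then show ?case using iter[OF Suc.prems, of p] by (simp add: mpow_mult[symmetric] mult.commute)
qed simp

lemma diffop_commute_act:
  "g \<in> B \<Longrightarrow> b \<in> B \<Longrightarrow> g ** b = b ** g \<Longrightarrow> v \<in> carrier V \<Longrightarrow> diffop g (\<rho> b v) = \<rho> b (diffop g v)"
  by (simp add: diffop_def V.minus_eq act_add act_minus act_mult[symmetric])

text \<open>
  As \<open>p\<close> is nilpotent on \<open>V\<close> and some \<open>g\<^bsup>p^m\<^esup>\<close>
  fixes \<open>v\<close> by smoothness, induction on \<open>j\<close> applies to the vectors that
  are fixed by \<open>g\<^bsup>p^m\<^esup>\<close> and killed by \<open>p\<^sup>j\<close>: the
  operator \<open>(g - 1)\<^bsup>p^m\<^esup>\<close> lowers \<open>j\<close> by one, since it agrees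
  with \<open>g\<^bsup>p^m\<^esup> - 1 = 0\<close> on multiples that are killed by \<open>p\<close>.
\<close>

lemma diffop_nilpotent:
  assumes g: "g \<in> NQ" and v: "v \<in> carrier V"
  shows "\<exists>n. (diffop g ^^ n) v = \<zero>\<^bsub>V\<^esub>"
proof -
  have gB: "g \<in> B" using g by (rule NQ_in_B)
  obtain k where k: "\<And>b. b \<in> B \<Longrightarrow> b - mat 1 \<in> mball (1 / real p ^ k) \<Longrightarrow> \<rho> b v = v"
    using stabilizer_near_1[OF v] by blast
  obtain d where d: "mpow (g - mat 1) d = 0" using NQ_unipotent[OF g] by blast
  obtain m where "mpow g (p ^ m) - mat 1 \<in> mball (1 / real p ^ k)"
    using unipotent_power_tends_to_1[OF d, of k] by blast
  then have fixed: "\<rho> (mpow g (p ^ m)) v = v" using k B_mpow[OF gB] by blast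
  define Q where "Q = p ^ m"
  have "(diffop g ^^ (Q * j)) w = \<zero>\<^bsub>V\<^esub>"
    if "w \<in> carrier V" "of_nat p ^ j \<cdot> w = \<zero>\<^bsub>V\<^esub>" "\<rho> (mpow g Q) w = w" for j w
    using that
  proof (induction j arbitrary: w)
    case 0 then show ?case by (simp add: osm)
  next
    case (Suc j)
    let ?w = "(diffop g ^^ Q) w"
    have pO: "of_nat p ^ j \<in> OK" "of_nat p \<in> OK" by (simp_all add: OK_power OK_of_nat)
    have u: "of_nat p ^ j \<cdot> w \<in> carrier V" using Suc.prems pO by (simp add: osm)
    have "of_nat p \<cdot> (of_nat p ^ j \<cdot> w) = \<zero>\<^bsub>V\<^esub>"
      using Suc.prems pO by (simp add: osm(2)[symmetric])
    from diffop_p_power[OF gB u this, of m]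
    have "(diffop g ^^ Q) (of_nat p ^ j \<cdot> w) = of_nat p ^ j \<cdot> diffop (mpow g Q) w"
      using Suc.prems pO gB by (simp add: Q_def diffop_osm B_mpow)
    also have "diffop (mpow g Q) w = \<zero>\<^bsub>V\<^esub>"
      using Suc.prems gB by (simp add: diffop_eq_zero_iff B_mpow)
    finally have 1: "of_nat p ^ j \<cdot> ?w = \<zero>\<^bsub>V\<^esub>"
      using Suc.prems pO gB by (simp add: diffop_pow_osm osm(9))
    have comm: "(diffop g ^^ n) (\<rho> (mpow g Q) w) = \<rho> (mpow g Q) ((diffop g ^^ n) w)" for n
      using Suc.prems(1) gB
      by (induction n) (auto simp: diffop_commute_act B_mpow mpow_commute)
    have 2: "\<rho> (mpow g Q) ?w = ?w" using comm[of Q] Suc.prems(3) by simp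
    have "(diffop g ^^ (Q * j)) ?w = \<zero>\<^bsub>V\<^esub>"
      using Suc.prems gB 1 2 by (intro Suc.IH) auto
    then show ?case by (simp add: funpow_add add.commute[of Q])
  qed
  from this[OF v, of h] fixed show ?thesis unfolding Q_def using v by (auto simp: osm(7))
qed

lemma X_nilpotent: "v \<in> carrier V \<Longrightarrow> \<exists>n. (act_X V \<rho> ^^ n) v = \<zero>\<^bsub>V\<^esub>"
  unfolding act_X_eq by (rule diffop_nilpotent[OF N0_in_NQ[OF gam(1)]])

lemma X_pow_zero_mono:
  "v \<in> carrier V \<Longrightarrow> (act_X V \<rho> ^^ n) v = \<zero>\<^bsub>V\<^esub> \<Longrightarrow> n \<le> m \<Longrightarrow> (act_X V \<rho> ^^ m) v = \<zero>\<^bsub>V\<^esub>"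
  unfolding act_X_eq using funpow_add[of "m - n" n "diffop gam"] gam_in_B by simp

lemma act_series_eq:
  assumes v: "v \<in> carrier V" and a: "a \<in> carrier AX" and n: "(act_X V \<rho> ^^ n) v = \<zero>\<^bsub>V\<^esub>"
  shows "act_series V \<rho> a v = finsum V (\<lambda>i. a i \<odot>\<^bsub>V\<^esub> (act_X V \<rho> ^^ i) v) {..<n}"
  unfolding act_series_def
proof (rule V.add.finprod_mono_neutral_cong_left)
  have "(act_X V \<rho> ^^ i) v = \<zero>\<^bsub>V\<^esub>" if "n \<le> i" for i using X_pow_zero_mono[OF v n that] .
  then show "{i. (act_X V \<rho> ^^ i) v \<noteq> \<zero>\<^bsub>V\<^esub>} \<subseteq> {..<n}" using not_le by blast
  have ai: "a i \<in> carrier A" for i using a by (auto simp: AX_def power_series_ring_def)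
  then show "(\<lambda>i. a i \<odot>\<^bsub>V\<^esub> (act_X V \<rho> ^^ i) v) \<in> {..<n} \<rightarrow> carrier V"
    using v gam_in_B by (simp add: act_X_eq)
  show "a i \<odot>\<^bsub>V\<^esub> (act_X V \<rho> ^^ i) v = \<zero>\<^bsub>V\<^esub>" if "i \<in> {..<n} - {i. (act_X V \<rho> ^^ i) v \<noteq> \<zero>\<^bsub>V\<^esub>}" for i
    using that ai by simp
qed auto

lemma AX_coeff: "a \<in> carrier AX \<Longrightarrow> a i \<in> carrier A"
  by (auto simp: AX_def power_series_ring_def)

lemma const_o_AX: "c \<in> OK \<Longrightarrow> const_o c \<in> carrier AX"
  using A_cring cring.cring_simprules(2) by (auto simp: const_o_def' AX_def power_series_ring_def cls_closed)

lemma var_X_AX: "var_X \<in> carrier AX"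
  using A_cring cring.cring_simprules(2,6) by (auto simp: var_X_def AX_def power_series_ring_def)

lemma act_series_single:
  assumes v: "v \<in> carrier V" and a: "a \<in> carrier AX" and single: "\<And>i. i \<noteq> j \<Longrightarrow> a i = \<zero>\<^bsub>A\<^esub>"
  shows "act_series V \<rho> a v = a j \<odot>\<^bsub>V\<^esub> (act_X V \<rho> ^^ j) v"
proof -
  obtain n where n: "(act_X V \<rho> ^^ n) v = \<zero>\<^bsub>V\<^esub>" using X_nilpotent[OF v] by blast
  let ?f = "\<lambda>i. a i \<odot>\<^bsub>V\<^esub> (act_X V \<rho> ^^ i) v"
  have cl: "?f i \<in> carrier V" for i using v a AX_coeff gam_in_B by (simp add: act_X_eq)
  have "(act_X V \<rho> ^^ max n (Suc j)) v = \<zero>\<^bsub>V\<^esub>" by (rule X_pow_zero_mono[OF v n]) simp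
  then have "act_series V \<rho> a v = finsum V ?f {..<max n (Suc j)}" by (rule act_series_eq[OF v a])
  also have "\<dots> = finsum V (\<lambda>i. if j = i then ?f i else \<zero>\<^bsub>V\<^esub>) {..<max n (Suc j)}"
    using single v gam_in_B cl by (intro V.finsum_cong') (auto simp: act_X_eq)
  also have "\<dots> = ?f j" using cl by (intro V.finsum_singleton) auto
  finally show ?thesis .
qed

lemma act_series_const: "c \<in> OK \<Longrightarrow> v \<in> carrier V \<Longrightarrow> act_series V \<rho> (const_o c) v = c \<cdot> v"
  using act_series_single[of v "const_o c" 0] const_o_AX by (simp add: const_o_def')

lemma act_series_var: "v \<in> carrier V \<Longrightarrow> act_series V \<rho> var_X v = act_X V \<rho> v"
  using act_series_single[of v var_X 1] var_X_AX gam_in_B by (simp add: var_X_def act_X_eq)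

lemma act_series_add:
  assumes a: "a \<in> carrier AX" and v: "v \<in> carrier V" and w: "w \<in> carrier V"
  shows "act_series V \<rho> a (v \<oplus>\<^bsub>V\<^esub> w) = act_series V \<rho> a v \<oplus>\<^bsub>V\<^esub> act_series V \<rho> a w"
proof -
  obtain n m where nm: "(act_X V \<rho> ^^ n) v = \<zero>\<^bsub>V\<^esub>" "(act_X V \<rho> ^^ m) w = \<zero>\<^bsub>V\<^esub>"
    using X_nilpotent v w by blast
  let ?N = "max n m"
  have z: "(act_X V \<rho> ^^ ?N) v = \<zero>\<^bsub>V\<^esub>" "(act_X V \<rho> ^^ ?N) w = \<zero>\<^bsub>V\<^esub>"
    using X_pow_zero_mono[OF v nm(1)] X_pow_zero_mono[OF w nm(2)] by simp_all
  then have zz: "(act_X V \<rho> ^^ ?N) (v \<oplus>\<^bsub>V\<^esub> w) = \<zero>\<^bsub>V\<^esub>"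
    using v w gam_in_B by (simp add: act_X_eq diffop_pow_add)
  have vw: "v \<oplus>\<^bsub>V\<^esub> w \<in> carrier V" using v w by simp
  have cl: "a i \<odot>\<^bsub>V\<^esub> (diffop gam ^^ i) x \<in> carrier V" if "x \<in> carrier V" for i x
    using that AX_coeff[OF a] gam_in_B by simp
  show ?thesis
    unfolding act_series_eq[OF v a z(1)] act_series_eq[OF w a z(2)] act_series_eq[OF vw a zz]
    using v w gam_in_B cl AX_coeff[OF a]
    by (subst V.finsum_addf[symmetric]) (auto simp: act_X_eq diffop_pow_add V.smult_r_distr)
qed

lemma act_series_osm:
  assumes a: "a \<in> carrier AX" and v: "v \<in> carrier V" and c: "c \<in> OK"
  shows "act_series V \<rho> a (c \<cdot> v) = c \<cdot> act_series V \<rho> a v"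
proof -
  obtain n where n: "(act_X V \<rho> ^^ n) v = \<zero>\<^bsub>V\<^esub>" using X_nilpotent[OF v] by blast
  have n': "(act_X V \<rho> ^^ n) (c \<cdot> v) = \<zero>\<^bsub>V\<^esub>"
    using n v c gam_in_B by (simp add: act_X_eq diffop_pow_osm osm(9))
  have cv: "c \<cdot> v \<in> carrier V" using c v by (simp add: osm)
  have cl: "a i \<odot>\<^bsub>V\<^esub> (diffop gam ^^ i) v \<in> carrier V" for i
    using v AX_coeff[OF a] gam_in_B by simp
  have sw: "a i \<odot>\<^bsub>V\<^esub> (diffop gam ^^ i) (c \<cdot> v) = c \<cdot> (a i \<odot>\<^bsub>V\<^esub> (diffop gam ^^ i) v)" for i
  proof -
    obtain b where b: "b \<in> OK" "a i = cls b" using A_elem[OF AX_coeff[OF a, of i]] by blast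
    show ?thesis using v c b gam_in_B by (simp add: diffop_pow_osm osm_commute)
  qed
  show ?thesis
    unfolding act_series_eq[OF v a n] act_series_eq[OF cv a n']
    using cl c cls_closed by (subst V.finsum_smult_ldistr) (auto simp: act_X_eq sw)
qed

end

section \<open>The functor on \<open>H\<^sub>0\<close>-invariants\<close>

context borel_rep
begin

definition inv_H0 :: "'v set" where
  "inv_H0 = {v \<in> carrier V. \<forall>x\<in>H0. \<rho> x v = v}"

lemma inv_H0_closed: "v \<in> inv_H0 \<Longrightarrow> v \<in> carrier V" by (simp add: inv_H0_def)

lemma H0_in_B: "x \<in> H0 \<Longrightarrow> x \<in> B" using H0_subset N0_in_B by blast

text \<open>
  On the invariants, \<open>N\<^sub>0\<close> acts through \<open>N\<^sub>0/H\<^sub>0\<close>, which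
  is commutative.
\<close>

lemma act_eq_of_ell:
  assumes "v \<in> inv_H0" "x \<in> N0" "y \<in> N0" "ell x = ell y"
  shows "\<rho> x v = \<rho> y v"
proof -
  have h: "matrix_inv y ** x \<in> H0" using assms N0_closed by (simp add: H0_def ell_mult ell_inv)
  have "x = y ** (matrix_inv y ** x)" using N0_closed(1)[OF assms(3)] by (simp add: matrix_mul_assoc matrix_inv)
  then have "\<rho> x v = \<rho> y (\<rho> (matrix_inv y ** x) v)"
    using assms h H0_in_B N0_in_B by (metis act_mult inv_H0_closed)
  then show ?thesis using assms h by (simp add: inv_H0_def)
qed

lemma act_N0_inv_H0: "v \<in> inv_H0 \<Longrightarrow> x \<in> N0 \<Longrightarrow> \<rho> x v \<in> inv_H0"
proof -
  assume v: "v \<in> inv_H0" and x: "x \<in> N0"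
  have "\<rho> y (\<rho> x v) = \<rho> x v" if "y \<in> H0" for y
  proof -
    have "\<rho> y (\<rho> x v) = \<rho> (y ** x) v"
      using v x that by (simp add: act_mult H0_in_B N0_in_B inv_H0_closed)
    also have "\<dots> = \<rho> x v"
      by (rule act_eq_of_ell[OF v]) (use that x N0_closed(3) in \<open>auto simp: H0_def ell_mult\<close>)
    finally show ?thesis .
  qed
  then show ?thesis using v x by (simp add: inv_H0_def N0_in_B)
qed

lemma act_N0_commute: "v \<in> inv_H0 \<Longrightarrow> x \<in> N0 \<Longrightarrow> y \<in> N0 \<Longrightarrow> \<rho> x (\<rho> y v) = \<rho> y (\<rho> x v)"
  using act_eq_of_ell[of v "x ** y" "y ** x"] N0_closed
  by (simp add: act_mult[symmetric] N0_in_B inv_H0_closed ell_mult add.commute)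

lemma inv_H0_zero [simp]: "\<zero>\<^bsub>V\<^esub> \<in> inv_H0" by (simp add: inv_H0_def H0_in_B)
lemma inv_H0_add: "v \<in> inv_H0 \<Longrightarrow> w \<in> inv_H0 \<Longrightarrow> v \<oplus>\<^bsub>V\<^esub> w \<in> inv_H0"
  by (simp add: inv_H0_def act_add H0_in_B)
lemma inv_H0_minus: "v \<in> inv_H0 \<Longrightarrow> \<ominus>\<^bsub>V\<^esub> v \<in> inv_H0"
  by (simp add: inv_H0_def act_minus H0_in_B)
lemma inv_H0_osm: "v \<in> inv_H0 \<Longrightarrow> c \<in> OK \<Longrightarrow> c \<cdot> v \<in> inv_H0"
  by (simp add: inv_H0_def act_osm H0_in_B osm)

abbreviation xop :: "'v \<Rightarrow> 'v" where "xop \<equiv> act_X V \<rho>"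

lemma xop_closed [simp]: "v \<in> carrier V \<Longrightarrow> (xop ^^ n) v \<in> carrier V"
  using gam_in_B by (simp add: act_X_eq)
lemma xop_zero [simp]: "(xop ^^ n) \<zero>\<^bsub>V\<^esub> = \<zero>\<^bsub>V\<^esub>"
  using gam_in_B by (simp add: act_X_eq)
lemma xop_add: "v \<in> carrier V \<Longrightarrow> w \<in> carrier V \<Longrightarrow> (xop ^^ n) (v \<oplus>\<^bsub>V\<^esub> w) = (xop ^^ n) v \<oplus>\<^bsub>V\<^esub> (xop ^^ n) w"
  using gam_in_B by (simp add: act_X_eq diffop_pow_add)
lemma xop_osm: "v \<in> carrier V \<Longrightarrow> c \<in> OK \<Longrightarrow> (xop ^^ n) (c \<cdot> v) = c \<cdot> (xop ^^ n) v"
  using gam_in_B by (simp add: act_X_eq diffop_pow_osm)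
lemma xop_eq: "xop v = \<rho> gam v \<oplus>\<^bsub>V\<^esub> (\<ominus>\<^bsub>V\<^esub> v)"
  by (simp add: act_X_eq diffop_def V.minus_eq)

lemma xop_pow_act:
  assumes "v \<in> inv_H0" "x \<in> N0"
  shows "(xop ^^ n) (\<rho> x v) = \<rho> x ((xop ^^ n) v) \<and> (xop ^^ n) v \<in> inv_H0"
proof (induction n)
  case (Suc n)
  let ?w = "(xop ^^ n) v"
  have w: "?w \<in> inv_H0" "?w \<in> carrier V" using Suc inv_H0_closed by auto
  have "xop (\<rho> x ?w) = \<rho> x (xop ?w)"
    using w assms(2) gam(1) act_N0_commute[OF w(1) gam(1) assms(2)]
    by (simp add: xop_eq act_add act_minus N0_in_B)
  moreover have "xop ?w \<in> inv_H0"
    unfolding xop_eq[of "(xop ^^ n) v"] using w by (intro inv_H0_add act_N0_inv_H0 inv_H0_minus gam(1))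
  ultimately show ?case using Suc by simp
qed (use assms in simp)

subsection \<open>Submodules\<close>

lemma invariants_simps [simp]:
  "carrier (invariants V \<rho>) = inv_H0" "\<zero>\<^bsub>invariants V \<rho>\<^esub> = \<zero>\<^bsub>V\<^esub>"
  "x \<oplus>\<^bsub>invariants V \<rho>\<^esub> y = x \<oplus>\<^bsub>V\<^esub> y" "a \<odot>\<^bsub>invariants V \<rho>\<^esub> x = act_series V \<rho> a x"
  by (simp_all add: invariants_def inv_H0_def)

lemma invariants_m_inv:
  assumes "v \<in> inv_H0" shows "m_inv (add_monoid (invariants V \<rho>)) v = \<ominus>\<^bsub>V\<^esub> v"
  unfolding m_inv_def
proof (rule the_equality)
  show "\<ominus>\<^bsub>V\<^esub> v \<in> carrier (add_monoid (invariants V \<rho>)) \<and>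
    v \<otimes>\<^bsub>add_monoid (invariants V \<rho>)\<^esub> \<ominus>\<^bsub>V\<^esub> v = \<one>\<^bsub>add_monoid (invariants V \<rho>)\<^esub> \<and>
    \<ominus>\<^bsub>V\<^esub> v \<otimes>\<^bsub>add_monoid (invariants V \<rho>)\<^esub> v = \<one>\<^bsub>add_monoid (invariants V \<rho>)\<^esub>"
    using assms inv_H0_closed[OF assms] by (simp add: inv_H0_minus V.r_neg V.l_neg)
  fix y assume "y \<in> carrier (add_monoid (invariants V \<rho>)) \<and>
    v \<otimes>\<^bsub>add_monoid (invariants V \<rho>)\<^esub> y = \<one>\<^bsub>add_monoid (invariants V \<rho>)\<^esub> \<and>
    y \<otimes>\<^bsub>add_monoid (invariants V \<rho>)\<^esub> v = \<one>\<^bsub>add_monoid (invariants V \<rho>)\<^esub>"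
  then have "y \<in> inv_H0" "y \<oplus>\<^bsub>V\<^esub> v = \<zero>\<^bsub>V\<^esub>" by simp_all
  then show "y = \<ominus>\<^bsub>V\<^esub> v"
    using V.minus_equality[of y v] inv_H0_closed[OF assms] inv_H0_closed[of y] by simp
qed

lemma AXF_submodule_iff:
  "AXF_submodule V \<rho> M \<longleftrightarrow> M \<subseteq> inv_H0 \<and> \<zero>\<^bsub>V\<^esub> \<in> M \<and> (\<forall>v\<in>M. \<forall>w\<in>M. v \<oplus>\<^bsub>V\<^esub> w \<in> M) \<and>
     (\<forall>v\<in>M. \<ominus>\<^bsub>V\<^esub> v \<in> M) \<and> (\<forall>a\<in>carrier AX. \<forall>v\<in>M. act_series V \<rho> a v \<in> M) \<and>
     (\<forall>m\<in>M. F_op V \<rho> m \<in> M)"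
proof -
  have "subgroup M (add_monoid (invariants V \<rho>)) \<longleftrightarrow>
      M \<subseteq> inv_H0 \<and> \<zero>\<^bsub>V\<^esub> \<in> M \<and> (\<forall>v\<in>M. \<forall>w\<in>M. v \<oplus>\<^bsub>V\<^esub> w \<in> M) \<and> (\<forall>v\<in>M. \<ominus>\<^bsub>V\<^esub> v \<in> M)"
    (is "?L \<longleftrightarrow> ?R")
  proof -
    have S: "?L \<longleftrightarrow> M \<subseteq> inv_H0 \<and> (\<forall>x\<in>M. \<forall>y\<in>M. x \<oplus>\<^bsub>V\<^esub> y \<in> M) \<and> \<zero>\<^bsub>V\<^esub> \<in> M \<and>
        (\<forall>x\<in>M. m_inv (add_monoid (invariants V \<rho>)) x \<in> M)"
      unfolding subgroup_def by simp blast
    have "(\<forall>v\<in>M. m_inv (add_monoid (invariants V \<rho>)) v \<in> M) \<longleftrightarrow> (\<forall>v\<in>M. \<ominus>\<^bsub>V\<^esub> v \<in> M)" if "M \<subseteq> inv_H0"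
    proof (rule ball_cong[OF refl])
      fix v assume "v \<in> M"
      then have "m_inv (add_monoid (invariants V \<rho>)) v = \<ominus>\<^bsub>V\<^esub> v" using that invariants_m_inv by blast
      then show "m_inv (add_monoid (invariants V \<rho>)) v \<in> M \<longleftrightarrow> \<ominus>\<^bsub>V\<^esub> v \<in> M" by simp
    qed
    then show ?thesis unfolding S by blast
  qed
  then show ?thesis
    unfolding AXF_submodule_def submodule_def submodule_axioms_def invariants_simps by blast
qed

text \<open>
  As \<open>X\<close> is locally nilpotent, closure under power series follows from closure under
  scalars and \<open>X\<close>.
\<close>

lemma AXF_submoduleI:
  assumes sub: "M \<subseteq> inv_H0" and zero: "\<zero>\<^bsub>V\<^esub> \<in> M"
    and add: "\<And>v w. v \<in> M \<Longrightarrow> w \<in> M \<Longrightarrow> v \<oplus>\<^bsub>V\<^esub> w \<in> M"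
    and osm: "\<And>c v. c \<in> OK \<Longrightarrow> v \<in> M \<Longrightarrow> c \<cdot> v \<in> M"
    and xop: "\<And>v. v \<in> M \<Longrightarrow> xop v \<in> M"
    and F: "\<And>v. v \<in> M \<Longrightarrow> F_op V \<rho> v \<in> M"
  shows "AXF_submodule V \<rho> M"
proof -
  have cl: "v \<in> carrier V" if "v \<in> M" for v using that sub inv_H0_closed by blast
  have minus: "\<ominus>\<^bsub>V\<^esub> v \<in> M" if "v \<in> M" for v
    using osm[OF OK_minus[OF OK_1] that] cls_smult(4,8)[OF V_module cl[OF that]] by simp
  have fs: "finsum V f I \<in> M" if "finite I" "f \<in> I \<rightarrow> M" for f and I :: "nat set"
    using that
  proof (induction I rule: finite_induct)
    case (insert i I)
    then have "f i \<in> M" "f \<in> I \<rightarrow> M" "f \<in> I \<rightarrow> carrier V" using cl by auto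
    then show ?case using insert cl by (simp add: V.finsum_insert add)
  qed (simp add: zero V.finsum_empty)
  have ser: "act_series V \<rho> a v \<in> M" if a: "a \<in> carrier AX" and v: "v \<in> M" for a v
  proof -
    obtain n where n: "(xop ^^ n) v = \<zero>\<^bsub>V\<^esub>" using X_nilpotent[OF cl[OF v]] by blast
    have "(xop ^^ i) v \<in> M" for i by (induction i) (use v xop in auto)
    then have "a i \<odot>\<^bsub>V\<^esub> (xop ^^ i) v \<in> M" for i
      using A_elem[OF AX_coeff[OF a, of i]] osm by auto
    then show ?thesis unfolding act_series_eq[OF cl[OF v] a n] by (intro fs) auto
  qed
  show ?thesis
    unfolding AXF_submodule_iff by (intro conjI ballI sub zero add minus F ser; assumption)
qed

lemma AXF_submoduleD:
  assumes "AXF_submodule V \<rho> M"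
  shows "v \<in> M \<Longrightarrow> v \<in> inv_H0" "v \<in> M \<Longrightarrow> v \<in> carrier V" "\<zero>\<^bsub>V\<^esub> \<in> M"
    "v \<in> M \<Longrightarrow> w \<in> M \<Longrightarrow> v \<oplus>\<^bsub>V\<^esub> w \<in> M" "v \<in> M \<Longrightarrow> \<ominus>\<^bsub>V\<^esub> v \<in> M"
    "c \<in> OK \<Longrightarrow> v \<in> M \<Longrightarrow> c \<cdot> v \<in> M" "v \<in> M \<Longrightarrow> (xop ^^ n) v \<in> M"
    "v \<in> M \<Longrightarrow> F_op V \<rho> v \<in> M" "a \<in> carrier AX \<Longrightarrow> v \<in> M \<Longrightarrow> act_series V \<rho> a v \<in> M"
    "v \<in> M \<Longrightarrow> (F_op V \<rho> ^^ n) v \<in> M" "v \<in> M \<Longrightarrow> \<rho> gam v \<in> M"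
proof -
  note M' = assms[unfolded AXF_submodule_iff]
  note M = M'[THEN conjunct1] M'[THEN conjunct2, THEN conjunct1] M'[THEN conjunct2, THEN conjunct2, THEN conjunct1]
    M'[THEN conjunct2, THEN conjunct2, THEN conjunct2, THEN conjunct1]
    M'[THEN conjunct2, THEN conjunct2, THEN conjunct2, THEN conjunct2, THEN conjunct1]
    M'[THEN conjunct2, THEN conjunct2, THEN conjunct2, THEN conjunct2, THEN conjunct2]
  show 1: "v \<in> inv_H0" if "v \<in> M" for v using M(1) that by (rule subsetD)
  show 2: "v \<in> carrier V" if "v \<in> M" for v using 1[OF that] by (rule inv_H0_closed)
  show "\<zero>\<^bsub>V\<^esub> \<in> M" by (rule M(2))
  show "v \<in> M \<Longrightarrow> \<ominus>\<^bsub>V\<^esub> v \<in> M" using M(4) by (rule bspec)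
  show 3: "v \<oplus>\<^bsub>V\<^esub> w \<in> M" if "v \<in> M" "w \<in> M" for v w using M(3) that by simp
  show 4: "act_series V \<rho> a v \<in> M" if "a \<in> carrier AX" "v \<in> M" for a v using M(5) that by simp
  show "c \<cdot> v \<in> M" if "c \<in> OK" "v \<in> M"
    using 4[OF const_o_AX that(2)] act_series_const that 2 by metis
  have 5: "xop v \<in> M" if "v \<in> M" for v using 4[OF var_X_AX that] act_series_var 2 that by metis
  show "(xop ^^ n) v \<in> M" if "v \<in> M" by (induction n) (use that 5 in auto)
  show 6: "F_op V \<rho> v \<in> M" if "v \<in> M" for v using M(6) that by simp
  show "(F_op V \<rho> ^^ n) v \<in> M" if "v \<in> M" by (induction n) (use that 6 in auto)
  show "\<rho> gam v \<in> M" if "v \<in> M"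
  proof -
    have "\<rho> gam v = v \<oplus>\<^bsub>V\<^esub> xop v"
      unfolding act_X_eq using 2[OF that] gam_in_B by (rule act_eq_diffop[rotated])
    then show ?thesis using 3[OF that 5[OF that]] by simp
  qed
qed

subsection \<open>The operator \<open>F\<close>\<close>

definition sH0 :: "('q^'n^'n) set" where "sH0 = cj s ` H0"

definition coset :: "'q^'n^'n \<Rightarrow> ('q^'n^'n) set" where "coset x = (\<lambda>y. x ** y) ` sH0"

definition rep :: "('q^'n^'n) set \<Rightarrow> 'q^'n^'n" where "rep C = (SOME x. x \<in> C)"

lemma F_op_eq: "F_op V \<rho> v = finsum V (\<lambda>C. \<rho> (rep C) (\<rho> s v)) (coset ` H0)"
proof -
  have "x <#\<^bsub>mat_group N0\<^esub> {s ** y ** matrix_inv s | y. y \<in> H0} = coset x" for x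
    by (auto simp: l_coset_def coset_def sH0_def cj_def)
  then show ?thesis by (simp add: F_op_def rep_def)
qed

lemma s_inv: "invertible s" using s_in_TQ TQ_closed by blast

lemma sH0_in_H0: "y \<in> sH0 \<Longrightarrow> y \<in> H0" using cj_s_H0 by (auto simp: sH0_def)

lemma sH0_subgroup: "matrix_subgroup sH0"
  unfolding matrix_subgroup_def
proof (intro conjI ballI)
  show "sH0 \<subseteq> GL" using sH0_in_H0 H0_closed(1) by (auto simp: GL_def)
  show "mat 1 \<in> sH0" unfolding sH0_def using H0_closed(2) cj_one[OF s_inv] by (metis imageI)
  show "x ** y \<in> sH0" if "x \<in> sH0" "y \<in> sH0" for x y
    using that H0_closed(3) by (auto simp: sH0_def cj_mult[OF s_inv, symmetric])
  show "matrix_inv x \<in> sH0" if "x \<in> sH0" for x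
    using that H0_closed(1,4) by (auto simp: sH0_def cj_matrix_inv[OF s_inv])
qed
lemmas sH0_closed = matrix_subgroupD[OF sH0_subgroup]

lemma coset_mem: "x \<in> coset x"
  unfolding coset_def using sH0_closed(2) by (metis imageI matrix_mul_rid)

lemma coset_eq: "x' \<in> coset x \<Longrightarrow> coset x' = coset x"
proof -
  assume "x' \<in> coset x"
  then obtain y where y: "y \<in> sH0" "x' = x ** y" by (auto simp: coset_def)
  show ?thesis
  proof (intro equalityI subsetI)
    fix z assume "z \<in> coset x'"
    then obtain w where "w \<in> sH0" "z = x ** (y ** w)" using y by (auto simp: coset_def matrix_mul_assoc)
    then show "z \<in> coset x" unfolding coset_def using sH0_closed(3) y by blast
  next
    fix z assume "z \<in> coset x"
    then obtain w where w: "w \<in> sH0" "z = x ** w" by (auto simp: coset_def)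
    then have "z = x' ** (matrix_inv y ** w)" using y sH0_closed(1) by (simp add: matrix_mul_assoc matrix_inv_cancel)
    then show "z \<in> coset x'" unfolding coset_def using sH0_closed(3,4) y w by blast
  qed
qed

lemma rep_mem: "rep (coset x) \<in> coset x"
  unfolding rep_def using coset_mem by (rule someI)

lemma coset_in_H0: "x \<in> H0 \<Longrightarrow> y \<in> coset x \<Longrightarrow> y \<in> H0"
  using H0_closed(3) sH0_in_H0 by (auto simp: coset_def)

lemma coset_term:
  assumes v: "v \<in> inv_H0" and x: "x \<in> H0" and y: "y \<in> coset x"
  shows "\<rho> y (\<rho> s v) = \<rho> x (\<rho> s v)"
proof -
  obtain z where z: "z \<in> H0" "y = x ** cj s z" using y by (auto simp: coset_def sH0_def)
  have vc: "v \<in> carrier V" using v by (rule inv_H0_closed)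
  have B: "x \<in> B" "cj s z \<in> B" "z \<in> B" using x z(1) cj_s_H0 H0_in_B by blast+
  have "\<rho> y (\<rho> s v) = \<rho> x (\<rho> (cj s z ** s) v)"
    using B vc s_in_B by (simp add: z(2) act_mult)
  also have "cj s z ** s = s ** z" by (rule cj_swap[OF s_inv])
  also have "\<rho> (s ** z) v = \<rho> s v" using B vc s_in_B v z(1) by (simp add: act_mult inv_H0_def)
  finally show ?thesis .
qed

lemma F_terms_closed:
  "v \<in> inv_H0 \<Longrightarrow> (\<lambda>C. \<rho> (rep C) (\<rho> s v)) \<in> coset ` H0 \<rightarrow> carrier V"
  using coset_in_H0[OF _ rep_mem] H0_in_B s_in_B inv_H0_closed by auto

text \<open>
  A permutation of \<open>H\<^sub>0\<close> that maps cosets to cosets permutes the summands of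
  \<open>F\<close>, up to the choice of representatives, which is immaterial by
  \<open>coset_term\<close>.
\<close>

lemma F_reindex:
  assumes v: "v \<in> inv_H0"
    and \<tau>: "\<And>x. x \<in> H0 \<Longrightarrow> \<tau> x \<in> H0" "\<And>x. x \<in> H0 \<Longrightarrow> \<exists>y\<in>H0. x = \<tau> y"
    and inj: "inj_on \<tau> H0"
    and cos: "\<And>x. x \<in> H0 \<Longrightarrow> \<tau> ` coset x = coset (\<tau> x)"
  shows "finsum V (\<lambda>C. \<rho> (\<tau> (rep C)) (\<rho> s v)) (coset ` H0) = F_op V \<rho> v"
proof -
  have img: "image \<tau> ` (coset ` H0) = coset ` H0"
  proof (intro equalityI subsetI)
    fix C assume "C \<in> coset ` H0"
    then obtain x where "x \<in> H0" "C = coset x" by blast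
    moreover then obtain y where "y \<in> H0" "x = \<tau> y" using \<tau>(2) by blast
    ultimately show "C \<in> image \<tau> ` (coset ` H0)" using cos by blast
  qed (use cos \<tau>(1) in auto)
  have sub: "C \<subseteq> H0" if "C \<in> coset ` H0" for C using that coset_in_H0 by blast
  have inj2: "inj_on (image \<tau>) (coset ` H0)"
    using inj_on_image_eq_iff[OF inj] sub by (intro inj_onI) blast
  have "F_op V \<rho> v = finsum V (\<lambda>C. \<rho> (rep C) (\<rho> s v)) (image \<tau> ` (coset ` H0))"
    by (simp add: F_op_eq img)
  also have "\<dots> = finsum V (\<lambda>C. \<rho> (rep (\<tau> ` C)) (\<rho> s v)) (coset ` H0)"
  proof (rule V.finsum_reindex[OF _ inj2])
    show "(\<lambda>C. \<rho> (rep C) (\<rho> s v)) \<in> image \<tau> ` (coset ` H0) \<rightarrow> carrier V"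
      using F_terms_closed[OF v] by (simp only: img)
  qed
  also have "\<dots> = finsum V (\<lambda>C. \<rho> (\<tau> (rep C)) (\<rho> s v)) (coset ` H0)"
  proof (rule V.finsum_cong')
    show "(\<lambda>C. \<rho> (\<tau> (rep C)) (\<rho> s v)) \<in> coset ` H0 \<rightarrow> carrier V"
      using coset_in_H0[OF _ rep_mem] H0_in_B s_in_B inv_H0_closed[OF v] \<tau>(1) by auto
    fix C assume "C \<in> coset ` H0"
    then obtain x where x: "x \<in> H0" "C = coset x" by blast
    have r: "rep C \<in> H0" "rep C \<in> C" using x rep_mem coset_in_H0 by blast+
    have "\<tau> ` C = coset (\<tau> (rep C))" using cos[OF r(1)] coset_eq r(2) x(2) by simp
    then have "rep (\<tau> ` C) \<in> coset (\<tau> (rep C))" using rep_mem by simp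
    then show "\<rho> (rep (\<tau> ` C)) (\<rho> s v) = \<rho> (\<tau> (rep C)) (\<rho> s v)"
      using coset_term[OF v \<tau>(1)[OF r(1)]] by blast
  qed simp
  finally show ?thesis by simp
qed

lemma F_closed: "v \<in> inv_H0 \<Longrightarrow> F_op V \<rho> v \<in> carrier V"
  unfolding F_op_eq by (intro V.finsum_closed F_terms_closed)

text \<open>
  An element of \<open>H\<^sub>0\<close> permutes the cosets by left multiplication.
\<close>

lemma F_inv_H0:
  assumes v: "v \<in> inv_H0" shows "F_op V \<rho> v \<in> inv_H0"
proof -
  have "\<rho> y (F_op V \<rho> v) = F_op V \<rho> v" if y: "y \<in> H0" for y
  proof -
    have yi: "invertible y" using H0_closed(1) y by blast
    have "\<rho> y (F_op V \<rho> v) = finsum V (\<lambda>C. \<rho> y (\<rho> (rep C) (\<rho> s v))) (coset ` H0)"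
      using F_terms_closed[OF v] H0_in_B[OF y] unfolding F_op_eq by (simp add: act_finsum)
    also have "\<dots> = finsum V (\<lambda>C. \<rho> (y ** rep C) (\<rho> s v)) (coset ` H0)"
    proof (rule V.finsum_cong')
      show "(\<lambda>C. \<rho> (y ** rep C) (\<rho> s v)) \<in> coset ` H0 \<rightarrow> carrier V"
        using coset_in_H0[OF _ rep_mem] H0_in_B s_in_B inv_H0_closed[OF v] y H0_closed(3) by auto
      fix C assume "C \<in> coset ` H0"
      then have "rep C \<in> B" using coset_in_H0 rep_mem H0_in_B by blast
      then show "\<rho> y (\<rho> (rep C) (\<rho> s v)) = \<rho> (y ** rep C) (\<rho> s v)"
        using H0_in_B[OF y] s_in_B inv_H0_closed[OF v] by (simp add: act_mult)
    qed simp
    also have "\<dots> = F_op V \<rho> v"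
    proof (rule F_reindex[OF v])
      show "\<exists>z\<in>H0. x = y ** z" if "x \<in> H0" for x
        using that y H0_closed by (intro bexI[of _ "matrix_inv y ** x"]) (auto simp: matrix_mul_assoc matrix_inv yi)
      show "inj_on (\<lambda>x. y ** x) H0"
        by (rule inj_on_inverseI[of _ "\<lambda>x. matrix_inv y ** x"]) (simp add: matrix_mul_assoc matrix_inv yi)
    qed (use y H0_closed in \<open>auto simp: coset_def matrix_mul_assoc image_image\<close>)
    finally show ?thesis .
  qed
  then show ?thesis using F_closed[OF v] by (simp add: inv_H0_def)
qed

text \<open>
  For a representative \<open>r\<close> of a coset, \<open>(sxs\<^sup>-\<^sup>1) r s =
  ((sxs\<^sup>-\<^sup>1) r (sxs\<^sup>-\<^sup>1)\<^sup>-\<^sup>1) s x\<close>; conjugation by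
  \<open>sxs\<^sup>-\<^sup>1\<close> permutes the cosets of
  \<open>sH\<^sub>0s\<^sup>-\<^sup>1\<close> in \<open>H\<^sub>0\<close>.
\<close>

lemma F_act:
  assumes v: "v \<in> inv_H0" and x: "x \<in> N0"
  shows "F_op V \<rho> (\<rho> x v) = \<rho> (cj s x) (F_op V \<rho> v)"
proof -
  let ?y = "cj s x"
  have y: "?y \<in> N0" by (rule cj_s_N0[OF x])
  have yi: "invertible ?y" using N0_closed(1) y by blast
  have xi: "invertible x" using N0_closed(1) x by blast
  have xv: "\<rho> x v \<in> inv_H0" using v x by (rule act_N0_inv_H0)
  have vc: "v \<in> carrier V" using v by (rule inv_H0_closed)
  have ysw: "cj ?y (cj s z) = cj s (cj x z)" for z
    by (simp add: cj_def[of ?y] cj_matrix_inv[OF s_inv xi]) (simp add: cj_mult[OF s_inv, symmetric] cj_def[of x])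
  have "\<rho> ?y (F_op V \<rho> v) = finsum V (\<lambda>C. \<rho> ?y (\<rho> (rep C) (\<rho> s v))) (coset ` H0)"
    using F_terms_closed[OF v] N0_in_B[OF y] unfolding F_op_eq by (simp add: act_finsum)
  also have "\<dots> = finsum V (\<lambda>C. \<rho> (cj ?y (rep C)) (\<rho> s (\<rho> x v))) (coset ` H0)"
  proof (rule V.finsum_cong')
    show "(\<lambda>C. \<rho> (cj ?y (rep C)) (\<rho> s (\<rho> x v))) \<in> coset ` H0 \<rightarrow> carrier V"
      using coset_in_H0[OF _ rep_mem] H0_normal[OF y] H0_in_B s_in_B N0_in_B[OF x] vc by auto
    fix C assume "C \<in> coset ` H0"
    then have r: "rep C \<in> H0" using coset_in_H0 rep_mem by blast
    have "\<rho> (cj ?y (rep C)) (\<rho> s (\<rho> x v)) = \<rho> (cj ?y (rep C) ** (s ** x)) v"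
      using H0_in_B[OF H0_normal[OF y r]] s_in_B N0_in_B[OF x] vc by (simp add: act_mult B_closed)
    also have "cj ?y (rep C) ** (s ** x) = ?y ** (rep C ** s)"
    proof -
      have "s ** x = ?y ** s" by (simp add: cj_swap s_inv)
      then show ?thesis by (simp add: matrix_mul_assoc cj_swap[OF yi])
    qed
    also have "\<rho> \<dots> v = \<rho> ?y (\<rho> (rep C) (\<rho> s v))"
      using H0_in_B[OF r] s_in_B N0_in_B[OF y] vc by (simp add: act_mult B_closed)
    finally show "\<rho> ?y (\<rho> (rep C) (\<rho> s v)) = \<rho> (cj ?y (rep C)) (\<rho> s (\<rho> x v))" by simp
  qed simp
  also have "\<dots> = F_op V \<rho> (\<rho> x v)"
  proof (rule F_reindex[OF xv])
    show "cj ?y z \<in> H0" if "z \<in> H0" for z using H0_normal[OF y that] .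
    show "\<exists>w\<in>H0. z = cj ?y w" if "z \<in> H0" for z
      using H0_normal[OF N0_closed(4)[OF y] that] cj_inv'[OF yi] by metis
    show "inj_on (cj ?y) H0" by (rule inj_on_inverseI[of _ "cj (matrix_inv ?y)"]) (rule cj_inv[OF yi])
    have yS: "cj ?y ` sH0 = sH0"
    proof -
      have "cj x ` H0 = H0"
      proof (intro equalityI subsetI)
        fix z assume "z \<in> H0"
        then have "cj (matrix_inv x) z \<in> H0" by (rule H0_normal[OF N0_closed(4)[OF x]])
        then show "z \<in> cj x ` H0" using cj_inv'[OF xi] by (metis imageI)
      qed (use H0_normal[OF x] in auto)
      then show ?thesis unfolding sH0_def image_image ysw by (simp add: image_image[symmetric, of "cj s" "cj x"])
    qed
    show "cj ?y ` coset z = coset (cj ?y z)" for z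
    proof -
      have "cj ?y ` coset z = (\<lambda>w. cj ?y z ** w) ` (cj ?y ` sH0)"
        by (simp add: coset_def image_image cj_mult[OF yi])
      then show ?thesis by (simp add: yS coset_def)
    qed
  qed
  finally show ?thesis by simp
qed

lemma F_add:
  assumes "v \<in> inv_H0" "w \<in> inv_H0"
  shows "F_op V \<rho> (v \<oplus>\<^bsub>V\<^esub> w) = F_op V \<rho> v \<oplus>\<^bsub>V\<^esub> F_op V \<rho> w"
proof -
  have vw: "v \<in> carrier V" "w \<in> carrier V" using assms inv_H0_closed by auto
  have "F_op V \<rho> (v \<oplus>\<^bsub>V\<^esub> w) = finsum V (\<lambda>C. \<rho> (rep C) (\<rho> s v) \<oplus>\<^bsub>V\<^esub> \<rho> (rep C) (\<rho> s w)) (coset ` H0)"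
    unfolding F_op_eq
  proof (rule V.finsum_cong')
    show "(\<lambda>C. \<rho> (rep C) (\<rho> s v) \<oplus>\<^bsub>V\<^esub> \<rho> (rep C) (\<rho> s w)) \<in> coset ` H0 \<rightarrow> carrier V"
      using F_terms_closed[OF assms(1)] F_terms_closed[OF assms(2)] by blast
    fix C assume "C \<in> coset ` H0"
    then have "rep C \<in> B" using coset_in_H0 rep_mem H0_in_B by blast
    then show "\<rho> (rep C) (\<rho> s (v \<oplus>\<^bsub>V\<^esub> w)) = \<rho> (rep C) (\<rho> s v) \<oplus>\<^bsub>V\<^esub> \<rho> (rep C) (\<rho> s w)"
      using vw s_in_B by (simp add: act_add)
  qed simp
  then show ?thesis
    unfolding F_op_eq using V.finsum_addf[OF F_terms_closed[OF assms(1)] F_terms_closed[OF assms(2)]] by simp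
qed

lemma F_osm:
  assumes v: "v \<in> inv_H0" and c: "c \<in> OK"
  shows "F_op V \<rho> (c \<cdot> v) = c \<cdot> F_op V \<rho> v"
proof (cases "finite (coset ` H0)")
  case True
  have vc: "v \<in> carrier V" using v inv_H0_closed by auto
  have "F_op V \<rho> (c \<cdot> v) = finsum V (\<lambda>C. c \<cdot> \<rho> (rep C) (\<rho> s v)) (coset ` H0)"
    unfolding F_op_eq
  proof (rule V.finsum_cong')
    show "(\<lambda>C. c \<cdot> \<rho> (rep C) (\<rho> s v)) \<in> coset ` H0 \<rightarrow> carrier V"
      using F_terms_closed[OF v] c cls_closed by blast
    fix C assume "C \<in> coset ` H0"
    then have "rep C \<in> B" using coset_in_H0 rep_mem H0_in_B by blast
    then show "\<rho> (rep C) (\<rho> s (c \<cdot> v)) = c \<cdot> \<rho> (rep C) (\<rho> s v)"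
      using vc s_in_B c by (simp add: act_osm)
  qed simp
  then show ?thesis
    unfolding F_op_eq using V.finsum_smult_ldistr[OF True cls_closed[OF c] F_terms_closed[OF v]] by simp
next
  case False
  then show ?thesis unfolding F_op_eq using c by (simp add: V.finsum_infinite osm)
qed

lemma F_zero [simp]: "F_op V \<rho> \<zero>\<^bsub>V\<^esub> = \<zero>\<^bsub>V\<^esub>"
  using F_osm[of "\<zero>\<^bsub>V\<^esub>" 0] F_closed[of "\<zero>\<^bsub>V\<^esub>"] by (simp add: osm)

lemma Fpow_inv_H0: "v \<in> inv_H0 \<Longrightarrow> (F_op V \<rho> ^^ j) v \<in> inv_H0"
  by (induction j) (auto simp: F_inv_H0)

lemma Fpow_zero [simp]: "(F_op V \<rho> ^^ j) \<zero>\<^bsub>V\<^esub> = \<zero>\<^bsub>V\<^esub>"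
  by (induction j) auto

lemma Fpow_add:
  "v \<in> inv_H0 \<Longrightarrow> w \<in> inv_H0 \<Longrightarrow> (F_op V \<rho> ^^ j) (v \<oplus>\<^bsub>V\<^esub> w) = (F_op V \<rho> ^^ j) v \<oplus>\<^bsub>V\<^esub> (F_op V \<rho> ^^ j) w"
  by (induction j) (auto simp: F_add Fpow_inv_H0)

lemma Fpow_osm: "v \<in> inv_H0 \<Longrightarrow> c \<in> OK \<Longrightarrow> (F_op V \<rho> ^^ j) (c \<cdot> v) = c \<cdot> (F_op V \<rho> ^^ j) v"
  by (induction j) (auto simp: F_osm Fpow_inv_H0)

lemma Fpow_act: "v \<in> inv_H0 \<Longrightarrow> x \<in> N0 \<Longrightarrow> \<exists>y\<in>N0. (F_op V \<rho> ^^ j) (\<rho> x v) = \<rho> y ((F_op V \<rho> ^^ j) v)"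
proof (induction j)
  case (Suc j)
  then obtain y where y: "y \<in> N0" "(F_op V \<rho> ^^ j) (\<rho> x v) = \<rho> y ((F_op V \<rho> ^^ j) v)" by blast
  then have "(F_op V \<rho> ^^ Suc j) (\<rho> x v) = \<rho> (cj s y) ((F_op V \<rho> ^^ Suc j) v)"
    using F_act[OF Fpow_inv_H0[OF Suc.prems(1)] y(1)] by simp
  then show ?case using cj_s_N0[OF y(1)] by blast
qed auto

text \<open>
  Once the generators of a module lie in this submodule for some \<open>e\<close>, the
  \<open>e\<close>-th power of \<open>X\<close> kills the module. It is stable under
  \<open>X\<close> because \<open>F x = (sxs\<^sup>-\<^sup>1) F\<close> for \<open>x\<close> in
  \<open>N\<^sub>0\<close>, which commutes with \<open>X\<close> on the invariants.
\<close>

lemma killed_submodule: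
  "AXF_submodule V \<rho> {v \<in> inv_H0. \<forall>j. (xop ^^ e) ((F_op V \<rho> ^^ j) v) = \<zero>\<^bsub>V\<^esub>}" (is "AXF_submodule V \<rho> ?M")
proof (rule AXF_submoduleI)
  note cl = Fpow_inv_H0 inv_H0_closed[OF Fpow_inv_H0]
  show "v \<oplus>\<^bsub>V\<^esub> w \<in> ?M" if "v \<in> ?M" "w \<in> ?M" for v w
    using that by (simp add: Fpow_add xop_add cl inv_H0_add)
  show "c \<cdot> v \<in> ?M" if "c \<in> OK" "v \<in> ?M" for c v
    using that by (simp add: Fpow_osm xop_osm cl inv_H0_osm osm)
  show "F_op V \<rho> v \<in> ?M" if "v \<in> ?M" for v
  proof -
    have "(xop ^^ e) ((F_op V \<rho> ^^ j) (F_op V \<rho> v)) = \<zero>\<^bsub>V\<^esub>" for j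
      using that by (auto simp: funpow_Suc_right[symmetric, THEN fun_cong, unfolded o_apply] simp del: funpow.simps)
    then show ?thesis using that F_inv_H0 by simp
  qed
  show "xop v \<in> ?M" if v: "v \<in> ?M" for v
  proof -
    have vi: "v \<in> inv_H0" using v by simp
    have xi: "xop v \<in> inv_H0" using xop_pow_act[OF vi gam(1), of 1] by simp
    have "(xop ^^ e) ((F_op V \<rho> ^^ j) (xop v)) = \<zero>\<^bsub>V\<^esub>" for j
    proof -
      let ?Fv = "(F_op V \<rho> ^^ j) v"
      obtain y where y: "y \<in> N0" "(F_op V \<rho> ^^ j) (\<rho> gam v) = \<rho> y ?Fv"
        using Fpow_act[OF vi gam(1)] by blast
      have m1: "(-1) \<cdot> w = \<ominus>\<^bsub>V\<^esub> w" if "w \<in> carrier V" for w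
        using that by (simp add: osm(8)[OF _ OK_1] osm(4))
      have "(F_op V \<rho> ^^ j) (\<ominus>\<^bsub>V\<^esub> v) = (-1) \<cdot> ?Fv"
        using Fpow_osm[OF vi OK_minus[OF OK_1]] m1[OF inv_H0_closed[OF vi]] by simp
      then have "(F_op V \<rho> ^^ j) (xop v) = \<rho> y ?Fv \<oplus>\<^bsub>V\<^esub> (-1) \<cdot> ?Fv"
        using y vi by (simp add: xop_eq Fpow_add act_N0_inv_H0 gam(1) inv_H0_minus)
      then have "(xop ^^ e) ((F_op V \<rho> ^^ j) (xop v)) = \<rho> y ((xop ^^ e) ?Fv) \<oplus>\<^bsub>V\<^esub> (-1) \<cdot> (xop ^^ e) ?Fv"
        using xop_pow_act[OF Fpow_inv_H0[OF vi] y(1)] cl[OF vi] y(1) OK_minus[OF OK_1]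
        by (simp add: xop_add xop_osm N0_in_B osm(3))
      then show ?thesis using v y(1) by (simp add: m1 N0_in_B)
    qed
    then show ?thesis using xi by simp
  qed
qed (auto simp: osm)

end

section \<open>Pontryagin duals of submodules\<close>

context coefficients
begin

lemma K_mod_o_scale_mult:
  "c \<in> OK \<Longrightarrow> k \<in> carrier K_mod_o \<Longrightarrow> l \<in> carrier K_mod_o \<Longrightarrow>
    scale_K_mod_o c (k \<otimes>\<^bsub>K_mod_o\<^esub> l) = scale_K_mod_o c k \<otimes>\<^bsub>K_mod_o\<^esub> scale_K_mod_o c l"
  by (auto simp: K_mod_o_carrier scale_kcl K_mod_o_mult distrib_left)
lemma K_mod_o_scale_one: "c \<in> OK \<Longrightarrow> scale_K_mod_o c \<one>\<^bsub>K_mod_o\<^esub> = \<one>\<^bsub>K_mod_o\<^esub>"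
  by (simp add: K_mod_o_one scale_kcl)

text \<open>
  The \<open>\<pi>\<close>-torsion of \<open>K/o\<close> has length one, so that any nonzero element
  generates it.
\<close>

lemma K_mod_o_torsion_multiple:
  assumes k: "k \<in> carrier K_mod_o" "scale_K_mod_o \<pi> k = \<one>\<^bsub>K_mod_o\<^esub>"
    and l: "l \<in> carrier K_mod_o" "scale_K_mod_o \<pi> l = \<one>\<^bsub>K_mod_o\<^esub>" "l \<noteq> \<one>\<^bsub>K_mod_o\<^esub>"
  shows "\<exists>a\<in>OK. k \<otimes>\<^bsub>K_mod_o\<^esub> scale_K_mod_o (- a) l = \<one>\<^bsub>K_mod_o\<^esub>"
proof -
  obtain x y where xy: "k = kcl x" "l = kcl y" using k l by (auto simp: K_mod_o_carrier)
  have px: "\<pi> * x \<in> OK" and py: "\<pi> * y \<in> OK" and y: "y \<notin> OK"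
    using k l uniformizer_in by (simp_all add: xy scale_kcl K_mod_o_one kcl_eq_iff)
  have "\<pi> * y \<notin> unif_ideal"
    using y uniformizer_nonzero by (auto simp: unif_ideal_def mult.commute)
  then obtain b c where bc: "b \<in> OK" "c \<in> OK" "(\<pi> * y) * b + c * \<pi> = 1"
    using unit_mod_uniformizer[OF py] by blast
  define a where "a = (\<pi> * x) * b"
  have a: "a \<in> OK" unfolding a_def by (intro OK_mult px bc)
  have "x - a * y = x * (1 - (\<pi> * y) * b)" by (simp add: a_def algebra_simps)
  also have "1 - (\<pi> * y) * b = c * \<pi>" using bc(3) by (simp add: algebra_simps)
  also have "x * (c * \<pi>) = c * (\<pi> * x)" by (simp add: mult_ac)
  finally have "x - a * y \<in> OK" using bc(2) px by (simp add: OK_mult)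
  then have "k \<otimes>\<^bsub>K_mod_o\<^esub> scale_K_mod_o (- a) l = \<one>\<^bsub>K_mod_o\<^esub>"
    using a OK_minus by (simp add: xy scale_kcl K_mod_o_mult K_mod_o_one kcl_eq_iff)
  then show ?thesis using a by blast
qed

text \<open>
  Cross-multiplication: the equations of two fractions hold after multiplication by a common power
  of \<open>X\<close>.
\<close>

lemma fraction_eqI:
  assumes "(g, k) \<in> fraction P f n" "f \<in> carrier P"
  shows "fraction P g k = fraction P f n"
proof -
  have X: "X_pow P (a + b) x = X_pow P a (X_pow P b x)" for a b x
    by (simp add: X_pow_def funpow_add)
  obtain j where g: "g \<in> carrier P" and j: "X_pow P (j + k) f = X_pow P (j + n) g"
    using assms(1) by (auto simp: fraction_def)
  have *: "(\<exists>i. X_pow P (i + l) f1 = X_pow P (i + n1) e)"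
    if 1: "X_pow P (i + l) g1 = X_pow P (i + k1) e" and 2: "X_pow P (j + k1) f1 = X_pow P (j + n1) g1"
    for i j l e f1 g1 k1 n1
  proof
    have "X_pow P ((i + j + k1) + l) f1 = X_pow P (i + l) (X_pow P (j + k1) f1)"
      by (simp add: X[symmetric] add_ac)
    also have "\<dots> = X_pow P (j + n1) (X_pow P (i + l) g1)" by (simp add: 2 X[symmetric] add_ac)
    also have "\<dots> = X_pow P ((i + j + k1) + n1) e" by (simp add: 1 X[symmetric] add_ac)
    finally show "X_pow P ((i + j + k1) + l) f1 = X_pow P ((i + j + k1) + n1) e" .
  qed
  show ?thesis
  proof (intro equalityI subsetI)
    fix z assume "z \<in> fraction P g k"
    then obtain e l i where "z = (e, l)" "e \<in> carrier P" "X_pow P (i + l) g = X_pow P (i + k) e"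
      by (auto simp: fraction_def)
    then show "z \<in> fraction P f n" using *[OF _ j] by (auto simp: fraction_def)
  next
    fix z assume "z \<in> fraction P f n"
    then obtain e l i where "z = (e, l)" "e \<in> carrier P" "X_pow P (i + l) f = X_pow P (i + n) e"
      by (auto simp: fraction_def)
    then show "z \<in> fraction P g k" using *[OF _ j[symmetric]] by (auto simp: fraction_def)
  qed
qed

end

context borel_rep
begin

lemma as_module_simps [simp]:
  "carrier (as_module V \<rho> M) = M" "\<zero>\<^bsub>as_module V \<rho> M\<^esub> = \<zero>\<^bsub>V\<^esub>"
  "x \<oplus>\<^bsub>as_module V \<rho> M\<^esub> y = x \<oplus>\<^bsub>V\<^esub> y" "a \<odot>\<^bsub>as_module V \<rho> M\<^esub> x = act_series V \<rho> a x"
  by (simp_all add: as_module_def invariants_def)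

definition PM :: "'v set \<Rightarrow> (nat \<Rightarrow> 'k set, 'v \<Rightarrow> 'k set) module" where
  "PM M = pdual (as_module V \<rho> M)"

definition functional :: "'v set \<Rightarrow> ('v \<Rightarrow> 'k set) \<Rightarrow> bool" where
  "functional M f \<longleftrightarrow> (\<forall>x\<in>M. f x \<in> carrier K_mod_o) \<and>
     (\<forall>x\<in>M. \<forall>y\<in>M. f (x \<oplus>\<^bsub>V\<^esub> y) = f x \<otimes>\<^bsub>K_mod_o\<^esub> f y) \<and>
     (\<forall>c\<in>OK. \<forall>x\<in>M. f (c \<cdot> x) = scale_K_mod_o c (f x))"

lemma functionalD:
  assumes "functional M f"
  shows "x \<in> M \<Longrightarrow> f x \<in> carrier K_mod_o" "x \<in> M \<Longrightarrow> y \<in> M \<Longrightarrow> f (x \<oplus>\<^bsub>V\<^esub> y) = f x \<otimes>\<^bsub>K_mod_o\<^esub> f y"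
    "c \<in> OK \<Longrightarrow> x \<in> M \<Longrightarrow> f (c \<cdot> x) = scale_K_mod_o c (f x)"
  using assms by (auto simp: functional_def)

lemma functional_zero:
  assumes "functional M f" "\<zero>\<^bsub>V\<^esub> \<in> M" shows "f \<zero>\<^bsub>V\<^esub> = \<one>\<^bsub>K_mod_o\<^esub>"
proof -
  have "f \<zero>\<^bsub>V\<^esub> = scale_K_mod_o 0 (f \<zero>\<^bsub>V\<^esub>)"
    using functionalD(3)[OF assms(1) OK_0 assms(2)] by (simp add: osm)
  also have "\<dots> = \<one>\<^bsub>K_mod_o\<^esub>"
    using functionalD(1)[OF assms] by (auto simp: K_mod_o_carrier scale_kcl K_mod_o_one)
  finally show ?thesis .
qed

lemma PM_simps:
  assumes "AXF_submodule V \<rho> M"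
  shows "f \<in> carrier (PM M) \<longleftrightarrow> f \<in> extensional M \<and> functional M f"
    and "\<zero>\<^bsub>PM M\<^esub> = (\<lambda>x\<in>M. \<one>\<^bsub>K_mod_o\<^esub>)"
    and "f \<oplus>\<^bsub>PM M\<^esub> g = (\<lambda>x\<in>M. f x \<otimes>\<^bsub>K_mod_o\<^esub> g x)"
    and "a \<odot>\<^bsub>PM M\<^esub> f = (\<lambda>x\<in>M. f (act_series V \<rho> a x))"
proof -
  have "act_series V \<rho> (const_o c) x = c \<cdot> x" if "c \<in> OK" "x \<in> M" for c x
    using act_series_const that AXF_submoduleD(2)[OF assms] by blast
  then have "(\<forall>c\<in>OK. \<forall>x\<in>M. f (act_series V \<rho> (const_o c) x) = scale_K_mod_o c (f x)) \<longleftrightarrow>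
      (\<forall>c\<in>OK. \<forall>x\<in>M. f (c \<cdot> x) = scale_K_mod_o c (f x))" by simp
  then show "f \<in> carrier (PM M) \<longleftrightarrow> f \<in> extensional M \<and> functional M f"
    by (auto simp: PM_def pdual_def functional_def PiE_def)
qed (simp_all add: PM_def pdual_def)

lemma functional_restrict:
  assumes M: "AXF_submodule V \<rho> M" and f: "functional M' f" "M \<subseteq> M'"
  shows "(\<lambda>x\<in>M. f x) \<in> carrier (PM M)"
proof -
  note D = AXF_submoduleD[OF M]
  have "functional M (\<lambda>x\<in>M. f x)"
    unfolding functional_def using f functionalD[OF f(1)] D(4,6) by (auto simp: subset_eq)
  then show ?thesis unfolding PM_simps(1)[OF M] by simp
qed

lemma PM_add_closed:
  assumes M: "AXF_submodule V \<rho> M" and fg: "f \<in> carrier (PM M)" "g \<in> carrier (PM M)"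
  shows "f \<oplus>\<^bsub>PM M\<^esub> g \<in> carrier (PM M)"
proof -
  interpret KG: comm_group K_mod_o by (rule K_mod_o_comm_group)
  note D = AXF_submoduleD[OF M]
  have f: "functional M f" "functional M g" using fg PM_simps(1)[OF M] by auto
  have "functional M (\<lambda>x\<in>M. f x \<otimes>\<^bsub>K_mod_o\<^esub> g x)"
    unfolding functional_def
    using functionalD[OF f(1)] functionalD[OF f(2)] D(4,6)
    by (auto simp: K_mod_o_scale_mult KG.m_ac)
  then show ?thesis unfolding PM_simps(1)[OF M] PM_simps(3)[OF M] by simp
qed

lemma PM_abelian_monoid:
  assumes M: "AXF_submodule V \<rho> M"
  shows "abelian_monoid (PM M)"
proof -
  interpret KG: comm_group K_mod_o by (rule K_mod_o_comm_group)
  have cl: "f x \<in> carrier K_mod_o" if "f \<in> carrier (PM M)" "x \<in> M" for f x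
    using that PM_simps(1)[OF M] functionalD(1) by blast
  have exten: "f \<in> extensional M" if "f \<in> carrier (PM M)" for f using that PM_simps(1)[OF M] by blast
  show ?thesis
  proof (rule abelian_monoidI)
    show "\<zero>\<^bsub>PM M\<^esub> \<in> carrier (PM M)"
      unfolding PM_simps(1)[OF M] PM_simps(2)[OF M] using AXF_submoduleD(4,6)[OF M]
      by (auto simp: functional_def K_mod_o_scale_one)
    fix f assume f: "f \<in> carrier (PM M)"
    show "\<zero>\<^bsub>PM M\<^esub> \<oplus>\<^bsub>PM M\<^esub> f = f"
      unfolding PM_simps(2,3)[OF M] using exten[OF f] cl[OF f] by (intro ext) (auto simp: extensional_def)
    fix g assume g: "g \<in> carrier (PM M)"
    show "f \<oplus>\<^bsub>PM M\<^esub> g = g \<oplus>\<^bsub>PM M\<^esub> f"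
      unfolding PM_simps(3)[OF M] using cl[OF f] cl[OF g] by (intro restrict_ext) (simp add: KG.m_comm)
    fix k assume k: "k \<in> carrier (PM M)"
    show "f \<oplus>\<^bsub>PM M\<^esub> g \<oplus>\<^bsub>PM M\<^esub> k = f \<oplus>\<^bsub>PM M\<^esub> (g \<oplus>\<^bsub>PM M\<^esub> k)"
      unfolding PM_simps(3)[OF M] using cl[OF f] cl[OF g] cl[OF k]
      by (intro restrict_ext) (simp add: KG.m_assoc)
  qed (rule PM_add_closed[OF M])
qed

lemma PM_smult_closed:
  assumes M: "AXF_submodule V \<rho> M" and a: "a \<in> carrier AX" and f: "f \<in> carrier (PM M)"
  shows "a \<odot>\<^bsub>PM M\<^esub> f \<in> carrier (PM M)"
proof -
  note D = AXF_submoduleD[OF M]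
  have f: "functional M f" using f PM_simps(1)[OF M] by auto
  have "functional M (\<lambda>x\<in>M. f (act_series V \<rho> a x))"
    unfolding functional_def
    using functionalD[OF f] D(2,4,6) D(9)[OF a]
    by (auto simp: act_series_add[OF a] act_series_osm[OF a])
  then show ?thesis unfolding PM_simps(1)[OF M] PM_simps(4)[OF M] by simp
qed

lemma PM_finsum_vanish:
  assumes M: "AXF_submodule V \<rho> M" and S: "finite S" "g \<in> S \<rightarrow> carrier (PM M)"
    and w: "w \<in> M" "\<And>f. f \<in> S \<Longrightarrow> g f w = \<one>\<^bsub>K_mod_o\<^esub>"
  shows "finsum (PM M) g S w = \<one>\<^bsub>K_mod_o\<^esub>"
proof -
  interpret P: abelian_monoid "PM M" by (rule PM_abelian_monoid[OF M])
  interpret KG: comm_group K_mod_o by (rule K_mod_o_comm_group)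
  show ?thesis
    using S w(2)
  proof (induction S rule: finite_induct)
    case empty
    then show ?case using w(1) by (simp add: P.finsum_empty PM_simps(2)[OF M])
  next
    case (insert f S)
    then have "g f \<in> carrier (PM M)" "g \<in> S \<rightarrow> carrier (PM M)" by auto
    then show ?case using insert w(1) by (simp add: P.finsum_insert PM_simps(3)[OF M])
  qed
qed

lemma X_pow_PM:
  assumes M: "AXF_submodule V \<rho> M" and f: "f \<in> carrier (PM M)"
  shows "X_pow (PM M) j f = (\<lambda>x\<in>M. f ((xop ^^ j) x))"
proof (induction j)
  case 0
  have "f \<in> extensional M" using f PM_simps(1)[OF M] by blast
  then show ?case by (simp add: X_pow_def extensional_restrict)
next
  case (Suc j)
  note D = AXF_submoduleD[OF M]
  have "X_pow (PM M) (Suc j) f = (\<lambda>x\<in>M. X_pow (PM M) j f (act_series V \<rho> var_X x))"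
    by (simp add: X_pow_def PM_simps(4)[OF M])
  also have "\<dots> = (\<lambda>x\<in>M. f ((xop ^^ Suc j) x))"
  proof (rule restrict_ext)
    fix x assume x: "x \<in> M"
    have "act_series V \<rho> var_X x = xop x" "xop x \<in> M" "x \<in> carrier V"
      using act_series_var D(2)[OF x] D(7)[OF x, of 1] by auto
    then show "X_pow (PM M) j f (act_series V \<rho> var_X x) = f ((xop ^^ Suc j) x)"
      by (simp add: Suc funpow_swap1)
  qed
  finally show ?case .
qed

text \<open>
  A functional on a module that is killed by \<open>X\<^sup>e\<close> is itself killed by
  \<open>X\<^sup>e\<close>, so all numerators become equal in the localization.
\<close>

lemma fraction_killed:
  assumes M: "AXF_submodule V \<rho> M" and e: "\<And>m. m \<in> M \<Longrightarrow> (xop ^^ e) m = \<zero>\<^bsub>V\<^esub>"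
    and f: "f \<in> carrier (PM M)"
  shows "fraction (PM M) f n = carrier (PM M) \<times> UNIV"
proof -
  note D = AXF_submoduleD[OF M]
  have z: "X_pow (PM M) (e + k) g = (\<lambda>x\<in>M. \<one>\<^bsub>K_mod_o\<^esub>)" if g: "g \<in> carrier (PM M)" for g k
    unfolding X_pow_PM[OF M g]
  proof (rule restrict_ext)
    fix x assume x: "x \<in> M"
    have "(xop ^^ (e + k)) x = \<zero>\<^bsub>V\<^esub>" using e D(7)[OF x, of k] by (simp add: funpow_add)
    moreover have "functional M g" using g PM_simps(1)[OF M] by blast
    ultimately show "g ((xop ^^ (e + k)) x) = \<one>\<^bsub>K_mod_o\<^esub>" using functional_zero D(3) by simp
  qed
  have "(g, k) \<in> fraction (PM M) f n" if "g \<in> carrier (PM M)" for g k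
    unfolding fraction_def using that z[OF f] z[OF that] by (auto intro!: exI[of _ e])
  then show ?thesis by (auto simp: fraction_def)
qed

lemma MM_submodule: "M \<in> MM V \<rho> \<Longrightarrow> AXF_submodule V \<rho> M" by (simp add: MM_def)

lemma PM_zero_closed: "AXF_submodule V \<rho> M \<Longrightarrow> \<zero>\<^bsub>PM M\<^esub> \<in> carrier (PM M)"
  using abelian_monoid.zero_closed[OF PM_abelian_monoid] .

text \<open>Each component of the limit is then a localization with a single element.\<close>

lemma D_xi_zero_of_killed:
  assumes kill: "\<And>M. M \<in> MM V \<rho> \<Longrightarrow> \<exists>e. \<forall>m\<in>M. (xop ^^ e) m = \<zero>\<^bsub>V\<^esub>"
  shows "carrier (D_xi V \<rho>) = {\<zero>\<^bsub>D_xi V \<rho>\<^esub>}"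
proof -
  have fr: "fraction (PM M) f n = carrier (PM M) \<times> UNIV" if "M \<in> MM V \<rho>" "f \<in> carrier (PM M)" for M f n
    using kill[OF that(1)] fraction_killed[OF MM_submodule[OF that(1)]] that(2) by blast
  have z: "\<zero>\<^bsub>localize (PM M)\<^esub> = carrier (PM M) \<times> UNIV" if "M \<in> MM V \<rho>" for M
    using fr[OF that PM_zero_closed[OF MM_submodule[OF that]]] by (simp add: localize_def)
  have car: "carrier (localize (PM M)) = {carrier (PM M) \<times> UNIV}" if M: "M \<in> MM V \<rho>" for M
  proof -
    have "carrier (localize (PM M)) = {fraction (PM M) f n | f n. f \<in> carrier (PM M)}"
      by (simp add: localize_def)
    also have "\<dots> = {carrier (PM M) \<times> UNIV}"
    proof (intro equalityI subsetI)
      fix c assume "c \<in> {fraction (PM M) f n | f n. f \<in> carrier (PM M)}"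
      then obtain f n where "f \<in> carrier (PM M)" "c = fraction (PM M) f n" by blast
      then show "c \<in> {carrier (PM M) \<times> UNIV}" using fr[OF M] by simp
    next
      fix c assume "c \<in> {carrier (PM M) \<times> (UNIV :: nat set)}"
      then have "c = fraction (PM M) \<zero>\<^bsub>PM M\<^esub> 0"
        using fr[OF M PM_zero_closed[OF MM_submodule[OF M]]] by simp
      then show "c \<in> {fraction (PM M) f n | f n. f \<in> carrier (PM M)}"
        using PM_zero_closed[OF MM_submodule[OF M]] by blast
    qed
    finally show ?thesis .
  qed
  have compat: "carrier (PM M) \<times> UNIV = dual_loc_map (as_module V \<rho> M) (\<lambda>m. m) (carrier (PM M') \<times> UNIV)"
    if MM: "M \<in> MM V \<rho>" "M' \<in> MM V \<rho>" "M \<subseteq> M'" for M M'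
  proof -
    have r: "(\<lambda>x\<in>M. f x) \<in> carrier (PM M)" if "f \<in> carrier (PM M')" for f
      using that PM_simps(1)[OF MM_submodule[OF MM(2)]] functional_restrict[OF MM_submodule[OF MM(1)] _ MM(3)] by blast
    have "dual_loc_map (as_module V \<rho> M) (\<lambda>m. m) (carrier (PM M') \<times> UNIV)
        = (\<Union>(f, n)\<in>carrier (PM M') \<times> UNIV. fraction (PM M) (\<lambda>x\<in>M. f x) n)"
      by (simp add: dual_loc_map_def PM_def)
    also have "\<dots> = (\<Union>(f, n)\<in>carrier (PM M') \<times> (UNIV :: nat set). carrier (PM M) \<times> UNIV)"
      using fr[OF MM(1) r] by (intro SUP_cong) auto
    also have "\<dots> = carrier (PM M) \<times> UNIV"
      using PM_zero_closed[OF MM_submodule[OF MM(2)]] by auto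
    finally show ?thesis by simp
  qed
  define z0 where "z0 = (\<lambda>M\<in>MM V \<rho>. carrier (PM M) \<times> (UNIV :: nat set))"
  have zero: "\<zero>\<^bsub>D_xi V \<rho>\<^esub> = z0"
    using z by (simp add: D_xi_def z0_def PM_def[symmetric] restrict_def fun_eq_iff)
  have "carrier (D_xi V \<rho>) = {y \<in> (\<Pi>\<^sub>E M\<in>MM V \<rho>. carrier (localize (PM M))).
      \<forall>M\<in>MM V \<rho>. \<forall>M'\<in>MM V \<rho>. M \<subseteq> M' \<longrightarrow> y M = dual_loc_map (as_module V \<rho> M) (\<lambda>m. m) (y M')}"
    by (simp add: D_xi_def PM_def)
  also have "(\<Pi>\<^sub>E M\<in>MM V \<rho>. carrier (localize (PM M))) = {z0}"
  proof -
    have "(\<Pi>\<^sub>E M\<in>MM V \<rho>. carrier (localize (PM M))) = (\<Pi>\<^sub>E M\<in>MM V \<rho>. {z0 M})"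
      by (rule PiE_cong) (simp add: car z0_def)
    also have "\<dots> = {z0}" by (rule PiE_singleton) (unfold z0_def, rule restrict_extensional)
    finally show ?thesis .
  qed
  also have "{y \<in> {z0}. \<forall>M\<in>MM V \<rho>. \<forall>M'\<in>MM V \<rho>. M \<subseteq> M' \<longrightarrow> y M = dual_loc_map (as_module V \<rho> M) (\<lambda>m. m) (y M')} = {z0}"
  proof -
    have "z0 M = dual_loc_map (as_module V \<rho> M) (\<lambda>m. m) (z0 M')"
      if "M \<in> MM V \<rho>" "M' \<in> MM V \<rho>" "M \<subseteq> M'" for M M'
      using compat[OF that] that by (simp add: z0_def)
    then show ?thesis by blast
  qed
  finally show ?thesis by (simp add: zero)
qed

subsection \<open>Vanishing in the presence of a degree\<close>

text \<open>
  A \<open>\<pi>\<close>-torsion module separated by \<open>r\<close> functionals has dimension at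
  most \<open>r\<close> over the residue field, so that only finitely many degrees occur in it. The
  induction splits off one functional \<open>f\<close>: every element differs from a multiple of one
  fixed \<open>w0\<close> by an element of the kernel of \<open>f\<close>.
\<close>

lemma torsion_finite_support:
  fixes supp :: "'v \<Rightarrow> real set"
  assumes fin: "\<And>v. v \<in> carrier V \<Longrightarrow> finite (supp v)"
    and supp_zero: "supp \<zero>\<^bsub>V\<^esub> = {}"
    and supp_add: "\<And>v w. v \<in> carrier V \<Longrightarrow> w \<in> carrier V \<Longrightarrow> supp (v \<oplus>\<^bsub>V\<^esub> w) \<subseteq> supp v \<union> supp w"
    and supp_osm: "\<And>c v. c \<in> OK \<Longrightarrow> v \<in> carrier V \<Longrightarrow> supp (c \<cdot> v) \<subseteq> supp v"
    and S: "finite S"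
  shows "W \<subseteq> carrier V \<Longrightarrow> (\<And>v w. v \<in> W \<Longrightarrow> w \<in> W \<Longrightarrow> v \<oplus>\<^bsub>V\<^esub> w \<in> W) \<Longrightarrow>
    (\<And>c v. c \<in> OK \<Longrightarrow> v \<in> W \<Longrightarrow> c \<cdot> v \<in> W) \<Longrightarrow> (\<And>v. v \<in> W \<Longrightarrow> \<pi> \<cdot> v = \<zero>\<^bsub>V\<^esub>) \<Longrightarrow> \<zero>\<^bsub>V\<^esub> \<in> W \<Longrightarrow>
    (\<And>f. f \<in> S \<Longrightarrow> functional W f) \<Longrightarrow>
    (\<And>w. w \<in> W \<Longrightarrow> (\<And>f. f \<in> S \<Longrightarrow> f w = \<one>\<^bsub>K_mod_o\<^esub>) \<Longrightarrow> w = \<zero>\<^bsub>V\<^esub>) \<Longrightarrow>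
    \<exists>D. finite D \<and> (\<forall>w\<in>W. supp w \<subseteq> D)"
  using S
proof (induction S arbitrary: W rule: finite_induct)
  case empty
  then have "w = \<zero>\<^bsub>V\<^esub>" if "w \<in> W" for w using that by blast
  then show ?case using supp_zero by (intro exI[of _ "{}"]) auto
next
  case (insert f S)
  interpret KG: comm_group K_mod_o by (rule K_mod_o_comm_group)
  note W = insert.prems
  have ff: "functional W f" and fS: "\<And>g. g \<in> S \<Longrightarrow> functional W g" using W(6) by auto
  let ?W = "{w \<in> W. f w = \<one>\<^bsub>K_mod_o\<^esub>}"
  have "\<exists>D. finite D \<and> (\<forall>w\<in>?W. supp w \<subseteq> D)"
  proof (rule insert.IH)
    show "?W \<subseteq> carrier V" using W(1) by blast
    show "v \<oplus>\<^bsub>V\<^esub> w \<in> ?W" if "v \<in> ?W" "w \<in> ?W" for v w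
      using that W(2) functionalD(2)[OF ff] by simp
    show "c \<cdot> v \<in> ?W" if "c \<in> OK" "v \<in> ?W" for c v
      using that W(3) functionalD(3)[OF ff] by (simp add: K_mod_o_scale_one)
    show "\<pi> \<cdot> v = \<zero>\<^bsub>V\<^esub>" if "v \<in> ?W" for v using that W(4) by simp
    show "\<zero>\<^bsub>V\<^esub> \<in> ?W" using W(5) functional_zero[OF ff] by simp
    show "functional ?W g" if "g \<in> S" for g
      using fS[OF that] by (simp add: functional_def)
    show "w = \<zero>\<^bsub>V\<^esub>" if "w \<in> ?W" "\<And>g. g \<in> S \<Longrightarrow> g w = \<one>\<^bsub>K_mod_o\<^esub>" for w
      using that by (intro W(7)) auto
  qed
  then obtain D where D: "finite D" "\<And>w. w \<in> ?W \<Longrightarrow> supp w \<subseteq> D" by blast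
  show ?case
  proof (cases "\<exists>w0\<in>W. f w0 \<noteq> \<one>\<^bsub>K_mod_o\<^esub>")
    case False
    then show ?thesis using D by blast
  next
    case True
    then obtain w0 where w0: "w0 \<in> W" "f w0 \<noteq> \<one>\<^bsub>K_mod_o\<^esub>" by blast
    have tors: "scale_K_mod_o \<pi> (f w) = \<one>\<^bsub>K_mod_o\<^esub>" if "w \<in> W" for w
      using functionalD(3)[OF ff uniformizer_in that] W(4)[OF that] functional_zero[OF ff W(5)] by simp
    have "supp w \<subseteq> D \<union> supp w0" if w: "w \<in> W" for w
    proof -
      obtain a where a: "a \<in> OK" "f w \<otimes>\<^bsub>K_mod_o\<^esub> scale_K_mod_o (- a) (f w0) = \<one>\<^bsub>K_mod_o\<^esub>"
        using K_mod_o_torsion_multiple functionalD(1)[OF ff] tors w w0 by blast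
      have ma: "- a \<in> OK" using a OK_minus by blast
      have aw: "(- a) \<cdot> w0 \<in> W" "a \<cdot> w0 \<in> W" using W(3) w0 a ma by blast+
      have c: "w \<in> carrier V" "w0 \<in> carrier V" "a \<cdot> w0 \<in> carrier V" "(- a) \<cdot> w0 \<in> carrier V"
        using w w0 aw W(1) by blast+
      have "f (w \<oplus>\<^bsub>V\<^esub> (- a) \<cdot> w0) = \<one>\<^bsub>K_mod_o\<^esub>"
        using functionalD(2)[OF ff w aw(1)] functionalD(3)[OF ff ma w0(1)] a by simp
      then have sD: "supp (w \<oplus>\<^bsub>V\<^esub> (- a) \<cdot> w0) \<subseteq> D" using D(2) W(2)[OF w aw(1)] by blast
      have "(- a) \<cdot> w0 \<oplus>\<^bsub>V\<^esub> a \<cdot> w0 = \<zero>\<^bsub>V\<^esub>"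
        using c a by (simp add: osm(8) V.l_neg)
      then have "w = (w \<oplus>\<^bsub>V\<^esub> (- a) \<cdot> w0) \<oplus>\<^bsub>V\<^esub> a \<cdot> w0" using c by (simp add: V.a_assoc)
      then have "supp w \<subseteq> supp (w \<oplus>\<^bsub>V\<^esub> (- a) \<cdot> w0) \<union> supp (a \<cdot> w0)"
        using supp_add[of "w \<oplus>\<^bsub>V\<^esub> (- a) \<cdot> w0" "a \<cdot> w0"] c by simp
      then show ?thesis using sD supp_osm[OF a(1) c(2)] by blast
    qed
    then show ?thesis using D(1) fin[of w0] w0(1) W(1)
      by (intro exI[of _ "D \<union> supp w0"]) (auto simp: subset_eq)
  qed
qed

text \<open>
  Functionals separate the points of \<open>V\<close>, and on vectors killed by \<open>X\<close> a
  combination of the generators over \<open>A[[X]]\<close> only involves the constant coefficients,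
  so it vanishes where all generators do.
\<close>

lemma generators_separate:
  assumes M: "AXF_submodule V \<rho> M" and S: "finite S" "S \<subseteq> carrier (PM M)"
    and gen: "\<And>f. f \<in> carrier (PM M) \<Longrightarrow> \<exists>c\<in>S \<rightarrow> carrier AX. f = finsum (PM M) (\<lambda>x. c x \<odot>\<^bsub>PM M\<^esub> x) S"
    and w: "w \<in> M" "xop w = \<zero>\<^bsub>V\<^esub>" "\<And>f. f \<in> S \<Longrightarrow> f w = \<one>\<^bsub>K_mod_o\<^esub>"
  shows "w = \<zero>\<^bsub>V\<^esub>"
proof (rule ccontr)
  assume "w \<noteq> \<zero>\<^bsub>V\<^esub>"
  note D = AXF_submoduleD[OF M]
  have wc: "w \<in> carrier V" using D(2) w by blast
  have "\<exists>f. functional (carrier V) f \<and> f w \<noteq> \<one>\<^bsub>K_mod_o\<^esub>"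
    using dual_separates_points[OF V_module wc \<open>w \<noteq> \<zero>\<^bsub>V\<^esub>\<close>] unfolding functional_def conj_assoc .
  then obtain f where f: "functional (carrier V) f" "f w \<noteq> \<one>\<^bsub>K_mod_o\<^esub>" by (elim exE conjE)
  let ?f = "\<lambda>x\<in>M. f x"
  have "?f \<in> carrier (PM M)" using f(1) D(2) by (intro functional_restrict[OF M]) auto
  then obtain c where c: "c \<in> S \<rightarrow> carrier AX" "?f = finsum (PM M) (\<lambda>x. c x \<odot>\<^bsub>PM M\<^esub> x) S"
    using gen by blast
  have "finsum (PM M) (\<lambda>x. c x \<odot>\<^bsub>PM M\<^esub> x) S w = \<one>\<^bsub>K_mod_o\<^esub>"
  proof (rule PM_finsum_vanish[OF M S(1) _ w(1)])
    show "(\<lambda>x. c x \<odot>\<^bsub>PM M\<^esub> x) \<in> S \<rightarrow> carrier (PM M)" using c(1) S(2) PM_smult_closed[OF M] by blast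
    fix g assume g: "g \<in> S"
    then have ca: "c g \<in> carrier AX" and gf: "functional M g" using c(1) S(2) PM_simps(1)[OF M] by auto
    obtain b where b: "b \<in> OK" "c g 0 = cls b" using A_elem[OF AX_coeff[OF ca]] by blast
    have "(xop ^^ 1) w = \<zero>\<^bsub>V\<^esub>" using w(2) by simp
    from act_series_eq[OF wc ca this] have "act_series V \<rho> (c g) w = b \<cdot> w"
      using b wc by (simp add: lessThan_Suc V.finsum_insert V.finsum_empty osm Pi_def)
    then have "(c g \<odot>\<^bsub>PM M\<^esub> g) w = g (b \<cdot> w)" using w(1) by (simp add: PM_simps(4)[OF M])
    then show "(c g \<odot>\<^bsub>PM M\<^esub> g) w = \<one>\<^bsub>K_mod_o\<^esub>"
      using functionalD(3)[OF gf b(1) w(1)] w(3)[OF g] b(1) by (simp add: K_mod_o_scale_one)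
  qed
  then have "?f w = \<one>\<^bsub>K_mod_o\<^esub>" using c(2) by simp
  then show False using f(2) w(1) by simp
qed

text \<open>
  Suppose that \<open>V\<close> carries degrees that are preserved by \<open>N\<^sub>0\<close>, hence by \<open>X\<close>, and rescaled by \<open>s\<close>,
  hence by \<open>F\<close>. A nonzero element of an admissible \<open>M\<close> has a nonzero multiple killed by \<open>X\<close> and \<open>\<pi>\<close>,
  so one of its degrees belongs to a fixed finite set. As \<open>F\<close> moves all degrees out of that set, it
  is locally nilpotent on \<open>M\<close>, and then a power of \<open>X\<close> kills the finitely generated module \<open>M\<close>.
\<close>

theorem D_xi_zero_of_degree:
  fixes supp :: "'v \<Rightarrow> real set"
  assumes fin: "\<And>v. v \<in> carrier V \<Longrightarrow> finite (supp v)"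
    and supp_empty: "\<And>v. v \<in> carrier V \<Longrightarrow> supp v = {} \<Longrightarrow> v = \<zero>\<^bsub>V\<^esub>"
    and supp_zero: "supp \<zero>\<^bsub>V\<^esub> = {}"
    and supp_pos: "\<And>v d. v \<in> carrier V \<Longrightarrow> d \<in> supp v \<Longrightarrow> d > 0"
    and supp_add: "\<And>v w. v \<in> carrier V \<Longrightarrow> w \<in> carrier V \<Longrightarrow> supp (v \<oplus>\<^bsub>V\<^esub> w) \<subseteq> supp v \<union> supp w"
    and supp_osm: "\<And>c v. c \<in> OK \<Longrightarrow> v \<in> carrier V \<Longrightarrow> supp (c \<cdot> v) \<subseteq> supp v"
    and supp_N0: "\<And>x v. x \<in> N0 \<Longrightarrow> v \<in> carrier V \<Longrightarrow> supp (\<rho> x v) \<subseteq> supp v"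
    and supp_s: "\<And>v. v \<in> carrier V \<Longrightarrow> supp (\<rho> s v) \<subseteq> (\<lambda>d. r * d) ` supp v"
    and r: "r > 0" "r \<noteq> 1"
  shows "carrier (D_xi V \<rho>) = {\<zero>\<^bsub>D_xi V \<rho>\<^esub>}"
proof (rule D_xi_zero_of_killed)
  fix M assume "M \<in> MM V \<rho>"
  then have M: "AXF_submodule V \<rho> M" and gF: "AXF_fin_gen V \<rho> M" and gX: "fin_gen AX (PM M)"
    by (auto simp: MM_def PM_def)
  note D = AXF_submoduleD[OF M]
  obtain S where S: "finite S" "S \<subseteq> carrier (PM M)"
    "\<And>f. f \<in> carrier (PM M) \<Longrightarrow> \<exists>c\<in>S \<rightarrow> carrier AX. f = finsum (PM M) (\<lambda>x. c x \<odot>\<^bsub>PM M\<^esub> x) S"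
    using gX unfolding fin_gen_def by blast
  have supp_minus: "supp (\<ominus>\<^bsub>V\<^esub> v) \<subseteq> supp v" if "v \<in> carrier V" for v
    using supp_osm[OF OK_minus[OF OK_1] that] that by (simp add: osm(8)[OF _ OK_1] osm(4))
  have supp_X: "supp (xop v) \<subseteq> supp v" if "v \<in> carrier V" for v
    unfolding xop_eq using supp_add[of "\<rho> gam v" "\<ominus>\<^bsub>V\<^esub> v"] supp_N0[OF gam(1) that] supp_minus[OF that] that gam_in_B
    by (auto simp: subset_eq)
  have supp_Xn: "supp ((xop ^^ n) v) \<subseteq> supp v" if "v \<in> carrier V" for v n
    by (induction n) (use supp_X that xop_closed in \<open>auto simp: subset_eq\<close>)
  let ?W = "{w \<in> M. xop w = \<zero>\<^bsub>V\<^esub> \<and> \<pi> \<cdot> w = \<zero>\<^bsub>V\<^esub>}"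
  have "\<exists>E. finite E \<and> (\<forall>w\<in>?W. supp w \<subseteq> E)"
  proof (rule torsion_finite_support[OF fin supp_zero supp_add supp_osm S(1)])
    show "v \<oplus>\<^bsub>V\<^esub> w \<in> ?W" if "v \<in> ?W" "w \<in> ?W" for v w
      using that D(2,4) xop_add[of v w 1] uniformizer_in by (simp add: osm_add)
    show "c \<cdot> v \<in> ?W" if "c \<in> OK" "v \<in> ?W" for c v
      using that D(2,6) xop_osm[of v c 1] uniformizer_in osm_commute[OF uniformizer_in] by (simp add: osm(9))
    show "functional ?W f" if "f \<in> S" for f
      using that S(2) PM_simps(1)[OF M] by (auto simp: functional_def)
    show "w = \<zero>\<^bsub>V\<^esub>" if "w \<in> ?W" "\<And>f. f \<in> S \<Longrightarrow> f w = \<one>\<^bsub>K_mod_o\<^esub>" for w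
      by (rule generators_separate[OF M S]) (use that in simp_all)
    show "\<zero>\<^bsub>V\<^esub> \<in> ?W" using D(3) xop_zero[of 1] uniformizer_in by (simp add: osm(9))
  qed (use D(2) in auto)
  then obtain E where E: "finite E" "\<And>w. w \<in> ?W \<Longrightarrow> supp w \<subseteq> E" by blast
  have zero: "m = \<zero>\<^bsub>V\<^esub>" if m: "m \<in> M" and disj: "supp m \<inter> E = {}" for m
  proof (rule ccontr)
    assume nz: "m \<noteq> \<zero>\<^bsub>V\<^esub>"
    have mc: "m \<in> carrier V" using D(2) m by blast
    let ?P = "\<lambda>n. (xop ^^ n) m = \<zero>\<^bsub>V\<^esub>"
    have ex: "\<exists>n. ?P n" using X_nilpotent[OF mc] .
    define n where "n = (LEAST n. ?P n)"
    have n: "?P n" unfolding n_def using ex by (rule LeastI_ex)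
    have "n \<noteq> 0" using n nz by (metis funpow_0)
    then obtain n' where n': "n = Suc n'" by (cases n) auto
    define v where "v = (xop ^^ n') m"
    have v: "v \<in> M" "v \<in> carrier V" "xop v = \<zero>\<^bsub>V\<^esub>" "supp v \<subseteq> supp m"
      using D(2,7) m n supp_Xn[OF mc] by (auto simp: v_def n')
    have vnz: "v \<noteq> \<zero>\<^bsub>V\<^esub>" using not_less_Least[of n' ?P] n' by (simp add: v_def n_def)
    let ?Q = "\<lambda>i. (\<pi> ^ i) \<cdot> v = \<zero>\<^bsub>V\<^esub>"
    have exQ: "\<exists>i. ?Q i" using osm(6)[OF v(2)] by blast
    define i where "i = (LEAST i. ?Q i)"
    have i: "?Q i" unfolding i_def using exQ by (rule LeastI_ex)
    have "i \<noteq> 0" using i vnz osm(4)[OF v(2)] by (metis power_0)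
    then obtain i' where i': "i = Suc i'" by (cases i) auto
    have pO: "\<pi> ^ i' \<in> OK" using uniformizer_in OK_power by blast
    define w where "w = (\<pi> ^ i') \<cdot> v"
    have wnz: "w \<noteq> \<zero>\<^bsub>V\<^esub>" using not_less_Least[of i' ?Q] i' by (simp add: w_def i_def)
    have "w \<in> M" unfolding w_def using D(6) pO v(1) by blast
    moreover have "xop w = \<zero>\<^bsub>V\<^esub>" using xop_osm[OF v(2) pO, of 1] v(3) pO by (simp add: w_def osm(9))
    moreover have "\<pi> \<cdot> w = \<zero>\<^bsub>V\<^esub>"
      using i osm(2)[OF v(2) uniformizer_in pO] by (simp add: w_def i')
    ultimately have "supp w \<subseteq> E" using E(2) by blast
    moreover have "supp w \<subseteq> supp m" using supp_osm[OF pO v(2)] v(4) by (auto simp: w_def)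
    ultimately have "supp w = {}" using disj by blast
    then show False using supp_empty wnz D(2)[OF \<open>w \<in> M\<close>] by blast
  qed
  have supp_finsum: "supp (finsum V f I) \<subseteq> U" if "f \<in> I \<rightarrow> carrier V" "\<And>i. i \<in> I \<Longrightarrow> supp (f i) \<subseteq> U"
    for f and I :: "('q^'n^'n) set set" and U
    using that
  proof (induction I rule: infinite_finite_induct)
    case (insert i I)
    then have fi: "f i \<in> carrier V" "f \<in> I \<rightarrow> carrier V" by auto
    have "finsum V f (insert i I) = f i \<oplus>\<^bsub>V\<^esub> finsum V f I"
      using insert.hyps fi by (simp add: V.finsum_insert)
    then have "supp (finsum V f (insert i I)) \<subseteq> supp (f i) \<union> supp (finsum V f I)"
      using supp_add[OF fi(1) V.finsum_closed[OF fi(2)]] by simp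
    moreover have "supp (finsum V f I) \<subseteq> U" using insert.IH[OF fi(2)] insert.prems(2) by blast
    ultimately show ?case using insert.prems(2)[of i] by blast
  qed (simp_all add: V.finsum_infinite V.finsum_empty supp_zero)
  have supp_F: "supp (F_op V \<rho> v) \<subseteq> (\<lambda>d. r * d) ` supp v" if v: "v \<in> inv_H0" for v
    unfolding F_op_eq
  proof (rule supp_finsum[OF F_terms_closed[OF v]])
    fix C assume "C \<in> coset ` H0"
    then have "rep C \<in> N0" using coset_in_H0 rep_mem H0_subset by blast
    then show "supp (\<rho> (rep C) (\<rho> s v)) \<subseteq> (\<lambda>d. r * d) ` supp v"
      using supp_N0[of "rep C" "\<rho> s v"] supp_s[of v] inv_H0_closed[OF v] s_in_B by auto
  qed
  have supp_Fk: "supp ((F_op V \<rho> ^^ k) m) \<subseteq> (\<lambda>d. r ^ k * d) ` supp m" if m: "m \<in> M" for k m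
  proof (induction k)
    case (Suc k)
    have "supp ((F_op V \<rho> ^^ Suc k) m) \<subseteq> (\<lambda>d. r * d) ` supp ((F_op V \<rho> ^^ k) m)"
      using supp_F[OF D(1)[OF D(10)[OF m]]] by simp
    also have "\<dots> \<subseteq> (\<lambda>d. r * d) ` (\<lambda>d. r ^ k * d) ` supp m" using Suc by blast
    also have "\<dots> = (\<lambda>d. r ^ Suc k * d) ` supp m" by (simp add: image_image mult.assoc)
    finally show ?case .
  qed simp
  have F_nil: "\<exists>k0. \<forall>k\<ge>k0. (F_op V \<rho> ^^ k) m = \<zero>\<^bsub>V\<^esub>" if m: "m \<in> M" for m
  proof -
    have mc: "m \<in> carrier V" using D(2) m by blast
    have one: "finite {k. r ^ k * d = e}" if "d \<in> supp m" for d e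
    proof -
      have "inj (\<lambda>k. r ^ k * d)"
      proof (rule injI)
        fix k l assume "r ^ k * d = r ^ l * d"
        then have "r ^ k = r ^ l" using supp_pos[OF mc \<open>d \<in> supp m\<close>] by simp
        then show "k = l" using r by (metis linorder_neqE_linordered_idom power_inject_exp power_strict_decreasing less_irrefl nat_neq_iff)
      qed
      then show ?thesis using finite_vimageI[of "{e}" "\<lambda>k. r ^ k * d"] by (simp add: vimage_def)
    qed
    have "{k. supp ((F_op V \<rho> ^^ k) m) \<inter> E \<noteq> {}} \<subseteq> (\<Union>d\<in>supp m. \<Union>e\<in>E. {k. r ^ k * d = e})"
      using supp_Fk[OF m] by blast
    moreover have "finite (\<Union>d\<in>supp m. \<Union>e\<in>E. {k. r ^ k * d = e})"
      using fin[OF mc] E(1) one by blast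
    ultimately have "finite {k. supp ((F_op V \<rho> ^^ k) m) \<inter> E \<noteq> {}}" by (rule finite_subset)
    then obtain k0 where "\<forall>k\<in>{k. supp ((F_op V \<rho> ^^ k) m) \<inter> E \<noteq> {}}. k < k0"
      using finite_nat_set_iff_bounded by blast
    then have "(F_op V \<rho> ^^ k) m = \<zero>\<^bsub>V\<^esub>" if "k \<ge> k0" for k
      using zero[OF D(10)[OF m, of k]] that by force
    then show ?thesis by blast
  qed
  have killed: "\<exists>e. \<forall>e'\<ge>e. \<forall>j. (xop ^^ e') ((F_op V \<rho> ^^ j) m) = \<zero>\<^bsub>V\<^esub>" if m: "m \<in> M" for m
  proof -
    obtain k0 where k0: "\<And>k. k \<ge> k0 \<Longrightarrow> (F_op V \<rho> ^^ k) m = \<zero>\<^bsub>V\<^esub>" using F_nil[OF m] by blast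
    obtain ex where ex: "\<And>j. (xop ^^ ex j) ((F_op V \<rho> ^^ j) m) = \<zero>\<^bsub>V\<^esub>"
      using X_nilpotent[OF D(2)[OF D(10)[OF m]]] by metis
    have "(xop ^^ e') ((F_op V \<rho> ^^ j) m) = \<zero>\<^bsub>V\<^esub>" if e': "e' \<ge> (\<Sum>j<k0. ex j)" for e' j
    proof (cases "j < k0")
      case True
      have "ex j \<le> (\<Sum>j<k0. ex j)" using True by (intro member_le_sum) auto
      then have "ex j \<le> e'" using e' by linarith
      then show ?thesis by (rule X_pow_zero_mono[OF D(2)[OF D(10)[OF m]] ex])
    qed (use k0 in simp)
    then show ?thesis by blast
  qed
  obtain SF where SF: "finite SF" "SF \<subseteq> M" "M = \<Inter>{M'. AXF_submodule V \<rho> M' \<and> SF \<subseteq> M'}"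
    using gF unfolding AXF_fin_gen_def by blast
  obtain ex where ex: "\<And>m e' j. m \<in> M \<Longrightarrow> e' \<ge> ex m \<Longrightarrow> (xop ^^ e') ((F_op V \<rho> ^^ j) m) = \<zero>\<^bsub>V\<^esub>"
    using killed by metis
  define e where "e = (\<Sum>m\<in>SF. ex m)"
  let ?M' = "{v \<in> inv_H0. \<forall>j. (xop ^^ e) ((F_op V \<rho> ^^ j) v) = \<zero>\<^bsub>V\<^esub>}"
  have "SF \<subseteq> ?M'"
  proof
    fix m assume m: "m \<in> SF"
    then have "ex m \<le> e" unfolding e_def using SF(1) by (intro member_le_sum) auto
    then show "m \<in> ?M'" using ex m SF(2) D(1) by auto
  qed
  then have "M \<subseteq> ?M'" using SF(3) killed_submodule[of e] by blast
  then have "(xop ^^ e) m = \<zero>\<^bsub>V\<^esub>" if "m \<in> M" for m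
  proof -
    have "(xop ^^ e) ((F_op V \<rho> ^^ 0) m) = \<zero>\<^bsub>V\<^esub>" using \<open>M \<subseteq> ?M'\<close> that by blast
    then show ?thesis by simp
  qed
  then show "\<exists>e. \<forall>m\<in>M. (xop ^^ e) m = \<zero>\<^bsub>V\<^esub>" by blast
qed

end

section \<open>Representations of \<open>B\<close> on functions\<close>

context borel_setting
begin

definition fun_module ::
    "('q^'n^'n \<Rightarrow> 'w) set \<Rightarrow> ('k set, 'w) module \<Rightarrow> ('k set, 'q^'n^'n \<Rightarrow> 'w) module" where
  "fun_module C W =
    \<lparr>carrier = C, mult = undefined, one = undefined, zero = (\<lambda>x\<in>B. \<zero>\<^bsub>W\<^esub>),
     add = (\<lambda>f f'. \<lambda>x\<in>B. f x \<oplus>\<^bsub>W\<^esub> f' x), smult = (\<lambda>a f. \<lambda>x\<in>B. a \<odot>\<^bsub>W\<^esub> f x)\<rparr>"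

lemma fun_module_simps [simp]:
  "carrier (fun_module C W) = C" "\<zero>\<^bsub>fun_module C W\<^esub> = (\<lambda>x\<in>B. \<zero>\<^bsub>W\<^esub>)"
  "f \<oplus>\<^bsub>fun_module C W\<^esub> g = (\<lambda>x\<in>B. f x \<oplus>\<^bsub>W\<^esub> g x)" "a \<odot>\<^bsub>fun_module C W\<^esub> f = (\<lambda>x\<in>B. a \<odot>\<^bsub>W\<^esub> f x)"
  by (simp_all add: fun_module_def)

definition smooth_fun :: "('q^'n^'n \<Rightarrow> 'w) \<Rightarrow> bool" where
  "smooth_fun f \<longleftrightarrow> (\<exists>k. \<forall>g\<in>B. g - mat 1 \<in> mball (1 / real p ^ k) \<longrightarrow> (\<forall>x\<in>B. f (x ** g) = f x))"

lemma smooth_fun_iff: "smooth_fun f \<longleftrightarrow> openin (top_of_set B) {g \<in> B. \<forall>x\<in>B. f (x ** g) = f x}"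
proof -
  have "openin (top_of_set B) {g \<in> B. \<forall>x\<in>B. f (x ** g) = f x} \<longleftrightarrow>
    (\<exists>k. \<forall>g\<in>B. g - mat 1 \<in> mball (1 / real p ^ k) \<longrightarrow> g \<in> {g \<in> B. \<forall>x\<in>B. f (x ** g) = f x})"
    by (rule open_subgroup_iff) (auto simp: B_closed matrix_mul_assoc)
  then show ?thesis by (auto simp: smooth_fun_def)
qed

lemma smooth_fun_common:
  assumes "smooth_fun f" "smooth_fun f'"
  shows "\<exists>k. \<forall>g\<in>B. g - mat 1 \<in> mball (1 / real p ^ k) \<longrightarrow> (\<forall>x\<in>B. f (x ** g) = f x \<and> f' (x ** g) = f' x)"
proof -
  obtain k where k: "\<forall>g\<in>B. g - mat 1 \<in> mball (1 / real p ^ k) \<longrightarrow> (\<forall>x\<in>B. f (x ** g) = f x)"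
    using assms(1) unfolding smooth_fun_def by (elim exE)
  obtain l where l: "\<forall>g\<in>B. g - mat 1 \<in> mball (1 / real p ^ l) \<longrightarrow> (\<forall>x\<in>B. f' (x ** g) = f' x)"
    using assms(2) unfolding smooth_fun_def by (elim exE)
  have "f (x ** g) = f x \<and> f' (x ** g) = f' x"
    if g: "g \<in> B" "g - mat 1 \<in> mball (1 / real p ^ max k l)" and x: "x \<in> B" for g x
  proof -
    have "g - mat 1 \<in> mball (1 / real p ^ k)" "g - mat 1 \<in> mball (1 / real p ^ l)"
      using g(2) mball_mono inverse_p_power_mono[of k "max k l"] inverse_p_power_mono[of l "max k l"] by auto
    then show ?thesis using k l g(1) x by simp
  qed
  then show ?thesis by blast
qed

lemma smooth_fun_add:
  assumes "smooth_fun f" "smooth_fun f'"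
  shows "smooth_fun (\<lambda>x\<in>B. f x \<oplus>\<^bsub>W\<^esub> f' x)"
proof -
  obtain k where "\<forall>g\<in>B. g - mat 1 \<in> mball (1 / real p ^ k) \<longrightarrow> (\<forall>x\<in>B. f (x ** g) = f x \<and> f' (x ** g) = f' x)"
    using smooth_fun_common[OF assms] by (elim exE)
  then show ?thesis unfolding smooth_fun_def by (intro exI[of _ k]) (simp add: B_closed(3))
qed

lemma smooth_fun_smult:
  assumes "smooth_fun f"
  shows "smooth_fun (\<lambda>x\<in>B. a \<odot>\<^bsub>W\<^esub> f x)"
proof -
  obtain k where "\<forall>g\<in>B. g - mat 1 \<in> mball (1 / real p ^ k) \<longrightarrow> (\<forall>x\<in>B. f (x ** g) = f x)"
    using assms unfolding smooth_fun_def by (elim exE)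
  then show ?thesis unfolding smooth_fun_def by (intro exI[of _ k]) (simp add: B_closed(3))
qed

lemma smooth_fun_const: "smooth_fun (\<lambda>x\<in>B. c)"
  unfolding smooth_fun_def by (simp add: B_closed)

lemma conj_near_1:
  fixes g :: "'q^'n^'n"
  shows "\<exists>m. \<forall>b. b - mat 1 \<in> mball (1 / real p ^ m) \<longrightarrow> invertible g \<longrightarrow> cj g b - mat 1 \<in> mball (1 / real p ^ k)"
proof -
  obtain C D where C: "C > 0" "g \<in> mball C" "D > 0" "matrix_inv g \<in> mball D"
    using mball_exists by metis
  obtain m where m: "C * D * (1 / real p ^ m) \<le> 1 / real p ^ k"
    using small_times[of "C * D" "1 / real p ^ k"] C p_gt_1 by auto
  have "cj g b - mat 1 \<in> mball (1 / real p ^ k)" if b: "b - mat 1 \<in> mball (1 / real p ^ m)" "invertible g" for b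
  proof -
    have "g ** (b - mat 1) ** matrix_inv g \<in> mball (C * (1 / real p ^ m) * D)"
      using C b by (intro mball_mult) auto
    moreover have "g ** (b - mat 1) ** matrix_inv g = cj g b - mat 1"
      using b(2) by (simp add: cj_def matrix_diff_ldistrib matrix_diff_rdistrib matrix_inv)
    moreover have "C * (1 / real p ^ m) * D \<le> 1 / real p ^ k" using m by (simp add: mult_ac)
    ultimately show ?thesis using mball_mono by metis
  qed
  then show ?thesis by blast
qed

lemma smooth_fun_act:
  assumes f: "smooth_fun f" and g: "g \<in> B"
  shows "smooth_fun (cind_action B g f)"
proof -
  obtain k where k: "\<forall>g\<in>B. g - mat 1 \<in> mball (1 / real p ^ k) \<longrightarrow> (\<forall>x\<in>B. f (x ** g) = f x)"
    using f unfolding smooth_fun_def by (elim exE)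
  have gi: "invertible g" using B_closed(1) g by blast
  obtain m where m: "\<forall>b. b - mat 1 \<in> mball (1 / real p ^ m) \<longrightarrow> invertible (matrix_inv g) \<longrightarrow>
      cj (matrix_inv g) b - mat 1 \<in> mball (1 / real p ^ k)"
    using conj_near_1[of "matrix_inv g" k] by (elim exE)
  have "cind_action B g f (x ** b) = cind_action B g f x"
    if b: "b \<in> B" "b - mat 1 \<in> mball (1 / real p ^ m)" and x: "x \<in> B" for b x
  proof -
    let ?c = "cj (matrix_inv g) b"
    have c: "?c \<in> B" by (simp add: cj_def matrix_inv_inv[OF gi] B_closed(3,4) g b(1))
    have n: "?c - mat 1 \<in> mball (1 / real p ^ k)"
      by (rule m[rule_format, OF b(2) invertible_matrix_inv[OF gi]])
    have "x ** b ** g = (x ** g) ** ?c"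
      by (simp add: cj_def matrix_inv_inv[OF gi] matrix_mul_assoc matrix_inv_cancel[OF gi])
    then have "f (x ** b ** g) = f (x ** g)" using k[rule_format, OF c n B_closed(3)[OF x g]] by simp
    then show ?thesis using x b g B_closed(3) by (simp add: cind_action_def)
  qed
  then show ?thesis unfolding smooth_fun_def by blast
qed

definition fun_subrep :: "('q^'n^'n \<Rightarrow> 'w) set \<Rightarrow> ('k set, 'w) module \<Rightarrow> bool" where
  "fun_subrep C W \<longleftrightarrow> (\<forall>f\<in>C. f \<in> B \<rightarrow>\<^sub>E carrier W \<and> smooth_fun f) \<and> (\<lambda>x\<in>B. \<zero>\<^bsub>W\<^esub>) \<in> C \<and>
     (\<forall>f\<in>C. \<forall>g\<in>C. (\<lambda>x\<in>B. f x \<oplus>\<^bsub>W\<^esub> g x) \<in> C) \<and>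
     (\<forall>a\<in>carrier A. \<forall>f\<in>C. (\<lambda>x\<in>B. a \<odot>\<^bsub>W\<^esub> f x) \<in> C) \<and>
     (\<forall>g\<in>B. \<forall>f\<in>C. cind_action B g f \<in> C)"

lemma fun_subrep_smooth_rep:
  fixes W :: "('k set, 'w) module"
  assumes W: "module A W" and C: "fun_subrep C W"
  shows "smooth_rep B (fun_module C W) (cind_action B)"
proof -
  interpret W: module A W by (rule W)
  have cl: "f x \<in> carrier W" if "f \<in> C" "x \<in> B" for f x using C that by (auto simp: fun_subrep_def)
  have ex: "f \<in> extensional B" if "f \<in> C" for f using C that by (auto simp: fun_subrep_def PiE_def)
  have sm: "smooth_fun f" if "f \<in> C" for f using C that by (auto simp: fun_subrep_def)
  have zC: "(\<lambda>x\<in>B. \<zero>\<^bsub>W\<^esub>) \<in> C" and aC: "\<And>f g. f \<in> C \<Longrightarrow> g \<in> C \<Longrightarrow> (\<lambda>x\<in>B. f x \<oplus>\<^bsub>W\<^esub> g x) \<in> C"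
    and sC: "\<And>a f. a \<in> carrier A \<Longrightarrow> f \<in> C \<Longrightarrow> (\<lambda>x\<in>B. a \<odot>\<^bsub>W\<^esub> f x) \<in> C"
    and gC: "\<And>g f. g \<in> B \<Longrightarrow> f \<in> C \<Longrightarrow> cind_action B g f \<in> C"
    using C by (auto simp: fun_subrep_def)
  have ag: "abelian_group (fun_module C W)"
  proof (rule abelian_groupI)
    fix f assume f: "f \<in> carrier (fun_module C W)"
    then have fC: "f \<in> C" by simp
    show "\<zero>\<^bsub>fun_module C W\<^esub> \<oplus>\<^bsub>fun_module C W\<^esub> f = f"
      using ex[OF fC] cl[OF fC] by (intro extensionalityI[of _ B]) simp_all
    have m1: "cls (- 1) \<odot>\<^bsub>W\<^esub> w \<oplus>\<^bsub>W\<^esub> w = \<zero>\<^bsub>W\<^esub>" if "w \<in> carrier W" for w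
      using that cls_smult(4,8)[OF W that] by (simp add: W.l_neg)
    have "(\<lambda>x\<in>B. cls (- 1) \<odot>\<^bsub>W\<^esub> f x) \<oplus>\<^bsub>fun_module C W\<^esub> f = \<zero>\<^bsub>fun_module C W\<^esub>"
      using cl[OF fC] m1 unfolding fun_module_simps by (intro restrict_ext) (simp)
    then show "\<exists>g\<in>carrier (fun_module C W). g \<oplus>\<^bsub>fun_module C W\<^esub> f = \<zero>\<^bsub>fun_module C W\<^esub>"
      using sC[OF cls_closed[OF OK_minus[OF OK_1]] fC] by (metis fun_module_simps(1))
    fix g assume "g \<in> carrier (fun_module C W)"
    then have gCC: "g \<in> C" by simp
    show "f \<oplus>\<^bsub>fun_module C W\<^esub> g = g \<oplus>\<^bsub>fun_module C W\<^esub> f"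
      using cl[OF fC] cl[OF gCC] unfolding fun_module_simps by (intro restrict_ext) (simp add: W.a_comm)
    fix k assume "k \<in> carrier (fun_module C W)"
    then have kC: "k \<in> C" by simp
    show "f \<oplus>\<^bsub>fun_module C W\<^esub> g \<oplus>\<^bsub>fun_module C W\<^esub> k = f \<oplus>\<^bsub>fun_module C W\<^esub> (g \<oplus>\<^bsub>fun_module C W\<^esub> k)"
      using cl[OF fC] cl[OF gCC] cl[OF kC] unfolding fun_module_simps by (intro restrict_ext) (simp add: W.a_assoc)
  qed (use zC aC in simp_all)
  have md: "module A (fun_module C W)"
  proof (rule moduleI)
    show "cring A" by (rule A_cring)
    show "abelian_group (fun_module C W)" by (rule ag)
    fix a f assume a: "a \<in> carrier A" and "f \<in> carrier (fun_module C W)"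
    then have fC: "f \<in> C" by simp
    show "a \<odot>\<^bsub>fun_module C W\<^esub> f \<in> carrier (fun_module C W)" using sC[OF a fC] by simp
    fix b assume b: "b \<in> carrier A"
    show "(a \<oplus>\<^bsub>A\<^esub> b) \<odot>\<^bsub>fun_module C W\<^esub> f = a \<odot>\<^bsub>fun_module C W\<^esub> f \<oplus>\<^bsub>fun_module C W\<^esub> b \<odot>\<^bsub>fun_module C W\<^esub> f"
      using a b cl[OF fC] unfolding fun_module_simps by (intro restrict_ext) (simp add: W.smult_l_distr)
    show "(a \<otimes>\<^bsub>A\<^esub> b) \<odot>\<^bsub>fun_module C W\<^esub> f = a \<odot>\<^bsub>fun_module C W\<^esub> (b \<odot>\<^bsub>fun_module C W\<^esub> f)"
      using a b cl[OF fC] unfolding fun_module_simps by (intro restrict_ext) (simp add: W.smult_assoc1)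
  next
    fix a f g assume a: "a \<in> carrier A" and "f \<in> carrier (fun_module C W)" "g \<in> carrier (fun_module C W)"
    then have fC: "f \<in> C" "g \<in> C" by simp_all
    show "a \<odot>\<^bsub>fun_module C W\<^esub> (f \<oplus>\<^bsub>fun_module C W\<^esub> g) = a \<odot>\<^bsub>fun_module C W\<^esub> f \<oplus>\<^bsub>fun_module C W\<^esub> a \<odot>\<^bsub>fun_module C W\<^esub> g"
      using a cl[OF fC(1)] cl[OF fC(2)] unfolding fun_module_simps by (intro restrict_ext) (simp add: W.smult_r_distr)
  next
    fix f assume "f \<in> carrier (fun_module C W)"
    then have fC: "f \<in> C" by simp
    show "\<one>\<^bsub>A\<^esub> \<odot>\<^bsub>fun_module C W\<^esub> f = f"
      using ex[OF fC] cl[OF fC] by (intro extensionalityI[of _ B]) simp_all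
  qed
  show ?thesis
    unfolding smooth_rep_def
  proof (intro conjI ballI)
    show "module A (fun_module C W)" by (rule md)
    show "cind_action B g v \<in> carrier (fun_module C W)" if "g \<in> B" "v \<in> carrier (fun_module C W)" for g v
      using gC that by simp
    show "cind_action B g (v \<oplus>\<^bsub>fun_module C W\<^esub> w) = cind_action B g v \<oplus>\<^bsub>fun_module C W\<^esub> cind_action B g w"
      if "g \<in> B" for g v w
      using that by (simp add: cind_action_def B_closed(3) cong: restrict_cong)
    show "cind_action B g (a \<odot>\<^bsub>fun_module C W\<^esub> v) = a \<odot>\<^bsub>fun_module C W\<^esub> cind_action B g v" if "g \<in> B" for g a v
      using that by (simp add: cind_action_def B_closed(3) cong: restrict_cong)
    show "cind_action B (mat 1) v = v" if "v \<in> carrier (fun_module C W)" for v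
      using ex that by (simp add: cind_action_def extensional_restrict)
    show "cind_action B (g ** g') v = cind_action B g (cind_action B g' v)" if "g \<in> B" "g' \<in> B" for g g' v
      using that by (simp add: cind_action_def B_closed(3) matrix_mul_assoc cong: restrict_cong)
    show "openin (top_of_set B) {g \<in> B. cind_action B g v = v}" if "v \<in> carrier (fun_module C W)" for v
    proof -
      have vC: "v \<in> C" using that by simp
      have "cind_action B g v = v \<longleftrightarrow> (\<forall>x\<in>B. v (x ** g) = v x)" for g
      proof
        assume e: "cind_action B g v = v"
        have "cind_action B g v x = v (x ** g)" if "x \<in> B" for x using that by (simp add: cind_action_def)
        then show "\<forall>x\<in>B. v (x ** g) = v x" using e by simp
      next
        assume "\<forall>x\<in>B. v (x ** g) = v x"
        then show "cind_action B g v = v"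
          by (intro extensionalityI[OF _ ex[OF vC]]) (simp_all add: cind_action_def)
      qed
      then show ?thesis using sm[OF vC] by (simp add: smooth_fun_iff)
    qed
  qed
qed

text \<open>
  Translation by \<open>N\<^sub>0\<close> preserves the degree of the argument, and translation by
  \<open>s\<close> rescales it.
\<close>

theorem D_xi_zero_of_finite_degrees:
  fixes W :: "('k set, 'w) module"
  assumes W: "module A W" and C: "fun_subrep C W"
    and fin: "\<And>f. f \<in> C \<Longrightarrow> finite (deg ` {x \<in> B. f x \<noteq> \<zero>\<^bsub>W\<^esub>})"
  shows "carrier (D_xi (fun_module C W) (cind_action B)) = {\<zero>\<^bsub>D_xi (fun_module C W) (cind_action B)\<^esub>}"
proof -
  interpret W: module A W by (rule W)
  interpret R: borel_rep p Qp \<iota> \<pi> h Fbar GG BB TT NN \<Delta> \<beta>s u T0 \<xi> ell "fun_module C W" "cind_action B"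
    by unfold_locales (rule fun_subrep_smooth_rep[OF W C])
  have ex: "f \<in> extensional B" if "f \<in> C" for f using C that by (auto simp: fun_subrep_def PiE_def)
  let ?supp = "\<lambda>f. deg ` {x \<in> B. f x \<noteq> \<zero>\<^bsub>W\<^esub>}"
  show ?thesis
  proof (rule R.D_xi_zero_of_degree[where supp = ?supp and r = "1 / deg s"])
    show "f = \<zero>\<^bsub>fun_module C W\<^esub>" if "f \<in> carrier (fun_module C W)" "?supp f = {}" for f
      using that ex by (intro extensionalityI[of _ B]) auto
    show "?supp (f \<oplus>\<^bsub>fun_module C W\<^esub> g) \<subseteq> ?supp f \<union> ?supp g" for f g
      unfolding image_Un[symmetric] by (rule image_mono) auto
    show "?supp (cls c \<odot>\<^bsub>fun_module C W\<^esub> f) \<subseteq> ?supp f" if "c \<in> OK" for c f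
      using that by (auto simp: cls_closed)
    show "?supp (cind_action B x f) \<subseteq> ?supp f" if x: "x \<in> N0" for x f
    proof
      fix d assume "d \<in> ?supp (cind_action B x f)"
      then obtain y where y: "y \<in> B" "f (y ** x) \<noteq> \<zero>\<^bsub>W\<^esub>" "d = deg y" by (auto simp: cind_action_def)
      have "deg (y ** x) = d" using deg_mult[OF y(1) N0_in_B[OF x]] deg_NQ[OF N0_in_NQ[OF x]] y(3) by simp
      then show "d \<in> ?supp f" using y B_closed(3)[OF y(1) N0_in_B[OF x]] by blast
    qed
    show "?supp (cind_action B s f) \<subseteq> (\<lambda>d. 1 / deg s * d) ` ?supp f" for f
    proof
      fix d assume "d \<in> ?supp (cind_action B s f)"
      then obtain y where y: "y \<in> B" "f (y ** s) \<noteq> \<zero>\<^bsub>W\<^esub>" "d = deg y" by (auto simp: cind_action_def)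
      have "d = 1 / deg s * deg (y ** s)" using deg_mult[OF y(1) s_in_B] deg_pos[OF s_in_B] y(3) by simp
      then show "d \<in> (\<lambda>d. 1 / deg s * d) ` ?supp f" using y B_closed(3)[OF y(1) s_in_B] by blast
    qed
    show "1 / deg s > 0" "1 / deg s \<noteq> 1" using deg_pos[OF s_in_B] deg_s by auto
  qed (use fin deg_pos in auto)
qed

subsection \<open>Compact induction\<close>

lemma cind_eq_fun_module: "cind J B V0 \<rho>0 = fun_module (carrier (cind J B V0 \<rho>0)) V0"
  by (simp add: cind_def fun_module_def)

lemma cind_carrier:
  "f \<in> carrier (cind J B V0 \<rho>0) \<longleftrightarrow> f \<in> B \<rightarrow>\<^sub>E carrier V0 \<and> (\<forall>j\<in>J. \<forall>x\<in>B. f (j ** x) = \<rho>0 j (f x)) \<and>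
    finite ((\<lambda>x. J #>\<^bsub>mat_group B\<^esub> x) ` {x\<in>B. f x \<noteq> \<zero>\<^bsub>V0\<^esub>}) \<and> smooth_fun f"
  by (simp add: cind_def smooth_fun_iff)

lemma cind_fun_subrep:
  fixes V0 :: "('k set, 'v) module"
  assumes J: "J \<subseteq> B" and rep: "smooth_rep J V0 \<rho>0"
  shows "fun_subrep (carrier (cind J B V0 \<rho>0)) V0"
proof -
  have V0: "module A V0" using rep by (simp add: smooth_rep_def)
  interpret V0: module A V0 by (rule V0)
  have radd: "\<And>j v w. j \<in> J \<Longrightarrow> v \<in> carrier V0 \<Longrightarrow> w \<in> carrier V0 \<Longrightarrow> \<rho>0 j (v \<oplus>\<^bsub>V0\<^esub> w) = \<rho>0 j v \<oplus>\<^bsub>V0\<^esub> \<rho>0 j w"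
    and rsm: "\<And>j a v. j \<in> J \<Longrightarrow> a \<in> carrier A \<Longrightarrow> v \<in> carrier V0 \<Longrightarrow> \<rho>0 j (a \<odot>\<^bsub>V0\<^esub> v) = a \<odot>\<^bsub>V0\<^esub> \<rho>0 j v"
    and rcl: "\<And>j v. j \<in> J \<Longrightarrow> v \<in> carrier V0 \<Longrightarrow> \<rho>0 j v \<in> carrier V0"
    using rep by (auto simp: smooth_rep_def)
  have r0: "\<rho>0 j \<zero>\<^bsub>V0\<^esub> = \<zero>\<^bsub>V0\<^esub>" if "j \<in> J" for j
  proof -
    have "\<rho>0 j \<zero>\<^bsub>V0\<^esub> = \<rho>0 j (\<zero>\<^bsub>A\<^esub> \<odot>\<^bsub>V0\<^esub> \<zero>\<^bsub>V0\<^esub>)" by simp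
    also have "\<dots> = \<zero>\<^bsub>A\<^esub> \<odot>\<^bsub>V0\<^esub> \<rho>0 j \<zero>\<^bsub>V0\<^esub>" using that by (intro rsm) auto
    finally show ?thesis using rcl[OF that V0.zero_closed] by simp
  qed
  have JB: "j ** x \<in> B" if "j \<in> J" "x \<in> B" for j x using that J B_closed(3) by blast
  let ?c = "\<lambda>x. J #>\<^bsub>mat_group B\<^esub> x"
  note cc = cind_carrier
  show ?thesis
    unfolding fun_subrep_def
  proof (intro conjI ballI)
    show "f \<in> B \<rightarrow>\<^sub>E carrier V0" "smooth_fun f" if "f \<in> carrier (cind J B V0 \<rho>0)" for f
      using that by (simp_all add: cc)
    show "(\<lambda>x\<in>B. \<zero>\<^bsub>V0\<^esub>) \<in> carrier (cind J B V0 \<rho>0)"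
      using JB r0 by (simp add: cc smooth_fun_const)
  next
    fix f g assume f: "f \<in> carrier (cind J B V0 \<rho>0)" and g: "g \<in> carrier (cind J B V0 \<rho>0)"
    have cl: "f x \<in> carrier V0" "g x \<in> carrier V0" if "x \<in> B" for x using f g that by (auto simp: cc)
    have "?c ` {x\<in>B. (\<lambda>x\<in>B. f x \<oplus>\<^bsub>V0\<^esub> g x) x \<noteq> \<zero>\<^bsub>V0\<^esub>}
        \<subseteq> ?c ` {x\<in>B. f x \<noteq> \<zero>\<^bsub>V0\<^esub>} \<union> ?c ` {x\<in>B. g x \<noteq> \<zero>\<^bsub>V0\<^esub>}"
      unfolding image_Un[symmetric] by (rule image_mono) auto
    moreover have "finite (?c ` {x\<in>B. f x \<noteq> \<zero>\<^bsub>V0\<^esub>} \<union> ?c ` {x\<in>B. g x \<noteq> \<zero>\<^bsub>V0\<^esub>})"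
      using f g by (simp add: cc)
    ultimately have "finite (?c ` {x\<in>B. (\<lambda>x\<in>B. f x \<oplus>\<^bsub>V0\<^esub> g x) x \<noteq> \<zero>\<^bsub>V0\<^esub>})" by (rule finite_subset)
    moreover have "smooth_fun (\<lambda>x\<in>B. f x \<oplus>\<^bsub>V0\<^esub> g x)" using f g by (intro smooth_fun_add) (simp_all add: cc)
    moreover have "\<forall>j\<in>J. \<forall>x\<in>B. (\<lambda>x\<in>B. f x \<oplus>\<^bsub>V0\<^esub> g x) (j ** x) = \<rho>0 j ((\<lambda>x\<in>B. f x \<oplus>\<^bsub>V0\<^esub> g x) x)"
      using f g cl JB by (simp add: cc radd)
    ultimately show "(\<lambda>x\<in>B. f x \<oplus>\<^bsub>V0\<^esub> g x) \<in> carrier (cind J B V0 \<rho>0)"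
      unfolding cc using cl by auto
  next
    fix a f assume a: "a \<in> carrier A" and f: "f \<in> carrier (cind J B V0 \<rho>0)"
    have cl: "f x \<in> carrier V0" if "x \<in> B" for x using f that by (auto simp: cc)
    have "?c ` {x\<in>B. (\<lambda>x\<in>B. a \<odot>\<^bsub>V0\<^esub> f x) x \<noteq> \<zero>\<^bsub>V0\<^esub>} \<subseteq> ?c ` {x\<in>B. f x \<noteq> \<zero>\<^bsub>V0\<^esub>}"
      using a by auto
    moreover have "finite (?c ` {x\<in>B. f x \<noteq> \<zero>\<^bsub>V0\<^esub>})" using f by (simp add: cc)
    ultimately have "finite (?c ` {x\<in>B. (\<lambda>x\<in>B. a \<odot>\<^bsub>V0\<^esub> f x) x \<noteq> \<zero>\<^bsub>V0\<^esub>})" by (rule finite_subset)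
    moreover have "smooth_fun (\<lambda>x\<in>B. a \<odot>\<^bsub>V0\<^esub> f x)" using f by (intro smooth_fun_smult) (simp add: cc)
    moreover have "\<forall>j\<in>J. \<forall>x\<in>B. (\<lambda>x\<in>B. a \<odot>\<^bsub>V0\<^esub> f x) (j ** x) = \<rho>0 j ((\<lambda>x\<in>B. a \<odot>\<^bsub>V0\<^esub> f x) x)"
      using f a cl JB by (simp add: cc rsm)
    ultimately show "(\<lambda>x\<in>B. a \<odot>\<^bsub>V0\<^esub> f x) \<in> carrier (cind J B V0 \<rho>0)"
      unfolding cc using cl a by auto
  next
    fix g f assume g: "g \<in> B" and f: "f \<in> carrier (cind J B V0 \<rho>0)"
    have gi: "invertible g" using B_closed(1) g by blast
    have val: "cind_action B g f x = f (x ** g)" if "x \<in> B" for x using that by (simp add: cind_action_def)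
    have shift: "?c x = (\<lambda>z. z ** matrix_inv g) ` ?c (x ** g)" for x
      by (simp add: r_coset_def image_UN matrix_mul_assoc matrix_inv_cancel[OF gi])
    have "?c ` {x\<in>B. cind_action B g f x \<noteq> \<zero>\<^bsub>V0\<^esub>}
        \<subseteq> image (\<lambda>z. z ** matrix_inv g) ` ?c ` {x\<in>B. f x \<noteq> \<zero>\<^bsub>V0\<^esub>}"
    proof
      fix D assume "D \<in> ?c ` {x\<in>B. cind_action B g f x \<noteq> \<zero>\<^bsub>V0\<^esub>}"
      then obtain x where x: "x \<in> B" "f (x ** g) \<noteq> \<zero>\<^bsub>V0\<^esub>" "D = ?c x" using val by auto
      then have "x ** g \<in> {x\<in>B. f x \<noteq> \<zero>\<^bsub>V0\<^esub>}" using B_closed(3) g by blast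
      then show "D \<in> image (\<lambda>z. z ** matrix_inv g) ` ?c ` {x\<in>B. f x \<noteq> \<zero>\<^bsub>V0\<^esub>}"
        using x(3) shift[of x] by blast
    qed
    moreover have "finite (image (\<lambda>z. z ** matrix_inv g) ` ?c ` {x\<in>B. f x \<noteq> \<zero>\<^bsub>V0\<^esub>})"
      using f by (simp add: cc)
    ultimately have fin: "finite (?c ` {x\<in>B. cind_action B g f x \<noteq> \<zero>\<^bsub>V0\<^esub>})" by (rule finite_subset)
    have "smooth_fun (cind_action B g f)" using f g by (intro smooth_fun_act) (simp_all add: cc)
    moreover have "\<forall>j\<in>J. \<forall>x\<in>B. cind_action B g f (j ** x) = \<rho>0 j (cind_action B g f x)"
      using f g JB B_closed(3) by (simp add: cc val matrix_mul_assoc[symmetric])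
    moreover have "cind_action B g f \<in> B \<rightarrow>\<^sub>E carrier V0"
      using f g B_closed(3) by (auto simp: cc cind_action_def)
    ultimately show "cind_action B g f \<in> carrier (cind J B V0 \<rho>0)" unfolding cc using fin by blast
  qed
qed

text \<open>
  The degree is constant on cosets of \<open>B\<^sub>0\<close>, so finite support modulo
  \<open>B\<^sub>0\<close> leaves finitely many degrees.
\<close>

theorem D_xi_cind_zero:
  fixes V0 :: "('k set, 'v) module"
  assumes rep: "smooth_rep B0 V0 \<rho>0"
  shows "carrier (D_xi (cind B0 B V0 \<rho>0) (cind_action B)) = {\<zero>\<^bsub>D_xi (cind B0 B V0 \<rho>0) (cind_action B)\<^esub>}"
proof -
  let ?C = "carrier (cind B0 B V0 \<rho>0)"
  have one: "mat 1 \<in> B0"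
  proof -
    have "mat 1 = mat 1 ** (mat 1 :: 'q^'n^'n)" by simp
    then show ?thesis unfolding B0_def
      using N0_closed(2) matrix_subgroupD(2)[OF T0_subgroup] by blast
  qed
  have "carrier (D_xi (fun_module ?C V0) (cind_action B)) = {\<zero>\<^bsub>D_xi (fun_module ?C V0) (cind_action B)\<^esub>}"
  proof (rule D_xi_zero_of_finite_degrees)
    show "module A V0" using rep by (simp add: smooth_rep_def)
    show "fun_subrep ?C V0" using B0_in_B by (intro cind_fun_subrep rep) auto
    fix f assume f: "f \<in> ?C"
    let ?c = "\<lambda>x. B0 #>\<^bsub>mat_group B\<^esub> x"
    \<comment> \<open>the degree is constant on the cosets of \<open>B\<^sub>0\<close>\<close>
    have "deg x = deg (SOME y. y \<in> ?c x)" if "x \<in> B" for x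
    proof -
      have "x \<in> ?c x" using one by (auto simp: r_coset_def intro!: bexI[of _ "mat 1"])
      then have "(SOME y. y \<in> ?c x) \<in> ?c x" by (rule someI)
      then obtain j where "j \<in> B0" "(SOME y. y \<in> ?c x) = j ** x" by (auto simp: r_coset_def)
      then show ?thesis using deg_mult[OF B0_in_B that] deg_B0 by simp
    qed
    then have "deg ` {x \<in> B. f x \<noteq> \<zero>\<^bsub>V0\<^esub>} \<subseteq> (\<lambda>D. deg (SOME y. y \<in> D)) ` ?c ` {x \<in> B. f x \<noteq> \<zero>\<^bsub>V0\<^esub>}"
      by (auto simp: image_image)
    moreover have "finite ((\<lambda>D. deg (SOME y. y \<in> D)) ` ?c ` {x \<in> B. f x \<noteq> \<zero>\<^bsub>V0\<^esub>})"
      using f by (simp add: cind_carrier)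
    ultimately show "finite (deg ` {x \<in> B. f x \<noteq> \<zero>\<^bsub>V0\<^esub>})" by (rule finite_subset)
  qed
  then show ?thesis using cind_eq_fun_module[of B0 V0 \<rho>0] by simp
qed

section \<open>A surjection from a representation with degrees\<close>

definition torus_inv :: "('k set, 'w) module \<Rightarrow> ('q^'n^'n \<Rightarrow> 'w) set" where
  "torus_inv W = {f \<in> B \<rightarrow>\<^sub>E carrier W. smooth_fun f \<and> (\<forall>t\<in>TQ. \<forall>x\<in>B. f (t ** x) = f x)}"

definition degrees :: "('k set, 'w) module \<Rightarrow> ('q^'n^'n \<Rightarrow> 'w) \<Rightarrow> real set" where
  "degrees W f = deg ` {x \<in> B. f x \<noteq> \<zero>\<^bsub>W\<^esub>}"

text \<open>
  A nonzero function that is invariant under all of \<open>T\<close> has infinitely many degrees, so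
  invariance is required only under the kernel of \<open>deg\<close> on \<open>T\<close>.
\<close>

definition graded_inv :: "('k set, 'w) module \<Rightarrow> ('q^'n^'n \<Rightarrow> 'w) set" where
  "graded_inv W = {f \<in> B \<rightarrow>\<^sub>E carrier W. smooth_fun f \<and>
     (\<forall>t\<in>TQ. deg t = 1 \<longrightarrow> (\<forall>x\<in>B. f (t ** x) = f x)) \<and> finite (degrees W f)}"

lemma TQ_mult_B: "t \<in> TQ \<Longrightarrow> x \<in> B \<Longrightarrow> t ** x \<in> B" using TQ_in_B B_closed(3) by blast

lemma torus_inv_subrep:
  assumes W: "module A W" shows "fun_subrep (torus_inv W) W"
proof -
  interpret W: module A W by (rule W)
  show ?thesis
    unfolding fun_subrep_def torus_inv_def
    by (intro conjI ballI)
      (auto simp: TQ_mult_B smooth_fun_const smooth_fun_add smooth_fun_smult smooth_fun_act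
        cind_action_def[of _ _ _, abs_def] B_closed(3) matrix_mul_assoc[symmetric]
        intro!: smooth_fun_act[unfolded cind_action_def])
qed

lemma degrees_add: "module A W \<Longrightarrow> degrees W (\<lambda>x\<in>B. f x \<oplus>\<^bsub>W\<^esub> g x) \<subseteq> degrees W f \<union> degrees W g"
proof -
  assume "module A W"
  then interpret W: module A W .
  show ?thesis unfolding degrees_def image_Un[symmetric] by (rule image_mono) auto
qed

lemma degrees_smult: "module A W \<Longrightarrow> a \<in> carrier A \<Longrightarrow> degrees W (\<lambda>x\<in>B. a \<odot>\<^bsub>W\<^esub> f x) \<subseteq> degrees W f"
  unfolding degrees_def by (auto simp: module.smult_r_null)

lemma degrees_act: "g \<in> B \<Longrightarrow> degrees W f = (\<lambda>d. d * deg g) ` degrees W (cind_action B g f)"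
proof -
  assume g: "g \<in> B"
  then have gi: "invertible g" "matrix_inv g \<in> B" using B_closed by blast+
  show ?thesis
  proof (intro equalityI subsetI)
    fix d assume "d \<in> degrees W f"
    then obtain y where y: "y \<in> B" "f y \<noteq> \<zero>\<^bsub>W\<^esub>" "d = deg y" by (auto simp: degrees_def)
    let ?x = "y ** matrix_inv g"
    have x: "?x \<in> B" "?x ** g = y" using y(1) gi B_closed(3) by (auto simp: matrix_inv_cancel)
    then have "deg ?x \<in> degrees W (cind_action B g f)" using y(2) by (auto simp: degrees_def cind_action_def)
    moreover have "d = deg ?x * deg g" using deg_mult[OF x(1) g] x(2) y(3) by simp
    ultimately show "d \<in> (\<lambda>d. d * deg g) ` degrees W (cind_action B g f)" by blast
  next
    fix d assume "d \<in> (\<lambda>d. d * deg g) ` degrees W (cind_action B g f)"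
    then obtain x where x: "x \<in> B" "f (x ** g) \<noteq> \<zero>\<^bsub>W\<^esub>" "d = deg x * deg g"
      by (auto simp: degrees_def cind_action_def)
    then show "d \<in> degrees W f" using deg_mult[OF x(1) g] B_closed(3)[OF x(1) g]
      by (auto simp: degrees_def intro!: image_eqI[of _ _ "x ** g"])
  qed
qed

lemma graded_inv_subrep:
  assumes W: "module A W" shows "fun_subrep (graded_inv W) W"
proof -
  interpret W: module A W by (rule W)
  have fa: "finite (degrees W (\<lambda>x\<in>B. f x \<oplus>\<^bsub>W\<^esub> g x))" if "finite (degrees W f)" "finite (degrees W g)" for f g
    using degrees_add[OF W] that by (meson finite_UnI finite_subset)
  have fs: "finite (degrees W (\<lambda>x\<in>B. a \<odot>\<^bsub>W\<^esub> f x))" if "a \<in> carrier A" "finite (degrees W f)" for a f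
    using degrees_smult[OF W] that by (meson finite_subset)
  have fg: "finite (degrees W (cind_action B g f))" if g: "g \<in> B" and f: "finite (degrees W f)" for g f
  proof (rule finite_imageD[of "\<lambda>d. d * deg g"])
    show "finite ((\<lambda>d. d * deg g) ` degrees W (cind_action B g f))" using degrees_act[OF g, of W f] f by simp
    show "inj_on (\<lambda>d. d * deg g) (degrees W (cind_action B g f))" using deg_pos[OF g] by (auto simp: inj_on_def)
  qed
  have f0: "finite (degrees W (\<lambda>x\<in>B. \<zero>\<^bsub>W\<^esub>))" by (simp add: degrees_def)
  have val: "cind_action B g f x = f (x ** g)" if "x \<in> B" for g f x using that by (simp add: cind_action_def)
  have cla: "cind_action B g f \<in> B \<rightarrow>\<^sub>E carrier W" if "g \<in> B" "f \<in> B \<rightarrow>\<^sub>E carrier W" for g f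
    using that B_closed(3) by (auto simp: cind_action_def)
  have cl: "f x \<in> carrier W" if "f \<in> B \<rightarrow>\<^sub>E carrier W" "x \<in> B" for f x using that by auto
  show ?thesis
    unfolding fun_subrep_def graded_inv_def
    by (intro conjI ballI)
      (simp_all add: TQ_mult_B smooth_fun_const smooth_fun_add smooth_fun_smult smooth_fun_act
        fa fs fg f0 val cla cl B_closed(3) matrix_mul_assoc[symmetric])
qed

text \<open>
  The value at any translate of \<open>x\<close> by \<open>T\<close> that has degree
  \<open>d\<close>; for functions in \<open>graded_inv\<close> it does not depend on the translate.
\<close>

definition translate_value :: "('q^'n^'n \<Rightarrow> 'w) \<Rightarrow> real \<Rightarrow> 'q^'n^'n \<Rightarrow> 'w" where
  "translate_value f d x = f ((SOME t. t \<in> TQ \<and> deg (t ** x) = d) ** x)"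

text \<open>
  The sum of the translates over \<open>T\<close> modulo its elements of degree \<open>1\<close>,
  which are indexed by their degrees.
\<close>

definition torus_sum :: "('k set, 'w) module \<Rightarrow> ('q^'n^'n \<Rightarrow> 'w) \<Rightarrow> 'q^'n^'n \<Rightarrow> 'w" where
  "torus_sum W f = (\<lambda>x\<in>B. finsum W (\<lambda>d. translate_value f d x) (degrees W f))"

lemma translate_exists:
  assumes "d \<in> deg ` B" "x \<in> B"
  shows "\<exists>t\<in>TQ. deg (t ** x) = d"
proof -
  obtain y where y: "y \<in> B" "d = deg y" using assms(1) by blast
  obtain t n where t: "t \<in> TQ" "n \<in> NQ" "y = t ** n" using y(1) unfolding B_eq by blast
  obtain t' n' where t': "t' \<in> TQ" "n' \<in> NQ" "x = t' ** n'" using assms(2) unfolding B_eq by blast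
  have i: "invertible t'" using TQ_closed(1) t'(1) by blast
  let ?t = "t ** matrix_inv t'"
  have T: "?t \<in> TQ" using t t' TQ_closed by blast
  have "?t ** x = t ** n'" by (simp add: t'(3) matrix_mul_assoc matrix_inv_cancel[OF i])
  then have "deg (?t ** x) = deg t" using deg_mult[OF TQ_in_B[OF t(1)] NQ_in_B[OF t'(2)]] deg_NQ[OF t'(2)] by simp
  also have "\<dots> = d" using deg_mult[OF TQ_in_B[OF t(1)] NQ_in_B[OF t(2)]] deg_NQ[OF t(2)] y t(3) by simp
  finally show ?thesis using T by blast
qed

lemma translate_value_eq:
  assumes f: "f \<in> graded_inv W" and t: "t \<in> TQ" and x: "x \<in> B"
  shows "translate_value f (deg (t ** x)) x = f (t ** x)"
proof -
  define t0 where "t0 = (SOME t'. t' \<in> TQ \<and> deg (t' ** x) = deg (t ** x))"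
  have "t0 \<in> TQ \<and> deg (t0 ** x) = deg (t ** x)" unfolding t0_def by (rule someI[of _ t]) (simp add: t)
  then have t0: "t0 \<in> TQ" "deg (t0 ** x) = deg (t ** x)" by auto
  have i: "invertible t" using TQ_closed(1) t by blast
  have dt: "deg t0 = deg t"
    using t0 deg_mult[OF TQ_in_B[OF t0(1)] x] deg_mult[OF TQ_in_B[OF t] x] deg_pos[OF x] by simp
  let ?r = "t0 ** matrix_inv t"
  have r: "?r \<in> TQ" using t0 t TQ_closed by blast
  have rt: "?r ** t = t0" by (simp add: matrix_inv_cancel[OF i])
  have "deg ?r * deg t = deg t" using deg_mult[OF TQ_in_B[OF r] TQ_in_B[OF t]] rt dt by simp
  then have "deg ?r = 1" using deg_pos[OF TQ_in_B[OF t]] by simp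
  then have "f (?r ** (t ** x)) = f (t ** x)"
    using f r TQ_mult_B[OF t x] by (simp add: graded_inv_def)
  moreover have "?r ** (t ** x) = t0 ** x" using rt by (simp add: matrix_mul_assoc)
  ultimately show ?thesis by (simp add: translate_value_def t0_def)
qed

lemma translate_value_ex:
  assumes f: "f \<in> graded_inv W" and d: "d \<in> deg ` B" and x: "x \<in> B"
  obtains t where "t \<in> TQ" "deg (t ** x) = d" "translate_value f d x = f (t ** x)"
  using translate_exists[OF d x] translate_value_eq[OF f _ x] by blast

lemma degrees_in: "degrees W f \<subseteq> deg ` B" by (auto simp: degrees_def)

lemma graded_inv_closed: "f \<in> graded_inv W \<Longrightarrow> x \<in> B \<Longrightarrow> f x \<in> carrier W"
  by (auto simp: graded_inv_def)

lemma translate_value_closed: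
  "f \<in> graded_inv W \<Longrightarrow> d \<in> deg ` B \<Longrightarrow> x \<in> B \<Longrightarrow> translate_value f d x \<in> carrier W"
  by (metis translate_value_ex graded_inv_closed TQ_mult_B)

lemma torus_sum_superset:
  assumes W: "module A W" and f: "f \<in> graded_inv W" and x: "x \<in> B"
    and E: "finite E" "degrees W f \<subseteq> E" "E \<subseteq> deg ` B"
  shows "torus_sum W f x = finsum W (\<lambda>d. translate_value f d x) E"
proof -
  interpret W: module A W by (rule W)
  have "finsum W (\<lambda>d. translate_value f d x) (degrees W f) = finsum W (\<lambda>d. translate_value f d x) E"
  proof (rule W.add.finprod_mono_neutral_cong_left[OF E(1,2)])
    fix d assume d: "d \<in> E - degrees W f"
    then obtain t where t: "t \<in> TQ" "deg (t ** x) = d" "translate_value f d x = f (t ** x)"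
      using translate_value_ex[OF f _ x] E(3) by blast
    then show "translate_value f d x = \<zero>\<^bsub>W\<^esub>"
      using d TQ_mult_B[OF t(1) x] by (auto simp: degrees_def)
  qed (use translate_value_closed[OF f _ x] E(3) in auto)
  then show ?thesis using x by (simp add: torus_sum_def)
qed

lemma torus_sum_closed:
  assumes W: "module A W" and f: "f \<in> graded_inv W" and x: "x \<in> B"
  shows "torus_sum W f x \<in> carrier W"
proof -
  interpret W: module A W by (rule W)
  show ?thesis unfolding torus_sum_def using x translate_value_closed[OF f _ x] degrees_in[of W f]
    by (auto intro!: W.finsum_closed)
qed

lemma torus_sum_add:
  assumes W: "module A W" and f: "f \<in> graded_inv W" and g: "g \<in> graded_inv W"
  shows "torus_sum W (\<lambda>x\<in>B. f x \<oplus>\<^bsub>W\<^esub> g x) = (\<lambda>x\<in>B. torus_sum W f x \<oplus>\<^bsub>W\<^esub> torus_sum W g x)"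
proof (rule extensionalityI[of _ B])
  interpret W: module A W by (rule W)
  fix x assume x: "x \<in> B"
  let ?fg = "\<lambda>x\<in>B. f x \<oplus>\<^bsub>W\<^esub> g x"
  have fg: "?fg \<in> graded_inv W" using graded_inv_subrep[OF W] f g by (simp add: fun_subrep_def)
  let ?E = "degrees W f \<union> degrees W g"
  have E: "finite ?E" "?E \<subseteq> deg ` B" using f g degrees_in by (auto simp: graded_inv_def)
  have cl: "(\<lambda>d. translate_value f d x) \<in> ?E \<rightarrow> carrier W" "(\<lambda>d. translate_value g d x) \<in> ?E \<rightarrow> carrier W"
    using translate_value_closed[OF f _ x] translate_value_closed[OF g _ x] E(2) by auto
  have "torus_sum W ?fg x = finsum W (\<lambda>d. translate_value ?fg d x) ?E"
    by (rule torus_sum_superset[OF W fg x E(1) degrees_add[OF W] E(2)])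
  also have "\<dots> = finsum W (\<lambda>d. translate_value f d x \<oplus>\<^bsub>W\<^esub> translate_value g d x) ?E"
  proof (rule W.finsum_cong')
    fix d assume "d \<in> ?E"
    then obtain t where t: "t \<in> TQ" "deg (t ** x) = d" using translate_exists[OF _ x] E(2) by blast
    show "translate_value ?fg d x = translate_value f d x \<oplus>\<^bsub>W\<^esub> translate_value g d x"
      unfolding t(2)[symmetric] translate_value_eq[OF f t(1) x] translate_value_eq[OF g t(1) x]
        translate_value_eq[OF fg t(1) x] using TQ_mult_B[OF t(1) x] by simp
  qed (use cl in auto)
  also have "\<dots> = finsum W (\<lambda>d. translate_value f d x) ?E \<oplus>\<^bsub>W\<^esub> finsum W (\<lambda>d. translate_value g d x) ?E"
    by (rule W.finsum_addf[OF cl])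
  also have "\<dots> = torus_sum W f x \<oplus>\<^bsub>W\<^esub> torus_sum W g x"
    using torus_sum_superset[OF W f x E(1) _ E(2)] torus_sum_superset[OF W g x E(1) _ E(2)] by simp
  finally show "torus_sum W ?fg x = (\<lambda>x\<in>B. torus_sum W f x \<oplus>\<^bsub>W\<^esub> torus_sum W g x) x" using x by simp
qed (simp_all add: torus_sum_def)

lemma torus_sum_smult:
  assumes W: "module A W" and f: "f \<in> graded_inv W" and a: "a \<in> carrier A"
  shows "torus_sum W (\<lambda>x\<in>B. a \<odot>\<^bsub>W\<^esub> f x) = (\<lambda>x\<in>B. a \<odot>\<^bsub>W\<^esub> torus_sum W f x)"
proof (rule extensionalityI[of _ B])
  interpret W: module A W by (rule W)
  fix x assume x: "x \<in> B"
  let ?af = "\<lambda>x\<in>B. a \<odot>\<^bsub>W\<^esub> f x"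
  have af: "?af \<in> graded_inv W" using graded_inv_subrep[OF W] f a by (simp add: fun_subrep_def)
  let ?E = "degrees W f"
  have E: "finite ?E" "?E \<subseteq> deg ` B" using f degrees_in by (auto simp: graded_inv_def)
  have cl: "(\<lambda>d. translate_value f d x) \<in> ?E \<rightarrow> carrier W"
    using translate_value_closed[OF f _ x] E(2) by auto
  have "torus_sum W ?af x = finsum W (\<lambda>d. translate_value ?af d x) ?E"
    by (rule torus_sum_superset[OF W af x E(1) degrees_smult[OF W a] E(2)])
  also have "\<dots> = finsum W (\<lambda>d. a \<odot>\<^bsub>W\<^esub> translate_value f d x) ?E"
  proof (rule W.finsum_cong')
    fix d assume "d \<in> ?E"
    then obtain t where t: "t \<in> TQ" "deg (t ** x) = d" using translate_exists[OF _ x] E(2) by blast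
    show "translate_value ?af d x = a \<odot>\<^bsub>W\<^esub> translate_value f d x"
      unfolding t(2)[symmetric] translate_value_eq[OF f t(1) x] translate_value_eq[OF af t(1) x]
      using TQ_mult_B[OF t(1) x] by simp
  qed (use cl a in auto)
  also have "\<dots> = a \<odot>\<^bsub>W\<^esub> finsum W (\<lambda>d. translate_value f d x) ?E"
    by (rule W.finsum_smult_ldistr[OF E(1) a cl, symmetric])
  finally show "torus_sum W ?af x = (\<lambda>x\<in>B. a \<odot>\<^bsub>W\<^esub> torus_sum W f x) x" using x by (simp add: torus_sum_def)
qed (simp_all add: torus_sum_def)

text \<open>
  Right translation by \<open>g\<close> multiplies all degrees by a constant, which reindexes the
  sum.
\<close>

lemma torus_sum_act:
  assumes W: "module A W" and f: "f \<in> graded_inv W" and g: "g \<in> B"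
  shows "torus_sum W (cind_action B g f) = cind_action B g (torus_sum W f)"
proof (rule extensionalityI[of _ B])
  interpret W: module A W by (rule W)
  fix x assume x: "x \<in> B"
  let ?gf = "cind_action B g f"
  have gf: "?gf \<in> graded_inv W" using graded_inv_subrep[OF W] f g by (simp add: fun_subrep_def)
  have xg: "x ** g \<in> B" using B_closed(3) x g by blast
  have cl: "(\<lambda>d. translate_value f d (x ** g)) \<in> (\<lambda>d. d * deg g) ` degrees W ?gf \<rightarrow> carrier W"
    using translate_value_closed[OF f _ xg] degrees_in[of W f] unfolding degrees_act[OF g, symmetric] by auto
  have inj: "inj_on (\<lambda>d. d * deg g) (degrees W ?gf)" using deg_pos[OF g] by (auto simp: inj_on_def)
  have "cind_action B g (torus_sum W f) x = finsum W (\<lambda>d. translate_value f d (x ** g)) (degrees W f)"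
    using x xg by (simp add: cind_action_def torus_sum_def)
  also have "\<dots> = finsum W (\<lambda>d. translate_value f (d * deg g) (x ** g)) (degrees W ?gf)"
    using W.finsum_reindex[OF cl inj] degrees_act[OF g, of W f] by simp
  also have "\<dots> = finsum W (\<lambda>d. translate_value ?gf d x) (degrees W ?gf)"
  proof (rule W.finsum_cong')
    show "(\<lambda>d. translate_value ?gf d x) \<in> degrees W ?gf \<rightarrow> carrier W"
      using translate_value_closed[OF gf _ x] degrees_in[of W ?gf] by auto
    fix d assume "d \<in> degrees W ?gf"
    then obtain t where t: "t \<in> TQ" "deg (t ** x) = d" using translate_exists[OF _ x] degrees_in[of W ?gf] by blast
    have tx: "t ** x \<in> B" by (rule TQ_mult_B[OF t(1) x])
    have "deg (t ** (x ** g)) = d * deg g" using deg_mult[OF tx g] t(2) by (simp add: matrix_mul_assoc)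
    then have "translate_value f (d * deg g) (x ** g) = f (t ** (x ** g))"
      using translate_value_eq[OF f t(1) xg] by simp
    also have "\<dots> = ?gf (t ** x)" using tx by (simp add: cind_action_def matrix_mul_assoc)
    also have "\<dots> = translate_value ?gf d x" using translate_value_eq[OF gf t(1) x] t(2) by simp
    finally show "translate_value f (d * deg g) (x ** g) = translate_value ?gf d x" .
  qed simp
  finally show "torus_sum W ?gf x = cind_action B g (torus_sum W f) x" using x by (simp add: torus_sum_def)
qed (simp_all add: torus_sum_def cind_action_def)

lemma torus_sum_in:
  assumes W: "module A W" and f: "f \<in> graded_inv W"
  shows "torus_sum W f \<in> torus_inv W"
proof -
  interpret W: module A W by (rule W)
  have ext: "torus_sum W f \<in> B \<rightarrow>\<^sub>E carrier W"
    using torus_sum_closed[OF W f] by (auto simp: torus_sum_def)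
  have fext: "f \<in> extensional B" using f by (auto simp: graded_inv_def PiE_def)
  obtain k where k: "\<forall>g\<in>B. g - mat 1 \<in> mball (1 / real p ^ k) \<longrightarrow> (\<forall>x\<in>B. f (x ** g) = f x)"
    using f unfolding graded_inv_def smooth_fun_def by blast
  have "torus_sum W f (x ** g) = torus_sum W f x"
    if g: "g \<in> B" "g - mat 1 \<in> mball (1 / real p ^ k)" and x: "x \<in> B" for g x
  proof -
    have "cind_action B g f = f"
      using k g by (intro extensionalityI[OF _ fext]) (auto simp: cind_action_def)
    then have "torus_sum W f = cind_action B g (torus_sum W f)" using torus_sum_act[OF W f g(1)] by simp
    then have "torus_sum W f x = cind_action B g (torus_sum W f) x" by simp
    then show ?thesis using x by (simp add: cind_action_def)
  qed
  then have sm: "smooth_fun (torus_sum W f)" unfolding smooth_fun_def by blast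
  have "torus_sum W f (t ** x) = torus_sum W f x" if t: "t \<in> TQ" and x: "x \<in> B" for t x
  proof -
    have tx: "t ** x \<in> B" by (rule TQ_mult_B[OF t x])
    have "finsum W (\<lambda>d. translate_value f d (t ** x)) (degrees W f) = finsum W (\<lambda>d. translate_value f d x) (degrees W f)"
    proof (rule W.finsum_cong')
      show "(\<lambda>d. translate_value f d x) \<in> degrees W f \<rightarrow> carrier W"
        using translate_value_closed[OF f _ x] degrees_in[of W f] by auto
      fix d assume "d \<in> degrees W f"
      then obtain t' where t': "t' \<in> TQ" "deg (t' ** (t ** x)) = d" using translate_exists[OF _ tx] degrees_in[of W f] by blast
      have tt: "t' ** t \<in> TQ" using t t' TQ_closed(3) by blast
      show "translate_value f d (t ** x) = translate_value f d x"
        using translate_value_eq[OF f t'(1) tx] translate_value_eq[OF f tt x] t'(2) by (simp add: matrix_mul_assoc)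
    qed simp
    then show ?thesis using x tx by (simp add: torus_sum_def)
  qed
  then show ?thesis using ext sm by (simp add: torus_inv_def)
qed

text \<open>
  The restriction of a \<open>T\<close>-invariant function to the elements of degree
  \<open>1\<close> is a preimage: exactly one of its translates is nonzero at a given point.
\<close>

lemma torus_sum_surj:
  assumes W: "module A W" and f: "f \<in> torus_inv W"
  shows "\<exists>\<phi>\<in>graded_inv W. torus_sum W \<phi> = f"
proof -
  interpret W: module A W by (rule W)
  have fcl: "f x \<in> carrier W" if "x \<in> B" for x using f that by (auto simp: torus_inv_def)
  have fext: "f \<in> extensional B" using f by (auto simp: torus_inv_def PiE_def)
  define \<phi> where "\<phi> = (\<lambda>x\<in>B. if deg x = 1 then f x else \<zero>\<^bsub>W\<^esub>)"
  obtain k where k: "\<forall>g\<in>B. g - mat 1 \<in> mball (1 / real p ^ k) \<longrightarrow> (\<forall>x\<in>B. f (x ** g) = f x)"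
    using f unfolding torus_inv_def smooth_fun_def by blast
  obtain l where l: "\<forall>b\<in>B. b - mat 1 \<in> mball (1 / real p ^ l) \<longrightarrow> deg b = 1"
    using B_decomp_near_1[of 0] by blast
  have "\<phi> (x ** g) = \<phi> x" if g: "g \<in> B" "g - mat 1 \<in> mball (1 / real p ^ max k l)" and x: "x \<in> B" for g x
  proof -
    have "g - mat 1 \<in> mball (1 / real p ^ k)" "g - mat 1 \<in> mball (1 / real p ^ l)"
      using g(2) mball_mono inverse_p_power_mono[of k "max k l"] inverse_p_power_mono[of l "max k l"] by auto
    then have "f (x ** g) = f x" "deg g = 1" using k l g(1) x by simp_all
    then show ?thesis using x g(1) B_closed(3) deg_mult[OF x g(1)] by (simp add: \<phi>_def)
  qed
  then have sm: "smooth_fun \<phi>" unfolding smooth_fun_def by blast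
  have "degrees W \<phi> \<subseteq> {1}" by (auto simp: degrees_def \<phi>_def split: if_splits)
  then have dg1: "degrees W \<phi> \<subseteq> {1}" "finite (degrees W \<phi>)" using finite_subset by auto
  have tinv: "f (t ** x) = f x" if "t \<in> TQ" "x \<in> B" for t x using f that by (simp add: torus_inv_def)
  have \<phi>: "\<phi> \<in> graded_inv W"
    unfolding graded_inv_def using sm dg1(2) fcl
    by (auto simp: \<phi>_def TQ_mult_B tinv deg_mult[OF TQ_in_B])
  have one: "1 \<in> deg ` B" using deg_one B_closed(2) by (metis imageI)
  have "torus_sum W \<phi> = f"
  proof (rule extensionalityI[OF _ fext])
    fix x assume x: "x \<in> B"
    obtain t where t: "t \<in> TQ" "deg (t ** x) = 1" "translate_value \<phi> 1 x = \<phi> (t ** x)"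
      using translate_value_ex[OF \<phi> one x] by blast
    have v: "translate_value \<phi> 1 x = f x" using t tinv[OF t(1) x] TQ_mult_B[OF t(1) x] by (simp add: \<phi>_def)
    have "torus_sum W \<phi> x = finsum W (\<lambda>d. translate_value \<phi> d x) {1}"
      using one by (intro torus_sum_superset[OF W \<phi> x _ dg1(1)]) auto
    also have "\<dots> = f x" using fcl[OF x] v by (simp add: W.finsum_insert W.finsum_empty Pi_def)
    finally show "torus_sum W \<phi> x = f x" .
  qed (simp add: torus_sum_def)
  then show ?thesis using \<phi> by blast
qed

text \<open>
  The middle term of the sequence \<open>0 \<rightarrow> ker \<rightarrow> graded_inv \<rightarrow>
  torus_inv \<rightarrow> 0\<close> has trivial \<open>D_xi\<close>, into which that of the quotient
  would embed by exactness.
\<close>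

theorem exact_imp_torus_inv_trivial:
  fixes W :: "('k set, 'w) module"
  assumes W: "module A W" and ex: "D_xi_exact TYPE('q^'n^'n \<Rightarrow> 'w)"
    and y: "y \<in> carrier (D_xi (fun_module (torus_inv W) W) (cind_action B))"
    and z: "z \<in> carrier (D_xi (fun_module (torus_inv W) W) (cind_action B))"
  shows "y = z"
proof -
  interpret W: module A W by (rule W)
  let ?V2 = "fun_module (graded_inv W) W" and ?V3 = "fun_module (torus_inv W) W"
  let ?C1 = "{f \<in> graded_inv W. torus_sum W f = (\<lambda>x\<in>B. \<zero>\<^bsub>W\<^esub>)}"
  let ?V1 = "fun_module ?C1 W"
  let ?a = "cind_action B"
  have G: "fun_subrep (graded_inv W) W" by (rule graded_inv_subrep[OF W])
  have s2: "smooth_rep B ?V2 ?a" by (rule fun_subrep_smooth_rep[OF W G])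
  have s3: "smooth_rep B ?V3 ?a" by (rule fun_subrep_smooth_rep[OF W torus_inv_subrep[OF W]])
  have z0: "torus_sum W (\<lambda>x\<in>B. \<zero>\<^bsub>W\<^esub>) = (\<lambda>x\<in>B. \<zero>\<^bsub>W\<^esub>)"
    by (simp add: torus_sum_def degrees_def W.finsum_empty cong: restrict_cong)
  have "fun_subrep ?C1 W"
    unfolding fun_subrep_def
  proof (intro conjI ballI)
    show "f \<in> B \<rightarrow>\<^sub>E carrier W" "smooth_fun f" if "f \<in> ?C1" for f using G that by (auto simp: fun_subrep_def)
    show "(\<lambda>x\<in>B. \<zero>\<^bsub>W\<^esub>) \<in> ?C1" using G z0 by (simp add: fun_subrep_def)
    show "(\<lambda>x\<in>B. f x \<oplus>\<^bsub>W\<^esub> g x) \<in> ?C1" if "f \<in> ?C1" "g \<in> ?C1" for f g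
      using G that by (simp add: fun_subrep_def torus_sum_add[OF W] cong: restrict_cong)
    show "(\<lambda>x\<in>B. a \<odot>\<^bsub>W\<^esub> f x) \<in> ?C1" if "a \<in> carrier A" "f \<in> ?C1" for a f
      using G that by (simp add: fun_subrep_def torus_sum_smult[OF W] cong: restrict_cong)
    show "cind_action B g f \<in> ?C1" if "g \<in> B" "f \<in> ?C1" for g f
      using G that B_closed(3)
      by (simp add: fun_subrep_def torus_sum_act[OF W]) (simp add: cind_action_def cong: restrict_cong)
  qed
  then have s1: "smooth_rep B ?V1 ?a" by (rule fun_subrep_smooth_rep[OF W])
  have h1: "rep_hom B ?V1 ?a ?V2 ?a (\<lambda>f. f)" by (simp add: rep_hom_def)
  have h2: "rep_hom B ?V2 ?a ?V3 ?a (torus_sum W)"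
    by (simp add: rep_hom_def torus_sum_in[OF W] torus_sum_add[OF W] torus_sum_smult[OF W] torus_sum_act[OF W])
  have i1: "inj_on (\<lambda>f. f) (carrier ?V1)" by simp
  have k1: "(\<lambda>f. f) ` carrier ?V1 = {v \<in> carrier ?V2. torus_sum W v = \<zero>\<^bsub>?V3\<^esub>}" by simp
  have su: "torus_sum W ` carrier ?V2 = carrier ?V3"
  proof (intro equalityI subsetI)
    fix f assume "f \<in> carrier ?V3"
    then show "f \<in> torus_sum W ` carrier ?V2" using torus_sum_surj[OF W, of f] by auto
  qed (auto simp: torus_sum_in[OF W])
  note E = ex[unfolded D_xi_exact_def, rule_format, OF conjI, OF s1 conjI, OF s2 conjI, OF s3 conjI, OF h1 conjI,
      OF h2 conjI, OF i1 conjI, OF k1 su]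
  have inj: "inj_on (D_xi_map ?V2 ?a (torus_sum W)) (carrier (D_xi ?V3 ?a))"
    and im: "D_xi_map ?V2 ?a (torus_sum W) ` carrier (D_xi ?V3 ?a) =
        {y \<in> carrier (D_xi ?V2 ?a). D_xi_map ?V1 ?a (\<lambda>f. f) y = \<zero>\<^bsub>D_xi ?V1 ?a\<^esub>}"
    using E by (rule conjunct1, rule conjunct1[OF conjunct2])
  have D2: "carrier (D_xi ?V2 ?a) = {\<zero>\<^bsub>D_xi ?V2 ?a\<^esub>}"
    by (rule D_xi_zero_of_finite_degrees[OF W G]) (simp add: graded_inv_def degrees_def)
  have "D_xi_map ?V2 ?a (torus_sum W) y \<in> carrier (D_xi ?V2 ?a)" "D_xi_map ?V2 ?a (torus_sum W) z \<in> carrier (D_xi ?V2 ?a)"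
    using im y z by blast+
  then have "D_xi_map ?V2 ?a (torus_sum W) y = D_xi_map ?V2 ?a (torus_sum W) z" unfolding D2 by simp
  then show ?thesis by (rule inj_onD[OF inj _ y z])
qed

end

section \<open>The behaviour of \<open>ell\<close>\<close>

context borel_setting
begin

lemma ell_in_Zp: "x \<in> N0 \<Longrightarrow> ell x \<in> Zp"
  using ell_surj by (auto simp: N0_def)

lemma ell_surjE: "z \<in> Zp \<Longrightarrow> \<exists>x\<in>N0. ell x = z"
  using ell_surj by (force simp: N0_def)

lemma ell_cj_s_cong: "x \<in> N0 \<Longrightarrow> y \<in> N0 \<Longrightarrow> ell x = ell y \<Longrightarrow> ell (cj s x) = ell (cj s y)"
proof -
  assume x: "x \<in> N0" and y: "y \<in> N0" and e: "ell x = ell y"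
  have si: "invertible s" using s_in_B B_closed(1) by blast
  have "matrix_inv y ** x \<in> H0" using x y e N0_closed by (simp add: H0_def ell_mult ell_inv)
  then have "ell (cj s (matrix_inv y ** x)) = 0" using cj_s_H0 by (simp add: H0_def)
  moreover have "cj s (matrix_inv y ** x) = matrix_inv (cj s y) ** cj s x"
    using N0_closed(1)[OF y] by (simp add: cj_mult si cj_matrix_inv)
  ultimately show ?thesis
    using ell_mult[OF N0_closed(4)[OF cj_s_N0[OF y]] cj_s_N0[OF x]] ell_inv[OF cj_s_N0[OF y]] by simp
qed

lemma root_in_N0:
  assumes "\<beta> \<in> set \<beta>s" "y \<in> Zp" shows "u \<beta> y \<in> N0"
proof -
  let ?c = "\<lambda>\<gamma>. if \<gamma> = \<beta> then y else 0"
  have 1: "rootprod ?c bs = mat 1" if "\<beta> \<notin> set bs" "set bs \<subseteq> set \<beta>s" for bs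
    using that by (induction bs) (auto simp: root_iso(5))
  have "rootprod ?c bs = u \<beta> y" if "\<beta> \<in> set bs" "distinct bs" "set bs \<subseteq> set \<beta>s" for bs
    using that
  proof (induction bs)
    case (Cons b bs)
    then show ?case using 1[of bs] by (cases "b = \<beta>") (auto simp: root_iso(5))
  qed simp
  then have "rootprod ?c \<beta>s = u \<beta> y" using assms(1) enum_roots(1) by simp
  moreover have "\<forall>\<gamma>\<in>set \<beta>s. ?c \<gamma> \<in> Zp" using assms(2) by simp
  ultimately show ?thesis unfolding N0_rootprod by (intro CollectI exI[of _ ?c]) simp
qed

text \<open>
  Conjugation by \<open>s\<close> induces an endomorphism of \<open>N\<^sub>0/H\<^sub>0 =
  \<int>\<^sub>p\<close>, which is a multiplication by continuity. On a root subgroup, conjugation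
  by \<open>s\<close> is multiplication by a power of \<open>p\<close>, and \<open>ell\<close> does
  not vanish on all of them.
\<close>

lemma ell_cj_s_ex: "\<exists>e\<ge>1. \<forall>x\<in>N0. ell (cj s x) = of_nat p ^ e * ell x"
proof -
  have si: "invertible s" using s_in_B B_closed(1) by blast
  define L where "L z = ell (cj s (SOME x. x \<in> N0 \<and> ell x = z))" for z
  have L: "L (ell x) = ell (cj s x)" if x: "x \<in> N0" for x
  proof -
    have "(SOME y. y \<in> N0 \<and> ell y = ell x) \<in> N0 \<and> ell (SOME y. y \<in> N0 \<and> ell y = ell x) = ell x"
      by (rule someI[of _ x]) (simp add: x)
    then show ?thesis unfolding L_def using ell_cj_s_cong x by blast
  qed
  have lin: "L z = z * L 1" if "z \<in> Zp" for z
  proof (rule additive_Zp_linear[OF _ _ that])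
    fix x y :: 'q assume "x \<in> Zp" "y \<in> Zp"
    then obtain a b where ab: "a \<in> N0" "ell a = x" "b \<in> N0" "ell b = y" using ell_surjE by metis
    have "L (x + y) = L (ell (a ** b))" using ab by (simp add: ell_mult)
    also have "\<dots> = ell (cj s a ** cj s b)" using ab N0_closed(3) by (simp add: L cj_mult si)
    also have "\<dots> = L x + L y" using ab L[OF ab(1)] L[OF ab(3)] by (simp add: ell_mult cj_s_N0)
    finally show "L (x + y) = L x + L y" .
  next
    fix x :: 'q assume "x \<in> Zp"
    then obtain a where "a \<in> N0" "ell a = x" using ell_surjE by blast
    then show "L x \<in> Zp" using L[of a] ell_in_Zp[OF cj_s_N0[of a]] by simp
  qed
  have "\<exists>\<beta>\<in>set \<beta>s. \<exists>y\<in>Zp. ell (u \<beta> y) \<noteq> 0"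
  proof (rule ccontr)
    assume "\<not> ?thesis"
    then have z: "ell (u \<beta> y) = 0" if "\<beta> \<in> set \<beta>s" "y \<in> Zp" for \<beta> y using that by blast
    have "ell (rootprod c bs) = 0 \<and> rootprod c bs \<in> N0" if "set bs \<subseteq> set \<beta>s" "\<forall>\<beta>\<in>set \<beta>s. c \<beta> \<in> Zp" for c bs
      using that
    proof (induction bs)
      case (Cons b bs)
      then have "u b (c b) \<in> N0" "ell (u b (c b)) = 0" using root_in_N0 z by auto
      then show ?case using Cons N0_closed(3) by (simp add: ell_mult)
    qed (simp add: ell_one N0_closed(2))
    then have "ell x = 0" if "x \<in> N0" for x using that unfolding N0_rootprod by blast
    then show False using gam by force
  qed
  then obtain \<beta> y where b: "\<beta> \<in> set \<beta>s" "y \<in> Zp" "ell (u \<beta> y) \<noteq> 0" by blast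
  obtain e where e: "e \<ge> 1" "\<forall>x. x \<noteq> 0 \<longrightarrow> \<beta> (\<xi> x) = x ^ e" using root_height[OF b(1)] by blast
  have mult: "ell (u \<beta> (of_nat m * y)) = of_nat m * ell (u \<beta> y)" for m
  proof (induction m)
    case 0 then show ?case by (simp add: root_iso(5)[OF b(1)] ell_one)
  next
    case (Suc m)
    have "u \<beta> (of_nat (Suc m) * y) = u \<beta> y ** u \<beta> (of_nat m * y)"
      using root_iso(2)[OF b(1), of y "of_nat m * y"] by (simp add: distrib_right)
    then show ?case using Suc root_in_N0[OF b(1,2)] root_in_N0[OF b(1), of "of_nat m * y"] b(2)
      by (simp add: ell_mult Zp_mult distrib_right)
  qed
  have "\<beta> s = of_nat (p ^ e)" using e(2) p_nonzero by (simp add: s_def)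
  then have "ell (cj s (u \<beta> y)) = of_nat (p ^ e) * ell (u \<beta> y)"
    using root_iso(3)[OF b(1) s_in_TQ, of y] mult[of "p ^ e"] by simp
  moreover have "ell (cj s (u \<beta> y)) = ell (u \<beta> y) * L 1"
    using L[OF root_in_N0[OF b(1,2)]] lin[OF ell_in_Zp[OF root_in_N0[OF b(1,2)]]] by simp
  ultimately have "L 1 = of_nat p ^ e" using b(3) by simp
  then have "\<forall>x\<in>N0. ell (cj s x) = of_nat p ^ e * ell x"
    using L lin ell_in_Zp by (metis mult.commute)
  then show ?thesis using e(1) by blast
qed

definition ee :: nat where
  "ee = (SOME e. e \<ge> 1 \<and> (\<forall>x\<in>N0. ell (cj s x) = of_nat p ^ e * ell x))"

lemma ee: "ee \<ge> 1" "x \<in> N0 \<Longrightarrow> ell (cj s x) = of_nat p ^ ee * ell x"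
proof -
  have "ee \<ge> 1 \<and> (\<forall>x\<in>N0. ell (cj s x) = of_nat p ^ ee * ell x)"
    unfolding ee_def by (rule someI_ex) (use ell_cj_s_ex in blast)
  then show "ee \<ge> 1" "x \<in> N0 \<Longrightarrow> ell (cj s x) = of_nat p ^ ee * ell x" by auto
qed

lemma ell_cj_sp: "x \<in> N0 \<Longrightarrow> cj (sp k) x \<in> N0 \<and> ell (cj (sp k) x) = of_nat p ^ (ee * k) * ell x"
proof (induction k)
  case (Suc k)
  have si: "invertible s" "invertible (sp k)" using s_in_TQ sp_in_TQ TQ_closed(1) by blast+
  have "cj (sp (Suc k)) x = cj s (cj (sp k) x)" by (simp add: sp_Suc(1) cj_cj si)
  then show ?case using Suc cj_s_N0[of "cj (sp k) x"] ee(2)[of "cj (sp k) x"] by (simp add: power_add)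
qed (simp add: sp_0 cj_id)

text \<open>
  Conjugation by \<open>s\<^sup>-\<^sup>k\<close> is continuous, so it maps elements close to
  \<open>1\<close> into \<open>N\<^sub>0\<close>.
\<close>

lemma near_1_in_sp_N0:
  "\<exists>m. \<forall>x\<in>NQ. x - mat 1 \<in> mball (1 / real p ^ m) \<longrightarrow> (\<exists>y\<in>N0. x = cj (sp k) y)"
proof -
  have i: "invertible (sp k)" using sp_in_TQ TQ_closed(1) by blast
  obtain m where m: "\<forall>b. b - mat 1 \<in> mball (1 / real p ^ m) \<longrightarrow> invertible (matrix_inv (sp k)) \<longrightarrow>
      cj (matrix_inv (sp k)) b - mat 1 \<in> mball (1 / real p ^ 0)"
    using conj_near_1[of "matrix_inv (sp k)" 0] by (elim exE)
  have "\<exists>y\<in>N0. x = cj (sp k) y" if x: "x \<in> NQ" "x - mat 1 \<in> mball (1 / real p ^ m)" for x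
  proof
    have "cj (matrix_inv (sp k)) x \<in> NQ"
      by (rule NQ_normal[OF TQ_in_B[OF TQ_closed(4)[OF sp_in_TQ]] x(1)])
    then show "cj (matrix_inv (sp k)) x \<in> N0"
      using m[rule_format, OF x(2) invertible_matrix_inv[OF i]] by (rule near_1_in_N0)
    show "x = cj (sp k) (cj (matrix_inv (sp k)) x)" by (simp add: cj_inv' i)
  qed
  then show ?thesis by blast
qed

text \<open>
  The values of \<open>ell\<close> on \<open>s\<^sup>kN\<^sub>0s\<^sup>-\<^sup>k\<close> are
  divisible by \<open>p\<^sup>k\<close>.
\<close>

lemma ell_continuous:
  "\<exists>m. \<forall>x\<in>NQ. x - mat 1 \<in> mball (1 / real p ^ m) \<longrightarrow> x \<in> N0 \<and> pabs (ell x) \<le> 1 / real p ^ k"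
proof -
  obtain m where m: "\<forall>x\<in>NQ. x - mat 1 \<in> mball (1 / real p ^ m) \<longrightarrow> (\<exists>y\<in>N0. x = cj (sp k) y)"
    using near_1_in_sp_N0[of k] by (elim exE)
  have "x \<in> N0 \<and> pabs (ell x) \<le> 1 / real p ^ k" if x: "x \<in> NQ" "x - mat 1 \<in> mball (1 / real p ^ m)" for x
  proof -
    obtain y where y: "y \<in> N0" "x = cj (sp k) y" using m x by blast
    have "pabs (ell x) \<le> 1 / real p ^ (ee * k) * 1"
      using ell_cj_sp[OF y(1), of k] ell_in_Zp[OF y(1)] unfolding y(2)
      by (simp only: Zp_def mem_Collect_eq) (intro pabs_mult_le, auto simp: pabs_p_power)
    also have "\<dots> \<le> 1 / real p ^ k" using ee(1) by (simp del: of_nat_power) (intro inverse_p_power_mono, simp)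
    finally show ?thesis using ell_cj_sp[OF y(1), of k] y(2) by simp
  qed
  then show ?thesis by blast
qed

lemma pabs_le_p_power_cases:
  assumes "pabs (z::'q) \<le> 1 / real p ^ k"
  shows "\<exists>x\<in>N0. z = of_nat p ^ k * ell x"
  using Zp_divide_p_power[OF assms] ell_surjE by metis

end

section \<open>Functions on \<open>T\<close>-cosets\<close>

text \<open>
  For a free \<open>A\<close>-module \<open>W\<close> of rank one, the representation on smooth functions on the quotient of
  \<open>B\<close> by \<open>T\<close>, which is \<open>N\<close> as a space, contains the locally constant functions on \<open>N\<^sub>0/H\<^sub>0 = \<int>\<^sub>p\<close>.
\<close>

locale torus_rep = borel_setting p Qp \<iota> \<pi> h Fbar GG BB TT NN \<Delta> \<beta>s u T0 \<xi> ell
  for p :: nat and Qp :: "'q::{field_char_0,metric_space} itself"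
    and \<iota> :: "'q \<Rightarrow> 'k::field" and \<pi> :: 'k and h :: nat
    and Fbar :: "'f::alg_closed_field itself"
    and GG BB TT NN :: "('q alg_closure^'n::finite^'n) set"
    and \<Delta> :: "('q^'n^'n \<Rightarrow> 'q) set"
    and \<beta>s :: "('q^'n^'n \<Rightarrow> 'q) list"
    and u :: "('q^'n^'n \<Rightarrow> 'q) \<Rightarrow> 'q \<Rightarrow> 'q^'n^'n"
    and T0 :: "('q^'n^'n) set"
    and \<xi> :: "'q \<Rightarrow> 'q^'n^'n"
    and ell :: "'q^'n^'n \<Rightarrow> 'q" +
  fixes W :: "('k set, 'w) module" and w1 :: 'w
  assumes W_module: "module A W" and w1: "w1 \<in> carrier W"
    and w1_gen: "\<And>w. w \<in> carrier W \<Longrightarrow> \<exists>a\<in>carrier A. w = a \<odot>\<^bsub>W\<^esub> w1"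
    and w1_free: "\<And>a. a \<in> carrier A \<Longrightarrow> a \<odot>\<^bsub>W\<^esub> w1 = \<zero>\<^bsub>W\<^esub> \<Longrightarrow> a = \<zero>\<^bsub>A\<^esub>"
begin

sublocale Wm: module A W by (rule W_module)

abbreviation VT :: "('k set, 'q^'n^'n \<Rightarrow> 'w) module" where "VT \<equiv> fun_module (torus_inv W) W"

sublocale borel_rep p Qp \<iota> \<pi> h Fbar GG BB TT NN \<Delta> \<beta>s u T0 \<xi> ell VT "cind_action B"
  by unfold_locales (rule fun_subrep_smooth_rep[OF W_module torus_inv_subrep[OF W_module]])

lemma VT_value_closed: "f \<in> torus_inv W \<Longrightarrow> x \<in> B \<Longrightarrow> f x \<in> carrier W" by (auto simp: torus_inv_def)
lemma VT_ext: "f \<in> torus_inv W \<Longrightarrow> f \<in> extensional B" by (auto simp: torus_inv_def PiE_def)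
lemma VT_torus: "f \<in> torus_inv W \<Longrightarrow> t \<in> TQ \<Longrightarrow> x \<in> B \<Longrightarrow> f (t ** x) = f x" by (simp add: torus_inv_def)

lemma act_value: "x \<in> B \<Longrightarrow> cind_action B g f x = f (x ** g)" by (simp add: cind_action_def)

lemma minus_value:
  assumes "f \<in> torus_inv W" "x \<in> B" shows "(\<ominus>\<^bsub>VT\<^esub> f) x = \<ominus>\<^bsub>W\<^esub> f x"
proof -
  have "\<ominus>\<^bsub>VT\<^esub> f = cls (- 1) \<odot>\<^bsub>VT\<^esub> f"
    using assms osm(8)[of f 1] osm(4)[of f] by simp
  then show ?thesis
    using assms cls_smult(4,8)[OF W_module VT_value_closed[OF assms]] by simp
qed

lemma xop_value: "f \<in> torus_inv W \<Longrightarrow> x \<in> B \<Longrightarrow> xop f x = f (x ** gam) \<oplus>\<^bsub>W\<^esub> \<ominus>\<^bsub>W\<^esub> f x"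
  by (simp add: xop_eq act_value minus_value)

lemma finsum_value:
  assumes "f \<in> I \<rightarrow> torus_inv W" "finite I" "x \<in> B"
  shows "finsum VT f I x = finsum W (\<lambda>i. f i x) I"
  using assms(2,1)
proof (induction I rule: finite_induct)
  case (insert i I)
  then have f: "f i \<in> carrier VT" "f \<in> I \<rightarrow> carrier VT" by auto
  have g: "f i x \<in> carrier W" "(\<lambda>i. f i x) \<in> I \<rightarrow> carrier W"
    using insert.prems VT_value_closed[OF _ assms(3)] by auto
  have "finsum VT f (insert i I) = f i \<oplus>\<^bsub>VT\<^esub> finsum VT f I"
    by (rule V.finsum_insert[OF insert.hyps f(2,1)])
  then show ?case
    using insert g assms(3) by (simp add: Wm.finsum_insert)
qed (simp add: V.finsum_empty Wm.finsum_empty assms(3))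

lemma inv_H0_value: "f \<in> inv_H0 \<Longrightarrow> y \<in> H0 \<Longrightarrow> x \<in> B \<Longrightarrow> f (x ** y) = f x"
  using act_value[of x y f] by (simp add: inv_H0_def)

lemma inv_H0_ell:
  assumes "f \<in> inv_H0" "x \<in> N0" "y \<in> N0" "ell x = ell y" shows "f x = f y"
proof -
  have h: "matrix_inv y ** x \<in> H0" using assms N0_closed by (simp add: H0_def ell_mult ell_inv)
  have "f (y ** (matrix_inv y ** x)) = f y" by (rule inv_H0_value[OF assms(1) h N0_in_B[OF assms(3)]])
  then show ?thesis using N0_closed(1)[OF assms(3)] by (simp add: matrix_mul_assoc matrix_inv)
qed

definition in_TN0 :: "'q^'n^'n \<Rightarrow> bool" where
  "in_TN0 x \<longleftrightarrow> (\<exists>t\<in>TQ. \<exists>n\<in>N0. x = t ** n)"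

lemma in_TN0I: "t \<in> TQ \<Longrightarrow> n \<in> N0 \<Longrightarrow> in_TN0 (t ** n)" by (auto simp: in_TN0_def)

lemma TN_unique:
  assumes "t ** n = t' ** n'" "t \<in> TQ" "t' \<in> TQ" "n \<in> NQ" "n' \<in> NQ"
  shows "t = t'" "n = n'"
proof -
  have i: "invertible t'" "invertible n" using assms TQ_closed(1) NQ_closed(1) by blast+
  have e: "matrix_inv t' ** t = n' ** matrix_inv n"
  proof -
    have "matrix_inv t' ** (t ** n) ** matrix_inv n = matrix_inv t' ** (t' ** n') ** matrix_inv n"
      using assms(1) by simp
    then show ?thesis by (simp add: matrix_mul_assoc matrix_inv_cancel i matrix_inv)
  qed
  have "matrix_inv t' ** t \<in> TQ" by (rule TQ_closed(3)[OF TQ_closed(4)[OF assms(3)] assms(2)])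
  moreover have "matrix_inv t' ** t \<in> NQ"
    unfolding e by (rule NQ_closed(3)[OF assms(5) NQ_closed(4)[OF assms(4)]])
  ultimately have "matrix_inv t' ** t = mat 1" by (rule TQ_NQ_inter)
  then have "t' ** (matrix_inv t' ** t) = t'" by simp
  then show tt: "t = t'" by (simp add: matrix_mul_assoc matrix_inv i)
  have "matrix_inv t' ** (t' ** n) = matrix_inv t' ** (t' ** n')" using assms(1) tt by simp
  then show "n = n'" by (simp add: matrix_mul_assoc matrix_inv i)
qed

lemma in_TN0_iff: "t \<in> TQ \<Longrightarrow> n \<in> NQ \<Longrightarrow> in_TN0 (t ** n) \<longleftrightarrow> n \<in> N0"
  using TN_unique(2) N0_in_NQ unfolding in_TN0_def by metis

lemma in_TN0_torus: "t \<in> TQ \<Longrightarrow> x \<in> B \<Longrightarrow> in_TN0 (t ** x) \<longleftrightarrow> in_TN0 x"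
proof -
  assume t: "t \<in> TQ" and "x \<in> B"
  then obtain t' n where x: "t' \<in> TQ" "n \<in> NQ" "x = t' ** n" unfolding B_eq by blast
  have "t ** x = (t ** t') ** n" by (simp add: x(3) matrix_mul_assoc)
  then show ?thesis using in_TN0_iff[OF TQ_closed(3)[OF t x(1)] x(2)] in_TN0_iff[OF x(1,2)] x(3) by simp
qed

text \<open>
  Since its elements are invariant under \<open>T\<close> from the left and under
  \<open>H\<^sub>0\<close> from the right, they are functions of \<open>ell\<close> on
  \<open>N\<^sub>0\<close>, extended by zero; they turn out to be the locally constant ones.
\<close>

definition M0 :: "('q^'n^'n \<Rightarrow> 'w) set" where
  "M0 = {f \<in> inv_H0. \<forall>x\<in>B. \<not> in_TN0 x \<longrightarrow> f x = \<zero>\<^bsub>W\<^esub>}"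

lemma M0_inv_H0: "f \<in> M0 \<Longrightarrow> f \<in> inv_H0" by (simp add: M0_def)
lemma M0_VT: "f \<in> M0 \<Longrightarrow> f \<in> torus_inv W" using M0_inv_H0 inv_H0_closed by fastforce
lemma M0_outside: "f \<in> M0 \<Longrightarrow> x \<in> B \<Longrightarrow> \<not> in_TN0 x \<Longrightarrow> f x = \<zero>\<^bsub>W\<^esub>" by (simp add: M0_def)

lemma M0_eqI:
  assumes "f \<in> M0" "g \<in> M0" "\<And>n. n \<in> N0 \<Longrightarrow> f n = g n" shows "f = g"
proof (rule extensionalityI[OF VT_ext[OF M0_VT[OF assms(1)]] VT_ext[OF M0_VT[OF assms(2)]]])
  fix x assume x: "x \<in> B"
  show "f x = g x"
  proof (cases "in_TN0 x")
    case True
    then obtain t n where tn: "t \<in> TQ" "n \<in> N0" "x = t ** n" unfolding in_TN0_def by blast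
    then show ?thesis
      using VT_torus[OF M0_VT[OF assms(1)] tn(1) N0_in_B[OF tn(2)]]
        VT_torus[OF M0_VT[OF assms(2)] tn(1) N0_in_B[OF tn(2)]] assms(3)[OF tn(2)] by simp
  next
    case False
    then show ?thesis using M0_outside[OF assms(1) x] M0_outside[OF assms(2) x] by simp
  qed
qed

text \<open>
  Smoothness gives local constancy uniformly in the argument, as
  \<open>s\<^sup>mN\<^sub>0s\<^sup>-\<^sup>m\<close> shrinks to \<open>1\<close>.
\<close>

lemma M0_locally_constant:
  assumes f: "f \<in> M0"
  shows "\<exists>k. \<forall>x\<in>N0. \<forall>y\<in>N0. pabs (ell x - ell y) \<le> 1 / real p ^ k \<longrightarrow> f x = f y"
proof -
  have "smooth_fun f" using M0_VT[OF f] by (simp add: torus_inv_def)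
  then obtain l where l: "\<forall>g\<in>B. g - mat 1 \<in> mball (1 / real p ^ l) \<longrightarrow> (\<forall>x\<in>B. f (x ** g) = f x)"
    unfolding smooth_fun_def by (elim exE)
  obtain m where m: "\<forall>x\<in>N0. cj (sp m) x - mat 1 \<in> mball (1 / real p ^ l)" using N0_contract[of l] by blast
  have "f x = f y" if x: "x \<in> N0" and y: "y \<in> N0" and xy: "pabs (ell x - ell y) \<le> 1 / real p ^ (ee * m)" for x y
  proof -
    obtain z where z: "z \<in> N0" "ell x - ell y = of_nat p ^ (ee * m) * ell z"
      using pabs_le_p_power_cases[OF xy] by blast
    let ?g = "cj (sp m) z"
    have g: "?g \<in> N0" "ell ?g = ell x - ell y" using ell_cj_sp[OF z(1), of m] z(2) by auto
    have "f (y ** ?g) = f y" using l m z(1) N0_in_B[OF g(1)] N0_in_B[OF y] by blast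
    moreover have "f (y ** ?g) = f x"
      by (rule inv_H0_ell[OF M0_inv_H0[OF f]]) (use x y g N0_closed(3) in \<open>auto simp: ell_mult\<close>)
    ultimately show ?thesis by simp
  qed
  then show ?thesis by blast
qed

subsection \<open>Functions on \<open>\<int>/p\<^sup>k\<close>\<close>

text \<open>
  For periodic \<open>d\<close>, this is \<open>d\<close> composed with reduction modulo
  \<open>p\<^sup>k\<close> and \<open>ell\<close>. The choice of \<open>j\<close> replaces the
  residue class of the value of \<open>ell\<close>; the result is \<open>d j\<close> for any
  approximation \<open>j\<close> of this value.
\<close>

definition stepf :: "(int \<Rightarrow> 'w) \<Rightarrow> nat \<Rightarrow> 'q^'n^'n \<Rightarrow> 'w" where
  "stepf d k = (\<lambda>x\<in>B. if in_TN0 x then d (SOME j. \<exists>t\<in>TQ. \<exists>n\<in>N0. x = t ** n \<and> pabs (ell n - of_int j) \<le> 1 / real p ^ k)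
     else \<zero>\<^bsub>W\<^esub>)"

definition periodic :: "(int \<Rightarrow> 'w) \<Rightarrow> nat \<Rightarrow> bool" where
  "periodic d k \<longleftrightarrow> (\<forall>j. d j \<in> carrier W) \<and> (\<forall>i j. int p ^ k dvd i - j \<longrightarrow> d i = d j)"

lemma ell_approx: "n \<in> N0 \<Longrightarrow> \<exists>j. 0 \<le> j \<and> j < int p ^ k \<and> pabs (ell n - of_int j) \<le> 1 / real p ^ k"
  using Zp_approx_int[OF ell_in_Zp] .

lemma stepf_value:
  assumes d: "periodic d k" and t: "t \<in> TQ" and n: "n \<in> N0" and j: "pabs (ell n - of_int j) \<le> 1 / real p ^ k"
  shows "stepf d k (t ** n) = d j"
proof -
  let ?P = "\<lambda>j. \<exists>t'\<in>TQ. \<exists>n'\<in>N0. t ** n = t' ** n' \<and> pabs (ell n' - of_int j) \<le> 1 / real p ^ k"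
  define i where "i = (SOME j. ?P j)"
  have "?P j" using t n j by blast
  then have "?P i" unfolding i_def by (rule someI)
  then obtain t' n' where tn: "t' \<in> TQ" "n' \<in> N0" "t ** n = t' ** n'" "pabs (ell n' - of_int i) \<le> 1 / real p ^ k"
    by blast
  have "n = n'" using TN_unique(2)[OF tn(3) t tn(1) N0_in_NQ[OF n] N0_in_NQ[OF tn(2)]] .
  then have "pabs (of_int (i - j) :: 'q) \<le> 1 / real p ^ k"
    using pabs_diff_le[OF j tn(4)] by simp
  then have "d i = d j" using d unfolding pabs_of_int_le_iff periodic_def by blast
  moreover have "t ** n \<in> B" using TQ_mult_B[OF t N0_in_B[OF n]] .
  ultimately show ?thesis using in_TN0I[OF t n] by (simp add: stepf_def i_def)
qed

lemma stepf_value_N0: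
  assumes "periodic d k" "n \<in> N0" "pabs (ell n - of_int j) \<le> 1 / real p ^ k"
  shows "stepf d k n = d j"
  using stepf_value[OF assms(1) TQ_closed(2) assms(2,3)] by simp

lemma stepf_outside: "x \<in> B \<Longrightarrow> \<not> in_TN0 x \<Longrightarrow> stepf d k x = \<zero>\<^bsub>W\<^esub>"
  by (simp add: stepf_def)

text \<open>
  An element \<open>b = t'n'\<close> close to \<open>1\<close> moves the \<open>T\<close>-coset of
  \<open>n\<close> to that of \<open>(t'\<^sup>-\<^sup>1nt')n'\<close>, whose image under
  \<open>ell\<close> is close to that of \<open>n\<close>, uniformly in \<open>n\<close>.
\<close>

lemma stepf_smooth:
  assumes d: "periodic d k" shows "smooth_fun (stepf d k)"
proof -
  obtain m where m: "\<forall>x\<in>NQ. x - mat 1 \<in> mball (1 / real p ^ m) \<longrightarrow> x \<in> N0 \<and> pabs (ell x) \<le> 1 / real p ^ k"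
    using ell_continuous[of k] by (elim exE)
  obtain l where l: "\<forall>b\<in>B. b - mat 1 \<in> mball (1 / real p ^ l) \<longrightarrow>
     (\<exists>t\<in>TQ. \<exists>x\<in>NQ. b = t ** x \<and> t - mat 1 \<in> mball (1 / real p ^ m) \<and>
        matrix_inv t - mat 1 \<in> mball (1 / real p ^ m) \<and> x - mat 1 \<in> mball (1 / real p ^ m) \<and> deg b = 1)"
    using B_decomp_near_1[of m] by (elim exE)
  have "stepf d k (x ** b) = stepf d k x" if b: "b \<in> B" "b - mat 1 \<in> mball (1 / real p ^ l)" and x: "x \<in> B" for b x
  proof -
    obtain t' n' where b': "t' \<in> TQ" "n' \<in> NQ" "b = t' ** n'" "t' - mat 1 \<in> mball (1 / real p ^ m)"
      "matrix_inv t' - mat 1 \<in> mball (1 / real p ^ m)" "n' - mat 1 \<in> mball (1 / real p ^ m)"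
      using l b by blast
    have n': "n' \<in> N0" "pabs (ell n') \<le> 1 / real p ^ k" using m b' by auto
    have ti: "invertible t'" using TQ_closed(1) b'(1) by blast
    have tint: "t' \<in> mball 1" "matrix_inv t' \<in> mball 1" using mball_1_of_near inverse_p_power_le_1 b' by blast+
    obtain t n where tn: "t \<in> TQ" "n \<in> NQ" "x = t ** n" using x unfolding B_eq by blast
    let ?n2 = "cj (matrix_inv t') n"
    have n2: "?n2 \<in> NQ" by (rule NQ_normal[OF TQ_in_B[OF TQ_closed(4)[OF b'(1)]] tn(2)])
    have xb: "x ** b = (t ** t') ** (?n2 ** n')"
      unfolding tn(3) b'(3) by (rule B_mult_decomp(1)[OF tn(1,2) b'(1,2)])
    have tt: "t ** t' \<in> TQ" "?n2 ** n' \<in> NQ" using TQ_closed(3) NQ_closed(3) tn b' n2 by blast+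
    show ?thesis
    proof (cases "n \<in> N0")
      case True
      have ni: "invertible n" using N0_closed(1) True by blast
      let ?q = "?n2 ** matrix_inv n"
      have q: "?q \<in> NQ" using n2 NQ_closed(3,4) tn(2) by blast
      have qe: "?q - mat 1 = matrix_inv t' ** (n ** (t' - mat 1) - (t' - mat 1) ** n) ** matrix_inv n"
        by (simp add: cj_def matrix_inv_inv[OF ti] matrix_diff_ldistrib matrix_diff_rdistrib matrix_mul_assoc
            matrix_inv ti ni)
      have nint: "n \<in> mball 1" "matrix_inv n \<in> mball 1" using True by (auto simp: N0_eq)
      have "n ** (t' - mat 1) - (t' - mat 1) ** n \<in> mball (1 / real p ^ m)"
        using mball_mult[OF _ _ nint(1) b'(4)] mball_mult[OF _ _ b'(4) nint(1)] by (intro mball_diff) auto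
      then have "?q - mat 1 \<in> mball (1 * (1 / real p ^ m) * 1)"
        unfolding qe by (intro mball_mult tint nint) auto
      then have q2: "?q \<in> N0" "pabs (ell ?q) \<le> 1 / real p ^ k" using m q by auto
      have n2q: "?n2 = ?q ** n" by (simp add: matrix_inv_cancel ni)
      then have n20: "?n2 \<in> N0" "ell ?n2 = ell ?q + ell n"
        using N0_closed(3)[OF q2(1) True] ell_mult[OF q2(1) True] by metis+
      obtain j where j: "pabs (ell n - of_int j) \<le> 1 / real p ^ k" using ell_approx[OF True] by blast
      have "ell (?n2 ** n') - of_int j = (ell n - of_int j) + (ell ?q + ell n')"
        using ell_mult[OF n20(1) n'(1)] n20(2) by simp
      moreover have "pabs ((ell n - of_int j) + (ell ?q + ell n')) \<le> 1 / real p ^ k"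
        by (intro pabs_add_le j q2(2) n'(2))
      ultimately have "pabs (ell (?n2 ** n') - of_int j) \<le> 1 / real p ^ k" by (simp only:)
      then have "stepf d k (x ** b) = d j"
        unfolding xb by (rule stepf_value[OF d tt(1) N0_closed(3)[OF n20(1) n'(1)]])
      then show ?thesis using stepf_value[OF d tn(1) True j] tn(3) by simp
    next
      case False
      have "\<not> in_TN0 (x ** b)"
      proof
        assume "in_TN0 (x ** b)"
        then have c: "?n2 ** n' \<in> N0" unfolding xb using in_TN0_iff[OF tt] by blast
        have "?n2 = (?n2 ** n') ** matrix_inv n'" using NQ_closed(1)[OF b'(2)] by (simp add: matrix_inv_cancel)
        then have "?n2 \<in> N0" using N0_closed(3)[OF c N0_closed(4)[OF n'(1)]] by simp
        then have "?n2 \<in> mball 1" by (simp add: N0_eq)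
        then have "cj t' ?n2 \<in> mball 1" unfolding cj_def[of t'] by (intro mball_mult1 tint)
        then have "n \<in> mball 1" by (simp add: cj_inv' ti)
        then show False using False integral_unipotent_in_N0[OF tn(2)] by blast
      qed
      moreover have "\<not> in_TN0 x" using False in_TN0_iff[OF tn(1,2)] tn(3) by simp
      ultimately show ?thesis using stepf_outside x B_closed(3)[OF x b(1)] by simp
    qed
  qed
  then show ?thesis unfolding smooth_fun_def by blast
qed

lemma stepf_M0:
  assumes d: "periodic d k" shows "stepf d k \<in> M0"
proof -
  have cl: "stepf d k \<in> B \<rightarrow>\<^sub>E carrier W" using d by (auto simp: stepf_def periodic_def)
  have tor: "stepf d k (t ** x) = stepf d k x" if t: "t \<in> TQ" and x: "x \<in> B" for t x
  proof (cases "in_TN0 x")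
    case True
    then obtain t' n where tn: "t' \<in> TQ" "n \<in> N0" "x = t' ** n" unfolding in_TN0_def by blast
    obtain j where j: "pabs (ell n - of_int j) \<le> 1 / real p ^ k" using ell_approx[OF tn(2)] by blast
    show ?thesis
      using stepf_value[OF d tn(1,2) j] stepf_value[OF d TQ_closed(3)[OF t tn(1)] tn(2) j] tn(3)
      by (simp add: matrix_mul_assoc)
  qed (use stepf_outside in_TN0_torus[OF t x] x TQ_mult_B[OF t x] in simp)
  have H: "stepf d k (x ** y) = stepf d k x" if y: "y \<in> H0" and x: "x \<in> B" for x y
  proof -
    obtain t n where tn: "t \<in> TQ" "n \<in> NQ" "x = t ** n" using x unfolding B_eq by blast
    have y0: "y \<in> N0" "y \<in> NQ" using y H0_subset N0_in_NQ by blast+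
    have xy: "x ** y = t ** (n ** y)" by (simp add: tn(3) matrix_mul_assoc)
    show ?thesis
    proof (cases "n \<in> N0")
      case True
      obtain j where j: "pabs (ell n - of_int j) \<le> 1 / real p ^ k" using ell_approx[OF True] by blast
      have "ell (n ** y) = ell n" using ell_mult[OF True y0(1)] y by (simp add: H0_def)
      then show ?thesis unfolding xy
        using stepf_value[OF d tn(1) True j] stepf_value[OF d tn(1) N0_closed(3)[OF True y0(1)]] j tn(3) by simp
    next
      case False
      have "n ** y \<notin> N0"
      proof
        assume "n ** y \<in> N0"
        then have "n ** y ** matrix_inv y \<in> N0" using N0_closed(3,4) y0(1) by blast
        then show False using False N0_closed(1)[OF y0(1)] by (simp add: matrix_inv_cancel)
      qed
      then have "\<not> in_TN0 (x ** y)" "\<not> in_TN0 x"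
        using False in_TN0_iff[OF tn(1) NQ_closed(3)[OF tn(2) y0(2)]] in_TN0_iff[OF tn(1,2)] xy tn(3) by simp_all
      then show ?thesis using stepf_outside x B_closed(3)[OF x N0_in_B[OF y0(1)]] by simp
    qed
  qed
  have VT: "stepf d k \<in> torus_inv W" using cl tor stepf_smooth[OF d] by (simp add: torus_inv_def)
  have "cind_action B y (stepf d k) = stepf d k" if "y \<in> H0" for y
    using H[OF that] by (intro extensionalityI[OF _ VT_ext[OF VT]]) (auto simp: cind_action_def)
  then have "stepf d k \<in> inv_H0" using VT by (simp add: inv_H0_def)
  then show ?thesis using stepf_outside by (simp add: M0_def)
qed

end

context torus_rep
begin

section \<open>The \<open>X\<close>-divisible module of step functions\<close>

abbreviation scale (infixr "\<cdot>" 75) where "c \<cdot> f \<equiv> cls c \<odot>\<^bsub>VT\<^esub> f"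

definition pt :: "int \<Rightarrow> 'q^'n^'n" where "pt j = (SOME x. x \<in> N0 \<and> ell x = of_int j)"

lemma pt: "pt j \<in> N0" "ell (pt j) = of_int j"
proof -
  have "\<exists>x. x \<in> N0 \<and> ell x = of_int j"
    using ell_surjE[of "of_int j"] pabs_of_int_le_1 by (auto simp: Zp_def)
  then have "pt j \<in> N0 \<and> ell (pt j) = of_int j" unfolding pt_def by (rule someI_ex)
  then show "pt j \<in> N0" "ell (pt j) = of_int j" by auto
qed

lemma pt_in_B: "pt j \<in> B" using pt(1) by (rule N0_in_B)

lemma M0_value_closed: "f \<in> M0 \<Longrightarrow> x \<in> B \<Longrightarrow> f x \<in> carrier W"
  using M0_VT VT_value_closed by blast

lemma pabs_self: "pabs (ell (pt j) - of_int j) \<le> 1 / real p ^ k" by (simp add: pt(2))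

lemma stepf_pt: "periodic d k \<Longrightarrow> stepf d k (pt j) = d j"
  by (rule stepf_value_N0[OF _ pt(1) pabs_self])

lemma M0_value_pt:
  assumes f: "f \<in> M0" and x: "x \<in> N0" "ell x = of_int j" shows "f x = f (pt j)"
  by (rule inv_H0_ell[OF M0_inv_H0[OF f] x(1) pt(1)]) (simp add: x(2) pt(2))

lemma periodic_mono: "periodic d k \<Longrightarrow> k \<le> l \<Longrightarrow> periodic d l"
  unfolding periodic_def using le_imp_power_dvd dvd_trans by blast

text \<open>By uniform local constancy, the values at integers are periodic.\<close>

lemma M0_step:
  assumes f: "f \<in> M0"
  shows "\<exists>k. periodic (\<lambda>j. f (pt j)) k"
proof -
  obtain k where k: "\<And>x y. x \<in> N0 \<Longrightarrow> y \<in> N0 \<Longrightarrow> pabs (ell x - ell y) \<le> 1 / real p ^ k \<Longrightarrow> f x = f y"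
    using M0_locally_constant[OF f] by blast
  have "f (pt i) = f (pt j)" if "int p ^ k dvd i - j" for i j
  proof (rule k[OF pt(1) pt(1)])
    show "pabs (ell (pt i) - ell (pt j)) \<le> 1 / real p ^ k"
      unfolding pt of_int_diff[symmetric] pabs_of_int_le_iff by (rule that)
  qed
  then show ?thesis unfolding periodic_def using M0_value_closed[OF f pt_in_B] by blast
qed

text \<open>The integers are dense in \<open>\<int>\<^sub>p\<close>.\<close>

lemma M0_eq_ptI:
  assumes f: "f \<in> M0" and g: "g \<in> M0" and eq: "\<And>j. f (pt j) = g (pt j)"
  shows "f = g"
proof (rule M0_eqI[OF f g])
  fix n assume n: "n \<in> N0"
  obtain k where k: "\<And>x y. x \<in> N0 \<Longrightarrow> y \<in> N0 \<Longrightarrow> pabs (ell x - ell y) \<le> 1 / real p ^ k \<Longrightarrow> f x = f y"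
    using M0_locally_constant[OF f] by blast
  obtain l where l: "\<And>x y. x \<in> N0 \<Longrightarrow> y \<in> N0 \<Longrightarrow> pabs (ell x - ell y) \<le> 1 / real p ^ l \<Longrightarrow> g x = g y"
    using M0_locally_constant[OF g] by blast
  obtain j where j: "pabs (ell n - of_int j) \<le> 1 / real p ^ max k l" using ell_approx[OF n] by blast
  have "1 / real p ^ max k l \<le> 1 / real p ^ k" "1 / real p ^ max k l \<le> 1 / real p ^ l"
    by (intro inverse_p_power_mono; simp)+
  then have "pabs (ell n - ell (pt j)) \<le> 1 / real p ^ k" "pabs (ell n - ell (pt j)) \<le> 1 / real p ^ l"
    using j unfolding pt(2) by linarith+
  then have "f n = f (pt j)" "g n = g (pt j)" using k[OF n pt(1)] l[OF n pt(1)] by blast+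
  then show "f n = g n" by (simp add: eq)
qed

lemma VT_add_value: "x \<in> B \<Longrightarrow> (f \<oplus>\<^bsub>VT\<^esub> g) x = f x \<oplus>\<^bsub>W\<^esub> g x" by simp
lemma VT_smult_value: "x \<in> B \<Longrightarrow> (a \<odot>\<^bsub>VT\<^esub> f) x = a \<odot>\<^bsub>W\<^esub> f x" by simp
lemma VT_zero_value: "x \<in> B \<Longrightarrow> \<zero>\<^bsub>VT\<^esub> x = \<zero>\<^bsub>W\<^esub>" by simp

lemma M0_VT': "f \<in> M0 \<Longrightarrow> f \<in> carrier VT" using M0_VT by simp

lemma M0_zero: "\<zero>\<^bsub>VT\<^esub> \<in> M0"
  using inv_H0_zero VT_zero_value unfolding M0_def by blast

lemma M0_add: "f \<in> M0 \<Longrightarrow> g \<in> M0 \<Longrightarrow> f \<oplus>\<^bsub>VT\<^esub> g \<in> M0"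
  using inv_H0_add[of f g] unfolding M0_def mem_Collect_eq
  by (auto simp: VT_add_value simp del: fun_module_simps(2-4))

lemma M0_osm: "c \<in> OK \<Longrightarrow> f \<in> M0 \<Longrightarrow> c \<cdot> f \<in> M0"
  using inv_H0_osm[of f c] unfolding M0_def mem_Collect_eq
  by (auto simp: VT_smult_value cls_smult_zero[OF W_module] simp del: fun_module_simps(2-4))

lemma in_TN0_N0:
  assumes x: "x \<in> B" and n: "n \<in> N0" shows "in_TN0 (x ** n) \<longleftrightarrow> in_TN0 x"
proof -
  have r: "in_TN0 (y ** m)" if "in_TN0 y" "m \<in> N0" for y m
    using that N0_closed(3) unfolding in_TN0_def by (metis matrix_mul_assoc)
  have "(x ** n) ** matrix_inv n = x" using N0_closed(1)[OF n] by (simp add: matrix_inv_cancel)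
  then show ?thesis using r[of x n] r[of "x ** n" "matrix_inv n"] n N0_closed(4) by metis
qed

lemma M0_act_N0:
  assumes f: "f \<in> M0" and n: "n \<in> N0" shows "cind_action B n f \<in> M0"
proof -
  have "cind_action B n f x = \<zero>\<^bsub>W\<^esub>" if "x \<in> B" "\<not> in_TN0 x" for x
    using that M0_outside[OF f, of "x ** n"] in_TN0_N0[OF that(1) n] B_closed(3)[OF that(1) N0_in_B[OF n]]
    by (simp add: act_value)
  then show ?thesis using act_N0_inv_H0[OF M0_inv_H0[OF f] n] by (simp add: M0_def)
qed

lemma M0_minus: "f \<in> M0 \<Longrightarrow> \<ominus>\<^bsub>VT\<^esub> f \<in> M0"
  using M0_osm[OF OK_minus[OF OK_1]] osm(8)[OF M0_VT' OK_1] osm(4)[OF M0_VT'] by simp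

lemma M0_xop: "f \<in> M0 \<Longrightarrow> xop f \<in> M0"
  unfolding xop_eq by (intro M0_add M0_act_N0 M0_minus gam(1))

lemma act_pt:
  assumes f: "f \<in> M0" and n: "n \<in> N0" "ell n = of_int i"
  shows "cind_action B n f (pt j) = f (pt (j + i))"
proof -
  have "f (pt j ** n) = f (pt (j + i))"
    by (rule M0_value_pt[OF f N0_closed(3)[OF pt(1) n(1)]]) (simp add: ell_mult pt n)
  then show ?thesis by (simp add: act_value pt_in_B)
qed

lemma xop_pt: "f \<in> M0 \<Longrightarrow> xop f (pt j) = f (pt (j + 1)) \<ominus>\<^bsub>W\<^esub> f (pt j)"
  using xop_value[OF M0_VT pt_in_B, of f j] act_pt[of f gam 1 j] gam
  by (simp add: act_value pt_in_B Wm.minus_eq)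

subsection \<open>The kernel of \<open>X\<close>\<close>

definition eps0 :: "'q^'n^'n \<Rightarrow> 'w" where "eps0 = stepf (\<lambda>_. w1) 0"

lemma periodic_const: "w \<in> carrier W \<Longrightarrow> periodic (\<lambda>_. w) k" by (simp add: periodic_def)

lemma eps0_M0: "eps0 \<in> M0" unfolding eps0_def by (rule stepf_M0[OF periodic_const[OF w1]])
lemma eps0_pt: "eps0 (pt j) = w1" unfolding eps0_def by (rule stepf_pt[OF periodic_const[OF w1]])

lemma xop_eps0: "xop eps0 = \<zero>\<^bsub>VT\<^esub>"
  using w1 by (intro M0_eq_ptI M0_xop eps0_M0 M0_zero)
    (simp add: xop_pt eps0_M0 eps0_pt VT_zero_value pt_in_B Wm.minus_eq Wm.r_neg del: fun_module_simps(2-4))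

lemma W_elem: "w \<in> carrier W \<Longrightarrow> \<exists>c\<in>OK. w = cls c \<odot>\<^bsub>W\<^esub> w1"
  using w1_gen A_elem by metis

lemma ker_xop:
  assumes f: "f \<in> M0" and z: "xop f = \<zero>\<^bsub>VT\<^esub>"
  shows "\<exists>c\<in>OK. f = c \<cdot> eps0"
proof -
  have cl: "f (pt j) \<in> carrier W" for j by (rule M0_value_closed[OF f pt_in_B])
  have step: "f (pt (j + 1)) = f (pt j)" for j
  proof -
    have "f (pt (j + 1)) \<ominus>\<^bsub>W\<^esub> f (pt j) = \<zero>\<^bsub>W\<^esub>"
      using xop_pt[OF f, of j] VT_zero_value[OF pt_in_B] z by simp
    then show ?thesis
      using Wm.minus_equality[of "f (pt (j + 1))" "\<ominus>\<^bsub>W\<^esub> f (pt j)"] cl by (simp add: Wm.minus_eq Wm.minus_minus)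
  qed
  have const: "f (pt j) = f (pt 0)" for j
  proof (induction j rule: int_induct[where k = 0])
    case (step2 i) then show ?case using step[of "i - 1"] by simp
  qed (simp_all add: step)
  obtain c where c: "c \<in> OK" "f (pt 0) = cls c \<odot>\<^bsub>W\<^esub> w1" using W_elem[OF cl[of 0]] by blast
  have "f (pt j) = (c \<cdot> eps0) (pt j)" for j
    using const[of j] by (simp add: c(2) VT_smult_value pt_in_B eps0_pt del: fun_module_simps(2-4))
  then have "f = c \<cdot> eps0"
    by (rule M0_eq_ptI[OF f M0_osm[OF c(1) eps0_M0]])
  then show ?thesis using c(1) by blast
qed

subsection \<open>Divisibility by \<open>X\<close>\<close>

primrec psum :: "(int \<Rightarrow> 'w) \<Rightarrow> nat \<Rightarrow> 'w" where
  "psum c 0 = \<zero>\<^bsub>W\<^esub>"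
| "psum c (Suc n) = c (int n) \<oplus>\<^bsub>W\<^esub> psum c n"

lemma psum_closed: "periodic c k \<Longrightarrow> psum c n \<in> carrier W"
  by (induction n) (auto simp: periodic_def)

lemma psum_period:
  assumes c: "periodic c k"
  shows "psum c (m * p ^ k) = cls (of_nat m) \<odot>\<^bsub>W\<^esub> psum c (p ^ k)"
proof (induction m)
  case 0
  then show ?case using cls_smult(5)[OF W_module psum_closed[OF c]] by simp
next
  case (Suc m)
  note pc = psum_closed[OF c]
  have cc: "c j \<in> carrier W" for j using c by (simp add: periodic_def)
  have add: "psum c (n + m * p ^ k) = psum c n \<oplus>\<^bsub>W\<^esub> psum c (m * p ^ k)" for n
  proof (induction n)
    case (Suc n)
    have "int p ^ k dvd int (n + m * p ^ k) - int n" by simp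
    then have "c (int (n + m * p ^ k)) = c (int n)" using c unfolding periodic_def by blast
    then show ?case using Suc cc pc by (simp add: Wm.a_assoc)
  qed (simp add: pc)
  have "psum c (Suc m * p ^ k) = psum c (p ^ k) \<oplus>\<^bsub>W\<^esub> psum c (m * p ^ k)"
    using add[of "p ^ k"] by simp
  also have "\<dots> = cls 1 \<odot>\<^bsub>W\<^esub> psum c (p ^ k) \<oplus>\<^bsub>W\<^esub> cls (of_nat m) \<odot>\<^bsub>W\<^esub> psum c (p ^ k)"
    using Suc cls_smult(4)[OF W_module pc] by simp
  also have "\<dots> = cls (1 + of_nat m) \<odot>\<^bsub>W\<^esub> psum c (p ^ k)"
    using cls_smult(1)[OF W_module pc OK_1 OK_of_nat] by simp
  finally show ?case by (simp add: add.commute)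
qed

text \<open>
  The partial sums of a function of period \<open>p\<^sup>k\<close> have period \<open>p\<^sup>k\<^sup>+\<^sup>h\<close>, as the sum over \<open>p\<^sup>h\<close> periods is a
  multiple of \<open>p\<^sup>h = 0\<close>.
\<close>

lemma xop_surj:
  assumes f: "f \<in> M0" shows "\<exists>g\<in>M0. xop g = f \<and> g (pt 0) = \<zero>\<^bsub>W\<^esub>"
proof -
  let ?c = "\<lambda>j. f (pt j)"
  obtain k where c: "periodic ?c k" using M0_step[OF f] by blast
  note pc = psum_closed[OF c]
  have cc: "?c j \<in> carrier W" for j by (rule M0_value_closed[OF f pt_in_B])
  let ?Q = "p ^ (k + h)"
  have Q0: "?Q > 0" using p_gt_1 by simp
  define d where "d j = psum ?c (nat (j mod int ?Q))" for j
  have d: "periodic d (k + h)"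
    unfolding periodic_def
  proof (intro conjI allI impI)
    show "d i = d j" if "int p ^ (k + h) dvd i - j" for i j
    proof -
      have "i mod int ?Q = j mod int ?Q" using that by (simp add: mod_eq_dvd_iff)
      then show ?thesis by (simp add: d_def)
    qed
  qed (simp add: d_def pc)
  have full: "psum ?c ?Q = \<zero>\<^bsub>W\<^esub>"
  proof -
    have "psum ?c ?Q = cls (of_nat (p ^ h)) \<odot>\<^bsub>W\<^esub> psum ?c (p ^ k)"
      using psum_period[OF c, of "p ^ h"] by (simp add: power_add mult.commute)
    then show ?thesis using cls_smult(7)[OF W_module pc] by simp
  qed
  have step: "d (j + 1) \<ominus>\<^bsub>W\<^esub> d j = ?c j" for j
  proof -
    define m where "m = nat (j mod int ?Q)"
    have m: "int m = j mod int ?Q" "m < ?Q" using Q0 by (simp_all add: m_def nat_less_iff)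
    have "int p ^ k dvd int ?Q" by (simp add: power_add)
    then have "int p ^ k dvd int m - j" using m(1) by (metis mod_eq_dvd_iff mod_mod_trivial dvd_trans)
    then have cm: "?c (int m) = ?c j" using c unfolding periodic_def by blast
    have e: "(j + 1) mod int ?Q = (int m + 1) mod int ?Q" unfolding m(1) by (simp add: mod_add_left_eq)
    have "d (j + 1) = psum ?c (Suc m)"
    proof (cases "Suc m = ?Q")
      case True
      then have "(j + 1) mod int ?Q = 0" unfolding e by (metis mod_self of_nat_Suc add.commute)
      then have "d (j + 1) = \<zero>\<^bsub>W\<^esub>" by (simp add: d_def)
      then show ?thesis using full True by simp
    next
      case False
      then have "int m + 1 < int ?Q" using m(2) by linarith
      then have "(j + 1) mod int ?Q = int (Suc m)" unfolding e by (subst mod_pos_pos_trivial) simp_all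
      then show ?thesis by (simp only: d_def nat_int)
    qed
    then have "d (j + 1) \<ominus>\<^bsub>W\<^esub> d j = ?c j \<oplus>\<^bsub>W\<^esub> psum ?c m \<ominus>\<^bsub>W\<^esub> psum ?c m"
      using cm by (simp add: d_def m_def)
    also have "\<dots> = ?c j" using cc pc by (simp add: Wm.minus_eq Wm.a_assoc Wm.r_neg)
    finally show ?thesis .
  qed
  have g: "stepf d (k + h) \<in> M0" by (rule stepf_M0[OF d])
  have "xop (stepf d (k + h)) = f"
    by (rule M0_eq_ptI[OF M0_xop[OF g] f]) (simp add: xop_pt[OF g] stepf_pt[OF d] step)
  moreover have "stepf d (k + h) (pt 0) = \<zero>\<^bsub>W\<^esub>" by (simp add: stepf_pt[OF d] d_def)
  ultimately show ?thesis using g by blast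
qed

text \<open>
  As functions on the integers, these are the multiples of \<open>w1\<close> by the binomial
  coefficients \<open>(x choose n)\<close>, which are characterized by their differences and their
  values at \<open>0\<close>.
\<close>

primrec eps :: "nat \<Rightarrow> 'q^'n^'n \<Rightarrow> 'w" where
  "eps 0 = eps0"
| "eps (Suc n) = (SOME g. g \<in> M0 \<and> xop g = eps n \<and> g (pt 0) = \<zero>\<^bsub>W\<^esub>)"

lemma eps_Suc:
  assumes "eps n \<in> M0"
  shows "eps (Suc n) \<in> M0 \<and> xop (eps (Suc n)) = eps n \<and> eps (Suc n) (pt 0) = \<zero>\<^bsub>W\<^esub>"
proof -
  have "\<exists>g. g \<in> M0 \<and> xop g = eps n \<and> g (pt 0) = \<zero>\<^bsub>W\<^esub>" using xop_surj[OF assms] by blast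
  then show ?thesis unfolding eps.simps(2) by (rule someI_ex)
qed

lemma eps_M0: "eps n \<in> M0"
  by (induction n) (use eps0_M0 eps_Suc in auto)

lemma eps_xop_pow: "i \<le> n \<Longrightarrow> (xop ^^ i) (eps n) = eps (n - i)"
proof (induction i)
  case (Suc i)
  then obtain m where "n - i = Suc m" "n - Suc i = m" by (cases "n - i") auto
  then show ?case using Suc eps_Suc[OF eps_M0, of m] by (simp del: eps.simps)
qed simp

lemma eps_pt_0: "eps n (pt 0) = (if n = 0 then w1 else \<zero>\<^bsub>W\<^esub>)"
proof (cases n)
  case (Suc m) then show ?thesis using eps_Suc[OF eps_M0, of m] by (simp del: eps.simps)
qed (simp add: eps0_pt)

subsection \<open>The residue functional\<close>

text \<open>
  An isomorphism of \<open>W\<close>, which is free of rank one, with the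
  \<open>\<pi>\<^sup>h\<close>-torsion of \<open>K/o\<close>.
\<close>

definition res :: "'w \<Rightarrow> 'k set" where
  "res w = kcl ((SOME c. c \<in> OK \<and> w = cls c \<odot>\<^bsub>W\<^esub> w1) / \<pi> ^ h)"

lemma res_cls:
  assumes c: "c \<in> OK" shows "res (cls c \<odot>\<^bsub>W\<^esub> w1) = kcl (c / \<pi> ^ h)"
proof -
  define b where "b = (SOME b. b \<in> OK \<and> cls c \<odot>\<^bsub>W\<^esub> w1 = cls b \<odot>\<^bsub>W\<^esub> w1)"
  have b: "b \<in> OK \<and> cls c \<odot>\<^bsub>W\<^esub> w1 = cls b \<odot>\<^bsub>W\<^esub> w1" unfolding b_def by (rule someI[of _ c]) (simp add: c)
  then have bO: "b \<in> OK" by blast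
  have bc: "b - c \<in> OK" using OK_add[OF bO OK_minus[OF c]] by simp
  have "cls (b - c) \<odot>\<^bsub>W\<^esub> w1 = cls b \<odot>\<^bsub>W\<^esub> w1 \<oplus>\<^bsub>W\<^esub> \<ominus>\<^bsub>W\<^esub> (cls c \<odot>\<^bsub>W\<^esub> w1)"
    using cls_smult(1)[OF W_module w1 bO OK_minus[OF c]] cls_smult(8)[OF W_module w1 c] by simp
  also have "\<dots> = \<zero>\<^bsub>W\<^esub>" using b cls_smult(3)[OF W_module w1 bO] by (simp add: Wm.r_neg)
  finally have "cls (b - c) = cls 0" using w1_free[OF cls_closed[OF bc]] by (simp add: cls_zero)
  then have "b - c \<in> modulus" using cls_eq_iff[OF bc OK_0] by simp
  then obtain x where "x \<in> OK" "b - c = x * \<pi> ^ h" by (auto simp: modulus_eq)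
  then have "b / \<pi> ^ h - c / \<pi> ^ h \<in> OK" using uniformizer_nonzero by (simp add: diff_divide_distrib[symmetric])
  then show ?thesis unfolding res_def b_def[symmetric] by (simp add: kcl_eq_iff)
qed

definition residue :: "('q^'n^'n \<Rightarrow> 'w) \<Rightarrow> 'k set" where "residue f = res (f (pt 0))"

lemma residue_functional: "functional (carrier VT) residue"
  unfolding functional_def
proof (intro conjI ballI)
  fix f assume f: "f \<in> carrier VT"
  have fc: "f (pt 0) \<in> carrier W" using f VT_value_closed[OF _ pt_in_B] by simp
  then obtain a where a: "a \<in> OK" "f (pt 0) = cls a \<odot>\<^bsub>W\<^esub> w1" using W_elem by blast
  show "residue f \<in> carrier K_mod_o" by (auto simp: residue_def res_def K_mod_o_carrier)
  show "residue (c \<cdot> f) = scale_K_mod_o c (residue f)" if c: "c \<in> OK" for c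
  proof -
    have "(c \<cdot> f) (pt 0) = cls (c * a) \<odot>\<^bsub>W\<^esub> w1"
      unfolding VT_smult_value[OF pt_in_B] a(2) by (rule cls_smult(2)[OF W_module w1 c a(1), symmetric])
    then show ?thesis
      using res_cls[OF OK_mult[OF c a(1)]] res_cls[OF a(1)] c by (simp add: residue_def a(2) scale_kcl)
  qed
  fix g assume g: "g \<in> carrier VT"
  then have "g (pt 0) \<in> carrier W" using VT_value_closed[OF _ pt_in_B] by simp
  then obtain b where b: "b \<in> OK" "g (pt 0) = cls b \<odot>\<^bsub>W\<^esub> w1" using W_elem by blast
  have "(f \<oplus>\<^bsub>VT\<^esub> g) (pt 0) = cls (a + b) \<odot>\<^bsub>W\<^esub> w1"
    unfolding VT_add_value[OF pt_in_B] a(2) b(2) by (rule cls_smult(1)[OF W_module w1 a(1) b(1), symmetric])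
  then show "residue (f \<oplus>\<^bsub>VT\<^esub> g) = residue f \<otimes>\<^bsub>K_mod_o\<^esub> residue g"
    using res_cls[OF OK_add[OF a(1) b(1)]] res_cls[OF a(1)] res_cls[OF b(1)]
    by (simp add: residue_def a(2) b(2) K_mod_o_mult add_divide_distrib)
qed

lemma residue_eps0: "residue eps0 \<noteq> \<one>\<^bsub>K_mod_o\<^esub>"
proof -
  have "residue eps0 = kcl (1 / \<pi> ^ h)"
    using res_cls[OF OK_1] cls_smult(4)[OF W_module w1] by (simp add: residue_def eps0_pt)
  then show ?thesis
    using inverse_uniformizer_power_notin h_pos by (simp add: K_mod_o_one kcl_eq_iff)
qed

end

context borel_setting
begin

text \<open>
  Elements with the same residue class modulo \<open>p\<^sup>m\<close> lie in the same coset of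
  \<open>sH\<^sub>0s\<^sup>-\<^sup>1\<close>, for large \<open>m\<close>, and there are finitely
  many residue classes. The cosets enter through a function that is constant on them.
\<close>

lemma index_finite:
  assumes c: "\<And>x y. x \<in> H0 \<Longrightarrow> y \<in> H0 \<Longrightarrow> matrix_inv y ** x \<in> cj s ` H0 \<Longrightarrow> c x = c y"
  shows "finite (c ` H0)"
proof -
  have sp1: "sp 1 = s" using sp_Suc(1)[of 0] sp_0 by simp
  obtain m where m: "\<And>x. x \<in> NQ \<Longrightarrow> x - mat 1 \<in> mball (1 / real p ^ m) \<Longrightarrow> \<exists>y\<in>N0. x = cj s y"
    using near_1_in_sp_N0[of 1] unfolding sp1 by blast
  let ?P = "\<lambda>z a. 0 \<le> a \<and> a < int p ^ m \<and> pabs (z - of_int a) \<le> 1 / real p ^ m"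
  define r where "r x = (\<lambda>ij :: 'n \<times> 'n. SOME a. ?P (x $ fst ij $ snd ij :: 'q) a)" for x
  have r: "?P (x $ i $ j) (r x (i, j))" if "x \<in> H0" for x i j
  proof -
    have "x $ i $ j \<in> Zp" using that H0_subset by (auto simp: N0_eq mball_def Zp_def)
    then have "\<exists>a. ?P (x $ i $ j) a" by (rule Zp_approx_int)
    then show ?thesis unfolding r_def by simp (rule someI_ex)
  qed
  have same: "c x = c y" if xy: "x \<in> H0" "y \<in> H0" and eq: "r x = r y" for x y
  proof (rule c[OF xy])
    have yN: "y \<in> N0" "x \<in> N0" using xy H0_subset by blast+
    have i: "invertible y" using N0_closed(1) yN by blast
    have "pabs (x $ i $ j - y $ i $ j) \<le> 1 / real p ^ m" for i j
      using pabs_diff_le[of "x $ i $ j - of_int (r x (i, j))" _ "y $ i $ j - of_int (r y (i, j))"]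
        r[OF xy(1), of i j] r[OF xy(2), of i j] by (simp add: eq)
    then have "x - y \<in> mball (1 / real p ^ m)" by (simp add: mball_def)
    moreover have "matrix_inv y \<in> mball 1" using yN by (auto simp: N0_eq)
    ultimately have "matrix_inv y ** (x - y) \<in> mball (1 * (1 / real p ^ m))" by (intro mball_mult) auto
    then have near: "matrix_inv y ** x - mat 1 \<in> mball (1 / real p ^ m)"
      by (simp add: matrix_diff_ldistrib matrix_inv i)
    have H: "matrix_inv y ** x \<in> H0" using H0_closed(3,4) xy by blast
    then obtain z where z: "z \<in> N0" "matrix_inv y ** x = cj s z" using m[OF _ near] H0_subset N0_in_NQ by blast
    then have "of_nat p ^ ee * ell z = 0" using ee(2)[OF z(1)] H by (simp add: H0_def)
    then have "z \<in> H0" using z(1) p_nonzero by (simp add: H0_def)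
    then show "matrix_inv y ** x \<in> cj s ` H0" using z(2) by blast
  qed
  have "r ` H0 \<subseteq> (UNIV \<rightarrow>\<^sub>E {0..<int p ^ m})"
  proof safe
    fix x ij assume "x \<in> H0"
    then show "r x ij \<in> {0..<int p ^ m}" using r[of x "fst ij" "snd ij"] by simp
  qed simp
  then have "finite (r ` H0)" by (rule finite_subset) (intro finite_PiE finite, simp)
  moreover have "c ` H0 \<subseteq> (\<lambda>f. c (SOME x. x \<in> H0 \<and> r x = f)) ` (r ` H0)"
  proof
    fix k assume "k \<in> c ` H0"
    then obtain x where x: "x \<in> H0" "k = c x" by blast
    have "(SOME y. y \<in> H0 \<and> r y = r x) \<in> H0 \<and> r (SOME y. y \<in> H0 \<and> r y = r x) = r x"
      by (rule someI[of _ x]) (simp add: x)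
    then have "c (SOME y. y \<in> H0 \<and> r y = r x) = k" using same[of "SOME y. y \<in> H0 \<and> r y = r x" x] x by simp
    then show "k \<in> (\<lambda>f. c (SOME x. x \<in> H0 \<and> r x = f)) ` (r ` H0)" using x(1) by blast
  qed
  ultimately show ?thesis by (meson finite_imageI finite_subset)
qed

end

context borel_rep
begin

lemma finite_cosets: "finite (coset ` H0)"
proof (rule index_finite)
  fix x y assume "x \<in> H0" "y \<in> H0" and h: "matrix_inv y ** x \<in> cj s ` H0"
  then have "y ** (matrix_inv y ** x) \<in> coset y" by (auto simp: coset_def sH0_def)
  moreover have "y ** (matrix_inv y ** x) = x"
    using H0_closed(1)[OF \<open>y \<in> H0\<close>] by (simp add: matrix_mul_assoc matrix_inv)
  ultimately show "coset x = coset y" using coset_eq by simp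
qed

text \<open>
  Restriction to the submodules turns a functional on \<open>V\<close> into an element of the limit.
\<close>

lemma functional_family:
  assumes f: "functional (carrier V) f"
  shows "(\<lambda>M\<in>MM V \<rho>. fraction (PM M) (\<lambda>x\<in>M. f x) 0) \<in> carrier (D_xi V \<rho>)" (is "?y \<in> _")
proof -
  have r: "(\<lambda>x\<in>M. f x) \<in> carrier (PM M)" if "M \<in> MM V \<rho>" for M
    using AXF_submoduleD(2)[OF MM_submodule[OF that]] by (intro functional_restrict[OF MM_submodule[OF that] f]) auto
  have compat: "fraction (PM M) (\<lambda>x\<in>M. f x) 0 =
      dual_loc_map (as_module V \<rho> M) (\<lambda>m. m) (fraction (PM M') (\<lambda>x\<in>M'. f x) 0)"
    if M: "M \<in> MM V \<rho>" and M': "M' \<in> MM V \<rho>" and sub: "M \<subseteq> M'" for M M'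
  proof -
    note S = MM_submodule[OF M] and S' = MM_submodule[OF M']
    have eq: "fraction (PM M) (\<lambda>x\<in>M. g x) n = fraction (PM M) (\<lambda>x\<in>M. f x) 0"
      if gn: "(g, n) \<in> fraction (PM M') (\<lambda>x\<in>M'. f x) 0" for g n
    proof (rule fraction_eqI[OF _ r[OF M]])
      obtain j where g: "g \<in> carrier (PM M')" and j: "X_pow (PM M') (j + n) (\<lambda>x\<in>M'. f x) = X_pow (PM M') (j + 0) g"
        using gn by (auto simp: fraction_def)
      have gM: "(\<lambda>x\<in>M. g x) \<in> carrier (PM M)"
        using g PM_simps(1)[OF S'] functional_restrict[OF S _ sub] by blast
      have "X_pow (PM M) (j + n) (\<lambda>x\<in>M. f x) = X_pow (PM M) (j + 0) (\<lambda>x\<in>M. g x)"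
        unfolding X_pow_PM[OF S r[OF M]] X_pow_PM[OF S gM]
      proof (rule restrict_ext)
        fix x assume x: "x \<in> M"
        have "X_pow (PM M') (j + n) (\<lambda>x\<in>M'. f x) x = X_pow (PM M') (j + 0) g x" by (simp only: j)
        then show "(\<lambda>x\<in>M. f x) ((xop ^^ (j + n)) x) = (\<lambda>x\<in>M. g x) ((xop ^^ (j + 0)) x)"
          unfolding X_pow_PM[OF S' r[OF M']] X_pow_PM[OF S' g]
          using x subsetD[OF sub x] AXF_submoduleD(7)[OF S x] AXF_submoduleD(7)[OF S' subsetD[OF sub x]] by simp
      qed
      then show "(\<lambda>x\<in>M. g x, n) \<in> fraction (PM M) (\<lambda>x\<in>M. f x) 0" using gM unfolding fraction_def by blast
    qed
    have "(\<lambda>x\<in>M'. f x, 0) \<in> fraction (PM M') (\<lambda>x\<in>M'. f x) 0" using r[OF M'] by (simp add: fraction_def)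
    then have "(\<Union>(g, n)\<in>fraction (PM M') (\<lambda>x\<in>M'. f x) 0. fraction (PM M) (\<lambda>x\<in>M. g x) n)
        = fraction (PM M) (\<lambda>x\<in>M. f x) 0" using eq by fast
    then show ?thesis by (simp add: dual_loc_map_def PM_def)
  qed
  have "fraction (PM M) (\<lambda>x\<in>M. f x) 0 \<in> carrier (localize (PM M))" if "M \<in> MM V \<rho>" for M
  proof -
    have "carrier (localize (PM M)) = {fraction (PM M) g n | g n. g \<in> carrier (PM M)}"
      by (simp add: localize_def)
    then show ?thesis using r[OF that] by blast
  qed
  then have "?y \<in> (\<Pi>\<^sub>E M\<in>MM V \<rho>. carrier (localize (PM M)))" by simp
  moreover have "\<forall>M\<in>MM V \<rho>. \<forall>M'\<in>MM V \<rho>. M \<subseteq> M' \<longrightarrow> ?y M = dual_loc_map (as_module V \<rho> M) (\<lambda>m. m) (?y M')"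
  proof (intro ballI impI)
    fix M M' assume M: "M \<in> MM V \<rho>" "M' \<in> MM V \<rho>" "M \<subseteq> M'"
    show "?y M = dual_loc_map (as_module V \<rho> M) (\<lambda>m. m) (?y M')"
      unfolding restrict_apply'[OF M(1)] restrict_apply'[OF M(2)] by (rule compat[OF M])
  qed
  moreover have "carrier (D_xi V \<rho>) = {y \<in> (\<Pi>\<^sub>E M\<in>MM V \<rho>. carrier (localize (PM M))).
        \<forall>M\<in>MM V \<rho>. \<forall>M'\<in>MM V \<rho>. M \<subseteq> M' \<longrightarrow> y M = dual_loc_map (as_module V \<rho> M) (\<lambda>m. m) (y M')}"
    by (simp add: D_xi_def PM_def)
  ultimately show ?thesis by blast
qed

text \<open>
  If the families of \<open>f\<close> and of the zero functional agreed at \<open>M\<close>, then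
  \<open>X\<^sup>jf\<close> would vanish on \<open>M\<close> for some \<open>j\<close>.
\<close>

lemma D_xi_nontrivial:
  assumes M: "M \<in> MM V \<rho>" and f: "functional (carrier V) f"
    and nz: "\<And>j. \<exists>m\<in>M. f ((xop ^^ j) m) \<noteq> \<one>\<^bsub>K_mod_o\<^esub>"
  shows "\<exists>y\<in>carrier (D_xi V \<rho>). \<exists>z\<in>carrier (D_xi V \<rho>). y \<noteq> z"
proof -
  interpret KG: comm_group K_mod_o by (rule K_mod_o_comm_group)
  note S = MM_submodule[OF M]
  have z: "functional (carrier V) (\<lambda>_. \<one>\<^bsub>K_mod_o\<^esub>)"
    by (simp add: functional_def K_mod_o_scale_one)
  have y1: "(\<lambda>M\<in>MM V \<rho>. fraction (PM M) (\<lambda>x\<in>M. f x) 0) \<in> carrier (D_xi V \<rho>)" by (rule functional_family[OF f])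
  have y2: "(\<lambda>M\<in>MM V \<rho>. fraction (PM M) (\<lambda>x\<in>M. \<one>\<^bsub>K_mod_o\<^esub>) 0) \<in> carrier (D_xi V \<rho>)"
    by (rule functional_family[OF z])
  have sub: "M \<subseteq> carrier V" using AXF_submoduleD(2)[OF S] by blast
  have c: "(\<lambda>x\<in>M. f x) \<in> carrier (PM M)" "(\<lambda>x\<in>M. \<one>\<^bsub>K_mod_o\<^esub>) \<in> carrier (PM M)"
    by (rule functional_restrict[OF S f sub], rule functional_restrict[OF S z sub])
  have "(\<lambda>M\<in>MM V \<rho>. fraction (PM M) (\<lambda>x\<in>M. f x) 0) \<noteq> (\<lambda>M\<in>MM V \<rho>. fraction (PM M) (\<lambda>x\<in>M. \<one>\<^bsub>K_mod_o\<^esub>) 0)"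
  proof
    assume "(\<lambda>M\<in>MM V \<rho>. fraction (PM M) (\<lambda>x\<in>M. f x) 0) = (\<lambda>M\<in>MM V \<rho>. fraction (PM M) (\<lambda>x\<in>M. \<one>\<^bsub>K_mod_o\<^esub>) 0)"
    then have e: "fraction (PM M) (\<lambda>x\<in>M. f x) 0 = fraction (PM M) (\<lambda>x\<in>M. \<one>\<^bsub>K_mod_o\<^esub>) 0"
      using M by (auto dest!: fun_cong[of _ _ M])
    have "(\<lambda>x\<in>M. f x, 0) \<in> fraction (PM M) (\<lambda>x\<in>M. f x) 0" using c(1) by (simp add: fraction_def)
    then obtain j where j: "X_pow (PM M) j (\<lambda>x\<in>M. \<one>\<^bsub>K_mod_o\<^esub>) = X_pow (PM M) j (\<lambda>x\<in>M. f x)"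
      unfolding e by (auto simp: fraction_def)
    obtain m where m: "m \<in> M" "f ((xop ^^ j) m) \<noteq> \<one>\<^bsub>K_mod_o\<^esub>" using nz by blast
    have "X_pow (PM M) j (\<lambda>x\<in>M. \<one>\<^bsub>K_mod_o\<^esub>) m = X_pow (PM M) j (\<lambda>x\<in>M. f x) m" by (simp only: j)
    then show False
      using m AXF_submoduleD(7)[OF S m(1)] unfolding X_pow_PM[OF S c(1)] X_pow_PM[OF S c(2)] by simp
  qed
  then show ?thesis by (rule bexI[OF bexI[OF _ y2] y1])
qed

end

context torus_rep
begin

subsection \<open>The action of \<open>F\<close> and \<open>\<Gamma>\<close> on step functions\<close>

text \<open>
  By left invariance under \<open>T\<close>, translation by \<open>t\<close> from the right becomes
  conjugation.
\<close>

lemma torus_translate: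
  assumes f: "f \<in> M0" and t: "t \<in> TQ" and n: "n \<in> NQ"
  shows "f (n ** t) = f (cj (matrix_inv t) n)"
proof -
  have i: "invertible t" using TQ_closed(1) t by blast
  have "cj (matrix_inv t) n \<in> B" using NQ_normal[OF TQ_in_B[OF TQ_closed(4)[OF t]] n] NQ_in_B by blast
  then have "f (t ** cj (matrix_inv t) n) = f (cj (matrix_inv t) n)" by (rule VT_torus[OF M0_VT[OF f] t])
  moreover have "t ** cj (matrix_inv t) n = n ** t"
    by (simp add: cj_def matrix_inv_inv[OF i] matrix_mul_assoc matrix_inv i)
  ultimately show ?thesis by simp
qed

lemma M0_outside_N0: "f \<in> M0 \<Longrightarrow> n \<in> NQ \<Longrightarrow> n \<notin> N0 \<Longrightarrow> f n = \<zero>\<^bsub>W\<^esub>"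
  using M0_outside[of f n] in_TN0_iff[OF TQ_closed(2), of n] NQ_in_B by simp

lemma F_value:
  assumes f: "f \<in> M0" and x: "x \<in> B"
  shows "F_op VT (cind_action B) f x = finsum W (\<lambda>C. f (x ** rep C ** s)) (coset ` H0)"
proof -
  have r: "rep C \<in> B" if "C \<in> coset ` H0" for C using that coset_in_H0 rep_mem H0_in_B by blast
  have "F_op VT (cind_action B) f x
      = finsum W (\<lambda>C. cind_action B (rep C) (cind_action B s f) x) (coset ` H0)"
    unfolding F_op_eq using F_terms_closed[OF M0_inv_H0[OF f]]
    by (intro finsum_value finite_cosets x) simp
  also have "\<dots> = finsum W (\<lambda>C. f (x ** rep C ** s)) (coset ` H0)"
  proof (rule Wm.finsum_cong')
    fix C assume C: "C \<in> coset ` H0"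
    show "cind_action B (rep C) (cind_action B s f) x = f (x ** rep C ** s)"
      using r[OF C] x B_closed(3) by (simp add: act_value)
  qed (use r x B_closed(3) s_in_B M0_value_closed[OF f] in auto)
  finally show ?thesis .
qed

lemma F_value_outside:
  assumes f: "f \<in> M0" and n: "n \<in> NQ" and out: "\<And>r z. r \<in> H0 \<Longrightarrow> z \<in> N0 \<Longrightarrow> n ** r \<noteq> cj s z"
  shows "F_op VT (cind_action B) f n = \<zero>\<^bsub>W\<^esub>"
proof -
  have "f (n ** rep C ** s) = \<zero>\<^bsub>W\<^esub>" if C: "C \<in> coset ` H0" for C
  proof -
    have r: "rep C \<in> H0" using C coset_in_H0 rep_mem by blast
    have nr: "n ** rep C \<in> NQ" using NQ_closed(3)[OF n N0_in_NQ[OF H0_subset[OF r]]] .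
    let ?y = "cj (matrix_inv s) (n ** rep C)"
    have "?y \<notin> N0" using out[OF r, of ?y] cj_inv'[OF s_inv] by auto
    then show ?thesis
      unfolding torus_translate[OF f s_in_TQ nr]
      by (intro M0_outside_N0[OF f] NQ_normal[OF TQ_in_B[OF TQ_closed(4)[OF s_in_TQ]] nr])
  qed
  then show ?thesis
    unfolding F_value[OF f NQ_in_B[OF n]] by (intro Wm.add.finprod_one_eqI) simp
qed

text \<open>
  Exactly one coset contributes: the representative \<open>r\<close> must satisfy \<open>nr =
  szs\<^sup>-\<^sup>1\<close> up to \<open>sH\<^sub>0s\<^sup>-\<^sup>1\<close>.
\<close>

lemma F_value_s:
  assumes f: "f \<in> M0" and n: "n \<in> N0" and z: "z \<in> N0" "ell n = of_nat p ^ ee * ell z"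
  shows "F_op VT (cind_action B) f n = f z"
proof -
  have sz: "cj s z \<in> N0" "ell (cj s z) = ell n" using cj_s_N0[OF z(1)] ee(2)[OF z(1)] z(2) by auto
  have ni: "invertible n" using N0_closed(1) n by blast
  define r0 where "r0 = matrix_inv n ** cj s z"
  have r0: "r0 \<in> H0" using n sz N0_closed by (simp add: r0_def H0_def ell_mult ell_inv)
  have nr0: "n ** r0 = cj s z" by (simp add: r0_def matrix_mul_assoc matrix_inv ni)
  have r0i: "invertible r0" using H0_closed(1) r0 by blast
  have fz: "f z \<in> carrier W" using M0_value_closed[OF f N0_in_B[OF z(1)]] .
  have val: "f (n ** rep C ** s) = (if coset r0 = C then f z else \<zero>\<^bsub>W\<^esub>)" if C: "C \<in> coset ` H0" for C
  proof -
    have r: "rep C \<in> H0" "C = coset (rep C)"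
      using C coset_in_H0 rep_mem coset_eq by blast+
    have nr: "n ** rep C \<in> NQ" using NQ_closed(3)[OF N0_in_NQ[OF n] N0_in_NQ[OF H0_subset[OF r(1)]]] .
    have v: "f (n ** rep C ** s) = f (cj (matrix_inv s) (n ** rep C))" by (rule torus_translate[OF f s_in_TQ nr])
    show ?thesis
    proof (cases "coset r0 = C")
      case True
      then have "rep C \<in> coset r0" using rep_mem by blast
      then obtain y where y: "y \<in> H0" "rep C = r0 ** cj s y" by (auto simp: coset_def sH0_def)
      have "n ** rep C = cj s (z ** y)" by (simp add: y(2) matrix_mul_assoc nr0 cj_mult[OF s_inv])
      then have "f (n ** rep C ** s) = f (z ** y)" using v cj_inv[OF s_inv] by simp
      also have "\<dots> = f z" by (rule inv_H0_value[OF M0_inv_H0[OF f] y(1) N0_in_B[OF z(1)]])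
      finally show ?thesis using True by simp
    next
      case False
      let ?y = "cj (matrix_inv s) (n ** rep C)"
      have "?y \<notin> N0"
      proof
        assume y: "?y \<in> N0"
        have sy: "cj s ?y = n ** rep C" by (rule cj_inv'[OF s_inv])
        have "of_nat p ^ ee * ell ?y = ell n"
          using ee(2)[OF y] r(1) ell_mult[OF n H0_subset[OF r(1)]] by (simp add: sy H0_def)
        then have e: "ell ?y = ell z" using z(2) p_nonzero by simp
        let ?h = "matrix_inv z ** ?y"
        have h: "?h \<in> H0" using y z(1) e N0_closed by (simp add: H0_def ell_mult ell_inv)
        have "cj s ?h = matrix_inv (cj s z) ** (n ** rep C)"
          by (simp add: cj_mult[OF s_inv] cj_matrix_inv[OF s_inv N0_closed(1)[OF z(1)]] sy)
        also have "\<dots> = matrix_inv r0 ** rep C"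
          by (simp add: nr0[symmetric] matrix_inv_mult ni r0i matrix_mul_assoc matrix_inv_cancel)
        finally have "rep C = r0 ** cj s ?h" by (simp add: matrix_mul_assoc matrix_inv r0i)
        then have "rep C \<in> coset r0" using h by (auto simp: coset_def sH0_def)
        then show False using False r(2) coset_eq by blast
      qed
      then have "f ?y = \<zero>\<^bsub>W\<^esub>"
        by (intro M0_outside_N0[OF f] NQ_normal[OF TQ_in_B[OF TQ_closed(4)[OF s_in_TQ]] nr])
      then show ?thesis using False v by simp
    qed
  qed
  have "F_op VT (cind_action B) f n = finsum W (\<lambda>C. if coset r0 = C then f z else \<zero>\<^bsub>W\<^esub>) (coset ` H0)"
    unfolding F_value[OF f N0_in_B[OF n]] using val fz by (intro Wm.finsum_cong') auto
  also have "\<dots> = f z" using r0 fz by (intro Wm.finsum_singleton finite_cosets) auto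
  finally show ?thesis .
qed

lemma M0I_NQ:
  assumes f: "f \<in> inv_H0" and z: "\<And>n. n \<in> NQ \<Longrightarrow> n \<notin> N0 \<Longrightarrow> f n = \<zero>\<^bsub>W\<^esub>"
  shows "f \<in> M0"
proof -
  have VT: "f \<in> torus_inv W" using inv_H0_closed[OF f] by simp
  have "f x = \<zero>\<^bsub>W\<^esub>" if x: "x \<in> B" "\<not> in_TN0 x" for x
  proof -
    obtain t n where tn: "t \<in> TQ" "n \<in> NQ" "x = t ** n" using x(1) unfolding B_eq by blast
    have "n \<notin> N0" using x(2) in_TN0_iff[OF tn(1,2)] tn(3) by simp
    then show ?thesis using VT_torus[OF VT tn(1) NQ_in_B[OF tn(2)]] z[OF tn(2)] tn(3) by simp
  qed
  then show ?thesis using f by (simp add: M0_def)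
qed

lemma F_M0:
  assumes f: "f \<in> M0" shows "F_op VT (cind_action B) f \<in> M0"
proof (rule M0I_NQ[OF F_inv_H0[OF M0_inv_H0[OF f]]])
  fix n assume n: "n \<in> NQ" "n \<notin> N0"
  show "F_op VT (cind_action B) f n = \<zero>\<^bsub>W\<^esub>"
  proof (rule F_value_outside[OF f n(1)])
    fix r z assume r: "r \<in> H0" and z: "z \<in> N0"
    show "n ** r \<noteq> cj s z"
    proof
      assume "n ** r = cj s z"
      then have "n = cj s z ** matrix_inv r" using H0_closed(1)[OF r] by (metis matrix_inv_cancel(1))
      then show False using n(2) N0_closed(3)[OF cj_s_N0[OF z] N0_closed(4)[OF H0_subset[OF r]]] by simp
    qed
  qed
qed

lemma M0_submodule: "AXF_submodule VT (cind_action B) M0"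
  by (rule AXF_submoduleI)
    (use M0_inv_H0 M0_zero M0_add M0_osm M0_xop F_M0 in \<open>auto simp del: fun_module_simps(2-4)\<close>)

text \<open>
  An element of \<open>\<Gamma>\<close> normalizes \<open>N\<^sub>0\<close> and
  \<open>H\<^sub>0\<close>.
\<close>

lemma M0_Gamma:
  assumes g: "g \<in> \<Gamma>" and f: "f \<in> M0" shows "cind_action B g f \<in> M0"
proof (rule M0I_NQ)
  obtain z where z: "z \<in> Zp_units" "g = \<xi> z" using g by (auto simp: \<Gamma>_def)
  have z1: "pabs z = 1" using z(1) by (simp add: Zp_units_def)
  have z0: "z \<noteq> 0" "z \<in> Zp" using z1 by (auto simp: Zp_def)
  have gT: "g \<in> TQ" unfolding z(2) by (rule xi_in_TQ[OF z0(1)])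
  have gi: "invertible g" "g \<in> B" using gT TQ_closed(1) TQ_in_B by blast+
  have zi: "inverse z \<in> Zp_units" using z1 by (simp add: Zp_units_def pabs_inverse)
  have gH: "cj (matrix_inv g) y \<in> H0" if "y \<in> H0" for y
    using Gamma_H0[OF zi, of y] that xi_inverse[OF z0(1)] by (simp add: H0_def N0_def cj_def z(2))
  show "cind_action B g f \<in> inv_H0"
    unfolding inv_H0_def
  proof (intro CollectI conjI ballI)
    show "cind_action B g f \<in> carrier VT" by (rule act_closed[OF gi(2) M0_VT'[OF f]])
    fix y assume y: "y \<in> H0"
    have sw: "y ** g = g ** cj (matrix_inv g) y"
      by (simp add: cj_def matrix_inv_inv[OF gi(1)] matrix_mul_assoc matrix_inv gi(1))
    have "cind_action B y (cind_action B g f) = cind_action B (g ** cj (matrix_inv g) y) f"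
      using act_mult[OF H0_in_B[OF y] gi(2) M0_VT'[OF f]] sw by simp
    also have "\<dots> = cind_action B g (cind_action B (cj (matrix_inv g) y) f)"
      by (rule act_mult[OF gi(2) H0_in_B[OF gH[OF y]] M0_VT'[OF f]])
    also have "cind_action B (cj (matrix_inv g) y) f = f"
      using M0_inv_H0[OF f] gH[OF y] by (simp add: inv_H0_def)
    finally show "cind_action B y (cind_action B g f) = cind_action B g f" .
  qed
  fix n assume n: "n \<in> NQ" "n \<notin> N0"
  have "cj (matrix_inv g) n \<notin> N0"
  proof
    assume "cj (matrix_inv g) n \<in> N0"
    then have "cj g (cj (matrix_inv g) n) \<in> N0" unfolding z(2) by (rule cj_xi_N0[OF z0(2,1)])
    then show False using n(2) cj_inv'[OF gi(1)] by simp
  qed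
  then have "f (n ** g) = \<zero>\<^bsub>W\<^esub>"
    unfolding torus_translate[OF f gT n(1)]
    by (intro M0_outside_N0[OF f] NQ_normal[OF TQ_in_B[OF TQ_closed(4)[OF gT]] n(1)])
  then show "cind_action B g f n = \<zero>\<^bsub>W\<^esub>" by (simp add: act_value NQ_in_B[OF n(1)])
qed

end

context borel_rep
begin

lemma AXF_finsum:
  assumes M: "AXF_submodule V \<rho> M" and f: "f \<in> I \<rightarrow> M"
  shows "finsum V f I \<in> M"
  using f
proof (induction I rule: infinite_finite_induct)
  case (insert i I)
  note D = AXF_submoduleD[OF M]
  have fi: "f i \<in> M" "f \<in> I \<rightarrow> M" "f i \<in> carrier V" "f \<in> I \<rightarrow> carrier V" using insert.prems D(2) by auto
  show ?case
    unfolding V.finsum_insert[OF insert.hyps fi(4,3)] by (rule D(4)[OF fi(1) insert.IH[OF fi(2)]])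
qed (simp_all add: V.finsum_infinite V.finsum_empty AXF_submoduleD(3)[OF M])

lemma AXF_act_mpow:
  assumes M: "AXF_submodule V \<rho> M" and v: "v \<in> M"
  shows "\<rho> (mpow gam m) v \<in> M"
proof (induction m)
  case 0
  then show ?case using v AXF_submoduleD(2)[OF M v] by (simp add: act_one)
next
  case (Suc m)
  then show ?case
    using AXF_submoduleD(11)[OF M Suc] act_mult[OF gam_in_B B_mpow[OF gam_in_B] AXF_submoduleD(2)[OF M v]] by simp
qed

lemma functional_minus_eq:
  assumes M: "AXF_submodule V \<rho> M" and f: "functional M f" and g: "functional M g"
    and v: "v \<in> M" and w: "w \<in> M" and eq: "f w = g w" "f (v \<oplus>\<^bsub>V\<^esub> w) = g (v \<oplus>\<^bsub>V\<^esub> w)"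
  shows "f v = g v"
proof -
  interpret KG: comm_group K_mod_o by (rule K_mod_o_comm_group)
  show ?thesis
    using eq functionalD(1)[OF f v] functionalD(1)[OF g v] functionalD(1)[OF f w]
    unfolding functionalD(2)[OF f v w] functionalD(2)[OF g v w] by simp
qed

end

context torus_rep
begin

subsection \<open>Finiteness of \<open>M0\<close>\<close>

abbreviation Fop where "Fop \<equiv> F_op VT (cind_action B)"

text \<open>
  By \<open>F_value_s\<close>, a function of \<open>ell\<close> is stretched by the factor
  \<open>p\<^bsup>ee\<^esup>\<close> under \<open>F\<close> and extended by zero; starting from a
  constant function, this yields multiples of indicator functions.
\<close>

lemma F_pow_eps0:
  "(Fop ^^ k) eps0 \<in> M0 \<and>
    (\<forall>j. (Fop ^^ k) eps0 (pt j) = (if int p ^ (ee * k) dvd j then w1 else \<zero>\<^bsub>W\<^esub>))"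
proof (induction k)
  case (Suc k)
  let ?g = "(Fop ^^ k) eps0"
  have g: "?g \<in> M0" "\<And>j. ?g (pt j) = (if int p ^ (ee * k) dvd j then w1 else \<zero>\<^bsub>W\<^esub>)" using Suc by blast+
  have "Fop ?g (pt j) = (if int p ^ (ee * Suc k) dvd j then w1 else \<zero>\<^bsub>W\<^esub>)" for j
  proof (cases "int p ^ ee dvd j")
    case True
    then obtain i where i: "j = int p ^ ee * i" by blast
    have "Fop ?g (pt j) = ?g (pt i)" by (rule F_value_s[OF g(1) pt(1) pt(1)]) (simp add: pt(2) i)
    moreover have "int p ^ (ee * Suc k) dvd j \<longleftrightarrow> int p ^ (ee * k) dvd i"
      using p_gt_1 by (simp add: i power_add)
    ultimately show ?thesis by (simp add: g(2))
  next
    case False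
    have "Fop ?g (pt j) = \<zero>\<^bsub>W\<^esub>"
    proof (rule F_value_outside[OF g(1) N0_in_NQ[OF pt(1)]])
      fix r z assume r: "r \<in> H0" and z: "z \<in> N0"
      show "pt j ** r \<noteq> cj s z"
      proof
        assume "pt j ** r = cj s z"
        then have "of_int j = of_nat p ^ ee * ell z"
          using ee(2)[OF z] ell_mult[OF pt(1) H0_subset[OF r], of j] r by (simp add: H0_def pt(2))
        moreover have "pabs (of_nat p ^ ee * ell z) \<le> 1 / real p ^ ee * 1"
          using ell_in_Zp[OF z] unfolding Zp_def by (intro pabs_mult_le) (auto simp: pabs_p_power)
        ultimately have "pabs (of_int j :: 'q) \<le> 1 / real p ^ ee" by simp
        then show False using False unfolding pabs_of_int_le_iff by blast
      qed
    qed
    moreover have "\<not> int p ^ (ee * Suc k) dvd j"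
      using False dvd_trans[of "int p ^ ee" "int p ^ (ee * Suc k)" j] by (auto simp: power_add)
    ultimately show ?thesis by simp
  qed
  then show ?case using F_M0[OF g(1)] by simp
qed (simp add: eps0_M0 eps0_pt)

lemma ell_mpow: "ell (mpow gam m) = of_nat m" and mpow_N0: "mpow gam m \<in> N0"
proof -
  have "mpow gam m \<in> N0 \<and> ell (mpow gam m) = of_nat m"
    by (induction m) (auto simp: N0_closed(2,3) ell_one ell_mult gam)
  then show "ell (mpow gam m) = of_nat m" "mpow gam m \<in> N0" by auto
qed

text \<open>
  The translates of \<open>F\<^sup>k\<close> of the constant function are indicator functions of the
  residue classes modulo \<open>p\<^bsup>ee k\<^esup>\<close>, and all functions of this period are
  combinations of them.
\<close>

lemma M0_generated: "AXF_fin_gen VT (cind_action B) M0"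
  unfolding AXF_fin_gen_def
proof (intro exI[of _ "{eps0}"] conjI equalityI)
  show "\<Inter>{M'. AXF_submodule VT (cind_action B) M' \<and> {eps0} \<subseteq> M'} \<subseteq> M0"
    using M0_submodule eps0_M0 by blast
  show "M0 \<subseteq> \<Inter>{M'. AXF_submodule VT (cind_action B) M' \<and> {eps0} \<subseteq> M'}"
  proof (intro subsetI InterI)
    fix f M' assume f: "f \<in> M0" and "M' \<in> {M'. AXF_submodule VT (cind_action B) M' \<and> {eps0} \<subseteq> M'}"
    then have M': "AXF_submodule VT (cind_action B) M'" "eps0 \<in> M'" by blast+
    let ?d = "\<lambda>j. f (pt j)"
    obtain k where k: "periodic ?d k" using M0_step[OF f] by blast
    have d: "periodic ?d (ee * k)" by (rule periodic_mono[OF k]) (use ee(1) in simp)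
    let ?Q = "p ^ (ee * k)"
    have Q0: "?Q > 0" using p_gt_1 by simp
    have dcl: "?d j \<in> carrier W" for j by (rule M0_value_closed[OF f pt_in_B])
    then have "\<forall>j. \<exists>c. c \<in> OK \<and> ?d j = cls c \<odot>\<^bsub>W\<^esub> w1" using W_elem by blast
    then obtain a where a: "\<And>j. a j \<in> OK" "\<And>j. ?d j = cls (a j) \<odot>\<^bsub>W\<^esub> w1" by metis
    let ?g = "(Fop ^^ k) eps0"
    have g: "?g \<in> M0" "\<And>j. ?g (pt j) = (if int p ^ (ee * k) dvd j then w1 else \<zero>\<^bsub>W\<^esub>)"
      using F_pow_eps0[of k] by blast+
    \<comment> \<open>the translate by \<open>m\<close> is supported on the residue class of \<open>- m\<close>\<close>
    define t where "t m = a (- int m) \<cdot> cind_action B (mpow gam m) ?g" for m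
    have tM': "t \<in> I \<rightarrow> M'" for I
      unfolding t_def
      using AXF_submoduleD(6)[OF M'(1) a(1) AXF_act_mpow[OF M'(1) AXF_submoduleD(10)[OF M'(1,2)]]] by blast
    have tM0: "t \<in> I \<rightarrow> M0" for I
      unfolding t_def using M0_osm[OF a(1) M0_act_N0[OF g(1) mpow_N0]] by blast
    have tval: "t m (pt i) = (if nat ((- i) mod int ?Q) = m then ?d i else \<zero>\<^bsub>W\<^esub>)" if m: "m < ?Q" for m i
    proof -
      have v: "t m (pt i) = cls (a (- int m)) \<odot>\<^bsub>W\<^esub> ?g (pt (i + int m))"
        using act_pt[OF g(1) mpow_N0, of m "int m" i]
        by (simp add: t_def VT_smult_value pt_in_B ell_mpow del: fun_module_simps(2-4))
      have "nat ((- i) mod int ?Q) = m \<longleftrightarrow> (- i) mod int ?Q = int m mod int ?Q"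
        using m Q0 by (auto simp: nat_eq_iff mod_pos_pos_trivial)
      also have "\<dots> \<longleftrightarrow> int ?Q dvd i + int m"
        unfolding mod_eq_dvd_iff using dvd_minus_iff[of "int ?Q" "i + int m"] by (simp add: algebra_simps)
      finally have iff: "nat ((- i) mod int ?Q) = m \<longleftrightarrow> int p ^ (ee * k) dvd i + int m" by simp
      show ?thesis
      proof (cases "int p ^ (ee * k) dvd i + int m")
        case True
        then have "int p ^ (ee * k) dvd i - (- int m)" by simp
        then have "?d i = ?d (- int m)" using d unfolding periodic_def by blast
        then show ?thesis using v True iff a(2)[of "- int m"] by (simp add: g(2))
      next
        case False
        then show ?thesis using v iff cls_smult_zero[OF W_module a(1)] by (simp add: g(2))
      qed
    qed
    have "f = finsum VT t {..<?Q}"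
    proof (rule M0_eq_ptI[OF f AXF_finsum[OF M0_submodule tM0]])
      fix i
      let ?m = "nat ((- i) mod int ?Q)"
      have "?m < ?Q" using Q0 by (simp add: nat_less_iff)
      have "finsum VT t {..<?Q} (pt i) = finsum W (\<lambda>m. t m (pt i)) {..<?Q}"
        by (rule finsum_value[OF _ _ pt_in_B]) (use tM0 M0_VT in auto)
      also have "\<dots> = finsum W (\<lambda>m. if ?m = m then ?d i else \<zero>\<^bsub>W\<^esub>) {..<?Q}"
        using dcl tval by (intro Wm.finsum_cong') auto
      also have "\<dots> = ?d i" using dcl \<open>?m < ?Q\<close> by (intro Wm.finsum_singleton) auto
      finally show "?d i = finsum VT t {..<?Q} (pt i)" by simp
    qed
    then show "f \<in> M'" using AXF_finsum[OF M'(1) tM'] by simp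
  qed
qed (use eps0_M0 in auto)

text \<open>
  Only the term of index \<open>n\<close> contributes, as \<open>X\<^sup>i\<close> maps \<open>eps
  n\<close> to \<open>eps (n - i)\<close>, which vanishes at \<open>0\<close> unless \<open>i =
  n\<close>.
\<close>

lemma residue_series_eps:
  assumes a: "a \<in> carrier AX" and b: "b \<in> OK" "a n = cls b"
  shows "residue (act_series VT (cind_action B) a (eps n)) = kcl (b / \<pi> ^ h)"
proof -
  have z: "(xop ^^ Suc n) (eps n) = \<zero>\<^bsub>VT\<^esub>"
    using eps_xop_pow[of n n] xop_eps0 by simp
  have c: "a i \<odot>\<^bsub>VT\<^esub> (xop ^^ i) (eps n) \<in> carrier VT" for i
    using V.smult_closed[OF AX_coeff[OF a] xop_closed[OF M0_VT'[OF eps_M0]]] by blast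
  have "act_series VT (cind_action B) a (eps n) (pt 0)
      = finsum W (\<lambda>i. (a i \<odot>\<^bsub>VT\<^esub> (xop ^^ i) (eps n)) (pt 0)) {..<Suc n}"
    unfolding act_series_eq[OF M0_VT'[OF eps_M0] a z] using c by (intro finsum_value pt_in_B) auto
  also have "\<dots> = finsum W (\<lambda>i. if n = i then cls b \<odot>\<^bsub>W\<^esub> w1 else \<zero>\<^bsub>W\<^esub>) {..<Suc n}"
  proof (rule Wm.finsum_cong')
    show "(\<lambda>i. if n = i then cls b \<odot>\<^bsub>W\<^esub> w1 else \<zero>\<^bsub>W\<^esub>) \<in> {..<Suc n} \<rightarrow> carrier W"
      using cls_smult(3)[OF W_module w1 b(1)] by simp
    fix i assume i: "i \<in> {..<Suc n}"
    then have "(xop ^^ i) (eps n) (pt 0) = (if n = i then w1 else \<zero>\<^bsub>W\<^esub>)"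
      using eps_xop_pow[of i n] by (auto simp: eps_pt_0)
    then show "(a i \<odot>\<^bsub>VT\<^esub> (xop ^^ i) (eps n)) (pt 0) = (if n = i then cls b \<odot>\<^bsub>W\<^esub> w1 else \<zero>\<^bsub>W\<^esub>)"
      unfolding VT_smult_value[OF pt_in_B] using b(2) Wm.smult_r_null[OF AX_coeff[OF a]] by auto
  qed simp
  also have "\<dots> = cls b \<odot>\<^bsub>W\<^esub> w1"
    using cls_smult(3)[OF W_module w1 b(1)] by (intro Wm.finsum_singleton) auto
  finally show ?thesis using res_cls[OF b(1)] by (simp add: residue_def)
qed

text \<open>
  By \<open>residue_series_eps\<close>, a power series is found that gives the same values at all
  \<open>eps n\<close> as a given functional. The \<open>eps n\<close> generate \<open>M0\<close>
  over \<open>A\<close>, by induction on the power of \<open>X\<close> that kills an element, as the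
  kernel of \<open>X\<close> is generated by \<open>eps0\<close>.
\<close>

lemma M0_dual_generated: "fin_gen AX (PM M0)"
  unfolding fin_gen_def
proof (intro exI[of _ "{\<lambda>x\<in>M0. residue x}"] conjI ballI)
  note S = M0_submodule
  note D = AXF_submoduleD[OF S]
  interpret P: abelian_monoid "PM M0" by (rule PM_abelian_monoid[OF S])
  have rM: "(\<lambda>x\<in>M0. residue x) \<in> carrier (PM M0)"
    using M0_VT' by (intro functional_restrict[OF S residue_functional]) blast
  then show "{\<lambda>x\<in>M0. residue x} \<subseteq> carrier (PM M0)" by simp
  fix f assume f: "f \<in> carrier (PM M0)"
  then have ff: "functional M0 f" "f \<in> extensional M0" using PM_simps(1)[OF S] by auto
  have "\<exists>b. b \<in> OK \<and> f (eps n) = kcl (b / \<pi> ^ h)" for n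
  proof -
    obtain x where x: "f (eps n) = kcl x" using functionalD(1)[OF ff(1) eps_M0] by (auto simp: K_mod_o_carrier)
    have pO: "\<pi> ^ h \<in> OK" using uniformizer_in OK_power by blast
    have "kcl (\<pi> ^ h * x) = f (\<pi> ^ h \<cdot> eps n)"
      using functionalD(3)[OF ff(1) pO eps_M0] x scale_kcl[OF pO] by simp
    also have "\<pi> ^ h \<cdot> eps n = \<zero>\<^bsub>VT\<^esub>" by (rule osm(6)[OF M0_VT'[OF eps_M0]])
    also have "f \<zero>\<^bsub>VT\<^esub> = kcl 0" using functional_zero[OF ff(1) M0_zero] by (simp only: K_mod_o_one)
    finally have "\<pi> ^ h * x \<in> OK" by (simp add: kcl_eq_iff)
    then show ?thesis using x uniformizer_nonzero by (intro exI[of _ "\<pi> ^ h * x"]) simp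
  qed
  then obtain b where b: "\<And>n. b n \<in> OK" "\<And>n. f (eps n) = kcl (b n / \<pi> ^ h)" by metis
  define a where "a n = cls (b n)" for n
  have a: "a \<in> carrier AX" using cls_closed[OF b(1)] by (simp add: a_def AX_def power_series_ring_def)
  let ?g = "a \<odot>\<^bsub>PM M0\<^esub> (\<lambda>x\<in>M0. residue x)"
  have gM: "?g \<in> carrier (PM M0)" by (rule PM_smult_closed[OF S a rM])
  then have g: "functional M0 ?g" "?g \<in> extensional M0" using PM_simps(1)[OF S] by auto
  have geps: "?g (eps n) = f (eps n)" for n
    using residue_series_eps[OF a b(1) a_def] b(2)[of n] eps_M0[of n] D(9)[OF a eps_M0]
    by (simp add: PM_simps(4)[OF S])
  have "f v = ?g v" if "v \<in> M0" "(xop ^^ n) v = \<zero>\<^bsub>VT\<^esub>" for v n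
    using that
  proof (induction n arbitrary: v)
    case 0
    then have "v = \<zero>\<^bsub>VT\<^esub>" by (simp only: funpow_0)
    then show ?case using functional_zero[OF ff(1) M0_zero] functional_zero[OF g(1) M0_zero] by (simp only:)
  next
    case (Suc n)
    have vM: "v \<in> M0" by (rule Suc.prems(1))
    note vc = M0_VT'[OF vM] and ec = M0_VT'[OF eps_M0]
    have "xop ((xop ^^ n) v) = \<zero>\<^bsub>VT\<^esub>" using Suc.prems(2) by (simp only: funpow.simps o_apply)
    then obtain c where c: "c \<in> OK" "(xop ^^ n) v = c \<cdot> eps0"
      using ker_xop[OF D(7)[OF vM]] by blast
    let ?w = "(- c) \<cdot> eps n"
    have mc: "- c \<in> OK" by (rule OK_minus[OF c(1)])
    have w: "?w \<in> M0" by (rule M0_osm[OF mc eps_M0])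
    have e0: "eps0 \<in> carrier VT" by (rule M0_VT'[OF eps0_M0])
    have xw: "(xop ^^ n) ?w = (- c) \<cdot> eps0"
      unfolding xop_osm[OF ec mc] using eps_xop_pow[of n n] by simp
    have "(xop ^^ n) (v \<oplus>\<^bsub>VT\<^esub> ?w) = c \<cdot> eps0 \<oplus>\<^bsub>VT\<^esub> (- c) \<cdot> eps0"
      unfolding xop_add[OF vc M0_VT'[OF w]] c(2) xw ..
    also have "\<dots> = \<zero>\<^bsub>VT\<^esub>"
      using osm(1)[OF e0 c(1) mc] osm(5)[OF e0] by (simp del: fun_module_simps(2-4))
    finally have "f (v \<oplus>\<^bsub>VT\<^esub> ?w) = ?g (v \<oplus>\<^bsub>VT\<^esub> ?w)" by (intro Suc.IH M0_add vM w)
    moreover have "f ?w = ?g ?w"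
      unfolding functionalD(3)[OF ff(1) mc eps_M0] functionalD(3)[OF g(1) mc eps_M0] geps ..
    ultimately show ?case by (intro functional_minus_eq[OF S ff(1) g(1) vM w])
  qed
  then have "f = ?g"
    using X_nilpotent[OF M0_VT'] by (intro extensionalityI[OF ff(2) g(2)]) blast
  then show "\<exists>c\<in>{\<lambda>x\<in>M0. residue x} \<rightarrow> carrier AX.
      f = finsum (PM M0) (\<lambda>x. c x \<odot>\<^bsub>PM M0\<^esub> x) {\<lambda>x\<in>M0. residue x}"
    using a gM by (intro bexI[of _ "\<lambda>_. a"]) (simp_all add: P.finsum_insert P.finsum_empty Pi_def del: restrict_apply)
qed simp

lemma M0_in_MM: "M0 \<in> MM VT (cind_action B)"
  unfolding MM_def using M0_submodule M0_generated M0_Gamma M0_dual_generated by (auto simp: PM_def)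

text \<open>
  The residue functional is nonzero at \<open>eps0 = X\<^sup>j(eps j)\<close> for all
  \<open>j\<close>.
\<close>

lemma D_xi_torus_nontrivial:
  "\<exists>y\<in>carrier (D_xi VT (cind_action B)). \<exists>z\<in>carrier (D_xi VT (cind_action B)). y \<noteq> z"
proof (rule D_xi_nontrivial[OF M0_in_MM residue_functional])
  fix j
  have "residue ((xop ^^ j) (eps j)) \<noteq> \<one>\<^bsub>K_mod_o\<^esub>"
    using eps_xop_pow[of j j] residue_eps0 by simp
  then show "\<exists>m\<in>M0. residue ((xop ^^ j) m) \<noteq> \<one>\<^bsub>K_mod_o\<^esub>" using eps_M0 by blast
qed

end

section \<open>Failure of exactness\<close>

context coefficients
begin

text \<open>
  The ring \<open>A\<close> as a module over itself, realized on functions so that its elements have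
  the type in question.
\<close>

definition constant_functions :: "('k set, 'x \<Rightarrow> 'k set) module" where
  "constant_functions =
    \<lparr>carrier = {\<lambda>_. a | a. a \<in> carrier A}, mult = undefined, one = undefined, zero = (\<lambda>_. \<zero>\<^bsub>A\<^esub>),
     add = (\<lambda>f g x. f x \<oplus>\<^bsub>A\<^esub> g x), smult = (\<lambda>a f x. a \<otimes>\<^bsub>A\<^esub> f x)\<rparr>"

lemma constant_functions_simps [simp]:
  "carrier constant_functions = {\<lambda>_. a | a. a \<in> carrier A}" "\<zero>\<^bsub>constant_functions\<^esub> = (\<lambda>_. \<zero>\<^bsub>A\<^esub>)"
  "f \<oplus>\<^bsub>constant_functions\<^esub> g = (\<lambda>x. f x \<oplus>\<^bsub>A\<^esub> g x)" "a \<odot>\<^bsub>constant_functions\<^esub> f = (\<lambda>x. a \<otimes>\<^bsub>A\<^esub> f x)"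
  by (simp_all add: constant_functions_def)

lemma constant_functions_module: "module A (constant_functions :: ('k set, 'x \<Rightarrow> 'k set) module)"
proof -
  interpret A: cring A by (rule A_cring)
  show ?thesis
  proof (rule moduleI)
    show "abelian_group (constant_functions :: ('k set, 'x \<Rightarrow> 'k set) module)"
    proof (rule abelian_groupI)
      fix f :: "'x \<Rightarrow> 'k set" assume "f \<in> carrier constant_functions"
      then obtain a where a: "a \<in> carrier A" "f = (\<lambda>_. a)" by auto
      show "\<exists>g\<in>carrier constant_functions. g \<oplus>\<^bsub>constant_functions\<^esub> f = \<zero>\<^bsub>constant_functions\<^esub>"
        using a by (intro bexI[of _ "\<lambda>_. \<ominus>\<^bsub>A\<^esub> a"]) (auto simp: A.l_neg)
    qed (auto simp: A.a_ac)
  qed (auto simp: A_cring A.l_distr A.r_distr A.m_assoc)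
qed

end

context borel_setting
begin

theorem D_xi_not_exact: "\<not> D_xi_exact TYPE('q^'n^'n \<Rightarrow> 'q^'n^'n \<Rightarrow> 'k set)"
proof
  interpret A: cring A by (rule A_cring)
  let ?W = "constant_functions :: ('k set, 'q^'n^'n \<Rightarrow> 'k set) module"
  assume ex: "D_xi_exact TYPE('q^'n^'n \<Rightarrow> 'q^'n^'n \<Rightarrow> 'k set)"
  interpret T: torus_rep p Qp \<iota> \<pi> h Fbar GG BB TT NN \<Delta> \<beta>s u T0 \<xi> ell ?W "\<lambda>_. \<one>\<^bsub>A\<^esub>"
  proof (intro torus_rep.intro torus_rep_axioms.intro)
    show "borel_setting p \<iota> \<pi> h Fbar GG BB TT NN \<Delta> \<beta>s u T0 \<xi> ell" by (rule borel_setting_axioms)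
    show "module A ?W" by (rule constant_functions_module)
    show "\<exists>a\<in>carrier A. w = a \<odot>\<^bsub>?W\<^esub> (\<lambda>_. \<one>\<^bsub>A\<^esub>)" if "w \<in> carrier ?W" for w using that by auto
    show "a = \<zero>\<^bsub>A\<^esub>" if "a \<in> carrier A" "a \<odot>\<^bsub>?W\<^esub> (\<lambda>_. \<one>\<^bsub>A\<^esub>) = \<zero>\<^bsub>?W\<^esub>" for a
      using that fun_cong[of "\<lambda>_::'q^'n^'n. a" "\<lambda>_. \<zero>\<^bsub>A\<^esub>"] by simp
  qed auto
  show False
    using T.D_xi_torus_nontrivial exact_imp_torus_inv_trivial[OF constant_functions_module ex] by blast
qed

end

theorem corollary2p13:
  fixes p :: nat
    and \<iota> :: "'q::{field_char_0,metric_space} \<Rightarrow> 'k::field" and \<pi> :: 'k and h :: nat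
    and Fbar :: "'f::alg_closed_field itself"
    and GG BB TT NN :: "('q alg_closure^'n::finite^'n) set"
    and \<Delta> :: "('q^'n^'n \<Rightarrow> 'q) set"
    and \<beta>s :: "('q^'n^'n \<Rightarrow> 'q) list"
    and u :: "('q^'n^'n \<Rightarrow> 'q) \<Rightarrow> 'q \<Rightarrow> 'q^'n^'n"
    and T0 :: "('q^'n^'n) set"
    and \<xi> :: "'q \<Rightarrow> 'q^'n^'n"
    and ell :: "'q^'n^'n \<Rightarrow> 'q"
  assumes "borel_setting p \<iota> \<pi> h Fbar GG BB TT NN \<Delta> \<beta>s u T0 \<xi> ell"
  shows "(\<forall>(V\<^sub>0 :: ('k set, 'v) module) \<rho>\<^sub>0.
            coefficients.smooth_rep \<iota> \<pi> h (borel_setting.B0 NN T0) V\<^sub>0 \<rho>\<^sub>0 \<longrightarrow>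
            (let B = borel_setting.B BB;
                 B0 = borel_setting.B0 NN T0;
                 D = borel_setting.D_xi p \<iota> \<pi> h NN \<xi> ell
                       (coefficients.cind B0 B V\<^sub>0 \<rho>\<^sub>0) (coefficients.cind_action B)
             in carrier D = {\<zero>\<^bsub>D\<^esub>})) \<and>
         \<not> borel_setting.D_xi_exact p \<iota> \<pi> h BB NN \<xi> ell
              TYPE('q^'n^'n \<Rightarrow> 'q^'n^'n \<Rightarrow> 'k set)"
proof -
  interpret borel_setting p "TYPE('q)" \<iota> \<pi> h Fbar GG BB TT NN \<Delta> \<beta>s u T0 \<xi> ell by (rule assms)
  show ?thesis unfolding Let_def using D_xi_cind_zero D_xi_not_exact by blast
qed

end
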